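(* Let $(X,\Lambda)$ be a two-dimensional rational vector space with a rational inner product $Q$, let $P$ be a Delzant lattice polytope in $(X,\Lambda)$ and let $\varphi\in C^\infty(P)$. Then the coefficients $A_n(P;\varphi)$ $(n\ge2)$ in the asymptotic expansion $R_N(P;\varphi)\sim\sum_{n\ge0}A_n(P;\varphi)N^{-n}$ $(N\to\infty)$ are given by $$A_n(P;\varphi)=\sum_{f\in\mathcal{F}(P)_1}\int_fD_n(P;f)\varphi+\sum_{v\in\mathcal{V}(P)}D_n(P;v)\varphi(v),$$ where the Berline–Vergne operators $D_n(P;f)$ and $D_n(P;v)$ are given by $$D_n(P;f)=-\frac{b_n}{n!}\nabla_{u_f}^{n-1},$$ $$D_n(P;v)=\sum_{k=1}^{n-1}\frac{b_kb_{n-k}}{k!(n-k)!}\nabla_{e_1(v)}^{k-1}\nabla_{e_2(v)}^{n-1-k}+\frac{b_n}{n!}\left(c_1(v)\sum_{s=0}^{n-2}\nabla_{u_1(v)}^s\nabla_{e_1(v)}^{n-2-s}+c_2(v)\sum_{s=0}^{n-2}\nabla_{u_2(v)}^s\nabla_{e_2(v)}^{n-2-s}\right).$$ Here, for a vertex $v$, $e_1(v),e_2(v)\in\Lambda$ denote the integral basis of $\Lambda$ such that the two facets meeting at $v$ lie on the half lines $v+te_i(v)$, $t\ge0$, $i=1,2$, and $u_1(v),u_2(v)\in X$ satisfy $$e_1(v)=u_1(v)+c_1(v)e_2(v),\quad Q(u_1(v),e_2(v))=0,\quad c_1(v)=\frac{Q(e_1(v),e_2(v))}{Q(e_2(v),e_2(v))},$$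 $$e_2(v)=u_2(v)+c_2(v)e_1(v),\quad Q(u_2(v),e_1(v))=0,\quad c_2(v)=\frac{Q(e_1(v),e_2(v))}{Q(e_1(v),e_1(v))},$$ and for $f\in\mathcal{F}(P)_1$ the vector $u_f$ is the inward normal $$u_f=\frac{Q(e_2,\alpha_f)}{Q(\alpha_f,\alpha_f)}\alpha_f,$$ where $\alpha_f\in\Lambda$ is the inward primitive normal of $f$ with respect to $Q$, and $e_2\in C_P(f)\cap\Lambda$ is any vector forming an integral basis $\{e_1,e_2\}$ of $\Lambda$ together with a generator $e_1$ of $L(f)\cap\Lambda$.
   Context: Rational spaces. A rational space $(X,\Lambda)$ is a finite-dimensional real vector space $X$ with a lattice $\Lambda$; $x$ is rational if $qx\in\Lambda$ for some nonzero integer $q$. An inner product $Q$ is rational if $Q(x,y)\in\mathbb{Q}$ for all rational $x,y$; $Q$ also denotes the induced inner product on $X^*$. A subspace $L$ is rational if $L\cap\Lambda$ is a lattice in $L$; then $X/L$ is a rational space with lattice $\pi_L(\Lambda)$, $\pi_L$ the projection, and with the inner product obtained by identifying $X/L$ with $L^{\perp_Q}$. $(X/L)^*$ is identified with the annihilator of $L$ in $X^*$, and $p_L:X^*\to(X/L)^*$ is the orthogonal projection. A rational subspace $L$ carries the Lebesgue measure for which a fundamental domain of $L\cap\Lambda$ has measure $1$, its translates carry the translated measure, and integrals over a set are with respect to this measure on its affine hull. $\langle S\rangle$ is the affine hull of $S$ and $L(S)$ the linear span of $\{y-x:x,y\in S\}$; for a face $f$, $\pi_f=\pi_{L(f)}$,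 $p_f=p_{L(f)}$. An integral basis is a $\mathbb{Z}$-basis of $\Lambda$. A lattice polytope has all vertices in $\Lambda$. A polytope $P$ is Delzant if at each vertex $v$ there are exactly $\dim(X)$ incident edges and there is an integral basis $E$ of $\Lambda$ such that each edge incident to $v$ lies on a half line $\{v+te:t\ge0\}$ with $e\in E$. $\mathcal{F}(P)$ is the set of non-empty faces, $\mathcal{F}(P)_k$ those of dimension $k$, $\mathcal{V}(P)=\mathcal{F}(P)_0$. $C_P(f)$ is the cone generated by the vectors $y-x$, $y\in P$, $x\in f$. $\nabla_u$ is the derivative in direction $u$; $b_n$ is defined by $\frac{z}{e^z-1}=\sum_{n\ge0}\frac{b_n}{n!}z^n$. Riemann sums. $R_N(P;\varphi)=N^{-\dim(P)}\sum_{\gamma\in(NP)\cap\Lambda}\varphi(\gamma/N)$ for positive integers $N$; $C^\infty(P)$ is the set of restrictions to $P$ of smooth functions on $X$; $R_N\sim\sum_{n\ge0}a_nN^{-n}$ means $R_N-\sum_{n<M}a_nN^{-n}=O(N^{-M})$ for every $M\ge1$. Berline–Vergne operators. For a rational polyhedron $P$ (finite intersection of half-spaces bounded by rational affine hyperplanes) let $S(P)(\xi)=\sum_{\gamma\in P\cap\Lambda}e^{\langle\xi,\gamma\rangle}$, $I(P)(\xi)=\int_Pe^{\langle\xi,x\rangle}$, as meromorphic functions on $X^*$ (by continuation; both $0$ if $P$ contains a straight line); similarly on rational quotients. Put $\mathfrak{t}(P,f)=\pi_f(\langle f\rangle+C_P(f))\subset X/L(f)$. A rational affine cone is $s+C$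 with $s$ rational and $C$ a cone generated by finitely many lattice vectors. By a theorem of Berline and Vergne there is a unique family of maps $\mu_W$, indexed by the rational quotients $W$ of $X$, assigning to each rational affine cone $\mathfrak{a}$ in $W$ a function $\mu_W(\mathfrak{a})$ analytic near $0\in W^*$ with rational Taylor coefficients, such that: $\mu_{\{0\}}(\{0\})=1$; $\mu_W(\mathfrak{a})=0$ if $\mathfrak{a}$ contains a straight line; $S(\mathfrak{a})(\xi)=\sum_{F\in\mathcal{F}(\mathfrak{a})}\mu_{W/L(F)}(\mathfrak{t}(\mathfrak{a},F))(\xi)I(F)(\xi)$, functions on $(W/L(F))^*$ being pulled back to $W^*$ by orthogonal projection. The Berline–Vergne operator $D_n(P;f)=D_n^X(P;f)$ ($n\ge\dim(P)-\dim(f)$) is the constant-coefficient operator on $X$ whose symbol $\sigma(D)(\xi)=e^{-\langle\xi,x\rangle}De^{\langle\xi,x\rangle}$ is the pullback by $p_f$ of the homogeneous part of degree $n-\dim(P)+\dim(f)$ of the Taylor expansion of $\mu_{X/L(f)}(\mathfrak{t}(P,f))$ at $0$. *)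

theory Defs
  imports "HOL-Analysis.Analysis" "HOL-Library.Landau_Symbols"
begin

text \<open>
  A finite-dimensional real vector space X with inner product Q is a type of class
  \<^class>\<open>euclidean_space\<close>; Q is the operation written \<open>x \<bullet> y\<close>.  A quotient \<open>X/L\<close> is
  realised, via Q, as the orthogonal complement of \<open>L\<close>.
\<close>

subsection \<open>Rational spaces\<close>

definition int_span :: "'a::real_vector set \<Rightarrow> 'a set" where
  "int_span B = range (\<lambda>c::'a \<Rightarrow> int. \<Sum>b\<in>B. of_int (c b) *\<^sub>R b)"

definition integral_basis :: "'a::euclidean_space set \<Rightarrow> 'a set \<Rightarrow> bool" where
  "integral_basis \<Gamma> B \<longleftrightarrow> independent B \<and> int_span B = \<Gamma>"

definition lattice_in :: "'a::euclidean_space set \<Rightarrow> 'a set \<Rightarrow> bool" where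
  "lattice_in M \<Gamma> \<longleftrightarrow> (\<exists>B. integral_basis \<Gamma> B \<and> span B = M)"

definition rational_point :: "'a::real_vector set \<Rightarrow> 'a \<Rightarrow> bool" where
  "rational_point \<Gamma> x \<longleftrightarrow> (\<exists>q::int. q \<noteq> 0 \<and> of_int q *\<^sub>R x \<in> \<Gamma>)"

definition rational_inner_product :: "'a::real_inner set \<Rightarrow> bool" where
  "rational_inner_product \<Lambda> \<longleftrightarrow>
     (\<forall>x y. rational_point \<Lambda> x \<longrightarrow> rational_point \<Lambda> y \<longrightarrow> x \<bullet> y \<in> \<rat>)"

definition rational_subspace :: "'a::euclidean_space set \<Rightarrow> 'a set \<Rightarrow> bool" where
  "rational_subspace \<Lambda> L \<longleftrightarrow> subspace L \<and> lattice_in L (L \<inter> \<Lambda>)"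

definition quot_proj :: "'a::euclidean_space set \<Rightarrow> 'a \<Rightarrow> 'a" where
  "quot_proj L x = (THE y. y \<in> L\<^sup>\<bottom> \<and> x - y \<in> L)"

definition quot_lattice :: "'a::euclidean_space set \<Rightarrow> 'a set \<Rightarrow> 'a set" where
  "quot_lattice \<Lambda> L = quot_proj L ` \<Lambda>"

definition direction_space :: "'a::real_vector set \<Rightarrow> 'a set" where
  "direction_space S = span {y - x |x y. x \<in> S \<and> y \<in> S}"

text \<open>
  The measure on the affine hull of \<open>S\<close> for which a fundamental domain of
  \<open>L(S) \<inter> \<Gamma>\<close> has measure 1, as a measure on the whole space.  It depends neither on the
  chosen integral basis nor on the chosen base point.
\<close>

definition lattice_measure :: "'a::euclidean_space set \<Rightarrow> 'a set \<Rightarrow> 'a measure" where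
  "lattice_measure \<Gamma> S =
     (let B = (SOME B. integral_basis (direction_space S \<inter> \<Gamma>) B); p = (SOME p. p \<in> S)
      in distr (Pi\<^sub>M B (\<lambda>_. lborel)) borel (\<lambda>t. p + (\<Sum>b\<in>B. t b *\<^sub>R b)))"

subsection \<open>Polytopes and cones\<close>

definition vertices :: "'a::euclidean_space set \<Rightarrow> 'a set" where
  "vertices P = {v. {v} face_of P}"

definition edges :: "'a::euclidean_space set \<Rightarrow> 'a set set" where
  "edges P = {f. f face_of P \<and> aff_dim f = 1}"

definition lattice_polytope :: "'a::euclidean_space set \<Rightarrow> 'a set \<Rightarrow> bool" where
  "lattice_polytope \<Lambda> P \<longleftrightarrow> polytope P \<and> vertices P \<subseteq> \<Lambda>"

definition half_line :: "'a::real_vector \<Rightarrow> 'a \<Rightarrow> 'a set" where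
  "half_line v e = {v + t *\<^sub>R e |t. t \<ge> 0}"

definition Delzant :: "'a::euclidean_space set \<Rightarrow> 'a set \<Rightarrow> bool" where
  "Delzant \<Lambda> P \<longleftrightarrow>
     polytope P \<and>
     (\<forall>v\<in>vertices P.
        card {f \<in> edges P. v \<in> f} = DIM('a) \<and>
        (\<exists>E. integral_basis \<Lambda> E \<and>
             (\<forall>f\<in>edges P. v \<in> f \<longrightarrow> (\<exists>e\<in>E. f \<subseteq> half_line v e))))"

definition face_cone :: "'a::euclidean_space set \<Rightarrow> 'a set \<Rightarrow> 'a set" where
  "face_cone P f = convex_cone hull {y - x |x y. y \<in> P \<and> x \<in> f}"

definition transverse_cone :: "'a::euclidean_space set \<Rightarrow> 'a set \<Rightarrow> 'a set" where
  "transverse_cone P f =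
     quot_proj (direction_space f) ` {x + y |x y. x \<in> affine hull f \<and> y \<in> face_cone P f}"

definition rational_affine_cone :: "'a::euclidean_space set \<Rightarrow> 'a set \<Rightarrow> bool" where
  "rational_affine_cone \<Gamma> \<aa> \<longleftrightarrow>
     (\<exists>s V. rational_point \<Gamma> s \<and> finite V \<and> V \<subseteq> \<Gamma> \<and> \<aa> = (+) s ` (convex_cone hull V))"

definition contains_line :: "'a::real_vector set \<Rightarrow> bool" where
  "contains_line S \<longleftrightarrow> (\<exists>x v. v \<noteq> 0 \<and> (\<forall>t. x + t *\<^sub>R v \<in> S))"

subsection \<open>Differential operators and smooth functions\<close>

definition nabla :: "'a::real_normed_vector \<Rightarrow> ('a \<Rightarrow> complex) \<Rightarrow> 'a \<Rightarrow> complex" where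
  "nabla u f x = vector_derivative (\<lambda>t::real. f (x + t *\<^sub>R u)) (at 0)"

definition smooth :: "('a::real_normed_vector \<Rightarrow> complex) \<Rightarrow> bool" where
  "smooth f \<longleftrightarrow> (\<forall>us x. foldr nabla us f differentiable at x)"

text \<open>\<open>\<phi>\<close> belongs to \<open>C\<^sup>\<infinity>(P)\<close> iff it has some smooth extension \<open>\<psi>\<close>; its derivatives
  on \<open>P\<close> are those of \<open>\<psi>\<close>.\<close>

definition smooth_extension ::
    "'a::real_normed_vector set \<Rightarrow> ('a \<Rightarrow> complex) \<Rightarrow> ('a \<Rightarrow> complex) \<Rightarrow> bool" where
  "smooth_extension P \<phi> \<psi> \<longleftrightarrow> smooth \<psi> \<and> (\<forall>x\<in>P. \<phi> x = \<psi> x)"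

text \<open>The complexified dual of X is the space of real-linear maps from X to the complex numbers.\<close>

type_synonym 'a cdual = "'a \<Rightarrow>\<^sub>L complex"

definition cscale :: "complex \<Rightarrow> 'a::real_normed_vector cdual \<Rightarrow> 'a cdual" where
  "cscale c \<xi> = blinfun_mult_right c o\<^sub>L \<xi>"

definition const_coeff_operator ::
    "(('a::real_normed_vector \<Rightarrow> complex) \<Rightarrow> ('a \<Rightarrow> complex)) \<Rightarrow> bool" where
  "const_coeff_operator D \<longleftrightarrow>
     (\<exists>T::(complex \<times> 'a list) list. \<forall>f x. D f x = (\<Sum>(c, us)\<leftarrow>T. c * foldr nabla us f x))"

definition has_symbol ::
    "(('a::real_normed_vector \<Rightarrow> complex) \<Rightarrow> ('a \<Rightarrow> complex)) \<Rightarrow> ('a cdual \<Rightarrow> complex) \<Rightarrow> bool" where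
  "has_symbol D \<sigma> \<longleftrightarrow>
     (\<forall>\<xi> x. exp (- blinfun_apply \<xi> x) * D (\<lambda>y. exp (blinfun_apply \<xi> y)) x = \<sigma> \<xi>)"

subsection \<open>Meromorphic functions on duals of quotients\<close>

text \<open>The (complexified) dual of \<open>X/L\<close> is the annihilator of \<open>L\<close>; \<open>dual_proj L\<close> is the
  orthogonal projection onto it.\<close>

definition quot_dual :: "'a::euclidean_space set \<Rightarrow> 'a cdual set" where
  "quot_dual L = {\<xi>. \<forall>x\<in>L. blinfun_apply \<xi> x = 0}"

definition dual_proj :: "'a::euclidean_space set \<Rightarrow> 'a cdual \<Rightarrow> 'a cdual" where
  "dual_proj L \<xi> = \<xi> o\<^sub>L Blinfun (quot_proj L)"

text \<open>Complex differentiability at \<open>\<xi>\<close> on a complex subspace \<open>V\<close>.\<close>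

definition holomorphic_at ::
    "'a::real_normed_vector cdual set \<Rightarrow> ('a cdual \<Rightarrow> complex) \<Rightarrow> 'a cdual \<Rightarrow> bool" where
  "holomorphic_at V g \<xi> \<longleftrightarrow>
     (\<exists>D. (g has_derivative D) (at \<xi> within V) \<and> (\<forall>h\<in>V. D (cscale \<i> h) = \<i> * D h))"

definition entire_on :: "'a::real_normed_vector cdual set \<Rightarrow> ('a cdual \<Rightarrow> complex) \<Rightarrow> bool" where
  "entire_on V g \<longleftrightarrow> (\<forall>\<xi>\<in>V. holomorphic_at V g \<xi>)"

text \<open>
  Meromorphic functions on a finite-dimensional complex vector space \<open>V\<close> are the quotients of
  entire functions; such a function is given by a pair (numerator, denominator).
  \<open>mero_continuation V U f\<close> is the meromorphic function on \<open>V\<close> that agrees with \<open>f\<close> on \<open>U\<close>;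
  as a quotient it is unique if \<open>U\<close> has non-empty interior in \<open>V\<close>.
\<close>

type_synonym 'a mero = "('a cdual \<Rightarrow> complex) \<times> ('a cdual \<Rightarrow> complex)"

definition mero_regular :: "'a::real_normed_vector mero \<Rightarrow> 'a cdual \<Rightarrow> bool" where
  "mero_regular m \<xi> \<longleftrightarrow> snd m \<xi> \<noteq> 0"

definition mero_value :: "'a::real_normed_vector mero \<Rightarrow> 'a cdual \<Rightarrow> complex" where
  "mero_value m \<xi> = fst m \<xi> / snd m \<xi>"

definition mero_continuation ::
    "'a::real_normed_vector cdual set \<Rightarrow> 'a cdual set \<Rightarrow> ('a cdual \<Rightarrow> complex) \<Rightarrow> 'a mero" where
  "mero_continuation V U f =
     (SOME (g, h). entire_on V g \<and> entire_on V h \<and> (\<exists>\<xi>\<in>V. h \<xi> \<noteq> 0) \<and>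
                   (\<forall>\<xi>\<in>U. g \<xi> = h \<xi> * f \<xi>))"

text \<open>\<open>S(P)\<close> and \<open>I(P)\<close> for a subset \<open>P\<close> of the quotient \<open>X/L\<close>.\<close>

definition exp_sum :: "'a::euclidean_space set \<Rightarrow> 'a set \<Rightarrow> 'a set \<Rightarrow> 'a mero" where
  "exp_sum \<Lambda> L P =
     (if contains_line P then (\<lambda>_. 0, \<lambda>_. 1)
      else mero_continuation (quot_dual L)
             {\<xi> \<in> quot_dual L. (\<lambda>\<gamma>. exp (blinfun_apply \<xi> \<gamma>)) summable_on (P \<inter> quot_lattice \<Lambda> L)}
             (\<lambda>\<xi>. \<Sum>\<^sub>\<infinity>\<gamma>\<in>P \<inter> quot_lattice \<Lambda> L. exp (blinfun_apply \<xi> \<gamma>)))"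

definition exp_integral :: "'a::euclidean_space set \<Rightarrow> 'a set \<Rightarrow> 'a set \<Rightarrow> 'a mero" where
  "exp_integral \<Lambda> L P =
     (let m = lattice_measure (quot_lattice \<Lambda> L) P in
      if contains_line P then (\<lambda>_. 0, \<lambda>_. 1)
      else mero_continuation (quot_dual L)
             {\<xi> \<in> quot_dual L. set_integrable m P (\<lambda>x. exp (blinfun_apply \<xi> x))}
             (\<lambda>\<xi>. set_lebesgue_integral m P (\<lambda>x. exp (blinfun_apply \<xi> x))))"

subsection \<open>Berline-Vergne operators\<close>

text \<open>Rational Taylor coefficients at 0: all iterated derivatives at 0 along rational covectors of
  \<open>X/L\<close> are rational.\<close>

definition rational_covector :: "'a::euclidean_space set \<Rightarrow> 'a cdual \<Rightarrow> bool" where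
  "rational_covector \<Lambda> \<xi> \<longleftrightarrow> (\<forall>x\<in>\<Lambda>. blinfun_apply \<xi> x \<in> \<rat>)"

definition rational_taylor ::
    "'a::euclidean_space set \<Rightarrow> 'a set \<Rightarrow> ('a cdual \<Rightarrow> complex) \<Rightarrow> bool" where
  "rational_taylor \<Lambda> L g \<longleftrightarrow>
     (\<forall>\<xi>s. set \<xi>s \<subseteq> quot_dual L \<inter> Collect (rational_covector \<Lambda>) \<longrightarrow> foldr nabla \<xi>s g 0 \<in> \<rat>)"

text \<open>
  \<open>\<mu> L\<close> is the map assigned to \<open>W = X/L\<close>.  If \<open>F\<close> is a subset of \<open>X/L\<close>, then \<open>(X/L)/L(F)\<close> is the
  quotient of X by \<open>span (L \<union> L(F))\<close>.  The values \<open>\<mu> L \<aa> \<xi>\<close> matter only for \<open>\<xi>\<close> near 0 in the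
  dual of \<open>X/L\<close>, and the main identity is one between germs of meromorphic functions.
\<close>

definition Berline_Vergne_family ::
    "'a::euclidean_space set \<Rightarrow> ('a set \<Rightarrow> 'a set \<Rightarrow> 'a cdual \<Rightarrow> complex) \<Rightarrow> bool" where
  "Berline_Vergne_family \<Lambda> \<mu> \<longleftrightarrow>
     \<mu> UNIV {0} 0 = 1 \<and>
     (\<forall>L \<aa>. rational_subspace \<Lambda> L \<longrightarrow> rational_affine_cone (quot_lattice \<Lambda> L) \<aa> \<longrightarrow>
        (\<forall>\<^sub>F \<xi> in nhds 0. \<xi> \<in> quot_dual L \<longrightarrow> holomorphic_at (quot_dual L) (\<mu> L \<aa>) \<xi>) \<and>
        rational_taylor \<Lambda> L (\<mu> L \<aa>) \<and>
        (contains_line \<aa> \<longrightarrow> (\<forall>\<^sub>F \<xi> in nhds 0. \<xi> \<in> quot_dual L \<longrightarrow> \<mu> L \<aa> \<xi> = 0)) \<and>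
        (\<forall>\<^sub>F \<xi> in nhds 0. \<xi> \<in> quot_dual L \<longrightarrow>
           mero_regular (exp_sum \<Lambda> L \<aa>) \<xi> \<longrightarrow>
           (\<forall>F. F face_of \<aa> \<and> F \<noteq> {} \<longrightarrow> mero_regular (exp_integral \<Lambda> L F) \<xi>) \<longrightarrow>
           mero_value (exp_sum \<Lambda> L \<aa>) \<xi> =
             (\<Sum>F | F face_of \<aa> \<and> F \<noteq> {}.
                \<mu> (span (L \<union> direction_space F)) (transverse_cone \<aa> F)
                  (dual_proj (direction_space F) \<xi>)
                * mero_value (exp_integral \<Lambda> L F) \<xi>)))"

text \<open>Homogeneous part of degree \<open>k\<close> of the Taylor expansion of \<open>g\<close> at 0.\<close>

definition taylor_part :: "nat \<Rightarrow> ('a::real_normed_vector cdual \<Rightarrow> complex) \<Rightarrow> 'a cdual \<Rightarrow> complex"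
  where "taylor_part k g \<xi> = (deriv ^^ k) (\<lambda>z. g (cscale z \<xi>)) 0 / fact k"

text \<open>\<open>D\<^sub>n(P;f)\<close>, meant for \<open>n \<ge> dim P - dim f\<close>.  The symbol determines the operator on smooth
  functions.\<close>

definition BV_operator ::
    "('a::euclidean_space set \<Rightarrow> 'a set \<Rightarrow> 'a cdual \<Rightarrow> complex) \<Rightarrow> nat \<Rightarrow> 'a set \<Rightarrow> 'a set
     \<Rightarrow> ('a \<Rightarrow> complex) \<Rightarrow> ('a \<Rightarrow> complex)" where
  "BV_operator \<mu> n P f =
     (SOME D. const_coeff_operator D \<and>
        has_symbol D (\<lambda>\<xi>. taylor_part (nat (int n - aff_dim P + aff_dim f))
          (\<mu> (direction_space f) (transverse_cone P f)) (dual_proj (direction_space f) \<xi>)))"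

subsection \<open>Riemann sums\<close>

definition riemann_sum :: "'a::euclidean_space set \<Rightarrow> 'a set \<Rightarrow> ('a \<Rightarrow> complex) \<Rightarrow> nat \<Rightarrow> complex" where
  "riemann_sum \<Lambda> P \<phi> N =
     (\<Sum>\<gamma>\<in>(\<lambda>x. real N *\<^sub>R x) ` P \<inter> \<Lambda>. \<phi> (\<gamma> /\<^sub>R real N)) / of_nat N ^ nat (aff_dim P)"

definition asymptotic_expansion :: "(nat \<Rightarrow> complex) \<Rightarrow> (nat \<Rightarrow> complex) \<Rightarrow> bool" where
  "asymptotic_expansion R a \<longleftrightarrow>
     (\<forall>M\<ge>1. (\<lambda>N. R N - (\<Sum>n<M. a n / of_nat N ^ n)) \<in> O(\<lambda>N. 1 / of_nat N ^ M))"

text \<open>\<open>b\<^sub>n\<close> from \<open>z / (e\<^sup>z - 1) = \<Sum> b\<^sub>n z\<^sup>n / n!\<close>; in particular \<open>b\<^sub>1 = - 1/2\<close>.\<close>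

definition bernoulli_number :: "nat \<Rightarrow> complex" where
  "bernoulli_number n = fact n * fps_nth (fps_X / (fps_exp 1 - 1)) n"

definition inward_primitive_normal ::
    "'a::euclidean_space set \<Rightarrow> 'a set \<Rightarrow> 'a set \<Rightarrow> 'a \<Rightarrow> bool" where
  "inward_primitive_normal \<Lambda> P f \<alpha> \<longleftrightarrow>
     \<alpha> \<in> \<Lambda> \<and> \<alpha> \<noteq> 0 \<and>
     (\<forall>\<beta>\<in>\<Lambda>. \<forall>k::int. \<alpha> = of_int k *\<^sub>R \<beta> \<longrightarrow> \<bar>k\<bar> = 1) \<and>
     (\<forall>x\<in>direction_space f. \<alpha> \<bullet> x = 0) \<and>
     (\<forall>y\<in>P. \<forall>x\<in>f. \<alpha> \<bullet> (y - x) \<ge> 0)"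

end

theory Submission
  imports Defs "HOL-Complex_Analysis.Complex_Analysis"
begin

text \<open>
  Multiplying \<open>\<phi>\<close> by a cutoff and applying the Brianchon-Gram relation
  \<open>[P] = \<Sum>v [cone at v] - \<Sum>f [half-plane of f] + 1\<close> splits the Riemann sum into sums over
  unimodular quadrants, half-planes and the plane, and the last two are quadrants with an apex far
  outside of the support.  On a quadrant the double Euler-Maclaurin expansion has interior terms,
  integrals of transversal derivatives along the two rays, and derivatives at the apex; splitting
  each transversal derivative \<open>e2 = u2 + c2 e1\<close> into its normal part and a part tangential to
  the ray, whose integral is a boundary term, turns the coefficients into powers of the normal
  derivative along the rays and the stated operator at the apex.  The rays
  from the two ends of an edge minus its full line add up to the edge.
  On the symbol side, the Berline-Vergne identity for the half-line \<open>X / L(f)\<close> and for the quadrant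
  at \<open>v\<close> can be solved for \<open>\<mu>\<close>, and the Taylor coefficients are those of
  \<open>z / (e^z - 1)\<close>.
\<close>

text \<open>Two choices by \<open>SOME\<close> shape the proof. A Berline-Vergne operator is known
  only through its symbol, so it is compared with an explicit operator by symbols; for the symbol to
  determine the operator on smooth functions, mixed derivatives must commute. A continued
  exponential sum or integral is known only as a quotient up to cross-multiplication, and the
  identity for \<mu> is available only where the chosen denominators do not vanish. It therefore
  holds off the zero set of one entire function, and continuity extends it to a neighbourhood of 0.
  The vertex equation carries the factor \<xi>(e1) \<xi>(e2), so its Taylor coefficients are first
  compared at covectors where this factor is nonzero, then by a limit.

  The two computations meet in the vector \<open>line_proj e1 e2\<close>: pulling a symbol back by
  p_f evaluates it on the orthogonal projection of the transversal lattice vector, and this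
  projection is both u_f and the normal part of e2 in the Euler-Maclaurin terms. The minus sign of
  the edge terms comes from the integral of exp(s X) over the half-line, which is -1/X.\<close>

section \<open>Directional derivatives\<close>

lemma nabla_has_derivative:
  assumes "f differentiable (at x)"
  shows "(f has_derivative (\<lambda>u. nabla u f x)) (at x)"
proof -
  obtain D where D: "(f has_derivative D) (at x)"
    using assms by (auto simp: differentiable_def)
  have "nabla u f x = D u" for u
  proof -
    have "((\<lambda>t::real. f (x + t *\<^sub>R u)) has_derivative (\<lambda>t. D (t *\<^sub>R u))) (at 0)"
      by (rule has_derivative_compose[where g=f and f="\<lambda>t. x + t *\<^sub>R u"])
         (use D in \<open>auto intro!: derivative_eq_intros\<close>)
    then have "((\<lambda>t::real. f (x + t *\<^sub>R u)) has_vector_derivative D u) (at 0)"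
      using D by (simp add: has_vector_derivative_def linear_cmul has_derivative_linear)
    then show ?thesis
      by (simp add: nabla_def vector_derivative_at)
  qed
  then show ?thesis using D by presburger
qed

lemma nabla_eqI: "(f has_derivative D) (at x) \<Longrightarrow> nabla u f x = D u"
  by (metis differentiableI has_derivative_unique nabla_has_derivative)

lemma nabla_vector_derivative:
  assumes "f differentiable (at (x + t *\<^sub>R u))"
  shows "((\<lambda>t. f (x + t *\<^sub>R u)) has_vector_derivative nabla u f (x + t *\<^sub>R u)) (at t within S)"
proof -
  have lin: "linear (\<lambda>u. nabla u f (x + t *\<^sub>R u'))" if "u' = u" for u'
    using nabla_has_derivative[OF assms] has_derivative_linear that by blast
  have "((\<lambda>t. f (x + t *\<^sub>R u)) has_derivative (\<lambda>h. nabla (h *\<^sub>R u) f (x + t *\<^sub>R u))) (at t within S)"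
    by (rule has_derivative_compose[where g=f and f="\<lambda>t. x + t *\<^sub>R u"])
       (use nabla_has_derivative[OF assms] in \<open>auto intro!: derivative_eq_intros\<close>)
  then show ?thesis
    unfolding has_vector_derivative_def using linear_cmul[OF lin[OF refl]] by simp
qed

lemma nabla_linear:
  assumes "f differentiable (at x)"
  shows "nabla (a *\<^sub>R u + b *\<^sub>R w) f x = of_real a * nabla u f x + of_real b * nabla w f x"
proof -
  have "linear (\<lambda>u. nabla u f x)"
    by (rule has_derivative_linear[OF nabla_has_derivative[OF assms]])
  from linear_add[OF this] linear_cmul[OF this] show ?thesis
    by (simp add: scaleR_conv_of_real)
qed

lemma nabla_cong_open:
  assumes "open U" "x \<in> U" "\<And>y. y \<in> U \<Longrightarrow> f y = g y"
  shows "nabla u f x = nabla u g x"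
proof -
  have "((\<lambda>t. x + t *\<^sub>R u) \<longlongrightarrow> x + 0 *\<^sub>R u) (at (0::real))"
    by (intro tendsto_intros)
  then have "\<forall>\<^sub>F t in at (0::real). x + t *\<^sub>R u \<in> U"
    using topological_tendstoD[OF _ assms(1)] assms(2) by fastforce
  then have "\<forall>\<^sub>F t in nhds (0::real). f (x + t *\<^sub>R u) = g (x + t *\<^sub>R u)"
    using assms(2,3) by (auto simp: eventually_at_filter elim!: eventually_mono)
  then show ?thesis
    unfolding nabla_def by (intro vector_derivative_cong_eq) auto
qed

lemma foldr_nabla_cong_open:
  assumes "open U" "x \<in> U" "\<And>y. y \<in> U \<Longrightarrow> f y = g y"
  shows "foldr nabla us f x = foldr nabla us g x"
  using assms(2)
proof (induction us arbitrary: x)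
  case (Cons u us)
  show ?case using nabla_cong_open[OF assms(1) Cons.prems, of "foldr nabla us f" "foldr nabla us g"] Cons.IH
    by simp
qed (use assms in auto)

lemma funpow_nabla: "(nabla u ^^ k) f = foldr nabla (replicate k u) f"
  by (induction k) auto

subsection \<open>Smooth functions\<close>

lemma smooth_differentiable: "smooth f \<Longrightarrow> f differentiable (at x)"
  unfolding smooth_def by (metis foldr.simps(1) id_apply)

lemma smooth_nabla: "smooth f \<Longrightarrow> smooth (nabla u f)"
  unfolding smooth_def
proof (intro allI)
  fix us x assume "\<forall>us x. foldr nabla us f differentiable at x"
  then have "foldr nabla (us @ [u]) f differentiable at x" by blast
  then show "foldr nabla us (nabla u f) differentiable at x" by simp
qed

lemma smooth_foldr_nabla: "smooth f \<Longrightarrow> smooth (foldr nabla us f)"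
  by (induction us) (auto intro: smooth_nabla)

lemma smooth_continuous: "smooth f \<Longrightarrow> continuous_on S f"
  by (meson continuous_at_imp_continuous_on differentiable_imp_continuous_within smooth_differentiable)

text \<open>Smoothness as a greatest fixed point. It serves for constants, affine pullbacks and the
  flat functions, whose derivatives stay in an explicit family.\<close>

lemma smooth_coinduct:
  assumes "f \<in> S" "\<And>f x. f \<in> S \<Longrightarrow> f differentiable (at x)" "\<And>f u. f \<in> S \<Longrightarrow> nabla u f \<in> S"
  shows "smooth f"
proof -
  have "foldr nabla us f \<in> S" for us
    by (induction us) (use assms in auto)
  then show ?thesis using assms(2) by (auto simp: smooth_def)
qed

text \<open>Products and reciprocals have derivatives of growing shape, so no handy closed family
  exists for them. Bounding the order allows induction instead.\<close>

definition differentiable_upto :: "nat \<Rightarrow> ('a::real_normed_vector \<Rightarrow> complex) \<Rightarrow> bool" where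
  "differentiable_upto n f \<longleftrightarrow> (\<forall>us x. length us \<le> n \<longrightarrow> foldr nabla us f differentiable at x)"

lemma differentiable_upto_0: "differentiable_upto 0 f \<longleftrightarrow> (\<forall>x. f differentiable (at x))"
  by (auto simp: differentiable_upto_def)

text \<open>\<open>foldr nabla\<close> applies the last vector of the list first, so the derivative
  taken first sits at the end of the list.\<close>

lemma differentiable_upto_Suc:
  "differentiable_upto (Suc n) f \<longleftrightarrow> (\<forall>x. f differentiable (at x)) \<and> (\<forall>u. differentiable_upto n (nabla u f))"
proof
  assume *: "differentiable_upto (Suc n) f"
  have "foldr nabla us (nabla u f) differentiable at x" if "length us \<le> n" for us u x
    using *[unfolded differentiable_upto_def, rule_format, of "us @ [u]"] that by simp
  moreover have "f differentiable (at x)" for x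
    using *[unfolded differentiable_upto_def, rule_format, of "[]"] by simp
  ultimately show "(\<forall>x. f differentiable (at x)) \<and> (\<forall>u. differentiable_upto n (nabla u f))"
    by (auto simp: differentiable_upto_def)
next
  assume *: "(\<forall>x. f differentiable (at x)) \<and> (\<forall>u. differentiable_upto n (nabla u f))"
  have "foldr nabla us f differentiable at x" if "length us \<le> Suc n" for us x
  proof (cases us rule: rev_cases)
    case (snoc vs u)
    then show ?thesis using * that by (auto simp: differentiable_upto_def)
  qed (use * in auto)
  then show "differentiable_upto (Suc n) f" by (auto simp: differentiable_upto_def)
qed

lemma smooth_iff_upto: "smooth f \<longleftrightarrow> (\<forall>n. differentiable_upto n f)"
  by (auto simp: smooth_def differentiable_upto_def)

lemma differentiable_upto_mono: "differentiable_upto n f \<Longrightarrow> m \<le> n \<Longrightarrow> differentiable_upto m f"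
  by (auto simp: differentiable_upto_def)

lemma nabla_add:
  assumes "f differentiable (at x)" "g differentiable (at x)"
  shows "nabla u (\<lambda>x. f x + g x) x = nabla u f x + nabla u g x"
  by (rule nabla_eqI) (auto intro!: derivative_eq_intros assms nabla_has_derivative)

lemma nabla_mult:
  assumes "f differentiable (at x)" "g differentiable (at x)"
  shows "nabla u (\<lambda>x. f x * g x) x = nabla u f x * g x + f x * nabla u g x"
  using nabla_eqI[OF has_derivative_mult[OF assms[THEN nabla_has_derivative]]]
  by (simp add: add.commute)

lemma nabla_cmult:
  assumes "f differentiable (at x)"
  shows "nabla u (\<lambda>x. c * f x) x = c * nabla u f x"
  using nabla_eqI[OF has_derivative_mult_right[OF nabla_has_derivative[OF assms]]] .

lemma differentiable_upto_add:
  "differentiable_upto n f \<Longrightarrow> differentiable_upto n g \<Longrightarrow> differentiable_upto n (\<lambda>x. f x + g x)"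
proof (induction n arbitrary: f g)
  case (Suc n)
  have "nabla u (\<lambda>x. f x + g x) = (\<lambda>x. nabla u f x + nabla u g x)" for u
    using Suc.prems by (auto simp: differentiable_upto_Suc nabla_add)
  then show ?case using Suc by (auto simp: differentiable_upto_Suc)
qed (auto simp: differentiable_upto_0)

lemma differentiable_upto_mult:
  "differentiable_upto n f \<Longrightarrow> differentiable_upto n g \<Longrightarrow> differentiable_upto n (\<lambda>x. f x * g x)"
proof (induction n arbitrary: f g)
  case (Suc n)
  have "nabla u (\<lambda>x. f x * g x) = (\<lambda>x. nabla u f x * g x + f x * nabla u g x)" for u
    using Suc.prems by (auto simp: differentiable_upto_Suc nabla_mult)
  moreover have "differentiable_upto n f" "differentiable_upto n g"
    using Suc.prems differentiable_upto_mono le_SucI by blast+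
  ultimately show ?case using Suc by (auto simp: differentiable_upto_Suc intro!: differentiable_upto_add)
qed (auto simp: differentiable_upto_0)

lemma smooth_mult: "smooth f \<Longrightarrow> smooth g \<Longrightarrow> smooth (\<lambda>x. f x * g x)"
  by (simp add: smooth_iff_upto differentiable_upto_mult)

lemma smooth_const: "smooth (\<lambda>_. c)"
proof (rule smooth_coinduct[of _ "{f. \<exists>c. f = (\<lambda>_. c)}"])
  show "nabla u f \<in> {f. \<exists>c. f = (\<lambda>_. c)}" if "f \<in> {f. \<exists>c. f = (\<lambda>_. c)}"
    for f :: "'a \<Rightarrow> complex" and u
    using that by (auto intro!: exI[of _ 0] ext nabla_eqI derivative_eq_intros)
qed auto

lemma has_derivative_affine_compose:
  assumes "smooth f" "bounded_linear T"
  shows "((\<lambda>x. f (p + T x)) has_derivative (\<lambda>u. nabla (T u) f (p + T x))) (at x)"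
  by (rule has_derivative_compose[where g=f and f="\<lambda>x. p + T x"])
     (use assms in \<open>auto intro!: derivative_eq_intros nabla_has_derivative smooth_differentiable
        bounded_linear_imp_has_derivative\<close>)

lemma nabla_affine_compose:
  assumes "smooth f" "bounded_linear T"
  shows "nabla u (\<lambda>x. f (p + T x)) = (\<lambda>x. nabla (T u) f (p + T x))"
  using nabla_eqI[OF has_derivative_affine_compose[OF assms]] by blast

lemma smooth_affine_compose:
  assumes "smooth f" "bounded_linear T"
  shows "smooth (\<lambda>x. f (p + T x))"
proof (rule smooth_coinduct[of _ "{\<lambda>x. g (p + T x) |g. smooth g}"])
  show "f differentiable at x" if "f \<in> {\<lambda>x. g (p + T x) |g. smooth g}" for f x
    using that has_derivative_affine_compose[OF _ assms(2)] by (auto simp: differentiable_def)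
  show "nabla u f \<in> {\<lambda>x. g (p + T x) |g. smooth g}" if "f \<in> {\<lambda>x. g (p + T x) |g. smooth g}" for f u
    using that nabla_affine_compose[OF _ assms(2)] smooth_nabla by fastforce
qed (use assms in auto)

lemma has_derivative_exp_blinfun:
  "((\<lambda>y. c * exp (blinfun_apply \<xi> y)) has_derivative (\<lambda>u. (c * blinfun_apply \<xi> u) * exp (blinfun_apply \<xi> x))) (at x)"
  for \<xi> :: "'a::real_normed_vector \<Rightarrow>\<^sub>L complex"
proof -
  have "((\<lambda>y. blinfun_apply \<xi> y) has_derivative blinfun_apply \<xi>) (at x)"
    by (rule bounded_linear_imp_has_derivative) (rule blinfun.bounded_linear_right)
  from has_derivative_compose[OF this DERIV_exp[unfolded has_field_derivative_def]]
  have "((\<lambda>y. exp (blinfun_apply \<xi> y)) has_derivative (\<lambda>u. exp (blinfun_apply \<xi> x) * blinfun_apply \<xi> u)) (at x)" .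
  from has_derivative_mult_right[OF this, of c] show ?thesis
    by (simp add: mult_ac)
qed

lemma nabla_exp_blinfun:
  "nabla u (\<lambda>y. c * exp (blinfun_apply \<xi> y)) = (\<lambda>y. (c * blinfun_apply \<xi> u) * exp (blinfun_apply \<xi> y))"
  using nabla_eqI[OF has_derivative_exp_blinfun] by blast

lemma foldr_nabla_exp_blinfun:
  "foldr nabla us (\<lambda>y. exp (blinfun_apply \<xi> y)) = (\<lambda>y. (\<Prod>u\<leftarrow>us. blinfun_apply \<xi> u) * exp (blinfun_apply \<xi> y))"
proof (induction us)
  case (Cons u us)
  then show ?case by (simp add: nabla_exp_blinfun) (simp add: mult_ac)
qed auto

lemma smooth_exp_blinfun: "smooth (\<lambda>y. exp (blinfun_apply \<xi> y))"
  unfolding smooth_def foldr_nabla_exp_blinfun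
  using has_derivative_exp_blinfun differentiableI by blast

text \<open>Mixed partials by integration: the increment of f along u is the integral of its
  u-derivative. Differentiating it in direction w under the integral sign and then in s at 0 gives
  the two orders of differentiation.\<close>

lemma nabla_commute:
  assumes f: "smooth (f :: 'a::real_normed_vector \<Rightarrow> complex)"
  shows "nabla u (nabla w f) x = nabla w (nabla u f) x"
proof -
  have diff: "g differentiable (at y)" if "smooth g" for g :: "'a \<Rightarrow> complex" and y
    using that by (rule smooth_differentiable)
  note sm = smooth_nabla[OF f] smooth_nabla[OF smooth_nabla[OF f]]
  have ftc: "((\<lambda>\<sigma>. nabla u f (y + \<sigma> *\<^sub>R u)) has_integral (f (y + s *\<^sub>R u) - f y)) {0..s}"
    if "s \<ge> 0" for y s
    using fundamental_theorem_of_calculus[of 0 s "\<lambda>\<sigma>. f (y + \<sigma> *\<^sub>R u)" "\<lambda>\<sigma>. nabla u f (y + \<sigma> *\<^sub>R u)"]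
      that nabla_vector_derivative[OF diff[OF f]] by simp
  \<comment> \<open>The two expressions below are the same function of t, namely the increment of f
    along s u based at x + t w. Equating their derivatives at t = 0 gives the claim.\<close>
  have int: "nabla w f (x + s *\<^sub>R u) - nabla w f x = integral {0..s} (\<lambda>\<sigma>. nabla w (nabla u f) (x + \<sigma> *\<^sub>R u))"
    if s: "s \<ge> 0" for s
  proof -
    have "((\<lambda>t. integral (cbox 0 s) (\<lambda>\<sigma>. nabla u f (x + \<sigma> *\<^sub>R u + t *\<^sub>R w))) has_vector_derivative
          integral (cbox 0 s) (\<lambda>\<sigma>. nabla w (nabla u f) (x + \<sigma> *\<^sub>R u + 0 *\<^sub>R w))) (at 0 within UNIV)"
    proof (rule leibniz_rule_vector_derivative)
      show "(\<lambda>\<sigma>. nabla u f (x + \<sigma> *\<^sub>R u + t *\<^sub>R w)) integrable_on cbox 0 s" for t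
        by (intro integrable_continuous continuous_on_compose2[OF smooth_continuous[OF sm(1), of UNIV]]
            continuous_intros) auto
      show "continuous_on (UNIV \<times> cbox 0 s) (\<lambda>(t, \<sigma>). nabla w (nabla u f) (x + \<sigma> *\<^sub>R u + t *\<^sub>R w))"
        unfolding split_beta
        by (intro continuous_on_compose2[OF smooth_continuous[OF sm(2), of UNIV]] continuous_intros) auto
    qed (auto intro!: nabla_vector_derivative diff sm)
    moreover have "integral (cbox 0 s) (\<lambda>\<sigma>. nabla u f (x + \<sigma> *\<^sub>R u + t *\<^sub>R w))
        = f ((x + s *\<^sub>R u) + t *\<^sub>R w) - f (x + t *\<^sub>R w)" for t
      using integral_unique[OF ftc[OF s, of "x + t *\<^sub>R w"]] by (simp add: add_ac)
    ultimately have "((\<lambda>t. f ((x + s *\<^sub>R u) + t *\<^sub>R w) - f (x + t *\<^sub>R w)) has_vector_derivative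
          integral {0..s} (\<lambda>\<sigma>. nabla w (nabla u f) (x + \<sigma> *\<^sub>R u))) (at 0)"
      by simp
    moreover have "((\<lambda>t. f ((x + s *\<^sub>R u) + t *\<^sub>R w) - f (x + t *\<^sub>R w)) has_vector_derivative
        (nabla w f ((x + s *\<^sub>R u) + 0 *\<^sub>R w) - nabla w f (x + 0 *\<^sub>R w))) (at 0)"
      by (intro has_vector_derivative_diff nabla_vector_derivative diff f)
    ultimately show ?thesis using vector_derivative_unique_at by fastforce
  qed
  \<comment> \<open>\<open>int\<close> is available only for s at least 0, so both derivatives at 0
    are taken within {0..1}, where they are still unique.\<close>
  have "((\<lambda>s. nabla w f (x + s *\<^sub>R u)) has_vector_derivative nabla u (nabla w f) (x + 0 *\<^sub>R u)) (at 0 within {0..1})"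
    by (intro nabla_vector_derivative diff sm)
  moreover have "((\<lambda>s. nabla w f x + integral {0..s} (\<lambda>\<sigma>. nabla w (nabla u f) (x + \<sigma> *\<^sub>R u))) has_vector_derivative
       0 + nabla w (nabla u f) (x + 0 *\<^sub>R u)) (at 0 within {0..1})"
    by (intro has_vector_derivative_add has_vector_derivative_const integral_has_vector_derivative
        continuous_on_compose2[OF smooth_continuous[OF sm(2), of UNIV]] continuous_intros) auto
  then have "((\<lambda>s. nabla w f (x + s *\<^sub>R u)) has_vector_derivative 0 + nabla w (nabla u f) (x + 0 *\<^sub>R u)) (at 0 within {0..1})"
    by (rule has_vector_derivative_transform[rotated 2]) (auto simp flip: int)
  ultimately show ?thesis
    using vector_derivative_unique_within[of 0 "{0..1::real}"] by (fastforce simp: trivial_limit_within islimpt_Icc)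
qed

subsection \<open>Constant coefficient operators\<close>

lemma const_coeff_operatorI:
  "(\<And>f x. D f x = (\<Sum>(c, us)\<leftarrow>T. c * foldr nabla us f x)) \<Longrightarrow> const_coeff_operator D"
  unfolding const_coeff_operator_def by blast

lemma const_coeff_foldr: "const_coeff_operator (\<lambda>g x. c * foldr nabla us g x)"
  by (rule const_coeff_operatorI[where T="[(c, us)]"]) simp

lemma const_coeff_add:
  assumes "const_coeff_operator D" "const_coeff_operator E"
  shows "const_coeff_operator (\<lambda>g x. D g x + E g x)"
proof -
  obtain T U where "\<And>f x. D f x = (\<Sum>(c, us)\<leftarrow>T. c * foldr nabla us f x)"
    "\<And>f x. E f x = (\<Sum>(c, us)\<leftarrow>U. c * foldr nabla us f x)"
    using assms unfolding const_coeff_operator_def by blast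
  then show ?thesis by (intro const_coeff_operatorI[where T="T @ U"]) simp
qed

lemma const_coeff_sum:
  assumes "finite I"
  shows "const_coeff_operator (\<lambda>g x. \<Sum>i\<in>I. c i * foldr nabla (us i) g x)"
  using assms
proof (induction I)
  case empty
  show ?case by (rule const_coeff_operatorI[where T="[]"]) simp
next
  case (insert i I)
  then show ?case using const_coeff_add[OF const_coeff_foldr insert.IH] by simp
qed

lemma has_symbol_foldr: "has_symbol (\<lambda>g x. c * foldr nabla us g x) (\<lambda>\<xi>. c * (\<Prod>u\<leftarrow>us. blinfun_apply \<xi> u))"
proof -
  have *: "exp (- z) * (c * (p * exp z)) = c * p" for p z :: complex
    by (simp add: exp_minus)
  show ?thesis unfolding has_symbol_def foldr_nabla_exp_blinfun using * by blast
qed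

lemma has_symbol_add:
  "has_symbol D \<sigma> \<Longrightarrow> has_symbol E \<tau> \<Longrightarrow> has_symbol (\<lambda>g x. D g x + E g x) (\<lambda>\<xi>. \<sigma> \<xi> + \<tau> \<xi>)"
  by (simp add: has_symbol_def ring_distribs)

lemma has_symbol_sum:
  "has_symbol (\<lambda>g x. \<Sum>i\<in>I. c i * foldr nabla (us i) g x) (\<lambda>\<xi>. \<Sum>i\<in>I. c i * (\<Prod>u\<leftarrow>us i. blinfun_apply \<xi> u))"
  using has_symbol_foldr[unfolded has_symbol_def, rule_format]
  unfolding has_symbol_def sum_distrib_left by (intro allI sum.cong refl)

lemma const_coeff_smooth_eq:
  assumes "const_coeff_operator D"
  obtains T where "\<And>g x. D g x = (\<Sum>(c, us)\<leftarrow>T. c * foldr nabla us g x)"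
  using assms unfolding const_coeff_operator_def by blast

lemma smooth_list_sum:
  "smooth g \<Longrightarrow> smooth (\<lambda>x. \<Sum>(c, us)\<leftarrow>T. c * foldr nabla us g x)"
proof (induction T)
  case (Cons cu T)
  obtain c us where cu: "cu = (c, us)" by fastforce
  have "smooth (\<lambda>x. c * foldr nabla us g x)"
    by (intro smooth_mult smooth_const smooth_foldr_nabla Cons.prems)
  then show ?case using Cons.IH[OF Cons.prems] unfolding cu
    by (simp add: smooth_iff_upto differentiable_upto_add)
qed (auto simp: smooth_const)

lemma nabla_funpow_commute:
  assumes "smooth (f :: 'a::real_normed_vector \<Rightarrow> complex)"
  shows "nabla u ((nabla w ^^ k) f) = (nabla w ^^ k) (nabla u f)"
  using assms
proof (induction k arbitrary: f)
  case (Suc k)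
  have "nabla u (nabla w f) = nabla w (nabla u f)"
    using nabla_commute[OF Suc.prems] by blast
  then show ?case using Suc.IH[OF smooth_nabla[OF Suc.prems, of w]]
    by (simp add: funpow_Suc_right \<open>nabla u (nabla w f) = nabla w (nabla u f)\<close> del: funpow.simps(2))
qed auto

section \<open>An operator is determined by its symbol\<close>

context
  fixes e1 e2 :: "'a::euclidean_space"
  assumes span: "\<And>x. \<exists>a b. x = a *\<^sub>R e1 + b *\<^sub>R e2"
    and dual: "\<And>X Y. \<exists>\<xi>::'a cdual. blinfun_apply \<xi> e1 = X \<and> blinfun_apply \<xi> e2 = Y"
begin

text \<open>Writing each vector in the basis and commuting derivatives turns a word in arbitrary
  directions into a polynomial in the two basis derivatives.\<close>

lemma foldr_nabla_normal_form:
  "\<exists>T::(complex \<times> nat \<times> nat) list. \<forall>g x. smooth g \<longrightarrow>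
     foldr nabla us g x = (\<Sum>(c, i, j)\<leftarrow>T. c * (nabla e1 ^^ i) ((nabla e2 ^^ j) g) x)"
proof (induction us)
  case Nil
  show ?case by (rule exI[of _ "[(1, 0, 0)]"]) simp
next
  case (Cons u us)
  then obtain T :: "(complex \<times> nat \<times> nat) list" where T: "\<And>g x. smooth g \<Longrightarrow>
     foldr nabla us g x = (\<Sum>(c, i, j)\<leftarrow>T. c * (nabla e1 ^^ i) ((nabla e2 ^^ j) g) x)" by blast
  obtain a b where u: "u = a *\<^sub>R e1 + b *\<^sub>R e2" using span by blast
  \<comment> \<open>One more derivative along u = a e1 + b e2 raises either exponent by one.\<close>
  define h where "h = (\<lambda>(c, i, j). [(c * of_real a, Suc i, j), (c * of_real b, i, Suc j)] :: (complex \<times> nat \<times> nat) list)"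
  have "nabla u (\<lambda>x. \<Sum>(c, i, j)\<leftarrow>T. c * (nabla e1 ^^ i) ((nabla e2 ^^ j) g) x) x
      = (\<Sum>(c, i, j)\<leftarrow>concat (map h T). c * (nabla e1 ^^ i) ((nabla e2 ^^ j) g) x)" (is "?L T = ?R T")
    if g: "smooth g" for g x
  proof (induction T)
    case Nil
    show ?case by (simp add: nabla_eqI[OF has_derivative_const])
  next
    case (Cons t T)
    obtain c i j where t: "t = (c, i, j)" by (metis prod_cases3)
    let ?p = "(nabla e1 ^^ i) ((nabla e2 ^^ j) g)"
    have sp: "smooth ?p" using smooth_foldr_nabla[OF smooth_foldr_nabla[OF g]] by (simp only: funpow_nabla)
    have sT: "smooth (\<lambda>x. \<Sum>(c, i, j)\<leftarrow>T. c * (nabla e1 ^^ i) ((nabla e2 ^^ j) g) x)"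
      using smooth_list_sum[OF g, of "map (\<lambda>(c, i, j). (c, replicate i e1 @ replicate j e2)) T"]
      by (simp add: o_def case_prod_unfold)
    have "nabla u (\<lambda>x. c * ?p x) x = c * (of_real a * nabla e1 ?p x + of_real b * nabla e2 ?p x)"
      by (simp add: nabla_cmult nabla_linear smooth_differentiable sp u)
    also have "nabla e2 ?p = (nabla e1 ^^ i) ((nabla e2 ^^ Suc j) g)"
      by (subst nabla_funpow_commute) (simp_all only: funpow_nabla smooth_foldr_nabla g foldr.simps replicate.simps o_apply)
    finally have 1: "nabla u (\<lambda>x. c * ?p x) x = c * of_real a * (nabla e1 ^^ Suc i) ((nabla e2 ^^ j) g) x
       + c * of_real b * (nabla e1 ^^ i) ((nabla e2 ^^ Suc j) g) x"
      by (simp add: algebra_simps)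
    have "?L (t # T) = nabla u (\<lambda>x. c * ?p x) x + ?L T"
      by (simp only: t list.map sum_list.Cons prod.case)
         (intro nabla_add smooth_differentiable smooth_mult smooth_const sp sT)
    also have "\<dots> = ?R (t # T)" unfolding 1 Cons.IH by (simp add: t h_def del: funpow.simps)
    finally show ?case .
  qed
  moreover have "foldr nabla us g = (\<lambda>x. \<Sum>(c, i, j)\<leftarrow>T. c * (nabla e1 ^^ i) ((nabla e2 ^^ j) g) x)" if "smooth g" for g
    using T[OF that] by blast
  ultimately show ?case by (intro exI[of _ "concat (map h T)"]) (simp del: funpow.simps)
qed

lemma const_coeff_normal_form:
  assumes "const_coeff_operator D"
  shows "\<exists>T::(complex \<times> nat \<times> nat) list. \<forall>g x. smooth g \<longrightarrow>
     D g x = (\<Sum>(c, i, j)\<leftarrow>T. c * (nabla e1 ^^ i) ((nabla e2 ^^ j) g) x)"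
proof -
  have "\<exists>T::(complex \<times> nat \<times> nat) list. \<forall>g x. smooth g \<longrightarrow>
     (\<Sum>(c, us)\<leftarrow>U. c * foldr nabla us g x) = (\<Sum>(c, i, j)\<leftarrow>T. c * (nabla e1 ^^ i) ((nabla e2 ^^ j) g) x)"
    for U :: "(complex \<times> 'a list) list"
  proof (induction U)
    case Nil
    show ?case by (rule exI[of _ "[]"]) simp
  next
    case (Cons cu U)
    obtain c us where cu: "cu = (c, us)" by fastforce
    obtain T where T: "\<forall>g x. smooth g \<longrightarrow>
      (\<Sum>(c, us)\<leftarrow>U. c * foldr nabla us g x) = (\<Sum>(c, i, j)\<leftarrow>T. c * (nabla e1 ^^ i) ((nabla e2 ^^ j) g) x)"
      using Cons.IH by blast
    obtain T' where T': "\<forall>g x. smooth g \<longrightarrow>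
      foldr nabla us g x = (\<Sum>(c, i, j)\<leftarrow>T'. c * (nabla e1 ^^ i) ((nabla e2 ^^ j) g) x)"
      using foldr_nabla_normal_form by blast
    show ?case
      by (rule exI[of _ "map (\<lambda>(d, i, j). (c * d, i, j)) T' @ T"])
         (use T T' in \<open>simp add: cu o_def case_prod_unfold sum_list_const_mult mult.assoc\<close>)
  qed
  moreover obtain U where "\<And>g x. D g x = (\<Sum>(c, us)\<leftarrow>U. c * foldr nabla us g x)"
    using const_coeff_smooth_eq[OF assms(1)] by blast
  ultimately show ?thesis by presburger
qed

text \<open>Covectors take arbitrary pairs of complex values on e1 and e2, so the assumption is the
  vanishing of a polynomial in two independent complex variables. Its collected coefficients are
  then zero, whatever is substituted for the monomials.\<close>

lemma const_coeff_zero: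
  assumes "\<And>\<xi>::'a cdual. (\<Sum>(c, i, j)\<leftarrow>T. c * (blinfun_apply \<xi> e1 ^ i * blinfun_apply \<xi> e2 ^ j)) = 0"
  shows "(\<Sum>(c, i, j)\<leftarrow>T. c * \<phi> i j) = (0::complex)"
proof -
  obtain m where m: "\<forall>(c, i, j) \<in> set T. i \<le> m \<and> j \<le> m"
  proof -
    have "\<exists>m. \<forall>(c, i, j) \<in> set T. i \<le> m \<and> j \<le> m"
    proof (induction T)
      case (Cons t T)
      then obtain m where "\<forall>(c, i, j) \<in> set T. i \<le> m \<and> j \<le> m" by blast
      then show ?case
        by (intro exI[of _ "m + fst (snd t) + snd (snd t)"]) fastforce
    qed auto
    then show ?thesis using that by blast
  qed
  \<comment> \<open>The list may repeat a pair of exponents; \<open>a\<close> collects the total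
    coefficient.\<close>
  define a where "a = (\<lambda>i j. \<Sum>(c, i', j')\<leftarrow>T. if i' = i \<and> j' = j then c else 0)"
  have conv: "(\<Sum>(c, i, j)\<leftarrow>T. c * \<phi> i j) = (\<Sum>i\<le>m. \<Sum>j\<le>m. a i j * \<phi> i j)" for \<phi> :: "nat \<Rightarrow> nat \<Rightarrow> complex"
    using m unfolding a_def
  proof (induction T)
    case (Cons t T)
    obtain c i j where t: "t = (c, i, j)" by (metis prod_cases3)
    have "(\<Sum>j'\<le>m. (if i = i' \<and> j = j' then c else 0) * \<phi> i' j') = (if i' = i then c * \<phi> i j else 0)" for i'
    proof (cases "i' = i")
      case True
      then have "(\<Sum>j'\<le>m. (if i = i' \<and> j = j' then c else 0) * \<phi> i' j') = (\<Sum>j'\<le>m. if j' = j then c * \<phi> i j else 0)"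
        by (intro sum.cong) auto
      then show ?thesis using Cons.prems t True by simp
    qed auto
    then have "(\<Sum>i'\<le>m. \<Sum>j'\<le>m. (if i = i' \<and> j = j' then c else 0) * \<phi> i' j') = c * \<phi> i j"
      using Cons.prems t by simp
    then show ?case using Cons by (simp add: t ring_distribs sum.distrib)
  qed auto
  have *: "(\<Sum>i\<le>m. (\<Sum>j\<le>m. a i j * Y ^ j) * X ^ i) = 0" for X Y
  proof -
    obtain \<xi> :: "'a cdual" where "blinfun_apply \<xi> e1 = X" "blinfun_apply \<xi> e2 = Y" using dual by blast
    then have "0 = (\<Sum>i\<le>m. \<Sum>j\<le>m. a i j * (X ^ i * Y ^ j))"
      using assms[of \<xi>] conv[of "\<lambda>i j. X ^ i * Y ^ j"] by simp
    also have "\<dots> = (\<Sum>i\<le>m. (\<Sum>j\<le>m. a i j * Y ^ j) * X ^ i)"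
      by (simp add: sum_distrib_right sum_distrib_left mult_ac)
    finally show ?thesis by simp
  qed
  \<comment> \<open>One-variable vanishing is used twice: in X with Y fixed, then in Y.\<close>
  have "(\<Sum>j\<le>m. a i j * Y ^ j) = 0" if "i \<le> m" for i Y
    using polyfun_eq_0[of "\<lambda>i. \<Sum>j\<le>m. a i j * Y ^ j" m] * that by blast
  then have "a i j = 0" if "i \<le> m" "j \<le> m" for i j
    using polyfun_eq_0[of "a i" m] that by blast
  then show ?thesis unfolding conv by simp
qed

text \<open>Exponentials separate the monomials of the normal form, since their iterated derivatives
  at 0 are the monomials in the values of the covector. Equal symbols make the difference of the two
  normal forms the zero polynomial.\<close>

lemma symbol_determines_operator:
  fixes D E :: "('a \<Rightarrow> complex) \<Rightarrow> 'a \<Rightarrow> complex"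
  assumes "const_coeff_operator D" "const_coeff_operator E" "has_symbol D \<sigma>" "has_symbol E \<sigma>" "smooth g"
  shows "D g x = E g x"
proof -
  obtain T U :: "(complex \<times> nat \<times> nat) list" where
    T: "\<And>g x. smooth g \<Longrightarrow> D g x = (\<Sum>(c, i, j)\<leftarrow>T. c * (nabla e1 ^^ i) ((nabla e2 ^^ j) g) x)" and
    U: "\<And>g x. smooth g \<Longrightarrow> E g x = (\<Sum>(c, i, j)\<leftarrow>U. c * (nabla e1 ^^ i) ((nabla e2 ^^ j) g) x)"
    using const_coeff_normal_form[OF assms(1)] const_coeff_normal_form[OF assms(2)] by (elim exE) blast
  define V where "V = T @ map (\<lambda>(c, i, j). (- c, i, j)) U"
  have "(\<Sum>(c, i, j)\<leftarrow>map (\<lambda>(c, i, j). (- c, i, j)) U. c * \<phi> i j) = - (\<Sum>(c, i, j)\<leftarrow>U. c * \<phi> i j)"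
    for \<phi> :: "nat \<Rightarrow> nat \<Rightarrow> complex"
    by (induction U) auto
  then have V: "(\<Sum>(c, i, j)\<leftarrow>V. c * \<phi> i j) = (\<Sum>(c, i, j)\<leftarrow>T. c * \<phi> i j) - (\<Sum>(c, i, j)\<leftarrow>U. c * \<phi> i j)" for \<phi>
    by (simp add: V_def)
  have pw: "(nabla e1 ^^ i) ((nabla e2 ^^ j) (\<lambda>y. exp (blinfun_apply \<xi> y))) 0
     = blinfun_apply \<xi> e1 ^ i * blinfun_apply \<xi> e2 ^ j" for \<xi> :: "'a cdual" and i j
    using foldr_nabla_exp_blinfun[of "replicate i e1 @ replicate j e2" \<xi>]
    by simp
  have "(\<Sum>(c, i, j)\<leftarrow>V. c * (blinfun_apply \<xi> e1 ^ i * blinfun_apply \<xi> e2 ^ j)) = 0" for \<xi> :: "'a cdual"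
  proof -
    have "D (\<lambda>y. exp (blinfun_apply \<xi> y)) 0 = E (\<lambda>y. exp (blinfun_apply \<xi> y)) 0"
      using assms(3,4) unfolding has_symbol_def by (metis blinfun.zero_right exp_zero minus_zero mult_1)
    then show ?thesis unfolding V T[OF smooth_exp_blinfun] U[OF smooth_exp_blinfun] pw by simp
  qed
  from const_coeff_zero[OF this] show ?thesis
    unfolding V T[OF assms(5)] U[OF assms(5)] by simp
qed

end

subsection \<open>Euler-Maclaurin expansion\<close>

definition bern_coeff :: "nat \<Rightarrow> complex" where
  "bern_coeff n = bernoulli_number n / fact n"

lemma bern_coeff_nth: "bern_coeff n = fps_nth (fps_X / (fps_exp 1 - 1)) n"
  by (simp add: bern_coeff_def bernoulli_number_def)

text \<open>Division of power series is exact here because e^z - 1, like z, has order 1.\<close>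

lemma fps_X_eq_bern: "fps_X / (fps_exp 1 - 1) * (fps_exp 1 - 1) = (fps_X :: complex fps)"
proof -
  have s: "subdegree (fps_exp 1 - 1 :: complex fps) = 1"
    by (rule subdegreeI) auto
  then have nz: "(fps_exp 1 - 1 :: complex fps) \<noteq> 0" by auto
  have "(fps_exp 1 - 1 :: complex fps) dvd fps_X"
    using nz s by (simp add: fps_dvd_iff)
  then show ?thesis by simp
qed

text \<open>Comparison of coefficients in z / (e^z - 1) times e^z - 1. The conditional kills the
  constant term of e^z - 1.\<close>

lemma bern_coeff_convolution:
  "(\<Sum>k\<le>j. bern_coeff k * (if j - k = 0 then 0 else 1 / fact (j - k))) = (if j = 1 then 1 else 0)"
proof -
  have "fps_nth (fps_X :: complex fps) j = fps_nth (fps_X / (fps_exp 1 - 1) * (fps_exp 1 - 1)) j"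
    by (simp only: fps_X_eq_bern)
  also have "\<dots> = (\<Sum>k\<le>j. bern_coeff k * (if j - k = 0 then 0 else 1 / fact (j - k)))"
    unfolding fps_mult_nth bern_coeff_nth[symmetric] atLeast0AtMost
    by (intro sum.cong refl) auto
  finally show ?thesis by (simp add: fps_X_nth split: if_splits)
qed

text \<open>The order of the expansion of \<open>D k\<close> is chosen so that every k uses the same
  top derivative \<open>D (Suc M)\<close> in the remainder. The factorial in the integral remainder
  is estimated by 1.\<close>

lemma Taylor_step:
  fixes D :: "nat \<Rightarrow> real \<Rightarrow> complex"
  assumes der: "\<And>k t. k \<le> M \<Longrightarrow> t \<ge> 0 \<Longrightarrow> (D k has_vector_derivative D (Suc k) t) (at t within {0..})"
    and bnd: "\<And>t. t \<ge> 0 \<Longrightarrow> norm (D (Suc M) t) \<le> B"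
    and "k \<le> M" "t \<ge> 0" "\<delta> > 0"
  shows "norm (D k (t + \<delta>) - (\<Sum>m<Suc M - k. (\<delta> ^ m / fact m) *\<^sub>R D (k + m) t)) \<le> B * \<delta> ^ (Suc M - k)"
proof -
  define p where "p = Suc M - k"
  have p: "p > 0" "k + p = Suc M" using assms by (auto simp: p_def)
  have "((\<lambda>x. ((t + \<delta> - x) ^ (p - 1) / fact (p - 1)) *\<^sub>R D (k + p) x) has_integral
          D k (t + \<delta>) - (\<Sum>m<p. ((t + \<delta> - t) ^ m / fact m) *\<^sub>R D (k + m) t)) {t..t + \<delta>}"
  proof (rule Taylor_has_integral[where Df = "\<lambda>m. D (k + m)"])
    fix m s assume "m < p" "t \<le> s" "s \<le> t + \<delta>"
    then have "(D (k + m) has_vector_derivative D (Suc (k + m)) s) (at s within {0..})"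
      using p assms by (intro der) auto
    then show "(D (k + m) has_vector_derivative D (k + Suc m) s) (at s within {t..t + \<delta>})"
      using assms by (auto intro: has_vector_derivative_within_subset)
  qed (use p assms in auto)
  then have "norm (D k (t + \<delta>) - (\<Sum>m<p. ((t + \<delta> - t) ^ m / fact m) *\<^sub>R D (k + m) t))
      \<le> (\<delta> ^ (p - 1) * B) * measure lborel (cbox t (t + \<delta>))"
  proof (intro has_integral_bound)
    fix x assume x: "x \<in> cbox t (t + \<delta>)"
    have "(t + \<delta> - x) ^ (p - 1) / fact (p - 1) \<le> (t + \<delta> - x) ^ (p - 1) / 1"
      using x by (intro divide_left_mono) auto
    also have "\<dots> \<le> \<delta> ^ (p - 1)" using x by (auto intro: power_mono)
    finally have "(t + \<delta> - x) ^ (p - 1) / fact (p - 1) \<le> \<delta> ^ (p - 1)" .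
    moreover have "0 \<le> (t + \<delta> - x) ^ (p - 1) / fact (p - 1)"
      using x by (intro divide_nonneg_pos zero_le_power) auto
    ultimately have "\<bar>(t + \<delta> - x) ^ (p - 1) / fact (p - 1)\<bar> \<le> \<delta> ^ (p - 1)"
      by simp
    moreover have "norm (D (k + p) x) \<le> B"
      unfolding p(2) by (rule bnd) (use x \<open>t \<ge> 0\<close> in auto)
    ultimately show "norm (((t + \<delta> - x) ^ (p - 1) / fact (p - 1)) *\<^sub>R D (k + p) x) \<le> \<delta> ^ (p - 1) * B"
      unfolding norm_scaleR using \<open>\<delta> > 0\<close> by (intro mult_mono norm_ge_zero zero_le_power) simp_all
  next
    have "0 \<le> B" by (rule order_trans[OF norm_ge_zero bnd[of 0]]) simp
    then show "0 \<le> \<delta> ^ (p - 1) * B" using \<open>\<delta> > 0\<close> by simp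
  qed auto
  also have "\<dots> = B * \<delta> ^ p"
    using p \<open>\<delta> > 0\<close> by (cases p) auto
  finally show ?thesis by (simp add: p_def)
qed

text \<open>
  Telescoping Taylor's formula for \<open>D k\<close> over the grid of mesh \<open>1 / N\<close> gives one linear relation
  between the grid sums of the \<open>D j\<close> for each \<open>k\<close>; the Bernoulli numbers invert this triangular
  system.
\<close>

lemma Euler_Maclaurin_half_line:
  fixes D :: "nat \<Rightarrow> real \<Rightarrow> complex" and K N M :: nat
  assumes der: "\<And>k t. k \<le> M \<Longrightarrow> t \<ge> 0 \<Longrightarrow> (D k has_vector_derivative D (Suc k) t) (at t within {0..})"
    and zero: "\<And>k t. k \<le> M \<Longrightarrow> t \<ge> real K \<Longrightarrow> D k t = 0"
    and bnd: "\<And>t. t \<ge> 0 \<Longrightarrow> norm (D (Suc M) t) \<le> B"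
    and "N > 0" "M \<ge> 1"
  shows "norm ((\<Sum>i<K * N. D 1 (real i / real N)) / of_nat N + (\<Sum>k\<le>M. bern_coeff k * D k 0 / of_nat N ^ k))
     \<le> (\<Sum>k\<le>M. norm (bern_coeff k)) * real K * B / real N ^ M"
proof -
  define \<delta> where "\<delta> = 1 / real N"
  have \<delta>: "\<delta> > 0" using assms by (simp add: \<delta>_def)
  \<comment> \<open>The summand is \<open>D 1\<close>, and \<open>D 0\<close> is its primitive
    vanishing far out. The term k = 0 of the claimed sum is thus minus the integral of the
    summand.\<close>
  define S where "S = (\<lambda>j. \<Sum>i<K * N. D j (real i * \<delta>))"
  define e where "e = (\<lambda>m. if m = 0 then 0 else 1 / fact m :: complex)"
  \<comment> \<open>\<open>e\<close> omits m = 0, because the zeroth Taylor term is absorbed into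
    the telescoping difference. That difference sums to \<open>- D k 0\<close>, since
    \<open>D k\<close> vanishes at K.\<close>
  define E where "E = (\<lambda>k. - D k 0 - (\<Sum>m\<le>M - k. e m * of_real \<delta> ^ m * S (k + m)))"
  have E: "norm (E k) \<le> real K * B * \<delta> ^ (M - k)" if k: "k \<le> M" for k
  proof -
    define T where "T = (\<lambda>i. D k (real i * \<delta> + \<delta>) - (\<Sum>m<Suc M - k. (\<delta> ^ m / fact m) *\<^sub>R D (k + m) (real i * \<delta>)))"
    have "{..<Suc M - k} = {..M - k}" using k by auto
    then have "T i = (D k (real (Suc i) * \<delta>) - D k (real i * \<delta>)) - (\<Sum>m\<le>M - k. e m * of_real \<delta> ^ m * D (k + m) (real i * \<delta>))" for i
    proof -
      have "(\<Sum>m\<le>M - k. (\<delta> ^ m / fact m) *\<^sub>R D (k + m) (real i * \<delta>)) =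
         D k (real i * \<delta>) + (\<Sum>m\<le>M - k. e m * of_real \<delta> ^ m * D (k + m) (real i * \<delta>))"
        by (subst (1 2) sum.atMost_shift) (simp add: e_def scaleR_conv_of_real)
      then show ?thesis
        unfolding T_def \<open>{..<Suc M - k} = {..M - k}\<close> by (simp add: algebra_simps)
    qed
    then have "(\<Sum>i<K * N. T i) = (\<Sum>i<K * N. D k (real (Suc i) * \<delta>) - D k (real i * \<delta>))
       - (\<Sum>i<K * N. \<Sum>m\<le>M - k. e m * of_real \<delta> ^ m * D (k + m) (real i * \<delta>))"
      by (simp only: sum_subtractf)
    also have "(\<Sum>i<K * N. D k (real (Suc i) * \<delta>) - D k (real i * \<delta>)) = D k (real (K * N) * \<delta>) - D k 0"
      by (subst sum_lessThan_telescope) simp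
    also have "D k (real (K * N) * \<delta>) = 0"
      using zero[OF k, of "real (K * N) * \<delta>"] assms by (simp add: \<delta>_def)
    also have "(\<Sum>i<K * N. \<Sum>m\<le>M - k. e m * of_real \<delta> ^ m * D (k + m) (real i * \<delta>))
        = (\<Sum>m\<le>M - k. e m * of_real \<delta> ^ m * S (k + m))"
      unfolding S_def by (subst sum.swap) (simp add: sum_distrib_left)
    finally have "E k = (\<Sum>i<K * N. T i)" by (simp add: E_def)
    also have "norm \<dots> \<le> (\<Sum>i<K * N. B * \<delta> ^ (Suc M - k))"
      unfolding T_def by (intro sum_norm_le Taylor_step der bnd k \<delta>) (use \<delta> in auto)
    \<comment> \<open>Summing over K N grid points costs one power of the mesh.\<close>
    also have "\<dots> = real K * B * \<delta> ^ (M - k)"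
      using k assms by (simp add: \<delta>_def Suc_diff_le field_simps)
    finally show ?thesis .
  qed
  \<comment> \<open>Collecting terms with k + m = j produces the Bernoulli convolution, which leaves
    only j = 1, the sum to be evaluated.\<close>
  have "(\<Sum>k\<le>M. \<Sum>m\<le>M - k. bern_coeff k * e m * of_real \<delta> ^ (k + m) * S (k + m))
      = (\<Sum>j\<le>M. \<Sum>k\<le>j. bern_coeff k * e (j - k) * of_real \<delta> ^ (k + (j - k)) * S (k + (j - k)))"
    by (subst sum.triangle_reindex_eq[symmetric]) (subst sum.Sigma, auto intro!: sum.cong)
  also have "\<dots> = (\<Sum>j\<le>M. (\<Sum>k\<le>j. bern_coeff k * e (j - k)) * of_real \<delta> ^ j * S j)"
    by (simp add: sum_distrib_right)
  also have "\<dots> = (\<Sum>j\<le>M. if j = 1 then of_real \<delta> * S 1 else 0)"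
    unfolding e_def bern_coeff_convolution by (intro sum.cong) auto
  also have "\<dots> = of_real \<delta> * S 1" using \<open>M \<ge> 1\<close> by simp
  finally have conv: "(\<Sum>k\<le>M. \<Sum>m\<le>M - k. bern_coeff k * e m * of_real \<delta> ^ (k + m) * S (k + m)) = of_real \<delta> * S 1" .
  have "(\<Sum>k\<le>M. bern_coeff k * of_real \<delta> ^ k * E k)
     = - (\<Sum>k\<le>M. bern_coeff k * of_real \<delta> ^ k * D k 0)
       - (\<Sum>k\<le>M. \<Sum>m\<le>M - k. bern_coeff k * e m * of_real \<delta> ^ (k + m) * S (k + m))"
    unfolding E_def by (simp add: right_diff_distrib sum_subtractf sum_negf sum_distrib_left power_add mult_ac)
  then have "(\<Sum>i<K * N. D 1 (real i / real N)) / of_nat N + (\<Sum>k\<le>M. bern_coeff k * D k 0 / of_nat N ^ k)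
     = - (\<Sum>k\<le>M. bern_coeff k * of_real \<delta> ^ k * E k)"
    unfolding conv by (simp add: S_def \<delta>_def power_inverse divide_inverse mult_ac)
  also have "norm \<dots> \<le> (\<Sum>k\<le>M. norm (bern_coeff k) * (real K * B / real N ^ M))"
    unfolding norm_minus_cancel
  proof (rule sum_norm_le)
    fix k assume "k \<in> {..M}"
    then have k: "k \<le> M" by simp
    have "norm (bern_coeff k * of_real \<delta> ^ k * E k) \<le> norm (bern_coeff k) * \<delta> ^ k * (real K * B * \<delta> ^ (M - k))"
      using E[OF k] \<delta> by (auto simp: norm_mult norm_power intro!: mult_left_mono)
    also have "\<dots> = norm (bern_coeff k) * (real K * B * \<delta> ^ M)"
      using k by (simp flip: power_add add: mult_ac)
    also have "\<dots> = norm (bern_coeff k) * (real K * B / real N ^ M)"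
      by (simp add: \<delta>_def power_one_over)
    finally show "norm (bern_coeff k * of_real \<delta> ^ k * E k) \<le> norm (bern_coeff k) * (real K * B / real N ^ M)" .
  qed
  also have "\<dots> = (\<Sum>k\<le>M. norm (bern_coeff k)) * (real K * B / real N ^ M)"
    by (rule sum_distrib_right[symmetric])
  finally show ?thesis by (simp add: mult.assoc)
qed

section \<open>Euler-Maclaurin on a quadrant\<close>

text \<open>\<open>G k l\<close> plays the role of the derivative of order k in s and l in t of one
  function on the closed quadrant. Carrying all derivatives as data turns passing to a primitive
  into an index shift. Derivatives at the boundary are one-sided.\<close>

definition derivative_family :: "nat \<Rightarrow> (nat \<Rightarrow> nat \<Rightarrow> real \<Rightarrow> real \<Rightarrow> complex) \<Rightarrow> bool" where
  "derivative_family K G \<longleftrightarrow>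
     (\<forall>k l. continuous_on ({0..} \<times> {0..}) (\<lambda>(s, t). G k l s t)) \<and>
     (\<forall>k l s t. s \<ge> 0 \<longrightarrow> t \<ge> 0 \<longrightarrow>
        ((\<lambda>s. G k l s t) has_vector_derivative G (Suc k) l s t) (at s within {0..}) \<and>
        ((\<lambda>t. G k l s t) has_vector_derivative G k (Suc l) s t) (at t within {0..}) \<and>
        (s \<ge> real K \<or> t \<ge> real K \<longrightarrow> G k l s t = 0))"

lemma derivative_familyD:
  assumes "derivative_family K G"
  shows "continuous_on ({0..} \<times> {0..}) (\<lambda>(s, t). G k l s t)"
    and "s \<ge> 0 \<Longrightarrow> t \<ge> 0 \<Longrightarrow> ((\<lambda>s. G k l s t) has_vector_derivative G (Suc k) l s t) (at s within {0..})"
    and "s \<ge> 0 \<Longrightarrow> t \<ge> 0 \<Longrightarrow> ((\<lambda>t. G k l s t) has_vector_derivative G k (Suc l) s t) (at t within {0..})"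
    and "s \<ge> 0 \<Longrightarrow> t \<ge> 0 \<Longrightarrow> s \<ge> real K \<or> t \<ge> real K \<Longrightarrow> G k l s t = 0"
  using assms by (auto simp: derivative_family_def)

lemma derivative_family_flip:
  assumes "derivative_family K G"
  shows "derivative_family K (\<lambda>k l s t. G l k t s)"
proof -
  have "continuous_on ({0..} \<times> {0..}) (\<lambda>(s, t). G l k t s)" for k l
  proof -
    have "continuous_on ({0..} \<times> {0..}) (\<lambda>x. (\<lambda>(s, t). G l k s t) (snd x, fst x))"
      by (rule continuous_on_compose2[OF derivative_familyD(1)[OF assms]]) (auto intro!: continuous_intros)
    then show ?thesis by (simp add: split_beta)
  qed
  with derivative_familyD[OF assms] show ?thesis
    unfolding derivative_family_def by blast
qed

text \<open>The new index 0 holds the primitive in s that vanishes far out, minus the integral from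
  s to infinity. By the support condition a window of fixed length K starting at s suffices; after
  the shift the domain of integration no longer depends on s, as the Leibniz rule requires.\<close>

definition primitive_family :: "nat \<Rightarrow> (nat \<Rightarrow> nat \<Rightarrow> real \<Rightarrow> real \<Rightarrow> complex) \<Rightarrow> nat \<Rightarrow> nat \<Rightarrow> real \<Rightarrow> real \<Rightarrow> complex" where
  "primitive_family K G k l s t =
     (case k of 0 \<Rightarrow> - integral {0..real K} (\<lambda>\<sigma>. G 0 l (s + \<sigma>) t) | Suc k' \<Rightarrow> G k' l s t)"

lemma derivative_family_primitive:
  assumes G: "derivative_family K G"
  shows "derivative_family K (primitive_family K G)"
proof -
  note D = derivative_familyD[OF G]
  have cont: "continuous_on S (\<lambda>x. G k l (f x) (g x))"
    if "continuous_on S f" "continuous_on S g" "\<And>x. x \<in> S \<Longrightarrow> f x \<ge> 0 \<and> g x \<ge> 0" for S k l f g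
    using continuous_on_compose2[OF D(1)[of k l], of S "\<lambda>x. (f x, g x)"] that
    by (auto intro!: continuous_intros)
  \<comment> \<open>Differentiation under the integral gives the integral of \<open>G 1 l\<close>.
    The fundamental theorem evaluates it, and the upper end s + K lies beyond the support.\<close>
  have d1: "((\<lambda>s. primitive_family K G 0 l s t) has_vector_derivative G 0 l s t) (at s within {0..})"
    if "s \<ge> 0" "t \<ge> 0" for l s t
  proof -
    have "((\<lambda>s. integral (cbox 0 (real K)) (\<lambda>\<sigma>. G 0 l (s + \<sigma>) t)) has_vector_derivative
          integral (cbox 0 (real K)) (\<lambda>\<sigma>. G 1 l (s + \<sigma>) t)) (at s within {0..})"
    proof (rule leibniz_rule_vector_derivative)
      fix s \<sigma> :: real assume *: "s \<in> {0..}" "\<sigma> \<in> cbox 0 (real K)"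
      have "((\<lambda>s. s + \<sigma>) has_vector_derivative 1) (at s within {0..})"
        by (auto intro!: derivative_eq_intros)
      moreover have "((\<lambda>s. G 0 l s t) has_vector_derivative G 1 l (s + \<sigma>) t) (at (s + \<sigma>) within (\<lambda>s. s + \<sigma>) ` {0..})"
        using D(2)[of "s + \<sigma>" t 0 l] * that by (auto intro: has_vector_derivative_within_subset)
      ultimately show "((\<lambda>s. G 0 l (s + \<sigma>) t) has_vector_derivative G 1 l (s + \<sigma>) t) (at s within {0..})"
        using vector_diff_chain_within[of "\<lambda>s. s + \<sigma>" 1 s "{0..}" "\<lambda>s. G 0 l s t" "G 1 l (s + \<sigma>) t"]
        by (simp add: o_def)
    next
      show "(\<lambda>\<sigma>. G 0 l (s + \<sigma>) t) integrable_on cbox 0 (real K)" if "s \<in> {0..}" for s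
        using that \<open>t \<ge> 0\<close> by (intro integrable_continuous cont continuous_intros) auto
      show "continuous_on ({0..} \<times> cbox 0 (real K)) (\<lambda>(s, \<sigma>). G 1 l (s + \<sigma>) t)"
        unfolding split_beta using \<open>t \<ge> 0\<close> by (intro cont continuous_intros) auto
    qed (use that in auto)
    moreover have "((\<lambda>\<sigma>. G 1 l (s + \<sigma>) t) has_integral (G 0 l (s + real K) t - G 0 l (s + 0) t)) {0..real K}"
    proof (rule fundamental_theorem_of_calculus)
      fix \<sigma> :: real assume *: "\<sigma> \<in> {0..real K}"
      have "((\<lambda>\<sigma>. s + \<sigma>) has_vector_derivative 1) (at \<sigma> within {0..real K})"
        by (auto intro!: derivative_eq_intros)
      moreover have "((\<lambda>s. G 0 l s t) has_vector_derivative G 1 l (s + \<sigma>) t) (at (s + \<sigma>) within (\<lambda>\<sigma>. s + \<sigma>) ` {0..real K})"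
        using D(2)[of "s + \<sigma>" t 0 l] * that by (auto intro: has_vector_derivative_within_subset)
      ultimately show "((\<lambda>\<sigma>. G 0 l (s + \<sigma>) t) has_vector_derivative G 1 l (s + \<sigma>) t) (at \<sigma> within {0..real K})"
        using vector_diff_chain_within[of "\<lambda>\<sigma>. s + \<sigma>" 1 \<sigma> "{0..real K}" "\<lambda>s. G 0 l s t" "G 1 l (s + \<sigma>) t"]
        by (simp add: o_def)
    qed auto
    moreover have "G 0 l (s + real K) t = 0" using D(4)[of "s + real K" t 0 l] that by auto
    ultimately show ?thesis
      using has_vector_derivative_minus by (fastforce simp: primitive_family_def dest!: integral_unique)
  qed
  have d2: "((\<lambda>t. primitive_family K G 0 l s t) has_vector_derivative primitive_family K G 0 (Suc l) s t) (at t within {0..})"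
    if "s \<ge> 0" "t \<ge> 0" for l s t
  proof -
    have "((\<lambda>t. integral (cbox 0 (real K)) (\<lambda>\<sigma>. G 0 l (s + \<sigma>) t)) has_vector_derivative
          integral (cbox 0 (real K)) (\<lambda>\<sigma>. G 0 (Suc l) (s + \<sigma>) t)) (at t within {0..})"
    proof (rule leibniz_rule_vector_derivative)
      show "(\<lambda>\<sigma>. G 0 l (s + \<sigma>) t) integrable_on cbox 0 (real K)" if "t \<in> {0..}" for t
        using that \<open>s \<ge> 0\<close> by (intro integrable_continuous cont continuous_intros) auto
      show "continuous_on ({0..} \<times> cbox 0 (real K)) (\<lambda>(t, \<sigma>). G 0 (Suc l) (s + \<sigma>) t)"
        unfolding split_beta using \<open>s \<ge> 0\<close> by (intro cont continuous_intros) auto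
    qed (use that in \<open>auto intro!: D(3)\<close>)
    then show ?thesis
      using has_vector_derivative_minus by (fastforce simp: primitive_family_def)
  qed
  have c: "continuous_on ({0..} \<times> {0..}) (\<lambda>(s, t). primitive_family K G 0 l s t)" for l
  proof -
    have "continuous_on ({0..} \<times> {0..}) (\<lambda>x. integral (cbox 0 (real K)) ((\<lambda>x \<sigma>. G 0 l (fst x + \<sigma>) (snd x)) x))"
      unfolding split_beta
      by (intro integral_continuous_on_param) (auto simp: split_beta intro!: cont continuous_intros)
    then show ?thesis
      by (auto simp: primitive_family_def split_beta intro!: continuous_intros)
  qed
  have z: "primitive_family K G 0 l s t = 0" if "s \<ge> 0" "t \<ge> 0" "s \<ge> real K \<or> t \<ge> real K" for l s t
  proof -
    have "integral {0..real K} (\<lambda>\<sigma>. G 0 l (s + \<sigma>) t) = integral {0..real K} (\<lambda>\<sigma>. 0)"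
      using that by (intro integral_cong D(4)) auto
    then show ?thesis by (simp add: primitive_family_def)
  qed
  have S: "primitive_family K G (Suc k) = G k" for k
    by (intro ext) (simp add: primitive_family_def)
  show ?thesis unfolding derivative_family_def
  proof (intro conjI allI impI)
    fix k l
    show "continuous_on ({0..} \<times> {0..}) (\<lambda>(s, t). primitive_family K G k l s t)"
      by (cases k) (use c D(1) S in auto)
    fix s t :: real assume st: "s \<ge> 0" "t \<ge> 0"
    show "((\<lambda>s. primitive_family K G k l s t) has_vector_derivative primitive_family K G (Suc k) l s t) (at s within {0..})"
      by (cases k) (use st d1 D(2) S in auto)
    show "((\<lambda>t. primitive_family K G k l s t) has_vector_derivative primitive_family K G k (Suc l) s t) (at t within {0..})"
      by (cases k) (use st d2 D(3) S in auto)
    show "primitive_family K G k l s t = 0" if "s \<ge> real K \<or> t \<ge> real K"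
      by (cases k) (use that st z D(4) S in auto)
  qed
qed

lemma derivative_family_bounded:
  assumes "derivative_family K G"
  obtains B where "\<And>s t. s \<ge> 0 \<Longrightarrow> t \<ge> 0 \<Longrightarrow> norm (G k l s t) \<le> B" "B \<ge> 0"
proof -
  have "compact ((\<lambda>(s, t). G k l s t) ` ({0..real K} \<times> {0..real K}))"
    by (intro compact_continuous_image compact_Times compact_Icc
        continuous_on_subset[OF derivative_familyD(1)[OF assms]]) auto
  then obtain B where B: "\<And>x. x \<in> (\<lambda>(s, t). G k l s t) ` ({0..real K} \<times> {0..real K}) \<Longrightarrow> norm x \<le> B"
    using compact_imp_bounded bounded_iff by metis
  show ?thesis
  proof
    fix s t :: real assume st: "s \<ge> 0" "t \<ge> 0"
    show "norm (G k l s t) \<le> max B 0"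
    proof (cases "s \<le> real K \<and> t \<le> real K")
      case True
      then show ?thesis using st by (intro order_trans[OF B]) force+
    next
      case False
      then show ?thesis using derivative_familyD(4)[OF assms st] by auto
    qed
  qed auto
qed

text \<open>The one-dimensional formula is applied in s for each fixed grid value of t, with
  \<open>F k 1\<close> in the role of \<open>D k\<close>. It is then applied in t to each boundary
  term at s = 0.\<close>

lemma Euler_Maclaurin_quadrant_square:
  assumes F: "derivative_family K F" and "M \<ge> 1"
  obtains C where "\<And>N. N > 0 \<Longrightarrow>
    norm ((\<Sum>i<K * N. \<Sum>j<K * N. F 1 1 (real i / real N) (real j / real N)) / of_nat N ^ 2
       - (\<Sum>k\<le>M. \<Sum>l\<le>M. bern_coeff k * bern_coeff l * F k l 0 0 / of_nat N ^ (k + l))) \<le> C / real N ^ M"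
proof -
  note D = derivative_familyD[OF F]
  define c where "c = (\<Sum>k\<le>M. norm (bern_coeff k))"
  have "c \<ge> 0" by (simp add: c_def sum_nonneg)
  obtain B1 where B1: "\<And>s t. s \<ge> 0 \<Longrightarrow> t \<ge> 0 \<Longrightarrow> norm (F (Suc M) 1 s t) \<le> B1" "B1 \<ge> 0"
    using derivative_family_bounded[OF F] by blast
  have "\<exists>B2. \<forall>k. (\<forall>s t. s \<ge> 0 \<longrightarrow> t \<ge> 0 \<longrightarrow> norm (F k (Suc M) s t) \<le> B2 k) \<and> B2 k \<ge> 0"
    by (rule choice) (metis derivative_family_bounded[OF F])
  then obtain B2 where B2: "\<And>k s t. s \<ge> 0 \<Longrightarrow> t \<ge> 0 \<Longrightarrow> norm (F k (Suc M) s t) \<le> B2 k" "\<And>k. B2 k \<ge> 0"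
    by blast
  define C where "C = c * real K * B1 * real K + (\<Sum>k\<le>M. norm (bern_coeff k) * (c * real K * B2 k))"
  show ?thesis
  proof
    fix N :: nat assume N: "N > 0"
    define x where "x = (\<lambda>i. real i / real N)"
    have x: "x i \<ge> 0" "x 0 = 0" for i by (auto simp: x_def)
    define A where "A = (\<lambda>j. (\<Sum>i<K * N. F 1 1 (x i) (x j)) / of_nat N + (\<Sum>k\<le>M. bern_coeff k * F k 1 0 (x j) / of_nat N ^ k))"
    define A' where "A' = (\<lambda>k. (\<Sum>j<K * N. F k 1 0 (x j)) / of_nat N + (\<Sum>l\<le>M. bern_coeff l * F k l 0 0 / of_nat N ^ l))"
    have A: "norm (A j) \<le> c * real K * B1 / real N ^ M" for j
      unfolding A_def c_def x_def using N \<open>M \<ge> 1\<close>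
      by (intro Euler_Maclaurin_half_line[where D="\<lambda>k s. F k 1 s (real j / real N)"] D(2) D(4) B1)
         (auto intro: order_trans[of 0 "real K"])
    have A': "norm (A' k) \<le> c * real K * B2 k / real N ^ M" for k
      unfolding A'_def c_def x_def using N \<open>M \<ge> 1\<close>
      by (intro Euler_Maclaurin_half_line[where D="\<lambda>l t. F k l 0 t"] D(3) D(4) B2)
         (auto intro: order_trans[of 0 "real K"])
    have "(\<Sum>i<K * N. \<Sum>j<K * N. F 1 1 (x i) (x j)) / of_nat N ^ 2
       = (\<Sum>j<K * N. (\<Sum>i<K * N. F 1 1 (x i) (x j)) / of_nat N) / of_nat N"
      by (subst sum.swap) (simp add: power2_eq_square flip: sum_divide_distrib)
    also have "\<dots> = (\<Sum>j<K * N. A j - (\<Sum>k\<le>M. bern_coeff k * F k 1 0 (x j) / of_nat N ^ k)) / of_nat N"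
      by (simp add: A_def)
    also have "\<dots> = (\<Sum>j<K * N. A j) / of_nat N - (\<Sum>j<K * N. \<Sum>k\<le>M. bern_coeff k * F k 1 0 (x j) / of_nat N ^ k) / of_nat N"
      by (simp add: sum_subtractf diff_divide_distrib)
    also have "(\<Sum>j<K * N. \<Sum>k\<le>M. bern_coeff k * F k 1 0 (x j) / of_nat N ^ k) / of_nat N
       = (\<Sum>k\<le>M. bern_coeff k / of_nat N ^ k * ((\<Sum>j<K * N. F k 1 0 (x j)) / of_nat N))"
      by (subst sum.swap) (simp add: sum_divide_distrib sum_distrib_left mult_ac)
    also have "\<dots> = (\<Sum>k\<le>M. bern_coeff k / of_nat N ^ k * (A' k - (\<Sum>l\<le>M. bern_coeff l * F k l 0 0 / of_nat N ^ l)))"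
      by (simp add: A'_def)
    also have "\<dots> = (\<Sum>k\<le>M. bern_coeff k / of_nat N ^ k * A' k)
       - (\<Sum>k\<le>M. \<Sum>l\<le>M. bern_coeff k * bern_coeff l * F k l 0 0 / of_nat N ^ (k + l))"
      by (simp add: right_diff_distrib sum_subtractf sum_distrib_left power_add mult_ac)
    finally have "(\<Sum>i<K * N. \<Sum>j<K * N. F 1 1 (x i) (x j)) / of_nat N ^ 2
        - (\<Sum>k\<le>M. \<Sum>l\<le>M. bern_coeff k * bern_coeff l * F k l 0 0 / of_nat N ^ (k + l))
       = (\<Sum>j<K * N. A j) / of_nat N - (\<Sum>k\<le>M. bern_coeff k / of_nat N ^ k * A' k)"
      by simp
    also have "norm \<dots> \<le> norm ((\<Sum>j<K * N. A j) / of_nat N) + norm (\<Sum>k\<le>M. bern_coeff k / of_nat N ^ k * A' k)"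
      by (rule norm_triangle_ineq4)
    \<comment> \<open>There are K N errors \<open>A j\<close>; division by N leaves the factor
      K.\<close>
    also have "norm ((\<Sum>j<K * N. A j) / of_nat N) \<le> (\<Sum>j<K * N. c * real K * B1 / real N ^ M) / real N"
      unfolding norm_divide norm_of_nat by (intro divide_right_mono sum_norm_le A) auto
    also have "\<dots> = c * real K * B1 * real K / real N ^ M" using N by simp
    also have "norm (\<Sum>k\<le>M. bern_coeff k / of_nat N ^ k * A' k) \<le> (\<Sum>k\<le>M. norm (bern_coeff k) * (c * real K * B2 k / real N ^ M))"
    proof (rule sum_norm_le)
      fix k
      have "real N ^ k \<ge> 1" using N by simp
      then have "norm (bern_coeff k) / real N ^ k \<le> norm (bern_coeff k) / 1"
        using N by (intro divide_left_mono mult_pos_pos zero_less_power norm_ge_zero zero_less_one) simp_all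
      then show "norm (bern_coeff k / of_nat N ^ k * A' k) \<le> norm (bern_coeff k) * (c * real K * B2 k / real N ^ M)"
        unfolding norm_mult norm_divide norm_power norm_of_nat using A'[of k]
        by (intro mult_mono) auto
    qed
    also have "\<dots> = (\<Sum>k\<le>M. norm (bern_coeff k) * (c * real K * B2 k)) / real N ^ M"
      by (simp add: sum_divide_distrib)
    finally show "norm ((\<Sum>i<K * N. \<Sum>j<K * N. F 1 1 (real i / real N) (real j / real N)) / of_nat N ^ 2
       - (\<Sum>k\<le>M. \<Sum>l\<le>M. bern_coeff k * bern_coeff l * F k l 0 0 / of_nat N ^ (k + l))) \<le> C / real N ^ M"
      by (simp add: C_def x_def add_divide_distrib)
  qed
qed

text \<open>Regroups the square of indices by total order. Index pairs of total order at least M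
  form the finite set \<open>R\<close> and go into the remainder.\<close>

lemma Euler_Maclaurin_quadrant:
  assumes F: "derivative_family K F" and "M \<ge> 1"
  obtains C where "\<And>N. N > 0 \<Longrightarrow>
    norm ((\<Sum>i<K * N. \<Sum>j<K * N. F 1 1 (real i / real N) (real j / real N)) / of_nat N ^ 2
       - (\<Sum>n<M. (\<Sum>k\<le>n. bern_coeff k * bern_coeff (n - k) * F k (n - k) 0 0) / of_nat N ^ n)) \<le> C / real N ^ M"
proof -
  obtain C where C: "\<And>N. N > 0 \<Longrightarrow>
    norm ((\<Sum>i<K * N. \<Sum>j<K * N. F 1 1 (real i / real N) (real j / real N)) / of_nat N ^ 2
       - (\<Sum>k\<le>M. \<Sum>l\<le>M. bern_coeff k * bern_coeff l * F k l 0 0 / of_nat N ^ (k + l))) \<le> C / real N ^ M"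
    using Euler_Maclaurin_quadrant_square[OF assms] by blast
  define h where "h = (\<lambda>(k, l). bern_coeff k * bern_coeff l * F k l 0 0)"
  define R where "R = {..M} \<times> {..M} - {(k, l). k + l < M}"
  show ?thesis
  proof
    fix N :: nat assume N: "N > 0"
    let ?t = "\<lambda>(k, l). h (k, l) / of_nat N ^ (k + l)"
    have "(\<Sum>k\<le>M. \<Sum>l\<le>M. bern_coeff k * bern_coeff l * F k l 0 0 / of_nat N ^ (k + l)) = sum ?t ({..M} \<times> {..M})"
      by (subst sum.cartesian_product) (auto simp: h_def intro!: sum.cong)
    also have "\<dots> = sum ?t R + sum ?t {(k, l). k + l < M}"
      unfolding R_def by (rule sum.subset_diff) auto
    also have "sum ?t {(k, l). k + l < M} = (\<Sum>n<M. \<Sum>k\<le>n. h (k, n - k) / of_nat N ^ (k + (n - k)))"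
      by (subst sum.triangle_reindex[symmetric]) simp
    also have "\<dots> = (\<Sum>n<M. (\<Sum>k\<le>n. bern_coeff k * bern_coeff (n - k) * F k (n - k) 0 0) / of_nat N ^ n)"
      by (simp add: h_def sum_divide_distrib)
    finally have eq: "(\<Sum>k\<le>M. \<Sum>l\<le>M. bern_coeff k * bern_coeff l * F k l 0 0 / of_nat N ^ (k + l))
       = sum ?t R + (\<Sum>n<M. (\<Sum>k\<le>n. bern_coeff k * bern_coeff (n - k) * F k (n - k) 0 0) / of_nat N ^ n)" .
    have "norm (sum ?t R) \<le> (\<Sum>p\<in>R. norm (h p) / real N ^ M)"
    proof (rule sum_norm_le)
      fix p assume p: "p \<in> R"
      obtain k l where kl: "p = (k, l)" by fastforce
      then have "M \<le> k + l" using p by (auto simp: R_def)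
      then have "real N ^ M \<le> real N ^ (k + l)" using N by (intro power_increasing) auto
      then show "norm (?t p) \<le> norm (h p) / real N ^ M"
        using N by (auto simp: kl norm_divide norm_power intro!: divide_left_mono)
    qed
    then have "norm (sum ?t R) \<le> (\<Sum>p\<in>R. norm (h p)) / real N ^ M"
      by (simp add: sum_divide_distrib)
    from norm_triangle_mono[OF C[OF N] this] show "norm ((\<Sum>i<K * N. \<Sum>j<K * N. F 1 1 (real i / real N) (real j / real N)) / of_nat N ^ 2
       - (\<Sum>n<M. (\<Sum>k\<le>n. bern_coeff k * bern_coeff (n - k) * F k (n - k) 0 0) / of_nat N ^ n))
       \<le> (C + (\<Sum>p\<in>R. norm (h p))) / real N ^ M"
      unfolding eq add_divide_distrib by (simp add: algebra_simps)
  qed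
qed

subsection \<open>Lattice bases of the plane\<close>

definition plane_basis :: "'a::euclidean_space \<Rightarrow> 'a \<Rightarrow> bool" where
  "plane_basis e1 e2 \<longleftrightarrow> (\<forall>x. \<exists>a b. x = a *\<^sub>R e1 + b *\<^sub>R e2) \<and>
     (\<forall>a b. a *\<^sub>R e1 + b *\<^sub>R e2 = 0 \<longrightarrow> a = 0 \<and> b = 0)"

lemma plane_basis_swap: "plane_basis e1 e2 \<Longrightarrow> plane_basis e2 e1"
  unfolding plane_basis_def add.commute[of "_ *\<^sub>R e2"] by blast

lemma plane_basis_eqD:
  assumes "plane_basis e1 e2" "a *\<^sub>R e1 + b *\<^sub>R e2 = c *\<^sub>R e1 + d *\<^sub>R e2"
  shows "a = c" "b = d"
proof -
  have "(a - c) *\<^sub>R e1 + (b - d) *\<^sub>R e2 = 0"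
    using assms(2) by (simp add: algebra_simps)
  then have "a - c = 0 \<and> b - d = 0" using assms(1) unfolding plane_basis_def by blast
  then show "a = c" "b = d" by auto
qed

lemma plane_basis_nonzero:
  assumes "plane_basis e1 e2"
  shows "e1 \<noteq> 0" "e2 \<noteq> 0" "e1 \<noteq> e2"
  using plane_basis_eqD[OF assms, of 1 0 0 0] plane_basis_eqD[OF assms, of 0 1 0 0]
    plane_basis_eqD[OF assms, of 1 0 0 1] by auto

text \<open>The dual basis with respect to the inner product, from the inverse of the Gram matrix;
  it reads off coordinates.\<close>

lemma plane_basis_dual:
  assumes pb: "plane_basis e1 e2"
  obtains d1 d2 :: "'a::euclidean_space" where
    "e1 \<bullet> d1 = 1" "e2 \<bullet> d1 = 0" "e1 \<bullet> d2 = 0" "e2 \<bullet> d2 = 1"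
    "\<And>x. x = (x \<bullet> d1) *\<^sub>R e1 + (x \<bullet> d2) *\<^sub>R e2"
proof -
  define G where "G = (e1 \<bullet> e1) * (e2 \<bullet> e2) - (e1 \<bullet> e2) * (e1 \<bullet> e2)"
  have "G \<noteq> 0"
  proof
    assume G: "G = 0"
    \<comment> \<open>The squared length of \<open>?v\<close> is e2 . e2 times the Gram determinant,
      so a zero determinant would give a linear relation with nonzero coefficient e2 . e2.\<close>
    let ?v = "(e2 \<bullet> e2) *\<^sub>R e1 + (- (e1 \<bullet> e2)) *\<^sub>R e2"
    have "?v \<bullet> ?v = (e2 \<bullet> e2) * G"
      by (simp add: G_def inner_simps algebra_simps inner_commute)
    then have "?v = 0" using G by simp
    then have "e2 \<bullet> e2 = 0" using pb unfolding plane_basis_def by blast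
    then show False using plane_basis_nonzero[OF pb] by simp
  qed
  define d1 where "d1 = (1 / G) *\<^sub>R ((e2 \<bullet> e2) *\<^sub>R e1 - (e1 \<bullet> e2) *\<^sub>R e2)"
  define d2 where "d2 = (1 / G) *\<^sub>R ((e1 \<bullet> e1) *\<^sub>R e2 - (e1 \<bullet> e2) *\<^sub>R e1)"
  have d: "e1 \<bullet> d1 = 1" "e2 \<bullet> d1 = 0" "e1 \<bullet> d2 = 0" "e2 \<bullet> d2 = 1"
    using \<open>G \<noteq> 0\<close> by (simp_all add: d1_def d2_def inner_simps inner_commute field_simps) (simp_all add: G_def inner_commute)
  show ?thesis
  proof (rule that[OF d])
    fix x :: 'a
    obtain a b where "x = a *\<^sub>R e1 + b *\<^sub>R e2" using pb unfolding plane_basis_def by blast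
    then show "x = (x \<bullet> d1) *\<^sub>R e1 + (x \<bullet> d2) *\<^sub>R e2" using d by (simp add: inner_simps)
  qed
qed

lemma plane_basis_functional:
  assumes "plane_basis e1 e2"
  shows "\<exists>\<xi>::'a::euclidean_space cdual. blinfun_apply \<xi> e1 = X \<and> blinfun_apply \<xi> e2 = Y"
proof -
  obtain d1 d2 where d: "e1 \<bullet> d1 = 1" "e2 \<bullet> d1 = 0" "e1 \<bullet> d2 = 0" "e2 \<bullet> d2 = 1"
    using plane_basis_dual[OF assms] by blast
  have "bounded_linear (\<lambda>x. of_real (x \<bullet> d1) * X + of_real (x \<bullet> d2) * Y)"
    by (intro bounded_linear_add bounded_linear_mult_const bounded_linear_compose[OF bounded_linear_of_real]
        bounded_linear_inner_left)
  then show ?thesis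
    using d by (intro exI[of _ "Blinfun (\<lambda>x. of_real (x \<bullet> d1) * X + of_real (x \<bullet> d2) * Y)"])
      (simp add: bounded_linear_Blinfun_apply)
qed

section \<open>Integral bases\<close>

lemma finite_independent_basis: "integral_basis \<Gamma> B \<Longrightarrow> finite B"
  unfolding integral_basis_def using independent_imp_finite by blast

lemma basis_subset_lattice:
  assumes "integral_basis \<Gamma> B"
  shows "B \<subseteq> \<Gamma>"
proof
  fix b assume b: "b \<in> B"
  have "(\<Sum>x\<in>B. of_int ((\<lambda>x. if x = b then 1 else 0) x) *\<^sub>R x) = (\<Sum>x\<in>B. if x = b then x else 0)"
    by (intro sum.cong) auto
  also have "\<dots> = b" using b finite_independent_basis[OF assms] by simp
  finally have eq: "(\<Sum>x\<in>B. of_int ((\<lambda>x. if x = b then 1 else 0) x) *\<^sub>R x) = b" .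
  have "b \<in> int_span B" unfolding int_span_def by (rule range_eqI, rule eq[symmetric])
  then show "b \<in> \<Gamma>" using assms by (simp add: integral_basis_def)
qed

lemma int_span_subset_span: "int_span B \<subseteq> span B"
  unfolding int_span_def by clarify (intro span_sum span_scale, erule span_base)

lemma integral_basis_span:
  assumes "integral_basis \<Gamma> B" "integral_basis \<Gamma> B'"
  shows "span B = span B'"
proof -
  have "B \<subseteq> span B'" "B' \<subseteq> span B"
    using basis_subset_lattice[OF assms(1)] basis_subset_lattice[OF assms(2)] int_span_subset_span[of B]
      int_span_subset_span[of B'] assms by (auto simp: integral_basis_def)
  then show ?thesis by (simp add: span_eq)
qed

lemma int_span_pair:
  assumes "e1 \<noteq> e2"
  shows "int_span {e1, e2} = {of_int i *\<^sub>R e1 + of_int j *\<^sub>R e2 |i j. True}"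
proof -
  have eq: "of_int i *\<^sub>R e1 + of_int j *\<^sub>R e2 = (\<Sum>b\<in>{e1, e2}. of_int ((\<lambda>x. if x = e1 then i else j) b) *\<^sub>R b)" for i j :: int
    using assms by simp
  have "of_int i *\<^sub>R e1 + of_int j *\<^sub>R e2 \<in> int_span {e1, e2}" for i j :: int
    unfolding int_span_def by (rule range_eqI, rule eq)
  then show ?thesis using assms by (auto simp: int_span_def)
qed

lemma int_span_singleton: "int_span {e} = {of_int i *\<^sub>R e |i. True}"
proof -
  have "of_int i *\<^sub>R e \<in> int_span {e}" for i :: int
    unfolding int_span_def by (rule range_eqI[of _ _ "\<lambda>_. i"]) simp
  then show ?thesis by (auto simp: int_span_def)
qed

lemma integral_basis_plane:
  fixes e1 e2 :: "'a::euclidean_space"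
  assumes "DIM('a) = 2" "lattice_in UNIV \<Lambda>" "integral_basis \<Lambda> {e1, e2}"
  shows "plane_basis e1 e2"
proof -
  obtain B where B: "integral_basis \<Lambda> B" "span B = (UNIV :: 'a set)"
    using assms(2) unfolding lattice_in_def by blast
  have sp: "span {e1, e2} = UNIV" using integral_basis_span[OF assms(3) B(1)] B(2) by simp
  have ind: "independent {e1, e2}" using assms(3) by (simp add: integral_basis_def)
  have "card {e1, e2} = 2"
    using dim_eq_card_independent[OF ind] sp assms(1) by (metis dim_UNIV dim_span)
  then have ne: "e1 \<noteq> e2" by auto
  show ?thesis unfolding plane_basis_def
  proof (intro conjI allI impI)
    fix x
    have "x \<in> span {e1, e2}" using sp by simp
    then obtain k l where "x - k *\<^sub>R e1 = l *\<^sub>R e2"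
      unfolding span_breakdown_eq[of x e1] span_singleton by blast
    then have "x = k *\<^sub>R e1 + l *\<^sub>R e2" by (simp add: algebra_simps)
    then show "\<exists>a b. x = a *\<^sub>R e1 + b *\<^sub>R e2" by blast
  next
    fix a b assume *: "a *\<^sub>R e1 + b *\<^sub>R e2 = 0"
    have "(\<Sum>v\<in>{e1, e2}. (if v = e1 then a else b) *\<^sub>R v) = 0" using * ne by simp
    from independentD[OF ind _ subset_refl this, of e1] independentD[OF ind _ subset_refl this, of e2]
    show "a = 0" "b = 0" using ne by auto
  qed
qed

lemma lattice_plane:
  assumes "plane_basis e1 e2" "integral_basis \<Lambda> {e1, e2}"
  shows "\<Lambda> = {of_int i *\<^sub>R e1 + of_int j *\<^sub>R e2 |i j. True}"
  using assms int_span_pair[OF plane_basis_nonzero(3)[OF assms(1)]] by (simp add: integral_basis_def)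

text \<open>Coordinates are inner products with the dual basis, so Cauchy-Schwarz bounds the integer
  coordinates in terms of the norm.\<close>

lemma lattice_ball_finite:
  assumes "plane_basis e1 e2" "integral_basis \<Lambda> {e1, e2}"
  shows "finite {\<gamma> \<in> \<Lambda>. norm \<gamma> \<le> R}"
proof -
  obtain d1 d2 where d: "e1 \<bullet> d1 = 1" "e2 \<bullet> d1 = 0" "e1 \<bullet> d2 = 0" "e2 \<bullet> d2 = 1"
    using plane_basis_dual[OF assms(1)] by blast
  define m where "m = \<lceil>\<bar>R\<bar> * (norm d1 + norm d2)\<rceil>"
  have "{\<gamma> \<in> \<Lambda>. norm \<gamma> \<le> R} \<subseteq> (\<lambda>(i, j). of_int i *\<^sub>R e1 + of_int j *\<^sub>R e2) ` ({-m..m} \<times> {-m..m})"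
  proof clarify
    fix \<gamma> assume g: "\<gamma> \<in> \<Lambda>" "norm \<gamma> \<le> R"
    then obtain i j :: int where ij: "\<gamma> = of_int i *\<^sub>R e1 + of_int j *\<^sub>R e2"
      using lattice_plane[OF assms] by blast
    have bd: "\<bar>\<gamma> \<bullet> d\<bar> \<le> of_int m" if "d = d1 \<or> d = d2" for d
    proof -
      have "\<bar>\<gamma> \<bullet> d\<bar> \<le> norm \<gamma> * norm d" by (rule Cauchy_Schwarz_ineq2)
      also have "\<dots> \<le> \<bar>R\<bar> * (norm d1 + norm d2)" using g that by (intro mult_mono) auto
      also have "\<dots> \<le> of_int m" by (simp add: m_def)
      finally show ?thesis .
    qed
    have "of_int \<bar>i\<bar> \<le> (of_int m :: real)" "of_int \<bar>j\<bar> \<le> (of_int m :: real)"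
      using bd[of d1] bd[of d2] d by (simp_all add: ij inner_simps)
    then have "\<bar>i\<bar> \<le> m" "\<bar>j\<bar> \<le> m" by linarith+
    then show "\<gamma> \<in> (\<lambda>(i, j). of_int i *\<^sub>R e1 + of_int j *\<^sub>R e2) ` ({-m..m} \<times> {-m..m})"
      using ij by (intro image_eqI[of _ _ "(i, j)"]) auto
  qed
  then show ?thesis by (rule finite_subset) auto
qed

subsection \<open>Riemann sums over unimodular cones\<close>

definition cone2 :: "'a::real_vector \<Rightarrow> 'a \<Rightarrow> 'a set" where
  "cone2 e1 e2 = {s *\<^sub>R e1 + t *\<^sub>R e2 |s t. s \<ge> 0 \<and> t \<ge> 0}"

text \<open>Restriction to the ball of radius r, outside of which \<psi> will vanish, keeps the sum
  finite for unbounded regions. The region enters linearly through its indicator, so the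
  Brianchon-Gram relation transfers to sums.\<close>

definition region_sum :: "'a::real_normed_vector set \<Rightarrow> real \<Rightarrow> ('a \<Rightarrow> complex) \<Rightarrow> 'a set \<Rightarrow> nat \<Rightarrow> complex" where
  "region_sum \<Lambda> r \<psi> S N =
     (\<Sum>\<gamma> | \<gamma> \<in> \<Lambda> \<and> norm \<gamma> \<le> real N * r. indicator S (\<gamma> /\<^sub>R real N) * \<psi> (\<gamma> /\<^sub>R real N)) / of_nat N ^ 2"

text \<open>Because the apex is a lattice point and e1, e2 is an integral basis, the lattice points
  of the dilated cone are N p + i e1 + j e2 with natural i, j. The support cuts them down to a box
  of side K N.\<close>

lemma region_sum_cone:
  assumes pb: "plane_basis e1 e2" and ib: "integral_basis \<Lambda> {e1, e2}" and p: "p \<in> \<Lambda>" and N: "N > 0"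
    and supp: "\<And>x. norm x > r \<Longrightarrow> \<psi> x = 0"
    and K: "\<And>s t. s \<ge> 0 \<Longrightarrow> t \<ge> 0 \<Longrightarrow> s \<ge> real K \<or> t \<ge> real K \<Longrightarrow> \<psi> (p + s *\<^sub>R e1 + t *\<^sub>R e2) = 0"
  shows "region_sum \<Lambda> r \<psi> ((+) p ` cone2 e1 e2) N =
    (\<Sum>i<K * N. \<Sum>j<K * N. \<psi> (p + (real i / real N) *\<^sub>R e1 + (real j / real N) *\<^sub>R e2)) / of_nat N ^ 2"
proof -
  note L = lattice_plane[OF pb ib]
  define g where "g = (\<lambda>(i, j). real N *\<^sub>R p + real i *\<^sub>R e1 + real j *\<^sub>R e2)"
  have gN: "g (i, j) /\<^sub>R real N = p + (real i / real N) *\<^sub>R e1 + (real j / real N) *\<^sub>R e2" for i j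
    using N by (simp add: g_def scaleR_add_right divide_inverse mult.commute)
  have gL: "g (i, j) \<in> \<Lambda>" for i j
  proof -
    obtain a b :: int where "p = of_int a *\<^sub>R e1 + of_int b *\<^sub>R e2" using p L by blast
    then have "g (i, j) = of_int (int N * a + int i) *\<^sub>R e1 + of_int (int N * b + int j) *\<^sub>R e2"
      by (simp add: g_def algebra_simps)
    then show ?thesis using L by blast
  qed
  have inj: "(i, j) = (i', j')" if "g (i, j) = g (i', j')" for i j i' j'
    using plane_basis_eqD[OF pb, of "real i" "real j" "real i'" "real j'"] that by (simp add: g_def add.assoc)
  define G where "G = {\<gamma> \<in> \<Lambda>. norm \<gamma> \<le> real N * r}"
  have fin: "finite G" unfolding G_def by (rule lattice_ball_finite[OF pb ib])
  define h where "h = (\<lambda>\<gamma>. indicator ((+) p ` cone2 e1 e2) (\<gamma> /\<^sub>R real N) * \<psi> (\<gamma> /\<^sub>R real N))"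
  have hg: "h (g (i, j)) = \<psi> (p + (real i / real N) *\<^sub>R e1 + (real j / real N) *\<^sub>R e2)" for i j
  proof -
    have "(real i / real N) *\<^sub>R e1 + (real j / real N) *\<^sub>R e2 \<in> cone2 e1 e2"
      unfolding cone2_def by (intro CollectI exI conjI, rule refl) simp_all
    then have "g (i, j) /\<^sub>R real N \<in> (+) p ` cone2 e1 e2"
      unfolding gN by (simp add: add.assoc)
    then show ?thesis unfolding h_def by (simp only: indicator_simps(1) gN mult_1)
  qed
  have G0: "h \<gamma> = 0" if "\<gamma> \<in> \<Lambda> - G" for \<gamma>
  proof -
    have "norm (\<gamma> /\<^sub>R real N) > r" using that N by (auto simp: G_def field_simps)
    then show ?thesis using supp by (simp add: h_def)
  qed
  have K0: "h (g (i, j)) = 0" if "(i, j) \<notin> {..<K * N} \<times> {..<K * N}" for i j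
  proof -
    have "real i \<ge> real (K * N) \<or> real j \<ge> real (K * N)"
      using that unfolding of_nat_le_iff by auto
    then have "real i / real N \<ge> real K \<or> real j / real N \<ge> real K"
      using N by (simp add: field_simps)
    then show ?thesis unfolding hg by (intro K) auto
  qed
  have out: "\<gamma> \<in> range g" if mem: "\<gamma> \<in> \<Lambda>" and "h \<gamma> \<noteq> 0" for \<gamma>
  proof -
    have "\<gamma> /\<^sub>R real N \<in> (+) p ` cone2 e1 e2" using that by (auto simp: h_def indicator_def split: if_splits)
    then obtain s t where st: "s \<ge> 0" "t \<ge> 0" "\<gamma> /\<^sub>R real N = p + (s *\<^sub>R e1 + t *\<^sub>R e2)" by (auto simp: cone2_def)
    have "\<gamma> = real N *\<^sub>R (\<gamma> /\<^sub>R real N)" using N by simp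
    also have "\<dots> = real N *\<^sub>R p + (real N * s) *\<^sub>R e1 + (real N * t) *\<^sub>R e2"
      unfolding st by (simp add: algebra_simps)
    finally have 1: "\<gamma> = real N *\<^sub>R p + (real N * s) *\<^sub>R e1 + (real N * t) *\<^sub>R e2" .
    obtain a b :: int where ab: "\<gamma> - g (0, 0) = of_int a *\<^sub>R e1 + of_int b *\<^sub>R e2"
    proof -
      obtain a b c d :: int where "\<gamma> = of_int a *\<^sub>R e1 + of_int b *\<^sub>R e2" "g (0, 0) = of_int c *\<^sub>R e1 + of_int d *\<^sub>R e2"
        using mem gL[of 0 0] L by blast
      then have "\<gamma> - g (0, 0) = of_int (a - c) *\<^sub>R e1 + of_int (b - d) *\<^sub>R e2" by (simp add: algebra_simps)
      then show ?thesis using that by blast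
    qed
    have "(real N * s) *\<^sub>R e1 + (real N * t) *\<^sub>R e2 = of_int a *\<^sub>R e1 + of_int b *\<^sub>R e2"
      using ab unfolding 1 by (simp add: g_def)
    from plane_basis_eqD[OF pb this] have ab2: "real N * s = of_int a" "real N * t = of_int b" by auto
    have "(0::real) \<le> of_int a" "(0::real) \<le> of_int b" unfolding ab2[symmetric] using st by simp_all
    then have nn: "a \<ge> 0" "b \<ge> 0" by simp_all
    have "\<gamma> = g (nat a, nat b)" using 1 ab2 nn by (simp add: g_def)
    then show ?thesis by blast
  qed
  let ?box = "{..<K * N} \<times> {..<K * N}"
  \<comment> \<open>Neither the ball nor the box contains the other, so both sums are compared with
    the sum over the union.\<close>
  have "sum h G = sum h (G \<union> g ` ?box)"
    using fin gL G0 by (intro sum.mono_neutral_left) auto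
  also have "\<dots> = sum h (g ` ?box)"
  proof (rule sum.mono_neutral_right)
    show "\<forall>\<gamma>\<in>G \<union> g ` ?box - g ` ?box. h \<gamma> = 0"
    proof (rule ballI, rule ccontr)
      fix \<gamma> assume \<gamma>: "\<gamma> \<in> G \<union> g ` ?box - g ` ?box" and nz: "h \<gamma> \<noteq> 0"
      then have "\<gamma> \<in> range g" by (intro out) (auto simp: G_def)
      then obtain i j where "\<gamma> = g (i, j)" by fastforce
      with \<gamma> nz K0[of i j] show False by blast
    qed
  qed (use fin in auto)
  also have "\<dots> = sum (\<lambda>x. h (g x)) ?box"
    by (subst sum.reindex) (auto simp: inj_on_def dest: inj)
  also have "\<dots> = (\<Sum>i<K * N. \<Sum>j<K * N. h (g (i, j)))" by (simp add: sum.cartesian_product)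
  finally show ?thesis unfolding region_sum_def hg[symmetric] G_def h_def by simp
qed

section \<open>Expansions with uniform remainder\<close>

text \<open>The bound is required for every positive N rather than eventually, so sums of expansions
  only need sums of constants.\<close>

definition expands :: "(nat \<Rightarrow> complex) \<Rightarrow> (nat \<Rightarrow> complex) \<Rightarrow> bool" where
  "expands R a \<longleftrightarrow> (\<forall>M\<ge>1. \<exists>C. \<forall>N>0. norm (R N - (\<Sum>n<M. a n / of_nat N ^ n)) \<le> C / real N ^ M)"

lemma expands_add:
  assumes "expands R a" "expands S b"
  shows "expands (\<lambda>N. R N + S N) (\<lambda>n. a n + b n)"
  unfolding expands_def
proof (intro allI impI)
  fix M :: nat assume "M \<ge> 1"
  then obtain C D where C: "\<And>N. N > 0 \<Longrightarrow> norm (R N - (\<Sum>n<M. a n / of_nat N ^ n)) \<le> C / real N ^ M"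
    and D: "\<And>N. N > 0 \<Longrightarrow> norm (S N - (\<Sum>n<M. b n / of_nat N ^ n)) \<le> D / real N ^ M"
    using assms unfolding expands_def by meson
  have "norm (R N + S N - (\<Sum>n<M. (a n + b n) / of_nat N ^ n)) \<le> (C + D) / real N ^ M" if "N > 0" for N
    using norm_triangle_mono[OF C[OF that] D[OF that]]
    by (simp add: add_divide_distrib sum.distrib algebra_simps)
  then show "\<exists>C. \<forall>N>0. norm (R N + S N - (\<Sum>n<M. (a n + b n) / of_nat N ^ n)) \<le> C / real N ^ M" by blast
qed

lemma expands_uminus:
  assumes "expands R a"
  shows "expands (\<lambda>N. - R N) (\<lambda>n. - a n)"
proof -
  have "norm (- R N - (\<Sum>n<M. - a n / of_nat N ^ n)) = norm (R N - (\<Sum>n<M. a n / of_nat N ^ n))" for N M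
    by (simp add: sum_negf norm_minus_commute)
  then show ?thesis using assms unfolding expands_def by presburger
qed

lemma expands_zero: "expands (\<lambda>N. 0) (\<lambda>n. 0)"
  unfolding expands_def by (auto intro!: exI[of _ 0])

lemma expands_sum:
  assumes "finite I" "\<And>i. i \<in> I \<Longrightarrow> expands (R i) (a i)"
  shows "expands (\<lambda>N. \<Sum>i\<in>I. R i N) (\<lambda>n. \<Sum>i\<in>I. a i n)"
  using assms by (induction I) (auto intro: expands_zero expands_add)

lemma expands_asymptotic:
  assumes "expands R a"
  shows "asymptotic_expansion R a"
  unfolding asymptotic_expansion_def
proof (intro allI impI)
  fix M :: nat assume "M \<ge> 1"
  then obtain C where C: "\<And>N. N > 0 \<Longrightarrow> norm (R N - (\<Sum>n<M. a n / of_nat N ^ n)) \<le> C / real N ^ M"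
    using assms unfolding expands_def by meson
  show "(\<lambda>N. R N - (\<Sum>n<M. a n / of_nat N ^ n)) \<in> O(\<lambda>N. 1 / of_nat N ^ M)"
  proof (rule bigoI)
    show "\<forall>\<^sub>F N in at_top. norm (R N - (\<Sum>n<M. a n / of_nat N ^ n)) \<le> C * norm (1 / of_nat N ^ M :: complex)"
      by (rule eventually_mono[OF eventually_gt_at_top[of 0]]) (use C in \<open>simp add: norm_divide norm_power\<close>)
  qed
qed

subsection \<open>The local coefficients\<close>

text \<open>The ray is parametrised by multiples of e. For e a generator of the lattice on its line
  this is integration against the lattice measure.\<close>

definition ray_integral :: "'a::real_vector \<Rightarrow> 'a \<Rightarrow> ('a \<Rightarrow> complex) \<Rightarrow> complex" where
  "ray_integral p e h = integral {0..} (\<lambda>s. h (p + s *\<^sub>R e))"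

definition edge_operator :: "nat \<Rightarrow> 'a::real_normed_vector \<Rightarrow> ('a \<Rightarrow> complex) \<Rightarrow> 'a \<Rightarrow> complex" where
  "edge_operator n u g x = - (bernoulli_number n / fact n) * (nabla u ^^ (n - 1)) g x"

definition vertex_operator ::
    "nat \<Rightarrow> 'a::real_normed_vector \<Rightarrow> 'a \<Rightarrow> 'a \<Rightarrow> 'a \<Rightarrow> real \<Rightarrow> real \<Rightarrow> ('a \<Rightarrow> complex) \<Rightarrow> 'a \<Rightarrow> complex" where
  "vertex_operator n e1 e2 u1 u2 c1 c2 g x =
     (\<Sum>k=1..n - 1.
        bernoulli_number k * bernoulli_number (n - k) / (fact k * fact (n - k))
        * (nabla e1 ^^ (k - 1)) ((nabla e2 ^^ (n - 1 - k)) g) x)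
     + bernoulli_number n / fact n
       * (of_real c1 * (\<Sum>s=0..n - 2. (nabla u1 ^^ s) ((nabla e1 ^^ (n - 2 - s)) g) x)
          + of_real c2 * (\<Sum>s=0..n - 2. (nabla u2 ^^ s) ((nabla e2 ^^ (n - 2 - s)) g) x))"

lemma nabla_sum:
  assumes "finite I" "\<And>i. i \<in> I \<Longrightarrow> smooth (f i)"
  shows "smooth (\<lambda>x. \<Sum>i\<in>I. f i x) \<and> nabla u (\<lambda>x. \<Sum>i\<in>I. f i x) = (\<lambda>x. \<Sum>i\<in>I. nabla u (f i) x)"
  using assms
proof (induction I)
  case empty
  show ?case using nabla_eqI[OF has_derivative_const, of u 0] smooth_const[of 0] by auto
next
  case (insert i I)
  then have IH: "smooth (\<lambda>x. \<Sum>i\<in>I. f i x)" "nabla u (\<lambda>x. \<Sum>i\<in>I. f i x) = (\<lambda>x. \<Sum>i\<in>I. nabla u (f i) x)"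
    "smooth (f i)" by auto
  have "smooth (\<lambda>x. f i x + (\<Sum>i\<in>I. f i x))" using IH by (simp add: smooth_iff_upto differentiable_upto_add)
  moreover have "nabla u (\<lambda>x. f i x + (\<Sum>i\<in>I. f i x)) x = nabla u (f i) x + (\<Sum>i\<in>I. nabla u (f i) x)" for x
    using nabla_add[OF smooth_differentiable[OF IH(3)] smooth_differentiable[OF IH(1)], of u x] IH(2) by simp
  ultimately show ?case using insert.hyps by auto
qed

lemma plane_symbol_determines_operator:
  fixes D E :: "('a::euclidean_space \<Rightarrow> complex) \<Rightarrow> 'a \<Rightarrow> complex"
  assumes pb: "plane_basis (e1 :: 'a) e2"
    and ops: "const_coeff_operator D" "const_coeff_operator E" "has_symbol D \<sigma>" "has_symbol E \<sigma>" "smooth g"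
  shows "D g x = E g x"
proof (rule symbol_determines_operator[OF _ _ ops])
  show "\<exists>a b. x = a *\<^sub>R e1 + b *\<^sub>R e2" for x using pb unfolding plane_basis_def by blast
  show "\<exists>\<xi>::'a cdual. blinfun_apply \<xi> e1 = X \<and> blinfun_apply \<xi> e2 = Y" for X Y
    by (rule plane_basis_functional[OF pb])
qed

text \<open>The factorisation of X^(n-1) - U^(n-1) with X - U = c Y, carried from symbols to
  operators. The derivative along e2 is pulled out so that the second term can be integrated along a
  ray in direction e2.\<close>

lemma nabla_power_split:
  assumes pb: "plane_basis (e1 :: 'a::euclidean_space) e2" and e: "e1 = u + c *\<^sub>R e2" and n: "n \<ge> 2" and g: "smooth g"
  shows "(nabla e1 ^^ (n - 1)) g x = (nabla u ^^ (n - 1)) g x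
     + of_real c * nabla e2 (\<lambda>x. \<Sum>s=0..n - 2. (nabla u ^^ s) ((nabla e1 ^^ (n - 2 - s)) g) x) x"
proof -
  define us where "us = (\<lambda>s. e2 # replicate s u @ replicate (n - 2 - s) e1)"
  define D where "D = (\<lambda>g x. 1 * foldr nabla (replicate (n - 1) e1) g x :: complex)"
  define E where "E = (\<lambda>g x. 1 * foldr nabla (replicate (n - 1) u) g x + (\<Sum>s\<in>{0..n - 2}. of_real c * foldr nabla (us s) g x) :: complex)"
  have "D g x = E g x"
  proof -
    have cD: "const_coeff_operator D" unfolding D_def by (rule const_coeff_foldr)
    have cE: "const_coeff_operator E" unfolding E_def
      by (intro const_coeff_add const_coeff_foldr const_coeff_sum) auto
    have sD: "has_symbol D (\<lambda>\<xi>. 1 * (\<Prod>u\<leftarrow>replicate (n - 1) e1. blinfun_apply \<xi> u))"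
      unfolding D_def by (rule has_symbol_foldr)
    have eq: "1 * (\<Prod>u\<leftarrow>replicate (n - 1) e1. blinfun_apply \<xi> u)
       = 1 * (\<Prod>u\<leftarrow>replicate (n - 1) u. blinfun_apply \<xi> u) + (\<Sum>s\<in>{0..n - 2}. of_real c * (\<Prod>u\<leftarrow>us s. blinfun_apply \<xi> u))" for \<xi> :: "'a cdual"
    proof -
      define X Y U where "X = blinfun_apply \<xi> e1" and "Y = blinfun_apply \<xi> e2" and "U = blinfun_apply \<xi> u"
      have XU: "X - U = of_real c * Y"
        unfolding X_def Y_def U_def by (subst e) (simp add: blinfun.add_right blinfun.scaleR_right scaleR_conv_of_real)
      obtain m where m: "n = Suc (Suc m)" using n by (metis add_2_eq_Suc le_Suc_ex)
      have "X ^ Suc m - U ^ Suc m = (X - U) * (\<Sum>s<Suc m. X ^ s * U ^ (m - s))"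
        by (rule diff_power_eq_sum)
      also have "(\<Sum>s<Suc m. X ^ s * U ^ (m - s)) = (\<Sum>s\<le>m. U ^ s * X ^ (m - s))"
        unfolding lessThan_Suc_atMost by (rule sum.reindex_bij_witness[of _ "\<lambda>s. m - s" "\<lambda>s. m - s"]) auto
      finally have "X ^ Suc m = of_real c * Y * (\<Sum>s\<le>m. U ^ s * X ^ (m - s)) + U ^ Suc m"
        unfolding diff_eq_eq XU .
      then show ?thesis
        unfolding us_def m by (simp add: X_def Y_def U_def atLeast0AtMost sum_distrib_left mult_ac)
    qed
    have sE: "has_symbol E (\<lambda>\<xi>. 1 * (\<Prod>u\<leftarrow>replicate (n - 1) e1. blinfun_apply \<xi> u))"
      unfolding eq E_def by (intro has_symbol_add has_symbol_foldr has_symbol_sum)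
    show ?thesis by (rule plane_symbol_determines_operator[OF pb cD cE sD sE g])
  qed
  moreover have "nabla e2 (\<lambda>x. \<Sum>s=0..n - 2. (nabla u ^^ s) ((nabla e1 ^^ (n - 2 - s)) g) x)
     = (\<lambda>x. \<Sum>s=0..n - 2. nabla e2 ((nabla u ^^ s) ((nabla e1 ^^ (n - 2 - s)) g)) x)"
    by (rule nabla_sum[THEN conjunct2]) (auto simp only: funpow_nabla finite_atLeastAtMost intro!: smooth_foldr_nabla g)
  ultimately show ?thesis
    unfolding D_def E_def us_def by (simp add: sum_distrib_left)
qed

lemma ray_integral_cutoff:
  fixes h :: "'a::real_normed_vector \<Rightarrow> complex"
  assumes "\<And>s. s \<ge> real K \<Longrightarrow> h (p + s *\<^sub>R e) = 0" "continuous_on UNIV h"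
  shows "((\<lambda>s. h (p + s *\<^sub>R e)) has_integral ray_integral p e h) {0..}"
    "ray_integral p e h = integral {0..real K} (\<lambda>s. h (p + s *\<^sub>R e))"
proof -
  have "(\<lambda>s. h (p + s *\<^sub>R e)) integrable_on {0..real K}"
    by (intro integrable_continuous_interval continuous_on_compose2[OF assms(2)]) (auto intro!: continuous_intros)
  then have "((\<lambda>s. h (p + s *\<^sub>R e)) has_integral integral {0..real K} (\<lambda>s. h (p + s *\<^sub>R e))) {0..real K}"
    by (rule integrable_integral)
  then have *: "((\<lambda>s. h (p + s *\<^sub>R e)) has_integral integral {0..real K} (\<lambda>s. h (p + s *\<^sub>R e))) {0..}"
  proof -
    assume "((\<lambda>s. h (p + s *\<^sub>R e)) has_integral integral {0..real K} (\<lambda>s. h (p + s *\<^sub>R e))) {0..real K}"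
    then have "((\<lambda>s. if s \<in> {0..real K} then h (p + s *\<^sub>R e) else 0) has_integral integral {0..real K} (\<lambda>s. h (p + s *\<^sub>R e))) {0..}"
      by (subst has_integral_restrict) auto
    then show ?thesis by (rule has_integral_eq[rotated]) (use assms(1) in auto)
  qed
  then show "ray_integral p e h = integral {0..real K} (\<lambda>s. h (p + s *\<^sub>R e))"
    unfolding ray_integral_def by (rule integral_unique)
  with * show "((\<lambda>s. h (p + s *\<^sub>R e)) has_integral ray_integral p e h) {0..}" by simp
qed

lemma ray_integral_nabla:
  assumes "smooth h" "\<And>s. s \<ge> real K \<Longrightarrow> h (p + s *\<^sub>R e) = 0" "\<And>s. s \<ge> real K \<Longrightarrow> nabla e h (p + s *\<^sub>R e) = 0"
  shows "ray_integral p e (nabla e h) = - h p"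
proof -
  have "((\<lambda>s. nabla e h (p + s *\<^sub>R e)) has_integral h (p + real K *\<^sub>R e) - h (p + 0 *\<^sub>R e)) {0..real K}"
    by (rule fundamental_theorem_of_calculus)
       (auto intro!: nabla_vector_derivative smooth_differentiable assms)
  then show ?thesis
    using ray_integral_cutoff(2)[of K "nabla e h" p e] assms smooth_continuous[OF smooth_nabla[OF assms(1)]]
    by (simp add: integral_unique)
qed

lemma foldr_nabla_zero: "foldr nabla us (\<lambda>_::'a::real_normed_vector. 0) = (\<lambda>_. 0)"
proof -
  have "nabla u (\<lambda>_. 0) = (\<lambda>_. 0)" for u :: 'a
    by (rule ext, rule nabla_eqI[OF has_derivative_const])
  then show ?thesis by (induction us) auto
qed

lemma foldr_nabla_vanish:
  assumes "\<And>x. norm x > r \<Longrightarrow> \<psi> x = 0" "norm x > r"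
  shows "foldr nabla us \<psi> x = 0"
proof -
  have "open {x :: 'a. norm x > r}" by (intro open_Collect_less continuous_intros)
  then show ?thesis
    using foldr_nabla_cong_open[of "{x. norm x > r}" x \<psi> "\<lambda>_. 0" us] assms
    by (simp add: foldr_nabla_zero)
qed

text \<open>The dual basis bounds each coordinate by the norm irrespective of the other one. Hence K
  also works for negative values of the other coordinate, as half-planes need.\<close>

lemma cone_cutoff:
  assumes "plane_basis e1 e2"
  obtains K :: nat where "\<And>s t. s \<ge> real K \<or> t \<ge> real K \<Longrightarrow> norm (p + s *\<^sub>R e1 + t *\<^sub>R e2) > r"
proof -
  obtain d1 d2 where d: "e1 \<bullet> d1 = 1" "e2 \<bullet> d1 = 0" "e1 \<bullet> d2 = 0" "e2 \<bullet> d2 = 1"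
    using plane_basis_dual[OF assms] by blast
  obtain K :: nat where K: "(\<bar>r\<bar> + norm p) * (norm d1 + norm d2) < real K"
    using reals_Archimedean2 by blast
  show ?thesis
  proof (rule that, rule ccontr)
    fix s t :: real assume st: "s \<ge> real K \<or> t \<ge> real K" and *: "\<not> norm (p + s *\<^sub>R e1 + t *\<^sub>R e2) > r"
    let ?y = "s *\<^sub>R e1 + t *\<^sub>R e2"
    have "norm ?y \<le> \<bar>r\<bar> + norm p"
      using * norm_triangle_ineq4[of "p + s *\<^sub>R e1 + t *\<^sub>R e2" p] by (simp add: add.assoc)
    then have bd: "\<bar>?y \<bullet> d\<bar> \<le> (\<bar>r\<bar> + norm p) * (norm d1 + norm d2)" if "d = d1 \<or> d = d2" for d
      using that by (intro order_trans[OF Cauchy_Schwarz_ineq2] mult_mono) auto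
    have "s \<le> (\<bar>r\<bar> + norm p) * (norm d1 + norm d2)" "t \<le> (\<bar>r\<bar> + norm p) * (norm d1 + norm d2)"
      using bd[of d1] bd[of d2] d by (simp_all add: inner_simps)
    then show False using st K by linarith
  qed
qed

lemma cone_derivative_family:
  fixes \<psi> :: "'a::euclidean_space \<Rightarrow> complex"
  assumes \<psi>: "smooth \<psi>"
    and K: "\<And>us s t. s \<ge> real K \<or> t \<ge> real K \<Longrightarrow> foldr nabla us \<psi> (p + s *\<^sub>R e1 + t *\<^sub>R e2) = 0"
  shows "derivative_family K (\<lambda>k l s t. (nabla e1 ^^ k) ((nabla e2 ^^ l) \<psi>) (p + s *\<^sub>R e1 + t *\<^sub>R e2))"
  unfolding derivative_family_def
proof (intro conjI allI impI)
  fix k l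
  let ?f = "(nabla e1 ^^ k) ((nabla e2 ^^ l) \<psi>)"
  have sm: "smooth ?f" and sm2: "smooth ((nabla e2 ^^ l) \<psi>)" unfolding funpow_nabla by (rule smooth_foldr_nabla smooth_foldr_nabla \<psi>)+
  show "continuous_on ({0..} \<times> {0..}) (\<lambda>(s, t). ?f (p + s *\<^sub>R e1 + t *\<^sub>R e2))"
    unfolding split_beta
    by (intro continuous_on_compose2[OF smooth_continuous[OF sm, of UNIV]]) (auto intro!: continuous_intros)
  fix s t :: real
  have "((\<lambda>s. ?f ((p + t *\<^sub>R e2) + s *\<^sub>R e1)) has_vector_derivative nabla e1 ?f ((p + t *\<^sub>R e2) + s *\<^sub>R e1)) (at s within {0..})"
    by (intro nabla_vector_derivative smooth_differentiable sm)
  then show "((\<lambda>s. ?f (p + s *\<^sub>R e1 + t *\<^sub>R e2)) has_vector_derivative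
      (nabla e1 ^^ Suc k) ((nabla e2 ^^ l) \<psi>) (p + s *\<^sub>R e1 + t *\<^sub>R e2)) (at s within {0..})"
    by (simp add: algebra_simps)
  have "((\<lambda>t. ?f ((p + s *\<^sub>R e1) + t *\<^sub>R e2)) has_vector_derivative nabla e2 ?f ((p + s *\<^sub>R e1) + t *\<^sub>R e2)) (at t within {0..})"
    by (intro nabla_vector_derivative smooth_differentiable sm)
  then show "((\<lambda>t. ?f (p + s *\<^sub>R e1 + t *\<^sub>R e2)) has_vector_derivative
      (nabla e1 ^^ k) ((nabla e2 ^^ Suc l) \<psi>) (p + s *\<^sub>R e1 + t *\<^sub>R e2)) (at t within {0..})"
    by (simp add: nabla_funpow_commute[OF sm2])
  show "?f (p + s *\<^sub>R e1 + t *\<^sub>R e2) = 0" if "s \<ge> real K \<or> t \<ge> real K"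
    using K[OF that, of "replicate k e1 @ replicate l e2"] by simp
qed

text \<open>The ray along e1 is paired with u2: the derivatives transversal to it are along e2 = u2
  + c2 e1, where only the part c2 e1 can be integrated out. The ray along e2 is paired with
  u1.\<close>

lemma cone_expansion:
  fixes \<psi> :: "'a::euclidean_space \<Rightarrow> complex"
  assumes pb: "plane_basis e1 e2" and ib: "integral_basis \<Lambda> {e1, e2}" and p: "p \<in> \<Lambda>"
    and e: "e1 = u1 + c1 *\<^sub>R e2" "e2 = u2 + c2 *\<^sub>R e1"
    and \<psi>: "smooth \<psi>" and supp: "\<And>x. norm x > r \<Longrightarrow> \<psi> x = 0"
  obtains a where "expands (region_sum \<Lambda> r \<psi> ((+) p ` cone2 e1 e2)) a"
    "\<And>n. n \<ge> 2 \<Longrightarrow> a n = ray_integral p e1 (edge_operator n u2 \<psi>) + ray_integral p e2 (edge_operator n u1 \<psi>)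
        + vertex_operator n e1 e2 u1 u2 c1 c2 \<psi> p"
proof -
  obtain K :: nat where "\<And>s t. s \<ge> real K \<or> t \<ge> real K \<Longrightarrow> norm (p + s *\<^sub>R e1 + t *\<^sub>R e2) > r"
    using cone_cutoff[OF pb] by blast
  then have K: "foldr nabla us \<psi> (p + s *\<^sub>R e1 + t *\<^sub>R e2) = 0" if "s \<ge> real K \<or> t \<ge> real K" for us s t
    using foldr_nabla_vanish[of r \<psi>, OF supp] that by blast
  have K1: "foldr nabla us \<psi> (p + s *\<^sub>R e1) = 0" if "s \<ge> real K" for us s using K[of s 0 us] that by simp
  have K2: "foldr nabla us \<psi> (p + t *\<^sub>R e2) = 0" if "t \<ge> real K" for us t using K[of 0 t us] that by simp
  define G where "G = (\<lambda>k l s t. (nabla e1 ^^ k) ((nabla e2 ^^ l) \<psi>) (p + s *\<^sub>R e1 + t *\<^sub>R e2))"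
  have G: "derivative_family K G"
    unfolding G_def by (rule cone_derivative_family[OF \<psi> K])
  \<comment> \<open>\<open>F\<close> is a primitive in both variables: one shift in s, then, after
    exchanging the variables, one in t. So \<open>F 1 1\<close> is the function itself and index 0
    in one slot is minus a ray integral.\<close>
  define P where "P = primitive_family K G"
  define Q where "Q = primitive_family K (\<lambda>k l s t. P l k t s)"
  define F where "F = (\<lambda>k l s t. Q l k t s)"
  have F: "derivative_family K F"
    unfolding F_def Q_def P_def
    by (rule derivative_family_flip[OF derivative_family_primitive[OF derivative_family_flip[OF derivative_family_primitive[OF G]]]])
  have F11: "F (Suc k) (Suc l) s t = G k l s t" for k l s t
    by (simp add: F_def Q_def P_def primitive_family_def)
  have F01: "F 0 (Suc l) 0 0 = - integral {0..real K} (\<lambda>\<sigma>. G 0 l \<sigma> 0)" for l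
    by (simp add: F_def Q_def P_def primitive_family_def)
  have F10: "F (Suc k) 0 0 0 = - integral {0..real K} (\<lambda>\<sigma>. G k 0 0 \<sigma>)" for k
    by (simp add: F_def Q_def P_def primitive_family_def)
  define a where "a = (\<lambda>n. \<Sum>k\<le>n. bern_coeff k * bern_coeff (n - k) * F k (n - k) 0 0)"
  have rs: "region_sum \<Lambda> r \<psi> ((+) p ` cone2 e1 e2) N = (\<Sum>i<K * N. \<Sum>j<K * N. F 1 1 (real i / real N) (real j / real N)) / of_nat N ^ 2"
    if "N > 0" for N
    using K[of _ _ "[]"] by (subst region_sum_cone[OF pb ib p that supp]) (auto simp: F11[of 0 0, simplified] G_def)
  have "\<exists>C. \<forall>N>0. norm (region_sum \<Lambda> r \<psi> ((+) p ` cone2 e1 e2) N - (\<Sum>n<M. a n / of_nat N ^ n)) \<le> C / real N ^ M"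
    if M: "M \<ge> 1" for M
  proof -
    from Euler_Maclaurin_quadrant[OF F M] obtain C where C: "\<And>N. N > 0 \<Longrightarrow>
      norm ((\<Sum>i<K * N. \<Sum>j<K * N. F 1 1 (real i / real N) (real j / real N)) / of_nat N ^ 2
         - (\<Sum>n<M. (\<Sum>k\<le>n. bern_coeff k * bern_coeff (n - k) * F k (n - k) 0 0) / of_nat N ^ n)) \<le> C / real N ^ M"
      by blast
    show ?thesis using C rs unfolding a_def by (intro exI[of _ C]) simp
  qed
  then have "expands (region_sum \<Lambda> r \<psi> ((+) p ` cone2 e1 e2)) a"
    unfolding expands_def by blast
  moreover have "a n = ray_integral p e1 (edge_operator n u2 \<psi>) + ray_integral p e2 (edge_operator n u1 \<psi>)
        + vertex_operator n e1 e2 u1 u2 c1 c2 \<psi> p" if n: "n \<ge> 2" for n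
  proof -
    have b0: "bern_coeff 0 = 1" using bern_coeff_convolution[of 1] by (simp add: atMost_Suc)
    define m where "m = n - 2"
    have m: "n = Suc (Suc m)" using n by (simp add: m_def)
    have fs: "smooth (foldr nabla us \<psi>)" for us by (rule smooth_foldr_nabla[OF \<psi>])
    \<comment> \<open>For a ray in direction y and transversal x = u + c y, the difference of the
      two powers is c times a derivative along the ray, whose integral is minus the value at the
      apex.\<close>
    have split: "ray_integral p y ((nabla x ^^ (n - 1)) \<psi>) = ray_integral p y ((nabla u ^^ (n - 1)) \<psi>)
        - of_real c * (\<Sum>s=0..n - 2. (nabla u ^^ s) ((nabla x ^^ (n - 2 - s)) \<psi>) p)"
      if pb': "plane_basis x y" and x: "x = u + c *\<^sub>R y" and Ky: "\<And>us t. t \<ge> real K \<Longrightarrow> foldr nabla us \<psi> (p + t *\<^sub>R y) = 0" for x y u c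
    proof -
      define h where "h = (\<lambda>z. \<Sum>s=0..n - 2. (nabla u ^^ s) ((nabla x ^^ (n - 2 - s)) \<psi>) z)"
      have h_eq: "h = (\<lambda>z. \<Sum>s=0..n - 2. foldr nabla (replicate s u @ replicate (n - 2 - s) x) \<psi> z)"
        by (simp add: h_def)
      have hs: "smooth h" and hn: "nabla y h = (\<lambda>z. \<Sum>s=0..n - 2. nabla y (foldr nabla (replicate s u @ replicate (n - 2 - s) x) \<psi>) z)"
        unfolding h_eq by (rule nabla_sum[THEN conjunct1] nabla_sum[THEN conjunct2]; simp only: finite_atLeastAtMost fs)+
      have hK: "h (p + t *\<^sub>R y) = 0" if "t \<ge> real K" for t using that Ky by (simp only: h_eq sum.neutral_const)
      have hnK: "nabla y h (p + t *\<^sub>R y) = 0" if "t \<ge> real K" for t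
        using that Ky[OF that, of "y # _"] by (simp only: hn foldr.simps o_apply sum.neutral_const)
      have "((\<lambda>t. (nabla u ^^ (n - 1)) \<psi> (p + t *\<^sub>R y)) has_integral ray_integral p y ((nabla u ^^ (n - 1)) \<psi>)) {0..}"
        unfolding funpow_nabla by (rule ray_integral_cutoff[OF Ky smooth_continuous[OF fs]])
      moreover have "((\<lambda>t. of_real c * nabla y h (p + t *\<^sub>R y)) has_integral of_real c * ray_integral p y (nabla y h)) {0..}"
        by (intro has_integral_mult_right ray_integral_cutoff hnK smooth_continuous smooth_nabla hs)
      ultimately have "((\<lambda>t. (nabla u ^^ (n - 1)) \<psi> (p + t *\<^sub>R y) + of_real c * nabla y h (p + t *\<^sub>R y)) has_integral
          ray_integral p y ((nabla u ^^ (n - 1)) \<psi>) + of_real c * ray_integral p y (nabla y h)) {0..}"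
        by (rule has_integral_add)
      then have "ray_integral p y ((nabla x ^^ (n - 1)) \<psi>) = ray_integral p y ((nabla u ^^ (n - 1)) \<psi>) + of_real c * ray_integral p y (nabla y h)"
        unfolding ray_integral_def[of _ _ "(nabla x ^^ (n - 1)) \<psi>"] nabla_power_split[OF pb' x n \<psi>] h_def[symmetric]
        by (rule integral_unique)
      also have "ray_integral p y (nabla y h) = - h p" by (rule ray_integral_nabla[OF hs hK hnK])
      finally show ?thesis by (simp add: h_def)
    qed
    have ri: "ray_integral p x (edge_operator n u \<psi>) = - bern_coeff n * ray_integral p x ((nabla u ^^ (n - 1)) \<psi>)" for x u
      unfolding ray_integral_def edge_operator_def bern_coeff_def by simp
    have r1: "integral {0..real K} (\<lambda>\<sigma>. G 0 (n - 1) \<sigma> 0) = ray_integral p e1 ((nabla e2 ^^ (n - 1)) \<psi>)"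
      unfolding G_def funpow_nabla
      by (subst ray_integral_cutoff(2)[OF K1 smooth_continuous[OF fs]]) simp_all
    have r2: "integral {0..real K} (\<lambda>\<sigma>. G (n - 1) 0 0 \<sigma>) = ray_integral p e2 ((nabla e1 ^^ (n - 1)) \<psi>)"
      unfolding G_def funpow_nabla
      by (subst ray_integral_cutoff(2)[OF K2 smooth_continuous[OF fs]]) simp_all
    have "a n = bern_coeff n * F 0 n 0 0 + (\<Sum>k=1..n - 1. bern_coeff k * bern_coeff (n - k) * F k (n - k) 0 0) + bern_coeff n * F n 0 0 0"
    proof -
      \<comment> \<open>For n at least 2 the indices 0 and n are distinct, so the double primitive
        \<open>F 0 0\<close> does not occur.\<close>
      have "{..n} = insert 0 (insert n {1..n - 1})" using n by auto
      then show ?thesis unfolding a_def using n by (simp add: b0)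
    qed
    also have "F 0 n 0 0 = - ray_integral p e1 ((nabla e2 ^^ (n - 1)) \<psi>)"
      using F01[of "n - 1"] n unfolding r1 by simp
    also have "F n 0 0 0 = - ray_integral p e2 ((nabla e1 ^^ (n - 1)) \<psi>)"
      using F10[of "n - 1"] n unfolding r2 by simp
    also have "(\<Sum>k=1..n - 1. bern_coeff k * bern_coeff (n - k) * F k (n - k) 0 0)
       = (\<Sum>k=1..n - 1. bernoulli_number k * bernoulli_number (n - k) / (fact k * fact (n - k))
        * (nabla e1 ^^ (k - 1)) ((nabla e2 ^^ (n - 1 - k)) \<psi>) p)"
    proof (intro sum.cong refl)
      fix k assume k: "k \<in> {1..n - 1}"
      then have "Suc (k - 1) = k" "Suc (n - 1 - k) = n - k" using n by auto
      then have "F k (n - k) 0 0 = G (k - 1) (n - 1 - k) 0 0" using F11[of "k - 1" "n - 1 - k" 0 0] by simp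
      then show "bern_coeff k * bern_coeff (n - k) * F k (n - k) 0 0
        = bernoulli_number k * bernoulli_number (n - k) / (fact k * fact (n - k)) * (nabla e1 ^^ (k - 1)) ((nabla e2 ^^ (n - 1 - k)) \<psi>) p"
        by (simp add: bern_coeff_def G_def)
    qed
    finally have an: "a n = bern_coeff n * - ray_integral p e1 ((nabla e2 ^^ (n - 1)) \<psi>) +
       (\<Sum>k=1..n - 1. bernoulli_number k * bernoulli_number (n - k) / (fact k * fact (n - k))
          * (nabla e1 ^^ (k - 1)) ((nabla e2 ^^ (n - 1 - k)) \<psi>) p) +
       bern_coeff n * - ray_integral p e2 ((nabla e1 ^^ (n - 1)) \<psi>)" .
    have s1: "ray_integral p e2 ((nabla e1 ^^ (n - 1)) \<psi>) = ray_integral p e2 ((nabla u1 ^^ (n - 1)) \<psi>)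
        - of_real c1 * (\<Sum>s=0..n - 2. (nabla u1 ^^ s) ((nabla e1 ^^ (n - 2 - s)) \<psi>) p)"
      by (rule split[OF pb e(1) K2])
    have s2: "ray_integral p e1 ((nabla e2 ^^ (n - 1)) \<psi>) = ray_integral p e1 ((nabla u2 ^^ (n - 1)) \<psi>)
        - of_real c2 * (\<Sum>s=0..n - 2. (nabla u2 ^^ s) ((nabla e2 ^^ (n - 2 - s)) \<psi>) p)"
      by (rule split[OF plane_basis_swap[OF pb] e(2) K1])
    show ?thesis
      unfolding an ri vertex_operator_def unfolding s1 s2
      by (simp add: bern_coeff_def algebra_simps)
  qed
  ultimately show ?thesis using that by blast
qed

subsection \<open>A smooth cutoff function\<close>

text \<open>The classical flat functions p(1/t) exp(-1/t). Allowing every polynomial p makes the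
  family closed under differentiation.\<close>

definition flat_fun :: "real poly \<Rightarrow> real \<Rightarrow> real" where
  "flat_fun p t = (if t \<le> 0 then 0 else poly p (1 / t) * exp (- (1 / t)))"

lemma poly_exp_decay: "((\<lambda>x. poly p x * exp (- x)) \<longlongrightarrow> (0::real)) at_top"
proof -
  have "((\<lambda>x. \<Sum>i\<le>degree p. coeff p i * (x ^ i / exp x)) \<longlongrightarrow> (\<Sum>i\<le>degree p. coeff p i * 0)) at_top"
    by (intro tendsto_sum tendsto_mult tendsto_const tendsto_power_div_exp_0)
  then show ?thesis
    by (simp add: poly_altdef sum_distrib_right exp_minus divide_inverse mult.assoc)
qed

text \<open>With X standing for 1/t, differentiation acts on the polynomial factor as p to X^2 (p -
  p').\<close>

lemma flat_fun_deriv: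
  "(flat_fun p has_real_derivative flat_fun (monom 1 2 * (p - pderiv p)) t) (at t)"
proof -
  consider "t < 0" | "t = 0" | "t > 0" by linarith
  then show ?thesis
  proof cases
    case 1
    have "((\<lambda>_. 0) has_real_derivative 0) (at t)" by simp
    then have "(flat_fun p has_real_derivative 0) (at t)"
      by (rule has_field_derivative_transform_within_open[of _ _ _ "{..<0}"]) (use 1 in \<open>auto simp: flat_fun_def\<close>)
    then show ?thesis using 1 by (simp add: flat_fun_def)
  next
    case 2
    \<comment> \<open>Dividing by h multiplies the polynomial in 1/h by its variable, hence
      \<open>pCons 0 p\<close>. Exponential decay still wins.\<close>
    have "((\<lambda>h. poly (pCons 0 p) (inverse h) * exp (- inverse h)) \<longlongrightarrow> 0) (at_right (0::real))"
      by (rule filterlim_compose[OF poly_exp_decay filterlim_inverse_at_top_right])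
    then have "((\<lambda>h. flat_fun p h / h) \<longlongrightarrow> 0) (at_right 0)"
      by (rule Lim_transform_eventually)
         (auto simp: eventually_at_right_field flat_fun_def field_simps intro!: exI[of _ 1])
    moreover have "((\<lambda>h. flat_fun p h / h) \<longlongrightarrow> 0) (at_left 0)"
      by (rule tendsto_eventually) (auto simp: eventually_at_left_field flat_fun_def intro!: exI[of _ "-1"])
    ultimately have "((\<lambda>h. flat_fun p h / h) \<longlongrightarrow> 0) (at 0)" by (simp add: filterlim_at_split)
    then show ?thesis using 2 by (simp add: DERIV_def flat_fun_def)
  next
    case 3
    have "((\<lambda>t. poly p (1 / t) * exp (- (1 / t))) has_real_derivative
       (poly (pderiv p) (1 / t) * (- 1 / t ^ 2)) * exp (- (1 / t)) + poly p (1 / t) * (exp (- (1 / t)) * (1 / t ^ 2))) (at t)"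
      using 3 by (auto intro!: derivative_eq_intros DERIV_chain'[where g="poly p"] poly_DERIV simp: power2_eq_square)
    then have "(flat_fun p has_real_derivative
       (poly (pderiv p) (1 / t) * (- 1 / t ^ 2)) * exp (- (1 / t)) + poly p (1 / t) * (exp (- (1 / t)) * (1 / t ^ 2))) (at t)"
      by (rule has_field_derivative_transform_within_open[of _ _ _ "{0<..}"]) (use 3 in \<open>auto simp: flat_fun_def\<close>)
    moreover have "(poly (pderiv p) (1 / t) * (- 1 / t ^ 2)) * exp (- (1 / t)) + poly p (1 / t) * (exp (- (1 / t)) * (1 / t ^ 2))
      = flat_fun (monom 1 2 * (p - pderiv p)) t"
      using 3 by (simp add: flat_fun_def poly_monom field_simps)
    ultimately show ?thesis by simp
  qed
qed

lemma smooth_flat_fun: "smooth (\<lambda>t. complex_of_real (flat_fun p t))"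
proof (rule smooth_coinduct[of _ "{\<lambda>t. complex_of_real (flat_fun p t) |p. True}"])
  have d: "((\<lambda>t. complex_of_real (flat_fun p t)) has_derivative
     (\<lambda>u. complex_of_real (u * flat_fun (monom 1 2 * (p - pderiv p)) t))) (at t)" for p t
    using has_derivative_of_real[OF flat_fun_deriv[of p t, unfolded has_field_derivative_def]]
    by (simp add: mult.commute)
  show "f differentiable at x" if "f \<in> {\<lambda>t. complex_of_real (flat_fun p t) |p. True}" for f x
    using that d by (auto simp: differentiable_def)
  show "nabla u f \<in> {\<lambda>t. complex_of_real (flat_fun p t) |p. True}"
    if mem: "f \<in> {\<lambda>t. complex_of_real (flat_fun p t) |p. True}" for f u
  proof -
    obtain p where f: "f = (\<lambda>t. complex_of_real (flat_fun p t))" using mem by blast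
    have "nabla u f = (\<lambda>t. complex_of_real (flat_fun (smult u (monom 1 2 * (p - pderiv p))) t))"
      unfolding f by (rule ext, subst nabla_eqI[OF d]) (simp add: flat_fun_def)
    then show ?thesis by blast
  qed
qed auto

text \<open>The derivative - f' / f^2 uses 1/f only to one order less, so induction on the order
  closes.\<close>

lemma differentiable_upto_inverse:
  fixes f :: "'a::real_normed_vector \<Rightarrow> complex"
  assumes "\<And>x. f x \<noteq> 0"
  shows "differentiable_upto n f \<Longrightarrow> differentiable_upto n (\<lambda>x. inverse (f x))"
proof (induction n)
  case 0
  then show ?case using assms by (auto simp: differentiable_upto_0 intro!: differentiable_inverse)
next
  case (Suc n)
  have d: "f differentiable (at x)" for x using Suc.prems by (simp add: differentiable_upto_Suc)
  have eq: "nabla u (\<lambda>x. inverse (f x)) = (\<lambda>x. (- 1) * (inverse (f x) * nabla u f x * inverse (f x)))" for u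
    using nabla_eqI[OF Deriv.has_derivative_inverse[OF assms nabla_has_derivative[OF d]]] by (auto simp: fun_eq_iff)
  have "differentiable_upto n (\<lambda>x. inverse (f x))"
    using Suc differentiable_upto_mono le_SucI by blast
  moreover have "differentiable_upto n (\<lambda>_::'a. - 1)" using smooth_const smooth_iff_upto by blast
  ultimately show ?case
    unfolding differentiable_upto_Suc eq using Suc.prems d assms
    by (intro conjI allI differentiable_inverse differentiable_upto_mult) (auto simp: differentiable_upto_Suc)
qed

lemma smooth_step:
  obtains \<sigma> :: "real \<Rightarrow> complex" where "smooth \<sigma>" "\<And>t. t \<le> 0 \<Longrightarrow> \<sigma> t = 0" "\<And>t. t \<ge> 1 \<Longrightarrow> \<sigma> t = 1"
proof -
  define g where "g = (\<lambda>t. complex_of_real (flat_fun 1 t))"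
  have g: "smooth g" unfolding g_def by (rule smooth_flat_fun)
  have g1: "smooth (\<lambda>t. g (1 + (- t)))"
    by (rule smooth_affine_compose[OF g]) (rule bounded_linear_minus[OF bounded_linear_ident])
  \<comment> \<open>t and 1 - t are never both nonpositive.\<close>
  have pos: "flat_fun 1 t + flat_fun 1 (1 - t) > 0" for t
    by (cases "t \<le> 0"; cases "t \<ge> 1") (auto simp: flat_fun_def intro!: add_pos_pos)
  have nz: "g t + g (1 + (- t)) \<noteq> 0" for t
    using pos[of t] by (simp add: g_def flip: of_real_add)
  have "smooth (\<lambda>t. g t * inverse (g t + g (1 + (- t))))"
    using g g1 nz by (intro smooth_mult g) (simp add: smooth_iff_upto differentiable_upto_inverse differentiable_upto_add)
  moreover have "g t * inverse (g t + g (1 + (- t))) = 0" if "t \<le> 0" for t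
    using that by (simp add: g_def flat_fun_def)
  moreover have "g t * inverse (g t + g (1 + (- t))) = 1" if "t \<ge> 1" for t
    using that nz[of t] by (simp add: g_def flat_fun_def)
  ultimately show ?thesis using that by blast
qed

lemma smooth_prod:
  assumes "finite I" "\<And>i. i \<in> I \<Longrightarrow> smooth (f i)"
  shows "smooth (\<lambda>x. \<Prod>i\<in>I. f i x)"
  using assms by (induction I) (auto intro: smooth_const smooth_mult)

lemma smooth_cutoff:
  fixes r :: real
  obtains \<eta> :: "'a::euclidean_space \<Rightarrow> complex" and R where "smooth \<eta>"
    "\<And>x. norm x < r \<Longrightarrow> \<eta> x = 1" "\<And>x. norm x > R \<Longrightarrow> \<eta> x = 0"
proof -
  obtain \<sigma> :: "real \<Rightarrow> complex" where \<sigma>: "smooth \<sigma>" "\<And>t. t \<le> 0 \<Longrightarrow> \<sigma> t = 0" "\<And>t. t \<ge> 1 \<Longrightarrow> \<sigma> t = 1"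
    using smooth_step by blast
  \<comment> \<open>Each factor is 1 when the coordinate is at most r in absolute value and 0 when
    it is at least r + 1.\<close>
  define \<eta> where "\<eta> = (\<lambda>x::'a. \<Prod>b\<in>Basis. \<sigma> (r + 1 + x \<bullet> b) * \<sigma> (r + 1 + (- (x \<bullet> b))))"
  have "smooth \<eta>" unfolding \<eta>_def
    by (intro smooth_prod finite_Basis smooth_mult smooth_affine_compose[OF \<sigma>(1)] bounded_linear_inner_left
        bounded_linear_minus)
  moreover have "\<eta> x = 1" if "norm x < r" for x
    unfolding \<eta>_def
  proof (rule prod.neutral, rule ballI)
    fix b :: 'a assume "b \<in> Basis"
    then have "\<bar>x \<bullet> b\<bar> < r" using Basis_le_norm[of b x] that by linarith
    then show "\<sigma> (r + 1 + x \<bullet> b) * \<sigma> (r + 1 + (- (x \<bullet> b))) = 1" by (simp add: \<sigma>(3))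
  qed
  \<comment> \<open>The radius comes from the l1 bound: if all coordinates were below r + 1 in
    absolute value, the norm would be at most the dimension times r + 1.\<close>
  moreover have "\<eta> x = 0" if "norm x > real DIM('a) * (r + 1)" for x
  proof -
    have "\<exists>b\<in>Basis. \<bar>x \<bullet> b\<bar> \<ge> r + 1"
    proof (rule ccontr)
      assume "\<not> ?thesis"
      then have "(\<Sum>b\<in>Basis. \<bar>x \<bullet> b\<bar>) \<le> (\<Sum>b\<in>(Basis::'a set). r + 1)" by (intro sum_mono) force
      then show False using norm_le_l1[of x] that by simp
    qed
    then obtain b where b: "b \<in> Basis" "\<bar>x \<bullet> b\<bar> \<ge> r + 1" by blast
    then have "x \<bullet> b \<ge> r + 1 \<or> - (x \<bullet> b) \<ge> r + 1" by linarith
    then have "\<sigma> (r + 1 + x \<bullet> b) * \<sigma> (r + 1 + (- (x \<bullet> b))) = 0" by (auto simp: \<sigma>(2))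
    then show ?thesis unfolding \<eta>_def using b(1) by (auto intro!: prod_zero)
  qed
  ultimately show ?thesis using that by blast
qed

subsection \<open>Lattice measures\<close>

text \<open>Working with nonnegative integrands leaves only measurability to check in Fubini and the
  changes of variables; this is enough to identify measures.\<close>

definition plane_nn_integral :: "'a::euclidean_space \<Rightarrow> 'a \<Rightarrow> ('a \<Rightarrow> ennreal) \<Rightarrow> ennreal" where
  "plane_nn_integral b1 b2 h = (\<integral>\<^sup>+s. \<integral>\<^sup>+t. h (s *\<^sub>R b1 + t *\<^sub>R b2) \<partial>lborel \<partial>lborel)"

lemma plane_nn_integral_swap:
  assumes [measurable]: "h \<in> borel_measurable borel"
  shows "plane_nn_integral b1 b2 h = plane_nn_integral b2 b1 h"
proof -
  have "(\<integral>\<^sup>+s. \<integral>\<^sup>+t. h (s *\<^sub>R b1 + t *\<^sub>R b2) \<partial>lborel \<partial>lborel) = (\<integral>\<^sup>+t. \<integral>\<^sup>+s. h (s *\<^sub>R b1 + t *\<^sub>R b2) \<partial>lborel \<partial>lborel)"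
    by (rule lborel_pair.Fubini'[symmetric]) measurable
  then show ?thesis by (simp add: plane_nn_integral_def add.commute)
qed

lemma plane_nn_integral_translate:
  assumes [measurable]: "h \<in> borel_measurable borel"
  shows "plane_nn_integral b1 b2 (\<lambda>x. h (a *\<^sub>R b1 + b *\<^sub>R b2 + x)) = plane_nn_integral b1 b2 h"
proof -
  have "(\<integral>\<^sup>+t. h (a *\<^sub>R b1 + b *\<^sub>R b2 + (s *\<^sub>R b1 + t *\<^sub>R b2)) \<partial>lborel) = (\<integral>\<^sup>+t. h ((a + 1 * s) *\<^sub>R b1 + t *\<^sub>R b2) \<partial>lborel)" for s
    using nn_integral_real_affine[of "\<lambda>t. h ((a + 1 * s) *\<^sub>R b1 + t *\<^sub>R b2)" 1 b] by (simp add: algebra_simps)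
  moreover have "(\<integral>\<^sup>+s. \<integral>\<^sup>+t. h ((a + 1 * s) *\<^sub>R b1 + t *\<^sub>R b2) \<partial>lborel \<partial>lborel) = (\<integral>\<^sup>+s. \<integral>\<^sup>+t. h (s *\<^sub>R b1 + t *\<^sub>R b2) \<partial>lborel \<partial>lborel)"
    using nn_integral_real_affine[of "\<lambda>s. \<integral>\<^sup>+t. h (s *\<^sub>R b1 + t *\<^sub>R b2) \<partial>lborel" 1 a] by simp
  ultimately show ?thesis by (simp add: plane_nn_integral_def)
qed

lemma plane_nn_integral_shear:
  assumes [measurable]: "h \<in> borel_measurable borel"
  shows "plane_nn_integral b1 (b2 + c *\<^sub>R b1) h = plane_nn_integral b1 b2 h"
proof -
  have "plane_nn_integral b1 (b2 + c *\<^sub>R b1) h = (\<integral>\<^sup>+t. \<integral>\<^sup>+s. h ((t * c + 1 * s) *\<^sub>R b1 + t *\<^sub>R b2) \<partial>lborel \<partial>lborel)"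
    unfolding plane_nn_integral_def
    by (subst lborel_pair.Fubini'[symmetric]) (measurable, simp add: algebra_simps)
  also have "(\<lambda>t. \<integral>\<^sup>+s. h ((t * c + 1 * s) *\<^sub>R b1 + t *\<^sub>R b2) \<partial>lborel) = (\<lambda>t. \<integral>\<^sup>+s. h (s *\<^sub>R b1 + t *\<^sub>R b2) \<partial>lborel)"
    using nn_integral_real_affine[of "\<lambda>s. h (s *\<^sub>R b1 + t *\<^sub>R b2)" 1 "t * c" for t] by simp
  also have "(\<integral>\<^sup>+t. \<integral>\<^sup>+s. h (s *\<^sub>R b1 + t *\<^sub>R b2) \<partial>lborel \<partial>lborel) = plane_nn_integral b1 b2 h"
    unfolding plane_nn_integral_def by (rule lborel_pair.Fubini') measurable
  finally show ?thesis .
qed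

lemma plane_nn_integral_shear':
  assumes "h \<in> borel_measurable borel"
  shows "plane_nn_integral (b1 + c *\<^sub>R b2) b2 h = plane_nn_integral b1 b2 h"
  using plane_nn_integral_shear[OF assms, of b2 b1 c] plane_nn_integral_swap[OF assms] by metis

lemma plane_nn_integral_scale:
  assumes [measurable]: "h \<in> borel_measurable borel" and "c \<noteq> 0"
  shows "ennreal \<bar>c\<bar> * plane_nn_integral (c *\<^sub>R b1) b2 h = plane_nn_integral b1 b2 h"
  using nn_integral_real_affine[of "\<lambda>s. \<integral>\<^sup>+t. h (s *\<^sub>R b1 + t *\<^sub>R b2) \<partial>lborel" c 0] \<open>c \<noteq> 0\<close>
  by (simp add: plane_nn_integral_def mult.commute)

text \<open>Gaussian elimination: two shears, which preserve the integral, reduce the pair of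
  vectors to multiples of e1 and e2. The scalings then give the determinant.\<close>

lemma plane_nn_integral_linear_aux:
  assumes h: "h \<in> borel_measurable borel" and "a \<noteq> 0" "a * d - b * c \<noteq> 0"
  shows "ennreal \<bar>a * d - b * c\<bar> * plane_nn_integral (a *\<^sub>R e1 + c *\<^sub>R e2) (b *\<^sub>R e1 + d *\<^sub>R e2) h = plane_nn_integral e1 e2 h"
proof -
  \<comment> \<open>The second pivot.\<close>
  define k where "k = (a * d - b * c) / a"
  have k: "k \<noteq> 0" "a * d - b * c = a * k" using assms by (auto simp: k_def)
  have "b *\<^sub>R e1 + d *\<^sub>R e2 = k *\<^sub>R e2 + (b / a) *\<^sub>R (a *\<^sub>R e1 + c *\<^sub>R e2)"
    using \<open>a \<noteq> 0\<close> by (simp add: k_def algebra_simps add_divide_distrib diff_divide_distrib)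
  then have "plane_nn_integral (a *\<^sub>R e1 + c *\<^sub>R e2) (b *\<^sub>R e1 + d *\<^sub>R e2) h = plane_nn_integral (a *\<^sub>R e1 + c *\<^sub>R e2) (k *\<^sub>R e2) h"
    using plane_nn_integral_shear[OF h] by simp
  also have "\<dots> = plane_nn_integral (a *\<^sub>R e1) (k *\<^sub>R e2) h"
    using plane_nn_integral_shear'[OF h, of "a *\<^sub>R e1" "c / k" "k *\<^sub>R e2"] k by simp
  finally have 1: "plane_nn_integral (a *\<^sub>R e1 + c *\<^sub>R e2) (b *\<^sub>R e1 + d *\<^sub>R e2) h = plane_nn_integral (a *\<^sub>R e1) (k *\<^sub>R e2) h" .
  have "ennreal \<bar>a * k\<bar> * plane_nn_integral (a *\<^sub>R e1) (k *\<^sub>R e2) h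
      = ennreal \<bar>k\<bar> * (ennreal \<bar>a\<bar> * plane_nn_integral (a *\<^sub>R e1) (k *\<^sub>R e2) h)"
    by (simp add: abs_mult ennreal_mult mult_ac)
  also have "\<dots> = ennreal \<bar>k\<bar> * plane_nn_integral (k *\<^sub>R e2) e1 h"
    unfolding plane_nn_integral_scale[OF h \<open>a \<noteq> 0\<close>] plane_nn_integral_swap[OF h, of e1] ..
  also have "\<dots> = plane_nn_integral e1 e2 h"
    unfolding plane_nn_integral_scale[OF h \<open>k \<noteq> 0\<close>] by (rule plane_nn_integral_swap[OF h])
  finally show ?thesis unfolding 1 k(2) .
qed

lemma plane_nn_integral_linear:
  assumes h: "h \<in> borel_measurable borel" and det: "\<bar>a * d - b * c\<bar> = 1"
  shows "plane_nn_integral (a *\<^sub>R e1 + c *\<^sub>R e2) (b *\<^sub>R e1 + d *\<^sub>R e2) h = plane_nn_integral e1 e2 h"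
proof (cases "a = 0")
  case False
  then show ?thesis using plane_nn_integral_linear_aux[OF h False, of d b c e1 e2] det by fastforce
next
  case True
  then have "b \<noteq> 0" "\<bar>b * c - a * d\<bar> = 1" using det by auto
  then have "plane_nn_integral (b *\<^sub>R e1 + d *\<^sub>R e2) (a *\<^sub>R e1 + c *\<^sub>R e2) h = plane_nn_integral e1 e2 h"
    using plane_nn_integral_linear_aux[OF h, of b c a d e1 e2] by fastforce
  then show ?thesis using plane_nn_integral_swap[OF h] by metis
qed

text \<open>The two matrices of base change are integral and inverse to each other, so their
  determinants are integers with product 1.\<close>

lemma integral_basis_unimodular:
  fixes e1 e2 :: "'a::euclidean_space"
  assumes pb: "plane_basis e1 e2" and ib: "integral_basis \<Lambda> {e1, e2}" and ib': "integral_basis \<Lambda> {b1, b2}" "b1 \<noteq> b2"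
  obtains a b c d :: real where "b1 = a *\<^sub>R e1 + c *\<^sub>R e2" "b2 = b *\<^sub>R e1 + d *\<^sub>R e2" "\<bar>a * d - b * c\<bar> = 1"
proof -
  note L = lattice_plane[OF pb ib]
  have "b1 \<in> \<Lambda>" "b2 \<in> \<Lambda>" using basis_subset_lattice[OF ib'(1)] by auto
  then obtain a b c d :: int where b: "b1 = of_int a *\<^sub>R e1 + of_int c *\<^sub>R e2" "b2 = of_int b *\<^sub>R e1 + of_int d *\<^sub>R e2"
    unfolding L by blast
  have "\<Lambda> = {of_int i *\<^sub>R b1 + of_int j *\<^sub>R b2 |i j. True}"
    using ib' int_span_pair[OF ib'(2)] by (simp add: integral_basis_def)
  moreover have "e1 \<in> \<Lambda>" "e2 \<in> \<Lambda>" using basis_subset_lattice[OF ib] by auto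
  ultimately obtain p q r s :: int where e: "e1 = of_int p *\<^sub>R b1 + of_int q *\<^sub>R b2" "e2 = of_int r *\<^sub>R b1 + of_int s *\<^sub>R b2"
    by blast
  have "1 *\<^sub>R e1 + 0 *\<^sub>R e2 = of_int (p * a + q * b) *\<^sub>R e1 + of_int (p * c + q * d) *\<^sub>R e2"
    by (subst e(1)) (simp add: b algebra_simps)
  from plane_basis_eqD[OF pb this] have 1: "p * a + q * b = 1" "p * c + q * d = 0" by linarith+
  have "0 *\<^sub>R e1 + 1 *\<^sub>R e2 = of_int (r * a + s * b) *\<^sub>R e1 + of_int (r * c + s * d) *\<^sub>R e2"
    by (subst e(2)) (simp add: b algebra_simps)
  from plane_basis_eqD[OF pb this] have 2: "r * a + s * b = 0" "r * c + s * d = 1" by linarith+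
  have "(p * s - q * r) * (a * d - b * c) = (p * a + q * b) * (r * c + s * d) - (p * c + q * d) * (r * a + s * b)"
    by (simp add: algebra_simps)
  also have "\<dots> = 1" unfolding 1 2 by simp
  finally have "\<bar>a * d - b * c\<bar> = 1" by (metis abs_zmult_eq_1 mult.commute abs_1)
  then have "\<bar>of_int a * of_int d - of_int b * of_int c\<bar> = (1::real)"
    by (simp flip: of_int_mult of_int_diff of_int_abs)
  with b show ?thesis using that by blast
qed

text \<open>The basis chosen by \<open>SOME\<close> differs from e1, e2 by a matrix of determinant 1
  or -1 and the chosen base point differs from q by a translation. Both leave Lebesgue measure
  invariant.\<close>

lemma lattice_measure_plane:
  fixes e1 e2 :: "'a::euclidean_space"
  assumes pb: "plane_basis e1 e2" and ib: "integral_basis \<Lambda> {e1, e2}" and S: "direction_space S = UNIV"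
  shows "lattice_measure \<Lambda> S = distr (lborel \<Otimes>\<^sub>M lborel) borel (\<lambda>(s, t). q + s *\<^sub>R e1 + t *\<^sub>R e2)"
proof -
  define B where "B = (SOME B. integral_basis (direction_space S \<inter> \<Lambda>) B)"
  define p where "p = (SOME p. p \<in> S)"
  have B: "integral_basis \<Lambda> B" unfolding B_def S Int_UNIV_left using ib by (rule someI)
  have "card B = card {e1, e2}"
    using integral_basis_span[OF B ib] B ib unfolding integral_basis_def by (metis dim_span_eq_card_independent)
  then have "card B = 2" using plane_basis_nonzero(3)[OF pb] by simp
  then obtain b1 b2 where b: "B = {b1, b2}" "b1 \<noteq> b2" by (auto simp: card_2_iff)
  obtain a b' c d where ab: "b1 = a *\<^sub>R e1 + c *\<^sub>R e2" "b2 = b' *\<^sub>R e1 + d *\<^sub>R e2" "\<bar>a * d - b' * c\<bar> = 1"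
    using integral_basis_unimodular[OF pb ib B[unfolded b(1)] b(2)] by metis
  obtain \<alpha> \<beta> where pq: "p - q = \<alpha> *\<^sub>R e1 + \<beta> *\<^sub>R e2" using pb unfolding plane_basis_def by blast
  then have p: "p = q + (\<alpha> *\<^sub>R e1 + \<beta> *\<^sub>R e2)" by (metis add.commute diff_add_cancel)
  interpret P: product_sigma_finite "\<lambda>_::'a. lborel :: real measure" by standard
  have lm: "lattice_measure \<Lambda> S = distr (Pi\<^sub>M {b1, b2} (\<lambda>_. lborel)) borel (\<lambda>t. p + (\<Sum>b\<in>{b1, b2}. t b *\<^sub>R b))"
    by (simp add: lattice_measure_def Let_def B_def[symmetric] p_def[symmetric] b(1)[symmetric])
  show ?thesis unfolding lm
  proof (rule measure_eqI)
    fix A :: "'a set" assume "A \<in> sets (distr (Pi\<^sub>M {b1, b2} (\<lambda>_. lborel)) borel (\<lambda>t. p + (\<Sum>b\<in>{b1, b2}. t b *\<^sub>R b)))"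
    then have A[measurable]: "A \<in> sets borel" by simp
    define h where "h = (\<lambda>x. indicator A x :: ennreal)"
    have h[measurable]: "h \<in> borel_measurable borel" unfolding h_def by measurable
    have T[measurable]: "(\<lambda>t. p + (\<Sum>b\<in>{b1, b2}. t b *\<^sub>R b)) \<in> measurable (Pi\<^sub>M {b1, b2} (\<lambda>_. lborel)) borel"
      by measurable
    have "emeasure (distr (Pi\<^sub>M {b1, b2} (\<lambda>_. lborel)) borel (\<lambda>t. p + (\<Sum>b\<in>{b1, b2}. t b *\<^sub>R b))) A
       = (\<integral>\<^sup>+t. h (p + (\<Sum>b\<in>{b1, b2}. t b *\<^sub>R b)) \<partial>Pi\<^sub>M {b1, b2} (\<lambda>_. lborel))"
      unfolding h_def by (subst nn_integral_indicator[symmetric], simp add: A) (rule nn_integral_distr, measurable)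
    also have "\<dots> = (\<integral>\<^sup>+x. (\<integral>\<^sup>+y. h (p + (\<Sum>b\<in>{b1, b2}. (x(b1 := y)) b *\<^sub>R b)) \<partial>lborel) \<partial>Pi\<^sub>M {b2} (\<lambda>_. lborel))"
      by (rule P.product_nn_integral_insert) (use b(2) in \<open>auto intro!: measurable_compose[OF T h]\<close>)
    also have "\<dots> = (\<integral>\<^sup>+x. (\<lambda>t. \<integral>\<^sup>+s. h (p + (s *\<^sub>R b1 + t *\<^sub>R b2)) \<partial>lborel) (x b2) \<partial>Pi\<^sub>M {b2} (\<lambda>_. lborel))"
      using b(2) by simp
    also have "\<dots> = (\<integral>\<^sup>+t. \<integral>\<^sup>+s. h (p + (s *\<^sub>R b1 + t *\<^sub>R b2)) \<partial>lborel \<partial>lborel)"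
      by (rule P.product_nn_integral_singleton) measurable
    also have "\<dots> = plane_nn_integral b1 b2 (\<lambda>x. h (p + x))"
      unfolding plane_nn_integral_def by (rule lborel_pair.Fubini') measurable
    also have "\<dots> = plane_nn_integral e1 e2 (\<lambda>x. h (p + x))"
      unfolding ab(1,2) by (rule plane_nn_integral_linear[OF _ ab(3)]) measurable
    also have "\<dots> = plane_nn_integral e1 e2 (\<lambda>x. (\<lambda>x. h (q + x)) (\<alpha> *\<^sub>R e1 + \<beta> *\<^sub>R e2 + x))"
      by (simp add: p add.assoc)
    also have "\<dots> = plane_nn_integral e1 e2 (\<lambda>x. h (q + x))"
      by (rule plane_nn_integral_translate) measurable
    also have "\<dots> = (\<integral>\<^sup>+s. \<integral>\<^sup>+t. (\<lambda>(s, t). h (q + s *\<^sub>R e1 + t *\<^sub>R e2)) (s, t) \<partial>lborel \<partial>lborel)"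
      by (simp add: plane_nn_integral_def add.assoc)
    also have "\<dots> = (\<integral>\<^sup>+z. (\<lambda>(s, t). h (q + s *\<^sub>R e1 + t *\<^sub>R e2)) z \<partial>(lborel \<Otimes>\<^sub>M lborel))"
      by (rule lborel.nn_integral_fst) measurable
    also have "\<dots> = (\<integral>\<^sup>+z. h ((\<lambda>(s, t). q + s *\<^sub>R e1 + t *\<^sub>R e2) z) \<partial>(lborel \<Otimes>\<^sub>M lborel))"
      by (simp add: split_beta)
    also have "\<dots> = emeasure (distr (lborel \<Otimes>\<^sub>M lborel) borel (\<lambda>(s, t). q + s *\<^sub>R e1 + t *\<^sub>R e2)) A"
      unfolding h_def by (subst nn_integral_indicator[symmetric], simp add: A) (rule nn_integral_distr[symmetric], measurable)
    finally show "emeasure (distr (Pi\<^sub>M {b1, b2} (\<lambda>_. lborel)) borel (\<lambda>t. p + (\<Sum>b\<in>{b1, b2}. t b *\<^sub>R b))) A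
       = emeasure (distr (lborel \<Otimes>\<^sub>M lborel) borel (\<lambda>(s, t). q + s *\<^sub>R e1 + t *\<^sub>R e2)) A" .
  qed simp
qed

lemma integral_basis_line:
  assumes "integral_basis (int_span {w}) B" "w \<noteq> (0::'a::euclidean_space)"
  shows "B = {w} \<or> B = {- w}"
proof -
  have iw: "integral_basis (int_span {w}) {w}" using assms(2) by (simp add: integral_basis_def)
  have "card B = card {w}"
    using integral_basis_span[OF assms(1) iw] assms(1) iw unfolding integral_basis_def by (metis dim_span_eq_card_independent)
  then obtain b where b: "B = {b}" by (auto simp: card_1_singleton_iff)
  have "b \<in> int_span {w}" "w \<in> int_span {b}"
    using basis_subset_lattice[OF assms(1)] basis_subset_lattice[OF iw] assms(1) b by (auto simp: integral_basis_def)
  then obtain k l :: int where kl: "b = of_int k *\<^sub>R w" "w = of_int l *\<^sub>R b" unfolding int_span_singleton by blast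
  have "w = of_int (l * k) *\<^sub>R w" using kl(2) unfolding kl(1) by simp
  then have "(of_int (l * k) - 1) *\<^sub>R w = 0" by (simp add: scaleR_diff_left)
  then have "of_int (l * k) = (1::real)" using assms(2) by simp
  then have "l * k = 1" by linarith
  then have "k = 1 \<or> k = -1" by (metis pos_zmult_eq_1_iff_lemma zmult_eq_1_iff)
  then show ?thesis using b kl(1) by auto
qed

text \<open>A generator is unique up to sign, so the chosen parametrisation differs from s to q + s
  w by a translation and possibly a reflection of the parameter.\<close>

lemma lattice_measure_line:
  fixes w :: "'a::euclidean_space"
  assumes S: "S \<noteq> {}" "\<And>x. x \<in> S \<Longrightarrow> \<exists>s. x = q + s *\<^sub>R w" and w: "w \<noteq> 0"
    and L: "direction_space S \<inter> \<Gamma> = int_span {w}"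
  shows "lattice_measure \<Gamma> S = distr lborel borel (\<lambda>s. q + s *\<^sub>R w)"
proof -
  define B where "B = (SOME B. integral_basis (direction_space S \<inter> \<Gamma>) B)"
  define p where "p = (SOME p. p \<in> S)"
  have "integral_basis (int_span {w}) {w}" using w by (simp add: integral_basis_def)
  then have "integral_basis (int_span {w}) B" unfolding B_def L by (rule someI)
  then have "B = {w} \<or> B = {- w}" using w by (rule integral_basis_line)
  then obtain b c where b: "B = {b}" "b = c *\<^sub>R w" "c = 1 \<or> c = -1"
    by (metis scaleR_minus1_left scaleR_one)
  have "p \<in> S" unfolding p_def using S(1) by (simp add: some_in_eq)
  then obtain s0 where s0: "p = q + s0 *\<^sub>R w" using S(2) by blast
  interpret P: product_sigma_finite "\<lambda>_::'a. lborel :: real measure" by standard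
  have "lattice_measure \<Gamma> S = distr (Pi\<^sub>M {b} (\<lambda>_. lborel)) borel ((\<lambda>s. p + s *\<^sub>R b) \<circ> (\<lambda>t. t b))"
    by (simp add: lattice_measure_def Let_def B_def[symmetric] p_def[symmetric] b(1) o_def)
  also have "\<dots> = distr (distr (Pi\<^sub>M {b} (\<lambda>_. lborel)) lborel (\<lambda>t. t b)) borel (\<lambda>s. p + s *\<^sub>R b)"
    by (rule distr_distr[symmetric]) measurable
  also have "\<dots> = distr lborel borel (\<lambda>s. p + s *\<^sub>R b)"
    by (simp only: P.distr_singleton)
  also have "\<dots> = distr lborel borel ((\<lambda>s. q + s *\<^sub>R w) \<circ> (\<lambda>s. s0 + c * s))"
    by (simp add: s0 b(2) o_def algebra_simps)
  also have "\<dots> = distr (distr lborel borel (\<lambda>s. s0 + c * s)) borel (\<lambda>s. q + s *\<^sub>R w)"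
    by (rule distr_distr[symmetric]) measurable
  also have "distr lborel borel (\<lambda>s. s0 + c * s) = lborel"
    using lborel_real_affine[of c s0] b(3) by (auto simp: density_1 one_ennreal_def[symmetric])
  finally show ?thesis .
qed

text \<open>The zero lattice has only the empty basis, and the product measure over the empty index
  set is a unit point mass.\<close>

lemma lattice_measure_point:
  fixes p :: "'a::euclidean_space"
  assumes "0 \<in> \<Gamma>"
  shows "lattice_measure \<Gamma> {p} = distr (count_space {()}) borel (\<lambda>_. p)"
proof -
  have d: "direction_space {p} \<inter> \<Gamma> = {0}" using assms by (auto simp: direction_space_def)
  define B where "B = (SOME B. integral_basis (direction_space {p} \<inter> \<Gamma>) B)"
  have "integral_basis {0::'a} {}" by (auto simp: integral_basis_def int_span_def independent_empty)
  then have "integral_basis {0} B" unfolding B_def d by (rule someI)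
  then have "B \<subseteq> {0}" "independent B" using basis_subset_lattice by (auto simp: integral_basis_def)
  then have "B = {}" using dependent_zero by blast
  then have "lattice_measure \<Gamma> {p} = distr (Pi\<^sub>M {} (\<lambda>_::'a. lborel :: real measure)) borel (\<lambda>t. p)"
    by (simp add: lattice_measure_def Let_def B_def[symmetric])
  also have "\<dots> = distr (count_space {()}) borel (\<lambda>_. p)"
  proof (rule measure_eqI)
    fix A assume "A \<in> sets (distr (Pi\<^sub>M {} (\<lambda>_::'a. lborel :: real measure)) borel (\<lambda>t. p))"
    then have "A \<in> sets borel" by simp
    then show "emeasure (distr (Pi\<^sub>M {} (\<lambda>_::'a. lborel :: real measure)) borel (\<lambda>t. p)) A = emeasure (distr (count_space {()}) borel (\<lambda>_. p)) A"
      by (subst (1 2) emeasure_distr) (auto simp: PiM_empty emeasure_count_space)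
  qed simp
  finally show ?thesis .
qed

subsection \<open>Meromorphic continuations\<close>

lemma cscale_apply [simp]: "blinfun_apply (cscale c \<xi>) x = c * blinfun_apply \<xi> x"
  by (simp add: cscale_def)

lemma cscale_0 [simp]: "cscale 0 \<xi> = 0"
  by (rule blinfun_eqI) simp

lemma cscale_quot_dual: "\<xi> \<in> quot_dual L \<Longrightarrow> cscale c \<xi> \<in> quot_dual L"
  by (simp add: quot_dual_def)

lemma add_quot_dual: "\<xi> \<in> quot_dual L \<Longrightarrow> \<zeta> \<in> quot_dual L \<Longrightarrow> \<xi> + \<zeta> \<in> quot_dual L"
  by (simp add: quot_dual_def blinfun.add_left)

lemma diff_quot_dual: "\<xi> \<in> quot_dual L \<Longrightarrow> \<zeta> \<in> quot_dual L \<Longrightarrow> \<xi> - \<zeta> \<in> quot_dual L"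
  by (simp add: quot_dual_def blinfun.diff_left)

lemma bounded_linear_cscale: "bounded_linear (\<lambda>z. cscale z \<xi>)"
  unfolding cscale_def
  by (rule bounded_bilinear.bounded_linear_left[OF bounded_bilinear_blinfun_compose, THEN bounded_linear_compose])
     (rule bounded_linear_blinfun_mult_right)

lemma cscale_split: "cscale h \<zeta> = Re h *\<^sub>R \<zeta> + Im h *\<^sub>R cscale \<i> \<zeta>"
proof (rule blinfun_eqI)
  fix x
  have "h * blinfun_apply \<zeta> x = (of_real (Re h) + \<i> * of_real (Im h)) * blinfun_apply \<zeta> x"
    by (simp flip: complex_eq)
  then show "blinfun_apply (cscale h \<zeta>) x = blinfun_apply (Re h *\<^sub>R \<zeta> + Im h *\<^sub>R cscale \<i> \<zeta>) x"
    by (simp add: blinfun.add_left blinfun.scaleR_left scaleR_conv_of_real algebra_simps)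
qed

text \<open>Reduction to one complex variable: a real-linear derivative that commutes with
  multiplication by i acts along a complex line as multiplication by a complex number.\<close>

lemma holomorphic_at_line:
  assumes "holomorphic_at (quot_dual L) g (\<zeta>0 + cscale z \<zeta>1)" "\<zeta>0 \<in> quot_dual L" "\<zeta>1 \<in> quot_dual L"
  shows "(\<lambda>z. g (\<zeta>0 + cscale z \<zeta>1)) field_differentiable (at z)"
proof -
  obtain D where D: "(g has_derivative D) (at (\<zeta>0 + cscale z \<zeta>1) within quot_dual L)"
    and i: "\<And>h. h \<in> quot_dual L \<Longrightarrow> D (cscale \<i> h) = \<i> * D h"
    using assms(1) unfolding holomorphic_at_def by blast
  have lin: "linear D" using D by (rule has_derivative_linear)
  have "((\<lambda>z. \<zeta>0 + cscale z \<zeta>1) has_derivative (\<lambda>h. cscale h \<zeta>1)) (at z)"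
  proof -
    have "((\<lambda>z. \<zeta>0 + cscale z \<zeta>1) has_derivative (\<lambda>h. 0 + cscale h \<zeta>1)) (at z)"
      by (intro has_derivative_add has_derivative_const bounded_linear_imp_has_derivative bounded_linear_cscale)
    then show ?thesis by simp
  qed
  moreover have "(g has_derivative D) (at (\<zeta>0 + cscale z \<zeta>1) within range (\<lambda>z. \<zeta>0 + cscale z \<zeta>1))"
    by (rule has_derivative_subset[OF D]) (use assms in \<open>auto intro: add_quot_dual cscale_quot_dual\<close>)
  ultimately have "((\<lambda>z. g (\<zeta>0 + cscale z \<zeta>1)) has_derivative (\<lambda>h. D (cscale h \<zeta>1))) (at z)"
    by (rule has_derivative_in_compose)
  moreover have "D (cscale h \<zeta>1) = D \<zeta>1 * h" for h
  proof -
    have "D (cscale h \<zeta>1) = of_real (Re h) * D \<zeta>1 + of_real (Im h) * (\<i> * D \<zeta>1)"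
      unfolding cscale_split[of h] i[OF assms(3), symmetric]
      by (simp add: linear_add[OF lin] linear_cmul[OF lin] scaleR_conv_of_real)
    also have "\<dots> = D \<zeta>1 * (of_real (Re h) + \<i> * of_real (Im h))" by (simp add: algebra_simps)
    finally show ?thesis by (simp flip: complex_eq)
  qed
  ultimately show ?thesis
    unfolding field_differentiable_def has_field_derivative_def by (auto simp: fun_eq_iff)
qed

lemma entire_on_line:
  assumes "entire_on (quot_dual L) g" "\<zeta>0 \<in> quot_dual L" "\<zeta>1 \<in> quot_dual L"
  shows "(\<lambda>z. g (\<zeta>0 + cscale z \<zeta>1)) holomorphic_on UNIV"
  unfolding holomorphic_on_def
  using assms by (auto intro!: holomorphic_at_line add_quot_dual cscale_quot_dual simp: entire_on_def)

lemma continuous_on_cscale: "continuous_on UNIV (\<lambda>z. \<zeta>0 + cscale z \<zeta>1)"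
  by (intro continuous_intros linear_continuous_on bounded_linear_cscale)

text \<open>The identity theorem on the complex line through u and \<xi>: the restriction vanishes
  near parameter 0, hence also at parameter 1.\<close>

lemma entire_on_zero:
  assumes g: "entire_on (quot_dual L) g" and u: "u \<in> quot_dual L" and "\<epsilon> > 0"
    and z: "\<And>\<xi>. \<xi> \<in> quot_dual L \<Longrightarrow> dist \<xi> u < \<epsilon> \<Longrightarrow> g \<xi> = 0" and \<xi>: "\<xi> \<in> quot_dual L"
  shows "g \<xi> = 0"
proof -
  let ?l = "\<lambda>z. u + cscale z (\<xi> - u)"
  have d: "\<xi> - u \<in> quot_dual L" by (rule diff_quot_dual[OF \<xi> u])
  have "open (?l -` ball u \<epsilon>)"
    by (intro open_vimage continuous_on_cscale open_ball)
  moreover have "(?l -` ball u \<epsilon>) \<noteq> {}"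
  proof -
    have "0 \<in> ?l -` ball u \<epsilon>" using \<open>\<epsilon> > 0\<close> by simp
    then show ?thesis by blast
  qed
  moreover have "g (?l z) = 0" if "z \<in> ?l -` ball u \<epsilon>" for z
    using that by (intro z add_quot_dual u cscale_quot_dual d) (auto simp: dist_commute)
  ultimately have "g (?l 1) = 0"
    using analytic_continuation_open[of "?l -` ball u \<epsilon>" UNIV "\<lambda>z. g (?l z)" "\<lambda>_. 0" 1]
      entire_on_line[OF g u d] connected_UNIV[where 'a=complex] by simp
  moreover have "?l 1 = \<xi>" by (rule blinfun_eqI) (simp add: blinfun.add_left blinfun.diff_left)
  ultimately show ?thesis by simp
qed

lemma entire_on_eval: "entire_on V (\<lambda>\<xi>. blinfun_apply \<xi> x)"
  unfolding entire_on_def holomorphic_at_def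
  by (intro ballI exI[of _ "\<lambda>h. blinfun_apply h x"] conjI bounded_linear_imp_has_derivative blinfun.bounded_linear_left) auto

lemma entire_on_const: "entire_on V (\<lambda>\<xi>. c)"
  unfolding entire_on_def holomorphic_at_def
  by (intro ballI exI[of _ "\<lambda>_. 0"] conjI has_derivative_const) auto

lemma entire_on_mult:
  assumes "entire_on V f" "entire_on V g"
  shows "entire_on V (\<lambda>\<xi>. f \<xi> * g \<xi>)"
  unfolding entire_on_def
proof
  fix \<xi> assume "\<xi> \<in> V"
  then obtain D E where D: "(f has_derivative D) (at \<xi> within V)" "\<forall>h\<in>V. D (cscale \<i> h) = \<i> * D h"
    and E: "(g has_derivative E) (at \<xi> within V)" "\<forall>h\<in>V. E (cscale \<i> h) = \<i> * E h"
    using assms unfolding entire_on_def holomorphic_at_def by meson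
  then show "holomorphic_at V (\<lambda>\<xi>. f \<xi> * g \<xi>) \<xi>"
    unfolding holomorphic_at_def
    by (intro exI[of _ "\<lambda>h. f \<xi> * E h + D h * g \<xi>"] conjI has_derivative_mult) (auto simp: algebra_simps)
qed

lemma entire_on_diff:
  assumes "entire_on V f" "entire_on V g"
  shows "entire_on V (\<lambda>\<xi>. f \<xi> - g \<xi>)"
  unfolding entire_on_def
proof
  fix \<xi> assume "\<xi> \<in> V"
  then obtain D E where D: "(f has_derivative D) (at \<xi> within V)" "\<forall>h\<in>V. D (cscale \<i> h) = \<i> * D h"
    and E: "(g has_derivative E) (at \<xi> within V)" "\<forall>h\<in>V. E (cscale \<i> h) = \<i> * E h"
    using assms unfolding entire_on_def holomorphic_at_def by meson
  then show "holomorphic_at V (\<lambda>\<xi>. f \<xi> - g \<xi>) \<xi>"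
    unfolding holomorphic_at_def
    by (intro exI[of _ "\<lambda>h. D h - E h"] conjI has_derivative_diff) (auto simp: algebra_simps)
qed

lemma entire_on_exp: "entire_on V (\<lambda>\<xi>. exp (blinfun_apply \<xi> x))"
  unfolding entire_on_def holomorphic_at_def
proof
  fix \<xi> assume "\<xi> \<in> V"
  have "((\<lambda>\<xi>. blinfun_apply \<xi> x) has_derivative (\<lambda>h. blinfun_apply h x)) (at \<xi> within V)"
    by (rule bounded_linear_imp_has_derivative[OF blinfun.bounded_linear_left])
  from has_derivative_compose[OF this DERIV_exp[unfolded has_field_derivative_def]]
  show "\<exists>D. ((\<lambda>\<xi>. exp (blinfun_apply \<xi> x)) has_derivative D) (at \<xi> within V) \<and> (\<forall>h\<in>V. D (cscale \<i> h) = \<i> * D h)"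
    by (intro exI conjI) auto
qed

text \<open>The chosen numerator and denominator of a continuation are unspecified; all that can be
  said is that they agree with an explicit quotient g / h after cross-multiplication.\<close>

definition mero_represents :: "'a::euclidean_space cdual set \<Rightarrow> 'a mero \<Rightarrow> ('a cdual \<Rightarrow> complex) \<Rightarrow> ('a cdual \<Rightarrow> complex) \<Rightarrow> bool" where
  "mero_represents V m g h \<longleftrightarrow> entire_on V (fst m) \<and> entire_on V (snd m) \<and> (\<exists>\<zeta>\<in>V. snd m \<zeta> \<noteq> 0) \<and>
     (\<forall>\<xi>\<in>V. fst m \<xi> * h \<xi> = g \<xi> * snd m \<xi>)"

lemma mero_represents_value:
  assumes "mero_represents V m g h" "\<xi> \<in> V" "h \<xi> \<noteq> 0" "mero_regular m \<xi>"
  shows "mero_value m \<xi> = g \<xi> / h \<xi>"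
  using assms by (auto simp: mero_represents_def mero_value_def mero_regular_def field_simps)

text \<open>The explicit pair shows that the choice is not vacuous. Both pairs continue the same
  function on a relatively open part of U, so the cross difference is entire and vanishes
  there.\<close>

lemma mero_continuation_represents:
  assumes g: "entire_on (quot_dual L) g" and h: "entire_on (quot_dual L) h"
    and nz: "\<exists>\<zeta>\<in>quot_dual L. h \<zeta> \<noteq> 0"
    and U: "u \<in> quot_dual L" "\<epsilon> > 0" "\<And>\<xi>. \<xi> \<in> quot_dual L \<Longrightarrow> dist \<xi> u < \<epsilon> \<Longrightarrow> \<xi> \<in> U"
    and eq: "\<And>\<xi>. \<xi> \<in> U \<Longrightarrow> g \<xi> = h \<xi> * f \<xi>"
  shows "mero_represents (quot_dual L) (mero_continuation (quot_dual L) U f) g h"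
proof -
  define Q where "Q = (\<lambda>(g, h). entire_on (quot_dual L) g \<and> entire_on (quot_dual L) h \<and> (\<exists>\<xi>\<in>quot_dual L. h \<xi> \<noteq> 0) \<and>
                   (\<forall>\<xi>\<in>U. g \<xi> = h \<xi> * f \<xi>))"
  define m where "m = mero_continuation (quot_dual L) U f"
  have m_eq: "m = (SOME m. Q m)" unfolding m_def mero_continuation_def Q_def by simp
  have "Q (g, h)" unfolding Q_def using g h nz eq by auto
  then have "Q m" unfolding m_eq by (rule someI)
  then have m: "entire_on (quot_dual L) (fst m)" "entire_on (quot_dual L) (snd m)" "\<exists>\<zeta>\<in>quot_dual L. snd m \<zeta> \<noteq> 0"
    "\<And>\<xi>. \<xi> \<in> U \<Longrightarrow> fst m \<xi> = snd m \<xi> * f \<xi>"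
    unfolding Q_def by (auto simp: split_beta)
  have "fst m \<xi> * h \<xi> - g \<xi> * snd m \<xi> = 0" if "\<xi> \<in> quot_dual L" for \<xi>
  proof (rule entire_on_zero[OF _ U(1,2) _ that])
    show "entire_on (quot_dual L) (\<lambda>\<xi>. fst m \<xi> * h \<xi> - g \<xi> * snd m \<xi>)"
      by (intro entire_on_diff entire_on_mult m g h)
    show "fst m \<xi> * h \<xi> - g \<xi> * snd m \<xi> = 0" if "\<xi> \<in> quot_dual L" "dist \<xi> u < \<epsilon>" for \<xi>
      using m(4) eq U(3)[OF that] by simp
  qed
  then show ?thesis unfolding mero_represents_def m_def[symmetric] using m by auto
qed

lemma Re_negative_ball:
  assumes "Re (blinfun_apply u w) < 0" "Re (blinfun_apply u w') < 0"
  obtains \<epsilon> where "\<epsilon> > 0" "\<And>\<xi>. dist \<xi> u < \<epsilon> \<Longrightarrow> Re (blinfun_apply \<xi> w) < 0 \<and> Re (blinfun_apply \<xi> w') < 0"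
proof -
  have "open {\<xi>. Re (blinfun_apply \<xi> w) < 0 \<and> Re (blinfun_apply \<xi> w') < 0}"
    by (intro open_Collect_conj open_Collect_less continuous_intros)
  then obtain \<epsilon> where "\<epsilon> > 0" "ball u \<epsilon> \<subseteq> {\<xi>. Re (blinfun_apply \<xi> w) < 0 \<and> Re (blinfun_apply \<xi> w') < 0}"
    using assms unfolding open_contains_ball by blast
  then show ?thesis using that[of \<epsilon>] by (auto simp: dist_commute subset_iff)
qed

subsection \<open>Exponential sums and integrals over unimodular cones\<close>

text \<open>The exact domain of summability matters, because the continuation is required to match
  the sum at every covector where it converges.\<close>

lemma exp_geometric:
  fixes c X :: complex
  shows "(\<lambda>i::nat. c * exp (of_nat i * X)) summable_on UNIV \<longleftrightarrow> c = 0 \<or> Re X < 0"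
    and "Re X < 0 \<Longrightarrow> (\<Sum>\<^sub>\<infinity>i::nat. c * exp (of_nat i * X)) * (1 - exp X) = c"
proof -
  have e: "exp (of_nat i * X) = exp X ^ i" for i by (rule exp_of_nat_mult)
  have hs: "((\<lambda>i::nat. c * exp (of_nat i * X)) has_sum c * (1 / (1 - exp X))) UNIV"
    if "Re X < 0"
  proof -
    have n: "norm (exp X) < 1" using that by simp
    have "((\<lambda>i::nat. exp (of_nat i * X)) has_sum (1 / (1 - exp X))) UNIV"
      unfolding e by (rule norm_summable_imp_has_sum) (use n in \<open>auto intro!: geometric_sums simp: norm_power summable_geometric\<close>)
    then show ?thesis by (rule has_sum_cmult_right)
  qed
  show "(\<lambda>i::nat. c * exp (of_nat i * X)) summable_on UNIV \<longleftrightarrow> c = 0 \<or> Re X < 0"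
  proof
    assume *: "(\<lambda>i::nat. c * exp (of_nat i * X)) summable_on UNIV"
    show "c = 0 \<or> Re X < 0"
    proof (rule disjCI)
      assume "\<not> Re X < 0"
      from * have "(\<lambda>i. c * exp X ^ i) \<longlonglongrightarrow> 0"
        unfolding e by (intro summable_LIMSEQ_zero summable_on_imp_summable)
      then have "(\<lambda>i. norm (c * exp X ^ i)) \<longlonglongrightarrow> 0" by (rule tendsto_norm_zero)
      moreover have "norm c \<le> norm (c * exp X ^ i)" for i
        using \<open>\<not> Re X < 0\<close> by (simp add: norm_mult norm_power mult_le_cancel_left1)
      ultimately have "norm c \<le> 0" by (intro LIMSEQ_le_const) auto
      then show "c = 0" by simp
    qed
  next
    assume "c = 0 \<or> Re X < 0"
    then show "(\<lambda>i::nat. c * exp (of_nat i * X)) summable_on UNIV"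
    proof
      assume "Re X < 0"
      then show ?thesis using hs unfolding summable_on_def by blast
    qed simp
  qed
  show "(\<Sum>\<^sub>\<infinity>i::nat. c * exp (of_nat i * X)) * (1 - exp X) = c" if "Re X < 0"
  proof -
    have "exp X \<noteq> 1" using that by (metis exp_eq_1 less_irrefl)
    then show ?thesis using infsumI[OF hs[OF that]] by simp
  qed
qed

lemma exp_geometric2:
  fixes V X Y :: complex
  shows "(\<lambda>(i::nat, j::nat). exp (V + of_nat i * X + of_nat j * Y)) summable_on UNIV \<longleftrightarrow> Re X < 0 \<and> Re Y < 0"
    and "Re X < 0 \<Longrightarrow> Re Y < 0 \<Longrightarrow>
      (\<Sum>\<^sub>\<infinity>(i::nat, j::nat). exp (V + of_nat i * X + of_nat j * Y)) * ((1 - exp X) * (1 - exp Y)) = exp V"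
proof -
  let ?f = "\<lambda>(i::nat, j::nat). exp (V + of_nat i * X + of_nat j * Y)"
  have f: "?f (i, j) = (exp V * exp (of_nat i * X)) * exp (of_nat j * Y)" for i j by (simp add: exp_add)
  have sY: "(\<lambda>j::nat. exp (of_nat j * Y)) summable_on UNIV \<longleftrightarrow> Re Y < 0"
    using exp_geometric(1)[of 1 Y] by simp
  have abs: "?f summable_on UNIV" if re: "Re X < 0" "Re Y < 0"
  proof -
    have aX: "(\<lambda>i::nat. norm (exp (of_nat i * X))) summable_on UNIV" and aY: "(\<lambda>j::nat. norm (exp (of_nat j * Y))) summable_on UNIV"
      using exp_geometric(1)[of 1 X] exp_geometric(1)[of 1 Y] re by (simp_all add: summable_on_iff_abs_summable_on_complex)
    have "(\<lambda>x. norm (?f x)) summable_on (UNIV \<times> UNIV)"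
    proof (rule Infinite_Sum.abs_summable_on_Sigma_iff[THEN iffD2], intro conjI ballI)
      show "(\<lambda>j. norm (?f (i, j))) summable_on UNIV" for i
        unfolding f norm_mult by (intro summable_on_cmult_right aY)
      have "(\<lambda>i. norm (infsum (\<lambda>j. norm (?f (i, j))) UNIV))
        = (\<lambda>i. norm (exp V) * norm (exp (of_nat i * X)) * norm (infsum (\<lambda>j::nat. norm (exp (of_nat j * Y))) UNIV))"
        unfolding f by (simp only: norm_mult infsum_cmult_right' real_norm_def abs_mult abs_norm_cancel)
      then show "(\<lambda>i. norm (infsum (\<lambda>j. norm (?f (i, j))) UNIV)) summable_on UNIV"
        by (simp only:) (intro summable_on_cmult_left summable_on_cmult_right aX)
    qed
    then show ?thesis by (simp add: Infinite_Sum.abs_summable_summable)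
  qed
  show "?f summable_on UNIV \<longleftrightarrow> Re X < 0 \<and> Re Y < 0"
  proof (intro iffI conjI)
    assume *: "?f summable_on UNIV"
    \<comment> \<open>Summability restricts to the two coordinate axes, where the one-variable
      criterion applies.\<close>
    have "(?f \<circ> (\<lambda>i. (i, 0::nat))) summable_on UNIV"
      by (rule summable_on_reindex[THEN iffD1, OF _ summable_on_subset_banach[OF *]]) (auto simp: inj_def)
    moreover have "(?f \<circ> (\<lambda>j. (0::nat, j))) summable_on UNIV"
      by (rule summable_on_reindex[THEN iffD1, OF _ summable_on_subset_banach[OF *]]) (auto simp: inj_def)
    ultimately have "(\<lambda>i::nat. exp V * exp (of_nat i * X)) summable_on UNIV" "(\<lambda>i::nat. exp V * exp (of_nat i * Y)) summable_on UNIV"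
      by (simp_all add: o_def exp_add)
    then show "Re X < 0" "Re Y < 0" unfolding exp_geometric(1) by auto
  qed (use abs in auto)
  assume re: "Re X < 0" "Re Y < 0"
  have "infsum ?f UNIV = infsum ?f (UNIV \<times> UNIV)" by simp
  also have "\<dots> = (\<Sum>\<^sub>\<infinity>i. \<Sum>\<^sub>\<infinity>j. ?f (i, j))"
    using infsum_Sigma'_banach[of "\<lambda>i j. ?f (i, j)" UNIV "\<lambda>_. UNIV"] abs[OF re] by simp
  also have "\<dots> = (\<Sum>\<^sub>\<infinity>i. exp V * exp (of_nat i * X) * (\<Sum>\<^sub>\<infinity>j::nat. exp (of_nat j * Y)))"
    unfolding f by (subst infsum_cmult_right') simp
  also have "\<dots> = (\<Sum>\<^sub>\<infinity>i::nat. exp V * exp (of_nat i * X)) * (\<Sum>\<^sub>\<infinity>j::nat. exp (of_nat j * Y))"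
    by (rule infsum_cmult_left')
  finally have "infsum ?f UNIV * ((1 - exp X) * (1 - exp Y))
      = ((\<Sum>\<^sub>\<infinity>i::nat. exp V * exp (of_nat i * X)) * (1 - exp X)) * ((\<Sum>\<^sub>\<infinity>j::nat. 1 * exp (of_nat j * Y)) * (1 - exp Y))"
    by simp
  also have "\<dots> = exp V" using re by (simp only: exp_geometric(2) mult_1_right)
  finally show "infsum ?f UNIV * ((1 - exp X) * (1 - exp Y)) = exp V" .
qed

lemma exp_half_line_integrable:
  "integrable lborel (\<lambda>s. indicator {0..} s *\<^sub>R exp (of_real s * X)) \<longleftrightarrow> Re X < 0" for X :: complex
proof
  assume X: "Re X < 0"
  have "(\<integral>\<^sup>+s. ennreal (exp (s * Re X)) * indicator {0..} s \<partial>lborel) = 0 - exp (0 * Re X) / Re X"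
  proof (rule nn_integral_FTC_atLeast)
    show "((\<lambda>s. exp (s * Re X) / Re X) has_real_derivative exp (s * Re X)) (at s)" for s
      using X by (auto intro!: derivative_eq_intros)
    have "filterlim (\<lambda>s. s * Re X) at_bot at_top"
      using X by (intro filterlim_tendsto_neg_mult_at_bot[OF tendsto_const _ filterlim_ident, THEN filterlim_cong[THEN iffD1, rotated -1]]) (auto simp: mult.commute)
    then have "((\<lambda>s. exp (s * Re X)) \<longlongrightarrow> 0) at_top" by (rule filterlim_compose[OF exp_at_bot])
    then show "((\<lambda>s. exp (s * Re X) / Re X) \<longlongrightarrow> 0) at_top" by (rule tendsto_divide_zero)
  qed auto
  then have fin: "(\<integral>\<^sup>+s. ennreal (exp (s * Re X)) * indicator {0..} s \<partial>lborel) < \<infinity>" by simp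
  show "integrable lborel (\<lambda>s. indicator {0..} s *\<^sub>R exp (of_real s * X))"
  proof (rule integrableI_bounded)
    have "ennreal (norm (indicator {0..} s *\<^sub>R exp (complex_of_real s * X))) = ennreal (exp (s * Re X)) * indicator {0..} s" for s
      by (auto simp: indicator_def)
    then show "(\<integral>\<^sup>+s. ennreal (norm (indicator {0..} s *\<^sub>R exp (complex_of_real s * X))) \<partial>lborel) < \<infinity>" using fin by simp
  qed simp
next
  assume *: "integrable lborel (\<lambda>s. indicator {0..} s *\<^sub>R exp (of_real s * X))"
  show "Re X < 0"
  proof (rule ccontr)
    assume X: "\<not> Re X < 0"
    \<comment> \<open>For nonnegative real part the exponential has modulus at least 1, so
      integrability would give the half-line finite length.\<close>
    have "integrable lborel (\<lambda>s::real. indicator {0..} s *\<^sub>R (1::real))"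
    proof (rule Bochner_Integration.integrable_bound[OF *])
      show "AE s in lborel. norm (indicator {0..} s *\<^sub>R (1::real)) \<le> norm (indicator {0..} s *\<^sub>R exp (complex_of_real s * X))"
        using X by (intro AE_I2) (auto simp: indicator_def)
    qed simp
    then have "emeasure lborel ({0::real..} \<inter> space lborel) < \<infinity>"
      using integrable_indicator_iff[of lborel "{0::real..}"] by simp
    then have fin: "emeasure lborel {0::real..} < \<infinity>" by simp
    then obtain n :: nat where "emeasure lborel {0::real..} < of_nat n"
      using ennreal_Ex_less_of_nat by auto
    moreover have "of_nat n = emeasure lborel {0..real n}" by (simp add: ennreal_of_nat_eq_real_of_nat)
    moreover have "emeasure lborel {0..real n} \<le> emeasure lborel {0::real..}"
      by (intro emeasure_mono) auto
    ultimately show False by simp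
  qed
qed

lemma exp_half_line_integral:
  fixes X :: complex
  assumes X: "Re X < 0"
  shows "(\<integral>s. indicator {0..} s *\<^sub>R exp (of_real s * X) \<partial>lborel) * (- X) = 1"
proof -
  have nz: "X \<noteq> 0" using X by auto
  have "((\<lambda>b. LINT s:{0..b}|lborel. exp (of_real s * X)) \<longlongrightarrow> (LINT s:{0..}|lborel. exp (of_real s * X))) at_top"
    by (rule tendsto_set_lebesgue_integral_at_top) (use X exp_half_line_integrable in \<open>auto simp: set_integrable_def\<close>)
  moreover have "\<forall>\<^sub>F b in at_top. (LINT s:{0..b}|lborel. exp (of_real s * X)) = exp (of_real b * X) / X - 1 / X"
    using eventually_ge_at_top[of 0]
  proof eventually_elim
    case (elim b)
    have "(LINT s:{0..b}|lborel. exp (of_real s * X)) = exp (of_real b * X) / X - exp (of_real 0 * X) / X"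
      unfolding set_lebesgue_integral_def
    proof (rule integral_FTC_atLeastAtMost[OF elim])
      fix s assume "0 \<le> s" "s \<le> b"
      have "((\<lambda>z. exp (z * X) / X) has_field_derivative exp (of_real s * X)) (at (of_real s))"
        using nz by (auto intro!: derivative_eq_intros)
      then show "((\<lambda>s. exp (of_real s * X) / X) has_vector_derivative exp (of_real s * X)) (at s within {0..b})"
        by (rule has_vector_derivative_real_field)
    next
      show "continuous_on {0..b} (\<lambda>s. exp (complex_of_real s * X))" by (intro continuous_intros)
    qed
    then show ?case by simp
  qed
  ultimately have 1: "((\<lambda>b. exp (of_real b * X) / X - 1 / X) \<longlongrightarrow> (LINT s:{0..}|lborel. exp (of_real s * X))) at_top"
    by (rule Lim_transform_eventually)
  have "((\<lambda>b. exp (of_real b * X)) \<longlongrightarrow> 0) at_top"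
  proof (rule tendsto_norm_zero_cancel)
    have "filterlim (\<lambda>s. s * Re X) at_bot at_top"
      using X by (intro filterlim_tendsto_neg_mult_at_bot[OF tendsto_const _ filterlim_ident, THEN filterlim_cong[THEN iffD1, rotated -1]]) (auto simp: mult.commute)
    then show "((\<lambda>b. norm (exp (complex_of_real b * X))) \<longlongrightarrow> 0) at_top"
      by (simp add: filterlim_compose[OF exp_at_bot])
  qed
  then have "((\<lambda>b. exp (of_real b * X) / X - 1 / X) \<longlongrightarrow> 0 / X - 1 / X) at_top" by (intro tendsto_intros nz)
  from tendsto_unique[OF _ 1 this] have "(LINT s:{0..}|lborel. exp (of_real s * X)) = - 1 / X" by simp
  then show ?thesis using nz by (simp add: set_lebesgue_integral_def)
qed

subsection \<open>Projections, cones and their faces\<close>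

text \<open>The concrete form of \<open>quot_proj (span {e})\<close>. For an edge with direction e1,
  \<open>line_proj e1 e2\<close> turns out to be the normal vector u_f.\<close>

definition line_proj :: "'a::euclidean_space \<Rightarrow> 'a \<Rightarrow> 'a" where
  "line_proj e x = x - ((x \<bullet> e) / (e \<bullet> e)) *\<^sub>R e"

lemma quot_proj_eqI:
  assumes "subspace L" "y \<in> L\<^sup>\<bottom>" "x - y \<in> L"
  shows "quot_proj L x = y"
  unfolding quot_proj_def
proof (rule the_equality)
  show "y \<in> L\<^sup>\<bottom> \<and> x - y \<in> L" using assms by blast
  fix z assume z: "z \<in> L\<^sup>\<bottom> \<and> x - z \<in> L"
  have "(x - z) - (x - y) \<in> L" by (rule subspace_diff[OF assms(1) conjunct2[OF z] assms(3)])
  then have yz: "y - z \<in> L" by simp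
  have "y - z \<in> L\<^sup>\<bottom>" using z assms subspace_diff[OF subspace_orthogonal_comp] by blast
  with yz have "orthogonal (y - z) (y - z)" unfolding orthogonal_comp_def by blast
  then show "z = y" by (simp add: orthogonal_def)
qed

lemma quot_proj_zero [simp]: "quot_proj {0} x = x"
  by (rule quot_proj_eqI) auto

lemma quot_proj_UNIV [simp]: "quot_proj UNIV x = 0"
  by (rule quot_proj_eqI) auto

lemma quot_proj_line:
  assumes "e \<noteq> 0"
  shows "quot_proj (span {e}) x = line_proj e x"
proof (rule quot_proj_eqI)
  have "e \<bullet> line_proj e x = 0"
    using assms by (simp add: line_proj_def inner_simps inner_commute)
  then show "line_proj e x \<in> (span {e})\<^sup>\<bottom>"
    by (auto simp: orthogonal_comp_def orthogonal_def span_singleton)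
  show "x - line_proj e x \<in> span {e}" by (simp add: line_proj_def span_scale span_base)
qed simp

lemma linear_line_proj: "linear (line_proj e)"
  by (rule linearI) (auto simp: line_proj_def inner_simps algebra_simps add_divide_distrib)

lemma line_proj_self: "e \<noteq> 0 \<Longrightarrow> line_proj e (a *\<^sub>R e) = 0"
  by (simp add: line_proj_def)

lemma line_proj_self': "e \<noteq> 0 \<Longrightarrow> line_proj e e = 0"
  by (simp add: line_proj_def)

lemma line_proj_add: "line_proj e (x + y) = line_proj e x + line_proj e y"
  by (rule linear_add[OF linear_line_proj])

lemma line_proj_scale: "line_proj e (c *\<^sub>R x) = c *\<^sub>R line_proj e x"
  by (rule linear_cmul[OF linear_line_proj])

lemma line_proj_orthogonal: "e \<noteq> 0 \<Longrightarrow> line_proj e x \<bullet> e = 0"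
  by (simp add: line_proj_def inner_simps)

lemma diff_direction_space: "x \<in> S \<Longrightarrow> y \<in> S \<Longrightarrow> y - x \<in> direction_space S"
  unfolding direction_space_def by (rule span_base) blast

lemma direction_space_point [simp]: "direction_space {p} = {0}"
proof -
  have "{y - x |x y. x \<in> {p} \<and> y \<in> {p}} = {0}" by auto
  then show ?thesis by (simp add: direction_space_def)
qed

lemma half_line_mem: "t \<ge> 0 \<Longrightarrow> p + t *\<^sub>R w \<in> half_line p w"
  by (auto simp: half_line_def)

lemma half_line_start: "p \<in> half_line p w"
  using half_line_mem[of 0 p w] by simp

lemma direction_space_line:
  assumes "\<And>x. x \<in> S \<Longrightarrow> \<exists>s. x = q + s *\<^sub>R w" "q + a *\<^sub>R w \<in> S" "q + b *\<^sub>R w \<in> S" "a \<noteq> b"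
  shows "direction_space S = span {w}"
proof
  have "y - x \<in> span {w}" if xy: "x \<in> S" "y \<in> S" for x y
  proof -
    obtain s t where "x = q + s *\<^sub>R w" "y = q + t *\<^sub>R w" using assms(1)[OF xy(1)] assms(1)[OF xy(2)] by blast
    then have "y - x = (t - s) *\<^sub>R w" by (simp add: algebra_simps)
    then show ?thesis by (auto simp: span_singleton)
  qed
  then show "direction_space S \<subseteq> span {w}"
    unfolding direction_space_def by (intro span_minimal) auto
  have "(q + b *\<^sub>R w) - (q + a *\<^sub>R w) \<in> direction_space S"
    unfolding direction_space_def using assms by (intro span_base) blast
  then have "(1 / (b - a)) *\<^sub>R ((q + b *\<^sub>R w) - (q + a *\<^sub>R w)) \<in> direction_space S"
    unfolding direction_space_def by (rule span_scale)
  also have "(1 / (b - a)) *\<^sub>R ((q + b *\<^sub>R w) - (q + a *\<^sub>R w)) = ((1 / (b - a)) * (b - a)) *\<^sub>R w"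
    by (simp add: scaleR_diff_left[symmetric])
  also have "\<dots> = w" using assms(4) by simp
  finally have "w \<in> direction_space S" .
  then have "span {w} \<subseteq> span (direction_space S)" by (intro span_mono) auto
  then show "span {w} \<subseteq> direction_space S" by (simp only: direction_space_def span_span)
qed

lemma direction_space_half_line: "direction_space (half_line p w) = span {w}"
proof (rule direction_space_line)
  show "\<exists>s. x = p + s *\<^sub>R w" if "x \<in> half_line p w" for x using that by (auto simp: half_line_def)
  show "p + 0 *\<^sub>R w \<in> half_line p w" "p + 1 *\<^sub>R w \<in> half_line p w" by (rule half_line_mem; simp)+
qed simp

lemma cone2_mem: "s \<ge> 0 \<Longrightarrow> t \<ge> 0 \<Longrightarrow> v + s *\<^sub>R e1 + t *\<^sub>R e2 \<in> (+) v ` cone2 e1 e2"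
  unfolding cone2_def by (intro image_eqI[of _ _ "s *\<^sub>R e1 + t *\<^sub>R e2"]) (auto simp: add.assoc)

lemma cone2_dual:
  assumes "e1 \<bullet> d1 = 1" "e2 \<bullet> d1 = 0" "e1 \<bullet> d2 = 0" "e2 \<bullet> d2 = 1"
    "\<And>x. x = (x \<bullet> d1) *\<^sub>R e1 + (x \<bullet> d2) *\<^sub>R e2"
  shows "cone2 e1 e2 = {x. d1 \<bullet> x \<ge> 0 \<and> d2 \<bullet> x \<ge> 0}"
proof
  show "cone2 e1 e2 \<subseteq> {x. d1 \<bullet> x \<ge> 0 \<and> d2 \<bullet> x \<ge> 0}"
    using assms(1-4) by (auto simp: cone2_def inner_simps inner_commute)
  show "{x. d1 \<bullet> x \<ge> 0 \<and> d2 \<bullet> x \<ge> 0} \<subseteq> cone2 e1 e2"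
  proof clarify
    fix x assume "0 \<le> d1 \<bullet> x" "0 \<le> d2 \<bullet> x"
    then show "x \<in> cone2 e1 e2" unfolding cone2_def using assms(5)[of x] by (auto simp: inner_commute)
  qed
qed

lemma mem_cone_dual:
  assumes "e1 \<bullet> d1 = 1" "e2 \<bullet> d1 = 0" "e1 \<bullet> d2 = 0" "e2 \<bullet> d2 = 1"
    "\<And>x. x = (x \<bullet> d1) *\<^sub>R e1 + (x \<bullet> d2) *\<^sub>R e2"
  shows "x \<in> (+) v ` cone2 e1 e2 \<longleftrightarrow> d1 \<bullet> x \<ge> d1 \<bullet> v \<and> d2 \<bullet> x \<ge> d2 \<bullet> v"
proof -
  have "x \<in> (+) v ` cone2 e1 e2 \<longleftrightarrow> x - v \<in> cone2 e1 e2"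
    by (metis (no_types, lifting) add_diff_cancel_left' diff_add_cancel add.commute image_iff)
  then show ?thesis unfolding cone2_dual[OF assms] by (simp add: inner_simps)
qed

lemma convex_cone2: "plane_basis e1 e2 \<Longrightarrow> convex_cone (cone2 e1 e2)"
proof -
  assume "plane_basis e1 e2"
  then obtain d1 d2 where d: "e1 \<bullet> d1 = 1" "e2 \<bullet> d1 = 0" "e1 \<bullet> d2 = 0" "e2 \<bullet> d2 = 1"
    "\<And>x. x = (x \<bullet> d1) *\<^sub>R e1 + (x \<bullet> d2) *\<^sub>R e2" by (rule plane_basis_dual) blast
  have "cone2 e1 e2 = \<Inter>{{x. d1 \<bullet> x \<ge> 0}, {x. d2 \<bullet> x \<ge> 0}}" unfolding cone2_dual[OF d] by auto
  then show ?thesis using convex_cone_Inter[of "{{x. d1 \<bullet> x \<ge> 0}, {x. d2 \<bullet> x \<ge> 0}}"] convex_cone_halfspace_ge by auto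
qed

lemma convex_cone_image: "plane_basis e1 e2 \<Longrightarrow> convex ((+) v ` cone2 e1 e2)"
  using convex_cone2 convex_translation unfolding convex_cone_def by blast

lemma cone2_hull: "plane_basis e1 e2 \<Longrightarrow> convex_cone hull {e1, e2} = cone2 e1 e2"
proof (rule hull_unique)
  show "{e1, e2} \<subseteq> cone2 e1 e2"
    using cone2_mem[of 1 0 0 e1 e2] cone2_mem[of 0 1 0 e1 e2] by simp
  show "cone2 e1 e2 \<subseteq> t'" if "{e1, e2} \<subseteq> t'" "convex_cone t'" for t'
    using that unfolding cone2_def convex_cone_iff by auto
qed (rule convex_cone2)

lemma direction_space_cone:
  assumes "plane_basis e1 e2"
  shows "direction_space ((+) v ` cone2 e1 e2) = UNIV"
proof -
  let ?D = "direction_space ((+) v ` cone2 e1 e2)"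
  have "(v + 1 *\<^sub>R e1 + 0 *\<^sub>R e2) - (v + 0 *\<^sub>R e1 + 0 *\<^sub>R e2) \<in> ?D" "(v + 0 *\<^sub>R e1 + 1 *\<^sub>R e2) - (v + 0 *\<^sub>R e1 + 0 *\<^sub>R e2) \<in> ?D"
    by (intro diff_direction_space cone2_mem; simp)+
  then have e: "e1 \<in> ?D" "e2 \<in> ?D" by simp_all
  have "x \<in> ?D" for x
  proof -
    obtain a b where "x = a *\<^sub>R e1 + b *\<^sub>R e2" using assms unfolding plane_basis_def by blast
    then show ?thesis using e unfolding direction_space_def by (simp add: span_add span_scale)
  qed
  then show ?thesis by blast
qed

lemma nonneg_affine: "(\<And>t. a + t * b \<ge> (0::real)) \<Longrightarrow> b = 0"
proof (rule ccontr)
  assume *: "\<And>t. a + t * b \<ge> 0" and b: "b \<noteq> 0"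
  \<comment> \<open>At this parameter the affine function has the negative value a - |a| -
    1.\<close>
  have "a + (- (\<bar>a\<bar> + 1) / b) * b \<ge> 0" by (rule *)
  then show False using b by simp
qed

lemma cone_no_line:
  assumes "plane_basis e1 e2"
  shows "\<not> contains_line ((+) v ` cone2 e1 e2)"
proof -
  obtain d1 d2 where d: "e1 \<bullet> d1 = 1" "e2 \<bullet> d1 = 0" "e1 \<bullet> d2 = 0" "e2 \<bullet> d2 = 1"
    "\<And>x. x = (x \<bullet> d1) *\<^sub>R e1 + (x \<bullet> d2) *\<^sub>R e2" using plane_basis_dual[OF assms] by blast
  have "z = 0" if "\<And>t. x + t *\<^sub>R z \<in> (+) v ` cone2 e1 e2" for x z
  proof -
    have "d1 \<bullet> (x - v) + t * (d1 \<bullet> z) \<ge> 0" "d2 \<bullet> (x - v) + t * (d2 \<bullet> z) \<ge> 0" for t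
      using that[of t] unfolding mem_cone_dual[OF d] by (auto simp: inner_simps)
    then have "d1 \<bullet> z = 0" "d2 \<bullet> z = 0" using nonneg_affine by blast+
    then show ?thesis using d(5)[of z] by (simp add: inner_commute)
  qed
  then show ?thesis unfolding contains_line_def by blast
qed

lemma half_line_no_line:
  assumes "w \<noteq> 0"
  shows "\<not> contains_line (half_line p (w::'a::euclidean_space))"
proof -
  have "z = 0" if "\<And>t. x + t *\<^sub>R z \<in> half_line p w" for x z
  proof -
    have "(x - p) \<bullet> w + t * (z \<bullet> w) \<ge> 0" for t
    proof -
      have "x + t *\<^sub>R z \<in> half_line p w" by (rule that)
      then obtain s where "s \<ge> 0" "x + t *\<^sub>R z = p + s *\<^sub>R w" by (auto simp: half_line_def)
      then have "(x - p) + t *\<^sub>R z = s *\<^sub>R w" by (simp add: algebra_simps)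
      then have "((x - p) + t *\<^sub>R z) \<bullet> w \<ge> 0" using \<open>s \<ge> 0\<close> by simp
      then show ?thesis by (simp add: inner_simps)
    qed
    then have zw: "z \<bullet> w = 0" using nonneg_affine by blast
    have "x + 0 *\<^sub>R z \<in> half_line p w" "x + 1 *\<^sub>R z \<in> half_line p w" by (rule that)+
    then obtain s0 s1 where "x + 0 *\<^sub>R z = p + s0 *\<^sub>R w" "x + 1 *\<^sub>R z = p + s1 *\<^sub>R w"
      unfolding half_line_def by blast
    then have "z = (s1 - s0) *\<^sub>R w" by (simp add: algebra_simps)
    then show ?thesis using zw assms by auto
  qed
  then show ?thesis unfolding contains_line_def by blast
qed

lemma point_no_line: "\<not> contains_line {p}"
proof
  assume "contains_line {p}"
  then obtain x v where v: "v \<noteq> 0" "\<forall>t. x + t *\<^sub>R v \<in> {p}" unfolding contains_line_def by blast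
  from v(2)[rule_format, of 0] v(2)[rule_format, of 1] show False using v(1) by auto
qed

lemma convex_half_line: "convex (half_line p w)"
proof -
  have "half_line p w = (\<lambda>t. p + t *\<^sub>R w) ` {0..}" by (auto simp: half_line_def)
  also have "\<dots> = (+) p ` (\<lambda>t. t *\<^sub>R w) ` {0..}" by (simp add: image_image)
  finally show ?thesis
    by (auto intro!: convex_translation convex_linear_image linearI simp: scaleR_add_left)
qed

lemma half_line_subset_face:
  assumes F: "F face_of S" and x: "p + s *\<^sub>R w \<in> F" "s > 0" and S: "half_line p w \<subseteq> S" and "w \<noteq> 0"
  shows "half_line p w \<subseteq> F"
proof
  fix y assume "y \<in> half_line p w"
  then obtain t where t: "t \<ge> 0" "y = p + t *\<^sub>R w" by (auto simp: half_line_def)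
  \<comment> \<open>Exceeds both s and t: the given point is then inside the segment from p to p + r
    w, which puts both ends into the face, and y lies on that segment.\<close>
  define r where "r = s + t + 1"
  have r: "r \<noteq> 0" using t x by (simp add: r_def)
  have "p + s *\<^sub>R w = (1 - s / r) *\<^sub>R p + (s / r) *\<^sub>R (p + r *\<^sub>R w)"
    using r by (simp add: algebra_simps)
  moreover have "p \<noteq> p + r *\<^sub>R w" using t x \<open>w \<noteq> 0\<close> by (simp add: r_def)
  moreover have "0 < s / r" "s / r < 1" using t x by (auto simp: r_def)
  ultimately have "p + s *\<^sub>R w \<in> open_segment p (p + r *\<^sub>R w)"
    unfolding in_segment by blast
  moreover have "p \<in> S" "p + r *\<^sub>R w \<in> S" using S half_line_start[of p w] half_line_mem[of r p w] t x by (auto simp: r_def)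
  ultimately have pF: "p \<in> F" "p + r *\<^sub>R w \<in> F" using face_ofD[OF F] x(1) by blast+
  have "y = (1 - t / r) *\<^sub>R p + (t / r) *\<^sub>R (p + r *\<^sub>R w)"
    using r by (simp add: t algebra_simps)
  moreover have "0 \<le> t / r" "t / r \<le> 1" using t x by (auto simp: r_def)
  ultimately have "y \<in> closed_segment p (p + r *\<^sub>R w)" unfolding in_segment by blast
  then show "y \<in> F" using closed_segment_subset[OF pF face_of_imp_convex[OF F]] by blast
qed

lemma faces_half_line:
  assumes "w \<noteq> (0::'a::euclidean_space)"
  shows "{F. F face_of half_line p w \<and> F \<noteq> {}} = {{p}, half_line p w}"
proof (intro equalityI subsetI)
  fix F assume "F \<in> {F. F face_of half_line p w \<and> F \<noteq> {}}"
  then have F: "F face_of half_line p w" "F \<noteq> {}" by auto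
  have sub: "F \<subseteq> half_line p w" by (rule face_of_imp_subset[OF F(1)])
  show "F \<in> {{p}, half_line p w}"
  proof (cases "F \<subseteq> {p}")
    case False
    then obtain x where "x \<in> F" "x \<noteq> p" by blast
    then obtain s where "s \<ge> 0" "x = p + s *\<^sub>R w" using sub by (auto simp: half_line_def)
    with \<open>x \<in> F\<close> \<open>x \<noteq> p\<close> have "p + s *\<^sub>R w \<in> F" "s > 0" by (auto simp: less_eq_real_def)
    then show ?thesis using half_line_subset_face[OF F(1) _ _ order_refl assms] sub by blast
  qed (use F in auto)
next
  fix F assume "F \<in> {{p}, half_line p w}"
  moreover have "half_line p w \<inter> {x. w \<bullet> x = w \<bullet> p} face_of half_line p w"
    by (rule face_of_Int_supporting_hyperplane_ge[OF convex_half_line]) (auto simp: half_line_def inner_simps)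
  moreover have "half_line p w \<inter> {x. w \<bullet> x = w \<bullet> p} = {p}"
    using assms by (auto simp: half_line_def inner_simps intro: exI[of _ 0])
  ultimately show "F \<in> {F. F face_of half_line p w \<and> F \<noteq> {}}"
    using face_of_refl[OF convex_half_line] half_line_start[of p w] by auto
qed

text \<open>A nonempty face is determined by two bits: whether it contains a point with positive
  e1-coordinate and whether it contains one with positive e2-coordinate.\<close>

lemma faces_cone:
  fixes v :: "'a::euclidean_space"
  assumes pb: "plane_basis e1 e2"
  defines "K \<equiv> (+) v ` cone2 e1 e2"
  shows "{F. F face_of K \<and> F \<noteq> {}} = {{v}, half_line v e1, half_line v e2, K}"
proof -
  obtain d1 d2 where d: "e1 \<bullet> d1 = 1" "e2 \<bullet> d1 = 0" "e1 \<bullet> d2 = 0" "e2 \<bullet> d2 = 1"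
    "\<And>x. x = (x \<bullet> d1) *\<^sub>R e1 + (x \<bullet> d2) *\<^sub>R e2" using plane_basis_dual[OF pb] by blast
  have cK: "convex K" unfolding K_def by (rule convex_cone_image[OF pb])
  have mem: "v + s *\<^sub>R e1 + t *\<^sub>R e2 \<in> K" if "s \<ge> 0" "t \<ge> 0" for s t unfolding K_def using that by (rule cone2_mem)
  have rep: "\<exists>s t. s \<ge> 0 \<and> t \<ge> 0 \<and> x = v + s *\<^sub>R e1 + t *\<^sub>R e2" if "x \<in> K" for x
    using that unfolding K_def cone2_def by (auto simp: add.assoc)
  have h1: "half_line v e1 \<subseteq> K" and h2: "half_line v e2 \<subseteq> K"
    using mem[of _ 0] mem[of 0] by (auto simp: half_line_def)
  have nz: "e1 \<noteq> 0" "e2 \<noteq> 0" using plane_basis_nonzero[OF pb] by auto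
  \<comment> \<open>The dual vectors are supporting functionals that expose the two boundary rays;
    their intersection makes the apex a face.\<close>
  have K2: "K \<inter> {x. d1 \<bullet> x = d1 \<bullet> v} = half_line v e2"
  proof
    show "K \<inter> {x. d1 \<bullet> x = d1 \<bullet> v} \<subseteq> half_line v e2"
    proof
      fix x assume x: "x \<in> K \<inter> {x. d1 \<bullet> x = d1 \<bullet> v}"
      then obtain s t where st: "s \<ge> 0" "t \<ge> 0" "x = v + s *\<^sub>R e1 + t *\<^sub>R e2" using rep by blast
      then have "s = 0" using x d by (auto simp: inner_simps inner_commute)
      then show "x \<in> half_line v e2" using st by (auto simp: half_line_def)
    qed
    show "half_line v e2 \<subseteq> K \<inter> {x. d1 \<bullet> x = d1 \<bullet> v}" using h2 d by (auto simp: half_line_def inner_simps inner_commute)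
  qed
  have K1: "K \<inter> {x. d2 \<bullet> x = d2 \<bullet> v} = half_line v e1"
  proof
    show "K \<inter> {x. d2 \<bullet> x = d2 \<bullet> v} \<subseteq> half_line v e1"
    proof
      fix x assume x: "x \<in> K \<inter> {x. d2 \<bullet> x = d2 \<bullet> v}"
      then obtain s t where st: "s \<ge> 0" "t \<ge> 0" "x = v + s *\<^sub>R e1 + t *\<^sub>R e2" using rep by blast
      then have "t = 0" using x d by (auto simp: inner_simps inner_commute)
      then show "x \<in> half_line v e1" using st by (auto simp: half_line_def)
    qed
    show "half_line v e1 \<subseteq> K \<inter> {x. d2 \<bullet> x = d2 \<bullet> v}" using h1 d by (auto simp: half_line_def inner_simps inner_commute)
  qed
  have f1: "half_line v e1 face_of K" and f2: "half_line v e2 face_of K"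
    unfolding K1[symmetric] K2[symmetric]
    by (rule face_of_Int_supporting_hyperplane_ge[OF cK]; simp add: K_def mem_cone_dual[OF d])+
  have "half_line v e1 \<inter> half_line v e2 = {v}"
  proof
    show "half_line v e1 \<inter> half_line v e2 \<subseteq> {v}"
    proof
      fix x assume "x \<in> half_line v e1 \<inter> half_line v e2"
      then obtain s t where st: "x = v + s *\<^sub>R e1" "x = v + t *\<^sub>R e2" unfolding half_line_def by blast
      then have "s *\<^sub>R e1 + 0 *\<^sub>R e2 = 0 *\<^sub>R e1 + t *\<^sub>R e2" by simp
      from plane_basis_eqD[OF pb this] show "x \<in> {v}" using st by simp
    qed
  qed (use half_line_start in auto)
  then have f0: "{v} face_of K" using face_of_Int[OF f1 f2] by simp
  show ?thesis
  proof (intro equalityI subsetI)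
    fix F assume "F \<in> {F. F face_of K \<and> F \<noteq> {}}"
    then have F: "F face_of K" "F \<noteq> {}" by auto
    have sub: "F \<subseteq> K" by (rule face_of_imp_subset[OF F(1)])
    \<comment> \<open>A point of the cone is the midpoint of two boundary points with doubled
      coordinates, so a face containing it contains these.\<close>
    have mid: "v + (2 * s) *\<^sub>R e1 \<in> F \<and> v + (2 * t) *\<^sub>R e2 \<in> F" if "v + s *\<^sub>R e1 + t *\<^sub>R e2 \<in> F" "s \<ge> 0" "t \<ge> 0" "s > 0 \<or> t > 0" for s t
    proof -
      have "v + s *\<^sub>R e1 + t *\<^sub>R e2 = (1 - 1 / 2) *\<^sub>R (v + (2 * s) *\<^sub>R e1) + (1 / 2) *\<^sub>R (v + (2 * t) *\<^sub>R e2)"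
        by (simp add: algebra_simps flip: scaleR_add_left)
      moreover have "v + (2 * s) *\<^sub>R e1 \<noteq> v + (2 * t) *\<^sub>R e2"
        using plane_basis_eqD[OF pb, of "2 * s" 0 0 "2 * t"] that by auto
      ultimately have "v + s *\<^sub>R e1 + t *\<^sub>R e2 \<in> open_segment (v + (2 * s) *\<^sub>R e1) (v + (2 * t) *\<^sub>R e2)"
        unfolding in_segment by (intro conjI exI[of _ "1/2"]) auto
      moreover have "v + (2 * s) *\<^sub>R e1 \<in> K" "v + (2 * t) *\<^sub>R e2 \<in> K" using mem[of "2 * s" 0] mem[of 0 "2 * t"] that by auto
      ultimately show ?thesis using face_ofD[OF F(1)] that(1) by blast
    qed
    define A where "A \<longleftrightarrow> (\<exists>s>0. \<exists>t\<ge>0. v + s *\<^sub>R e1 + t *\<^sub>R e2 \<in> F)"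
    define B where "B \<longleftrightarrow> (\<exists>s\<ge>0. \<exists>t>0. v + s *\<^sub>R e1 + t *\<^sub>R e2 \<in> F)"
    have A: "half_line v e1 \<subseteq> F" if a: A
    proof -
      obtain s t where st: "s > 0" "t \<ge> 0" "v + s *\<^sub>R e1 + t *\<^sub>R e2 \<in> F" using a by (auto simp: A_def)
      then have "v + (2 * s) *\<^sub>R e1 \<in> F" using mid by auto
      then show ?thesis using half_line_subset_face[OF F(1) _ _ h1 nz(1)] st(1) by simp
    qed
    have B: "half_line v e2 \<subseteq> F" if b: B
    proof -
      obtain s t where st: "s \<ge> 0" "t > 0" "v + s *\<^sub>R e1 + t *\<^sub>R e2 \<in> F" using b by (auto simp: B_def)
      then have "v + (2 * t) *\<^sub>R e2 \<in> F" using mid by auto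
      then show ?thesis using half_line_subset_face[OF F(1) _ _ h2 nz(2)] st(2) by simp
    qed
    consider "A \<and> B" | "A \<and> \<not> B" | "\<not> A \<and> B" | "\<not> A \<and> \<not> B" by blast
    then show "F \<in> {{v}, half_line v e1, half_line v e2, K}"
    proof cases
      case 1
      have "K \<subseteq> F"
      proof
        fix x assume "x \<in> K"
        then obtain s t where st: "s \<ge> 0" "t \<ge> 0" "x = v + s *\<^sub>R e1 + t *\<^sub>R e2" using rep by blast
        have "v + (2 * s) *\<^sub>R e1 \<in> F" "v + (2 * t) *\<^sub>R e2 \<in> F"
          using A B 1 half_line_mem[of "2 * s" v e1] half_line_mem[of "2 * t" v e2] st by auto
        then have "(1 / 2) *\<^sub>R (v + (2 * s) *\<^sub>R e1) + (1 / 2) *\<^sub>R (v + (2 * t) *\<^sub>R e2) \<in> F"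
          by (intro convexD[OF face_of_imp_convex[OF F(1)]]) auto
        also have "(1 / 2) *\<^sub>R (v + (2 * s) *\<^sub>R e1) + (1 / 2) *\<^sub>R (v + (2 * t) *\<^sub>R e2) = x"
          unfolding st by (simp add: algebra_simps flip: scaleR_add_left)
        finally show "x \<in> F" .
      qed
      then show ?thesis using sub by blast
    next
      case 2
      have "F \<subseteq> half_line v e1"
      proof
        fix x assume "x \<in> F"
        then obtain s t where st: "s \<ge> 0" "t \<ge> 0" "x = v + s *\<^sub>R e1 + t *\<^sub>R e2" using rep sub by blast
        then have "t = 0" using 2 \<open>x \<in> F\<close> unfolding B_def by (metis less_eq_real_def)
        then show "x \<in> half_line v e1" using st by (auto simp: half_line_def)
      qed
      then show ?thesis using A 2 by blast
    next
      case 3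
      have "F \<subseteq> half_line v e2"
      proof
        fix x assume "x \<in> F"
        then obtain s t where st: "s \<ge> 0" "t \<ge> 0" "x = v + s *\<^sub>R e1 + t *\<^sub>R e2" using rep sub by blast
        then have "s = 0" using 3 \<open>x \<in> F\<close> unfolding A_def by (metis less_eq_real_def)
        then show "x \<in> half_line v e2" using st by (auto simp: half_line_def)
      qed
      then show ?thesis using B 3 by blast
    next
      case 4
      have "F \<subseteq> {v}"
      proof
        fix x assume "x \<in> F"
        then obtain s t where st: "s \<ge> 0" "t \<ge> 0" "x = v + s *\<^sub>R e1 + t *\<^sub>R e2" using rep sub by blast
        then have "s = 0" "t = 0" using 4 \<open>x \<in> F\<close> unfolding A_def B_def by (metis less_eq_real_def)+
        then show "x \<in> {v}" using st by simp
      qed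
      then show ?thesis using F by blast
    qed
  next
    fix F assume "F \<in> {{v}, half_line v e1, half_line v e2, K}"
    then show "F \<in> {F. F face_of K \<and> F \<noteq> {}}"
      using f0 f1 f2 face_of_refl[OF cK] half_line_start[of v e1] half_line_start[of v e2] mem[of 0 0] by auto
  qed
qed

subsection \<open>Transverse cones\<close>

lemma convex_cone_ray: "convex_cone {t *\<^sub>R w |t. t \<ge> 0}"
  unfolding convex_cone_iff
proof (intro conjI ballI allI impI)
  show "0 \<in> {t *\<^sub>R w |t. t \<ge> 0}" by (auto intro: exI[of _ 0])
  show "x + y \<in> {t *\<^sub>R w |t. t \<ge> 0}" if xy: "x \<in> {t *\<^sub>R w |t. t \<ge> 0}" "y \<in> {t *\<^sub>R w |t. t \<ge> 0}" for x y
  proof -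
    obtain s t where "s \<ge> 0" "t \<ge> 0" "x = s *\<^sub>R w" "y = t *\<^sub>R w" using xy by blast
    then have "s + t \<ge> 0" "x + y = (s + t) *\<^sub>R w" by (auto simp: scaleR_add_left)
    then show ?thesis by blast
  qed
  show "c *\<^sub>R x \<in> {t *\<^sub>R w |t. t \<ge> 0}" if "x \<in> {t *\<^sub>R w |t. t \<ge> 0}" "c \<ge> 0" for x c
    using that by auto
qed

lemma face_cone_start:
  "face_cone P {v} = convex_cone hull {y - v |y. y \<in> P}"
  by (simp add: face_cone_def)

lemma transverse_cone_point:
  "transverse_cone P {v} = (+) v ` (convex_cone hull {y - v |y. y \<in> P})"
  unfolding transverse_cone_def direction_space_point face_cone_start by (auto simp: image_iff)

lemma transverse_cone_half_line_start: "transverse_cone (half_line p w) {p} = half_line p w"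
proof -
  have "{y - p |y. y \<in> half_line p w} = {t *\<^sub>R w |t. t \<ge> 0}" by (force simp: half_line_def)
  then have "convex_cone hull {y - p |y. y \<in> half_line p w} = {t *\<^sub>R w |t. t \<ge> 0}"
    by (simp only: hull_same[of convex_cone, OF convex_cone_ray])
  then show ?thesis unfolding transverse_cone_point by (auto simp: half_line_def)
qed

lemma transverse_cone_vertex:
  assumes pb: "plane_basis e1 e2" and P: "P \<subseteq> (+) v ` cone2 e1 e2" and "v + a *\<^sub>R e1 \<in> P" "a > 0" "v + b *\<^sub>R e2 \<in> P" "b > 0"
  shows "transverse_cone P {v} = (+) v ` cone2 e1 e2"
proof -
  let ?S = "{y - v |y. y \<in> P}"
  have "convex_cone hull ?S \<subseteq> cone2 e1 e2" by (rule hull_minimal) (use P convex_cone2[OF pb] in auto)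
  moreover have "cone2 e1 e2 \<subseteq> convex_cone hull ?S"
  proof -
    have s: "(v + a *\<^sub>R e1) - v \<in> convex_cone hull ?S" "(v + b *\<^sub>R e2) - v \<in> convex_cone hull ?S"
      using assms by (intro hull_inc; blast)+
    then have "(1 / a) *\<^sub>R ((v + a *\<^sub>R e1) - v) \<in> convex_cone hull ?S" "(1 / b) *\<^sub>R ((v + b *\<^sub>R e2) - v) \<in> convex_cone hull ?S"
      using assms by (intro convex_cone_hull_mul; simp)+
    then have "{e1, e2} \<subseteq> convex_cone hull ?S" using assms by simp
    then show ?thesis unfolding cone2_hull[OF pb, symmetric] by (intro hull_minimal convex_cone_convex_cone_hull)
  qed
  ultimately show ?thesis unfolding transverse_cone_point by blast
qed

text \<open>Modulo e1 only the coordinate along e2 survives. It is nonnegative on P, zero on f and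
  positive somewhere, so the image is a full ray.\<close>

lemma transverse_cone_edge:
  assumes pb: "plane_basis e1 e2" and df: "direction_space f = span {e1}"
    and f: "\<And>x. x \<in> f \<Longrightarrow> \<exists>s. x = v + s *\<^sub>R e1" "f \<noteq> {}"
    and P: "\<And>x. x \<in> P \<Longrightarrow> \<exists>s t. t \<ge> 0 \<and> x = v + s *\<^sub>R e1 + t *\<^sub>R e2" "v + s0 *\<^sub>R e1 + t0 *\<^sub>R e2 \<in> P" "t0 > 0"
  shows "transverse_cone P f = half_line (line_proj e1 v) (line_proj e1 e2)"
proof -
  have nz: "e1 \<noteq> 0" using plane_basis_nonzero[OF pb] by blast
  obtain d1 d2 where d: "e1 \<bullet> d1 = 1" "e2 \<bullet> d1 = 0" "e1 \<bullet> d2 = 0" "e2 \<bullet> d2 = 1"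
    "\<And>x. x = (x \<bullet> d1) *\<^sub>R e1 + (x \<bullet> d2) *\<^sub>R e2" using plane_basis_dual[OF pb] by blast
  let ?S = "{y - x |x y. y \<in> P \<and> x \<in> f}"
  have hull: "convex_cone hull ?S \<subseteq> {x. d2 \<bullet> x \<ge> 0}"
  proof (rule hull_minimal)
    show "?S \<subseteq> {x. d2 \<bullet> x \<ge> 0}"
    proof clarify
      fix x y assume "y \<in> P" "x \<in> f"
      then obtain s t s' where "t \<ge> 0" "y = v + s *\<^sub>R e1 + t *\<^sub>R e2" "x = v + s' *\<^sub>R e1" using P(1) f(1) by meson
      then show "0 \<le> d2 \<bullet> (y - x)" using d by (simp add: inner_simps inner_commute)
    qed
  qed (rule convex_cone_halfspace_ge)
  have aff: "affine hull f \<subseteq> (\<lambda>s. v + s *\<^sub>R e1) ` UNIV"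
  proof (rule hull_minimal)
    show "f \<subseteq> (\<lambda>s. v + s *\<^sub>R e1) ` UNIV" using f(1) by blast
    have "(\<lambda>s. v + s *\<^sub>R e1) ` UNIV = (+) v ` span {e1}" by (auto simp: span_singleton)
    then show "affine ((\<lambda>s. v + s *\<^sub>R e1) ` UNIV)" by (simp add: affine_translation[symmetric] subspace_imp_affine)
  qed
  have lp: "line_proj e1 (v + s *\<^sub>R e1 + y) = line_proj e1 v + line_proj e1 y" for s y
    by (simp add: line_proj_add line_proj_self[OF nz])
  show ?thesis unfolding transverse_cone_def df face_cone_def
  proof (intro equalityI subsetI)
    fix z assume "z \<in> quot_proj (span {e1}) ` {x + y |x y. x \<in> affine hull f \<and> y \<in> convex_cone hull ?S}"
    then obtain x y where xy: "x \<in> affine hull f" "y \<in> convex_cone hull ?S" "z = line_proj e1 (x + y)"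
      by (auto simp: quot_proj_line[OF nz])
    obtain s where s: "x = v + s *\<^sub>R e1" using aff xy by blast
    have y: "y = (y \<bullet> d1) *\<^sub>R e1 + (y \<bullet> d2) *\<^sub>R e2" by (rule d)
    have "line_proj e1 y = (y \<bullet> d2) *\<^sub>R line_proj e1 e2"
      by (subst y) (simp add: line_proj_add line_proj_self'[OF nz] line_proj_scale)
    moreover have "y \<bullet> d2 \<ge> 0" using hull xy(2) by (auto simp: inner_commute)
    ultimately show "z \<in> half_line (line_proj e1 v) (line_proj e1 e2)"
      unfolding xy(3) s lp by (simp add: half_line_mem)
  next
    fix z assume "z \<in> half_line (line_proj e1 v) (line_proj e1 e2)"
    then obtain t where t: "t \<ge> 0" "z = line_proj e1 v + t *\<^sub>R line_proj e1 e2" by (auto simp: half_line_def)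
    obtain x0 where x0: "x0 \<in> f" using f(2) by blast
    obtain s where s: "x0 = v + s *\<^sub>R e1" using f(1)[OF x0] by blast
    \<comment> \<open>Scaled so that its e2-coordinate is t; the e1-coordinate is killed by the
      projection.\<close>
    let ?y = "(t / t0) *\<^sub>R ((v + s0 *\<^sub>R e1 + t0 *\<^sub>R e2) - x0)"
    have "?y \<in> convex_cone hull ?S"
      using P(2,3) x0 t by (intro convex_cone_hull_mul hull_inc) auto
    moreover have "line_proj e1 (x0 + ?y) = z"
    proof -
      have eq: "(v + s0 *\<^sub>R e1 + t0 *\<^sub>R e2) - x0 = (s0 - s) *\<^sub>R e1 + t0 *\<^sub>R e2"
        by (simp add: s algebra_simps)
      have "?y = (t / t0 * (s0 - s)) *\<^sub>R e1 + t *\<^sub>R e2" unfolding eq using P(3) by (simp add: scaleR_add_right)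
      then have "x0 + ?y = v + s *\<^sub>R e1 + ((t / t0 * (s0 - s)) *\<^sub>R e1 + t *\<^sub>R e2)" by (simp add: s)
      then have "line_proj e1 (x0 + ?y) = line_proj e1 v + line_proj e1 ((t / t0 * (s0 - s)) *\<^sub>R e1 + t *\<^sub>R e2)"
        by (simp only: lp)
      then show ?thesis by (simp add: t line_proj_add line_proj_self'[OF nz] line_proj_scale)
    qed
    ultimately show "z \<in> quot_proj (span {e1}) ` {x + y |x y. x \<in> affine hull f \<and> y \<in> convex_cone hull ?S}"
      using hull_inc[OF x0, of affine] by (intro image_eqI[of _ _ "x0 + ?y"]) (auto simp: quot_proj_line[OF nz])
  qed
qed

lemma transverse_cone_full:
  assumes "quot_proj (direction_space F) ` {x + y |x y. x \<in> affine hull F \<and> y \<in> face_cone F F} \<subseteq> {0}" "F \<noteq> {}"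
  shows "transverse_cone F F = {0}"
proof -
  obtain x where "x \<in> F" using assms(2) by blast
  then have "x \<in> affine hull F" by (rule hull_inc)
  moreover have "0 \<in> face_cone F F" unfolding face_cone_def by (rule convex_cone_hull_contains_0)
  ultimately show ?thesis using assms(1) unfolding transverse_cone_def by fastforce
qed

text \<open>Since p lies on the line spanned by w, the affine hull of the half-line passes through 0
  and projects to 0 rather than to another point. In a one-dimensional quotient this is
  automatic.\<close>

lemma transverse_cone_half_line_full:
  assumes w: "w \<noteq> 0" and p: "p \<in> span {w}"
  shows "transverse_cone (half_line p w) (half_line p w) = {0}"
proof (rule transverse_cone_full)
  have sub: "half_line p w \<subseteq> span {w}"
    unfolding half_line_def by clarify (intro span_add p span_scale, simp add: span_base)
  have "affine hull (half_line p w) \<subseteq> span {w}"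
    by (rule hull_minimal[OF sub]) (simp add: subspace_imp_affine)
  moreover have "face_cone (half_line p w) (half_line p w) \<subseteq> span {w}"
    unfolding face_cone_def
    by (rule hull_minimal) (use sub in \<open>auto intro!: span_diff simp: convex_cone_iff span_zero span_add span_scale\<close>)
  ultimately have "x + y \<in> span {w}" if "x \<in> affine hull (half_line p w)" "y \<in> face_cone (half_line p w) (half_line p w)" for x y
    using that by (intro span_add) auto
  then show "quot_proj (direction_space (half_line p w)) ` {x + y |x y. x \<in> affine hull half_line p w \<and> y \<in> face_cone (half_line p w) (half_line p w)} \<subseteq> {0}"
    unfolding direction_space_half_line quot_proj_line[OF w] by (force simp: span_singleton line_proj_self[OF w])
qed (use half_line_start in blast)

lemma transverse_cone_cone_full:
  assumes "plane_basis e1 e2"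
  shows "transverse_cone ((+) v ` cone2 e1 e2) ((+) v ` cone2 e1 e2) = {0}"
  by (rule transverse_cone_full) (use cone2_mem[of 0 0 v e1 e2] in \<open>auto simp: direction_space_cone[OF assms]\<close>)

section \<open>Explicit quotients for exponential sums and integrals\<close>

lemma quot_dual_zero [simp]: "quot_dual {0} = UNIV"
  by (auto simp: quot_dual_def)

lemma quot_lattice_zero [simp]: "quot_lattice \<Lambda> {0} = \<Lambda>"
  by (simp add: quot_lattice_def)

lemma exp_neq_1: "Re z < 0 \<Longrightarrow> exp z \<noteq> 1"
  by (metis exp_eq_1 less_irrefl)

lemma Re_negative_near:
  assumes "Re (blinfun_apply u w) < 0" "Re (blinfun_apply u w') < 0"
  shows "\<exists>\<epsilon>>0. \<forall>\<xi>. dist \<xi> u < \<epsilon> \<longrightarrow> Re (blinfun_apply \<xi> w) < 0 \<and> Re (blinfun_apply \<xi> w') < 0"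
proof (rule Re_negative_ball[OF assms])
  fix \<epsilon> :: real
  assume "\<epsilon> > 0" and *: "\<And>\<xi>. dist \<xi> u < \<epsilon> \<Longrightarrow> Re (blinfun_apply \<xi> w) < 0 \<and> Re (blinfun_apply \<xi> w') < 0"
  then show ?thesis by (intro exI[of _ \<epsilon>]) simp
qed

text \<open>The covector u shows that the domain of convergence has interior points in the dual of
  the quotient, which fixes the continuation.\<close>

lemma exp_sum_half_line:
  fixes w :: "'a::euclidean_space"
  assumes w: "w \<noteq> 0" and lat: "half_line p w \<inter> quot_lattice \<Lambda> L = range (\<lambda>i::nat. p + of_nat i *\<^sub>R w)"
    and u: "u \<in> quot_dual L" "Re (blinfun_apply u w) < 0"
  shows "mero_represents (quot_dual L) (exp_sum \<Lambda> L (half_line p w)) (\<lambda>\<xi>. exp (blinfun_apply \<xi> p)) (\<lambda>\<xi>. 1 - exp (blinfun_apply \<xi> w))"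
proof -
  define g where "g = (\<lambda>i::nat. p + of_nat i *\<^sub>R w)"
  have inj: "inj g" using w by (auto simp: inj_def g_def)
  have fg: "(\<lambda>\<gamma>. exp (blinfun_apply \<xi> \<gamma>)) \<circ> g = (\<lambda>i. exp (blinfun_apply \<xi> p) * exp (of_nat i * blinfun_apply \<xi> w))" for \<xi> :: "'a cdual"
  proof -
    have "blinfun_apply \<xi> (g i) = blinfun_apply \<xi> p + of_nat i * blinfun_apply \<xi> w" for i
      by (simp add: g_def blinfun.add_right blinfun.scaleR_right scaleR_conv_of_real)
    then show ?thesis by (simp only: o_def exp_add)
  qed
  have sm: "(\<lambda>\<gamma>. exp (blinfun_apply \<xi> \<gamma>)) summable_on range g \<longleftrightarrow> Re (blinfun_apply \<xi> w) < 0" for \<xi> :: "'a cdual"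
    unfolding summable_on_reindex[OF inj] fg exp_geometric(1) by simp
  obtain \<epsilon> where \<epsilon>: "\<epsilon> > 0" "\<And>\<xi>. dist \<xi> u < \<epsilon> \<Longrightarrow> Re (blinfun_apply \<xi> w) < 0 \<and> Re (blinfun_apply \<xi> w) < 0"
    using Re_negative_near[OF u(2) u(2)] by blast
  show ?thesis
    unfolding exp_sum_def if_not_P[OF half_line_no_line[OF w]] lat g_def[symmetric]
  proof (rule mero_continuation_represents[OF _ _ _ u(1) \<epsilon>(1)])
    show "\<exists>\<zeta>\<in>quot_dual L. 1 - exp (blinfun_apply \<zeta> w) \<noteq> 0" using u exp_neq_1 by (intro bexI[of _ u]) auto
    show "\<xi> \<in> {\<xi> \<in> quot_dual L. (\<lambda>\<gamma>. exp (blinfun_apply \<xi> \<gamma>)) summable_on range g}" if "\<xi> \<in> quot_dual L" "dist \<xi> u < \<epsilon>" for \<xi>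
      using that sm \<epsilon>(2) by auto
    fix \<xi> assume "\<xi> \<in> {\<xi> \<in> quot_dual L. (\<lambda>\<gamma>. exp (blinfun_apply \<xi> \<gamma>)) summable_on range g}"
    then have re: "Re (blinfun_apply \<xi> w) < 0" using sm by auto
    show "exp (blinfun_apply \<xi> p) = (1 - exp (blinfun_apply \<xi> w)) * infsum (\<lambda>\<gamma>. exp (blinfun_apply \<xi> \<gamma>)) (range g)"
      unfolding infsum_reindex[OF inj] fg using exp_geometric(2)[OF re, of "exp (blinfun_apply \<xi> p)"] by (simp only: mult.commute)
  qed (intro entire_on_exp entire_on_diff entire_on_const)+
qed

lemma exp_sum_cone:
  fixes e1 e2 :: "'a::euclidean_space"
  assumes pb: "plane_basis e1 e2" and ib: "integral_basis \<Lambda> {e1, e2}" and v: "v \<in> \<Lambda>"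
  shows "mero_represents UNIV (exp_sum \<Lambda> {0} ((+) v ` cone2 e1 e2)) (\<lambda>\<xi>. exp (blinfun_apply \<xi> v))
    (\<lambda>\<xi>. (1 - exp (blinfun_apply \<xi> e1)) * (1 - exp (blinfun_apply \<xi> e2)))"
proof -
  note L = lattice_plane[OF pb ib]
  define g where "g = (\<lambda>(i::nat, j::nat). v + of_nat i *\<^sub>R e1 + of_nat j *\<^sub>R e2)"
  have inj: "inj g"
  proof (rule injI, clarify)
    fix i j i' j' assume "g (i, j) = g (i', j')"
    then have "of_nat i *\<^sub>R e1 + of_nat j *\<^sub>R e2 = of_nat i' *\<^sub>R e1 + of_nat j' *\<^sub>R e2" by (simp add: g_def add.assoc)
    from plane_basis_eqD[OF pb this] show "i = i' \<and> j = j'" by simp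
  qed
  have lat: "(+) v ` cone2 e1 e2 \<inter> quot_lattice \<Lambda> {0} = range g"
  proof (intro equalityI subsetI)
    fix x assume x: "x \<in> (+) v ` cone2 e1 e2 \<inter> quot_lattice \<Lambda> {0}"
    then obtain s t where st: "s \<ge> 0" "t \<ge> 0" "x = v + (s *\<^sub>R e1 + t *\<^sub>R e2)" by (auto simp: cone2_def)
    obtain a b c d :: int where ab: "x = of_int a *\<^sub>R e1 + of_int b *\<^sub>R e2" "v = of_int c *\<^sub>R e1 + of_int d *\<^sub>R e2"
      using x v L by auto
    have "s *\<^sub>R e1 + t *\<^sub>R e2 = x - v" using st by simp
    also have "\<dots> = of_int (a - c) *\<^sub>R e1 + of_int (b - d) *\<^sub>R e2" by (simp add: ab algebra_simps)
    finally have eq: "s = of_int (a - c)" "t = of_int (b - d)" using plane_basis_eqD[OF pb] by blast+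
    then have "(0::real) \<le> of_int (a - c)" "(0::real) \<le> of_int (b - d)" using st by auto
    then have nn: "a - c \<ge> 0" "b - d \<ge> 0" unfolding of_int_0_le_iff by auto
    have "x = g (nat (a - c), nat (b - d))" unfolding st(3) eq g_def using nn by simp
    then show "x \<in> range g" by blast
  next
    fix x assume "x \<in> range g"
    then obtain i j where x: "x = v + of_nat i *\<^sub>R e1 + of_nat j *\<^sub>R e2" by (auto simp: g_def)
    obtain c d :: int where "v = of_int c *\<^sub>R e1 + of_int d *\<^sub>R e2" using v L by auto
    then have "x = of_int (c + int i) *\<^sub>R e1 + of_int (d + int j) *\<^sub>R e2" by (simp add: x algebra_simps)
    then have "x \<in> \<Lambda>" using L by blast
    then show "x \<in> (+) v ` cone2 e1 e2 \<inter> quot_lattice \<Lambda> {0}" using cone2_mem[of "of_nat i" "of_nat j" v e1 e2] x by simp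
  qed
  have fg: "(\<lambda>\<gamma>. exp (blinfun_apply \<xi> \<gamma>)) \<circ> g = (\<lambda>(i, j). exp (blinfun_apply \<xi> v + of_nat i * blinfun_apply \<xi> e1 + of_nat j * blinfun_apply \<xi> e2))" for \<xi> :: "'a cdual"
  proof -
    have "blinfun_apply \<xi> (g (i, j)) = blinfun_apply \<xi> v + of_nat i * blinfun_apply \<xi> e1 + of_nat j * blinfun_apply \<xi> e2" for i j
      by (simp add: g_def blinfun.add_right blinfun.scaleR_right scaleR_conv_of_real)
    then show ?thesis by (auto simp only: o_def fun_eq_iff split: prod.split)
  qed
  have sm: "(\<lambda>\<gamma>. exp (blinfun_apply \<xi> \<gamma>)) summable_on range g \<longleftrightarrow> Re (blinfun_apply \<xi> e1) < 0 \<and> Re (blinfun_apply \<xi> e2) < 0" for \<xi> :: "'a cdual"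
    unfolding summable_on_reindex[OF inj] fg exp_geometric2(1) by simp
  obtain u :: "'a cdual" where u: "blinfun_apply u e1 = -1" "blinfun_apply u e2 = -1"
    using plane_basis_functional[OF pb] by blast
  obtain \<epsilon> where \<epsilon>: "\<epsilon> > 0" "\<And>\<xi>. dist \<xi> u < \<epsilon> \<Longrightarrow> Re (blinfun_apply \<xi> e1) < 0 \<and> Re (blinfun_apply \<xi> e2) < 0"
    using Re_negative_near[of u e1 e2] u by auto
  have "mero_represents (quot_dual {0}) (exp_sum \<Lambda> {0} ((+) v ` cone2 e1 e2)) (\<lambda>\<xi>. exp (blinfun_apply \<xi> v))
    (\<lambda>\<xi>. (1 - exp (blinfun_apply \<xi> e1)) * (1 - exp (blinfun_apply \<xi> e2)))"
    unfolding exp_sum_def if_not_P[OF cone_no_line[OF pb]] lat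
  proof (rule mero_continuation_represents[OF _ _ _ _ \<epsilon>(1), of _ _ _ u])
    show "\<exists>\<zeta>\<in>quot_dual {0}. (1 - exp (blinfun_apply \<zeta> e1)) * (1 - exp (blinfun_apply \<zeta> e2)) \<noteq> 0"
      using u exp_neq_1[of "-1"] by (intro bexI[of _ u]) auto
    show "\<xi> \<in> {\<xi> \<in> quot_dual {0}. (\<lambda>\<gamma>. exp (blinfun_apply \<xi> \<gamma>)) summable_on range g}" if "dist \<xi> u < \<epsilon>" for \<xi>
      using that sm \<epsilon>(2) by auto
    fix \<xi> assume "\<xi> \<in> {\<xi> \<in> quot_dual {0}. (\<lambda>\<gamma>. exp (blinfun_apply \<xi> \<gamma>)) summable_on range g}"
    then have re: "Re (blinfun_apply \<xi> e1) < 0" "Re (blinfun_apply \<xi> e2) < 0" using sm by auto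
    show "exp (blinfun_apply \<xi> v) = (1 - exp (blinfun_apply \<xi> e1)) * (1 - exp (blinfun_apply \<xi> e2)) * infsum (\<lambda>\<gamma>. exp (blinfun_apply \<xi> \<gamma>)) (range g)"
      unfolding infsum_reindex[OF inj] fg using exp_geometric2(2)[OF re, of "blinfun_apply \<xi> v"] by (simp only: mult.commute)
  qed (intro entire_on_exp entire_on_diff entire_on_const entire_on_mult | simp)+
  then show ?thesis by simp
qed

lemma blinfun_exp_measurable [measurable]: "(\<lambda>x. exp (blinfun_apply \<xi> x)) \<in> borel_measurable borel"
  for \<xi> :: "'a::euclidean_space cdual"
  by (intro borel_measurable_continuous_onI continuous_intros)

lemma indicator_exp_measurable:
  fixes \<xi> :: "'a::euclidean_space cdual"
  assumes "closed S"
  shows "(\<lambda>x. indicator S x *\<^sub>R exp (blinfun_apply \<xi> x)) \<in> borel_measurable borel"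
proof -
  have [measurable]: "S \<in> sets borel" using assms by simp
  show ?thesis by measurable
qed

lemma exp_integral_point:
  fixes p :: "'a::euclidean_space"
  assumes "0 \<in> quot_lattice \<Lambda> L"
  shows "mero_represents (quot_dual L) (exp_integral \<Lambda> L {p}) (\<lambda>\<xi>. exp (blinfun_apply \<xi> p)) (\<lambda>\<xi>. 1)"
proof -
  let ?m = "distr (count_space {()}) borel (\<lambda>_. p)"
  have 1: "set_integrable ?m {p} (\<lambda>x. exp (blinfun_apply \<xi> x))" for \<xi> :: "'a cdual"
    unfolding set_integrable_def
    by (subst integrable_distr_eq[OF _ indicator_exp_measurable]) (auto intro: integrable_count_space)
  have 2: "set_lebesgue_integral ?m {p} (\<lambda>x. exp (blinfun_apply \<xi> x)) = exp (blinfun_apply \<xi> p)" for \<xi> :: "'a cdual"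
    unfolding set_lebesgue_integral_def
    by (subst integral_distr[OF _ indicator_exp_measurable]) (auto simp: lebesgue_integral_count_space_finite)
  have z: "(0 :: 'a cdual) \<in> quot_dual L" by (simp add: quot_dual_def)
  show ?thesis
    unfolding exp_integral_def Let_def if_not_P[OF point_no_line] lattice_measure_point[OF assms] 2
    by (rule mero_continuation_represents[OF _ _ _ z zero_less_one]) (use z 1 in \<open>auto intro: entire_on_exp entire_on_const\<close>)
qed

lemma half_line_closed: "closed (half_line p (w::'a::euclidean_space))"
proof -
  have "half_line p w = (+) p ` (\<lambda>t. t *\<^sub>R w) ` {0..}" by (auto simp: half_line_def image_image)
  moreover have "closed ((\<lambda>t. t *\<^sub>R w) ` {0..})"
  proof (cases "w = 0")
    case True
    then have "(\<lambda>t. t *\<^sub>R w) ` {0..} = {0}" by auto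
    then show ?thesis by simp
  next
    case False
    then have "inj (\<lambda>t::real. t *\<^sub>R w)" by (auto simp: inj_def)
    then show ?thesis by (intro closed_injective_linear_image) (auto intro: linearI simp: scaleR_add_left)
  qed
  ultimately show ?thesis by (simp add: closed_translation)
qed

lemma half_line_indicator:
  assumes "w \<noteq> (0::'a::euclidean_space)"
  shows "indicator (half_line p w) (p + s *\<^sub>R w) = (indicator {0..} s :: real)"
  using assms by (auto simp: indicator_def half_line_def)

lemma integrable_cmult_iff:
  fixes c :: complex
  shows "integrable M (\<lambda>x. c * f x) \<longleftrightarrow> c = 0 \<or> integrable M f"
proof
  assume *: "integrable M (\<lambda>x. c * f x)"
  show "c = 0 \<or> integrable M f"
  proof (rule disjCI)
    assume "\<not> integrable M f"
    with integrable_mult_right[OF *, of "inverse c"] show "c = 0" by (cases "c = 0") (simp_all flip: mult.assoc)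
  qed
qed (auto intro: integrable_mult_right)

lemma exp_integral_half_line:
  fixes w :: "'a::euclidean_space"
  assumes w: "w \<noteq> 0" and lat: "span {w} \<inter> quot_lattice \<Lambda> L = int_span {w}"
    and u: "u \<in> quot_dual L" "Re (blinfun_apply u w) < 0"
  shows "mero_represents (quot_dual L) (exp_integral \<Lambda> L (half_line p w)) (\<lambda>\<xi>. exp (blinfun_apply \<xi> p)) (\<lambda>\<xi>. - 1 * blinfun_apply \<xi> w)"
proof -
  let ?m = "distr lborel borel (\<lambda>s. p + s *\<^sub>R w)"
  have lm: "lattice_measure (quot_lattice \<Lambda> L) (half_line p w) = ?m"
  proof (rule lattice_measure_line)
    show "half_line p w \<noteq> {}" using half_line_start[of p w] by blast
    show "\<exists>s. x = p + s *\<^sub>R w" if "x \<in> half_line p w" for x using that by (auto simp: half_line_def)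
    show "direction_space (half_line p w) \<inter> quot_lattice \<Lambda> L = int_span {w}"
      unfolding direction_space_half_line by (rule lat)
  qed (rule w)
  have meas: "(\<lambda>x. indicator (half_line p w) x *\<^sub>R exp (blinfun_apply \<xi> x)) \<in> borel_measurable borel" for \<xi> :: "'a cdual"
    by (rule indicator_exp_measurable[OF half_line_closed])
  have f: "indicator (half_line p w) (p + s *\<^sub>R w) *\<^sub>R exp (blinfun_apply \<xi> (p + s *\<^sub>R w))
      = exp (blinfun_apply \<xi> p) * (indicator {0..} s *\<^sub>R exp (of_real s * blinfun_apply \<xi> w))" for s and \<xi> :: "'a cdual"
    unfolding half_line_indicator[OF w] by (simp add: blinfun.add_right blinfun.scaleR_right scaleR_conv_of_real exp_add)
  have 1: "set_integrable ?m (half_line p w) (\<lambda>x. exp (blinfun_apply \<xi> x)) \<longleftrightarrow> Re (blinfun_apply \<xi> w) < 0" for \<xi> :: "'a cdual"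
    unfolding set_integrable_def by (subst integrable_distr_eq[OF _ meas]) (simp_all only: f integrable_cmult_iff exp_not_eq_zero exp_half_line_integrable, auto)
  have 2: "set_lebesgue_integral ?m (half_line p w) (\<lambda>x. exp (blinfun_apply \<xi> x)) = exp (blinfun_apply \<xi> p) *
      (\<integral>s. indicator {0..} s *\<^sub>R exp (of_real s * blinfun_apply \<xi> w) \<partial>lborel)" for \<xi> :: "'a cdual"
    unfolding set_lebesgue_integral_def by (subst integral_distr[OF _ meas]) (simp_all only: f integral_mult_right_zero, auto)
  obtain \<epsilon> where \<epsilon>: "\<epsilon> > 0" "\<And>\<xi>. dist \<xi> u < \<epsilon> \<Longrightarrow> Re (blinfun_apply \<xi> w) < 0 \<and> Re (blinfun_apply \<xi> w) < 0"
    using Re_negative_near[OF u(2) u(2)] by blast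
  show ?thesis
    unfolding exp_integral_def Let_def if_not_P[OF half_line_no_line[OF w]] lm 1 2
  proof (rule mero_continuation_represents[OF _ _ _ u(1) \<epsilon>(1)])
    show "\<exists>\<zeta>\<in>quot_dual L. - 1 * blinfun_apply \<zeta> w \<noteq> 0" using u by (intro bexI[of _ u]) auto
    fix \<xi> assume "\<xi> \<in> {\<xi> \<in> quot_dual L. Re (blinfun_apply \<xi> w) < 0}"
    then have re: "Re (blinfun_apply \<xi> w) < 0" by simp
    show "exp (blinfun_apply \<xi> p) = - 1 * blinfun_apply \<xi> w * (exp (blinfun_apply \<xi> p) *
        (\<integral>s. indicator {0..} s *\<^sub>R exp (of_real s * blinfun_apply \<xi> w) \<partial>lborel))"
    proof -
      have "- 1 * x * (y * z) = y * (z * - x)" for x y z :: complex by simp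
      then show ?thesis by (simp only: exp_half_line_integral[OF re] mult_1_right)
    qed
  qed (use \<epsilon>(2) in \<open>auto intro!: entire_on_exp entire_on_mult[OF entire_on_const entire_on_eval, of _ "-1", simplified]\<close>)
qed

text \<open>In the coordinates of the basis the integral factors into two half-line integrals; the
  two signs of -1/X and -1/Y cancel.\<close>

lemma exp_integral_cone:
  fixes e1 e2 :: "'a::euclidean_space"
  assumes pb: "plane_basis e1 e2" and ib: "integral_basis \<Lambda> {e1, e2}"
  shows "mero_represents UNIV (exp_integral \<Lambda> {0} ((+) v ` cone2 e1 e2)) (\<lambda>\<xi>. exp (blinfun_apply \<xi> v))
    (\<lambda>\<xi>. blinfun_apply \<xi> e1 * blinfun_apply \<xi> e2)"
proof -
  let ?K = "(+) v ` cone2 e1 e2"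
  let ?T = "\<lambda>(s, t). v + s *\<^sub>R e1 + t *\<^sub>R e2"
  let ?m = "distr (lborel \<Otimes>\<^sub>M lborel) borel ?T"
  define E where "E = (\<lambda>X s. indicator {0..} s *\<^sub>R exp (of_real s * X) :: complex)"
  have lm: "lattice_measure \<Lambda> ?K = ?m" by (rule lattice_measure_plane[OF pb ib direction_space_cone[OF pb]])
  obtain d1 d2 where d: "e1 \<bullet> d1 = 1" "e2 \<bullet> d1 = 0" "e1 \<bullet> d2 = 0" "e2 \<bullet> d2 = 1"
    "\<And>x. x = (x \<bullet> d1) *\<^sub>R e1 + (x \<bullet> d2) *\<^sub>R e2" using plane_basis_dual[OF pb] by blast
  have "?K = {x. d1 \<bullet> x \<ge> d1 \<bullet> v} \<inter> {x. d2 \<bullet> x \<ge> d2 \<bullet> v}" using mem_cone_dual[OF d] by blast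
  then have "closed ?K" by (simp add: closed_Int closed_halfspace_ge)
  then have meas: "(\<lambda>x. indicator ?K x *\<^sub>R exp (blinfun_apply \<xi> x)) \<in> borel_measurable borel" for \<xi> :: "'a cdual"
    by (rule indicator_exp_measurable)
  have T: "?T \<in> measurable (lborel \<Otimes>\<^sub>M lborel) borel" by measurable
  have ind: "indicator ?K (v + s *\<^sub>R e1 + t *\<^sub>R e2) = (indicator {0..} s * indicator {0..} t :: real)" for s t
    using d(1-4) by (auto simp: indicator_def mem_cone_dual[OF d] inner_simps inner_commute)
  have f: "indicator ?K (?T z) *\<^sub>R exp (blinfun_apply \<xi> (?T z))
      = exp (blinfun_apply \<xi> v) * (case z of (s, t) \<Rightarrow> E (blinfun_apply \<xi> e1) s * E (blinfun_apply \<xi> e2) t)" for z and \<xi> :: "'a cdual"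
    by (cases z) (simp add: ind E_def blinfun.add_right blinfun.scaleR_right scaleR_conv_of_real exp_add)
  have E_int: "integrable lborel (E X) \<longleftrightarrow> Re X < 0" for X unfolding E_def by (rule exp_half_line_integrable)
  have E_meas[measurable]: "E X \<in> borel_measurable borel" for X unfolding E_def by measurable
  \<comment> \<open>Integrability of the product passes to almost every section. If the second
    factor is not integrable, the first must vanish almost everywhere, but it is nonzero on
    {0..1}.\<close>
  have prod_imp: "Re Y < 0" if "integrable (lborel \<Otimes>\<^sub>M lborel) (\<lambda>(s, t). E X s * E Y t)" for X Y
  proof (rule ccontr)
    assume Y: "\<not> Re Y < 0"
    have "AE s in lborel. integrable lborel (\<lambda>t. E X s * E Y t)"
      using lborel_pair.AE_integrable_fst[OF that] by simp
    then have "AE s in lborel. s \<notin> {0::real..1}"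
    proof eventually_elim
      case (elim s)
      then have "E X s = 0" using E_int[of Y] Y by (simp add: integrable_cmult_iff)
      then show ?case by (auto simp: E_def)
    qed
    then have "emeasure lborel {0::real..1} = 0"
      by (subst (asm) AE_iff_measurable[of "{0::real..1}"]) auto
    then show False by simp
  qed
  have prod_iff: "integrable (lborel \<Otimes>\<^sub>M lborel) (\<lambda>(s, t). E X s * E Y t) \<longleftrightarrow> Re X < 0 \<and> Re Y < 0" for X Y
  proof (intro iffI conjI)
    assume *: "integrable (lborel \<Otimes>\<^sub>M lborel) (\<lambda>(s, t). E X s * E Y t)"
    show "Re Y < 0" by (rule prod_imp[OF *])
    have "integrable (lborel \<Otimes>\<^sub>M lborel) (\<lambda>(t, s). E X s * E Y t)"
      using lborel_pair.integrable_product_swap[OF *] by (simp add: split_beta)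
    then show "Re X < 0" by (intro prod_imp[of Y]) (simp add: mult.commute)
  next
    assume re: "Re X < 0 \<and> Re Y < 0"
    show "integrable (lborel \<Otimes>\<^sub>M lborel) (\<lambda>(s, t). E X s * E Y t)"
    proof (rule lborel_pair.Fubini_integrable)
      have "integrable lborel (\<lambda>s. norm (E X s) * (\<integral>t. norm (E Y t) \<partial>lborel))"
        using E_int[of X] re by (intro integrable_mult_left integrable_norm) auto
      then show "integrable lborel (\<lambda>s. \<integral>t. norm (case (s, t) of (s, t) \<Rightarrow> E X s * E Y t) \<partial>lborel)"
        by (simp add: norm_mult)
      show "AE s in lborel. integrable lborel (\<lambda>t. case (s, t) of (s, t) \<Rightarrow> E X s * E Y t)"
        using E_int[of Y] re by (intro AE_I2) auto
    qed measurable
  qed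
  have 1: "set_integrable ?m ?K (\<lambda>x. exp (blinfun_apply \<xi> x)) \<longleftrightarrow> Re (blinfun_apply \<xi> e1) < 0 \<and> Re (blinfun_apply \<xi> e2) < 0" for \<xi> :: "'a cdual"
    unfolding set_integrable_def by (subst integrable_distr_eq[OF T meas]) (simp only: f integrable_cmult_iff exp_not_eq_zero prod_iff simp_thms)
  have 2: "set_lebesgue_integral ?m ?K (\<lambda>x. exp (blinfun_apply \<xi> x)) * (blinfun_apply \<xi> e1 * blinfun_apply \<xi> e2) = exp (blinfun_apply \<xi> v)"
    if re: "Re (blinfun_apply \<xi> e1) < 0 \<and> Re (blinfun_apply \<xi> e2) < 0" for \<xi> :: "'a cdual"
  proof -
    let ?X = "blinfun_apply \<xi> e1" and ?Y = "blinfun_apply \<xi> e2"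
    have "set_lebesgue_integral ?m ?K (\<lambda>x. exp (blinfun_apply \<xi> x)) = exp (blinfun_apply \<xi> v) *
        (\<integral>z. (case z of (s, t) \<Rightarrow> E ?X s * E ?Y t) \<partial>(lborel \<Otimes>\<^sub>M lborel))"
      unfolding set_lebesgue_integral_def by (subst integral_distr[OF T meas]) (simp only: f integral_mult_right_zero)
    also have "(\<integral>z. (case z of (s, t) \<Rightarrow> E ?X s * E ?Y t) \<partial>(lborel \<Otimes>\<^sub>M lborel)) = (\<integral>s. \<integral>t. E ?X s * E ?Y t \<partial>lborel \<partial>lborel)"
      using lborel_pair.integral_fst'[of "\<lambda>(s, t). E ?X s * E ?Y t"] prod_iff re by simp
    also have "\<dots> = (\<integral>s. E ?X s \<partial>lborel) * (\<integral>t. E ?Y t \<partial>lborel)" by simp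
    finally have "set_lebesgue_integral ?m ?K (\<lambda>x. exp (blinfun_apply \<xi> x)) * (?X * ?Y)
       = exp (blinfun_apply \<xi> v) * (((\<integral>s. E ?X s \<partial>lborel) * (- ?X)) * ((\<integral>t. E ?Y t \<partial>lborel) * (- ?Y)))"
      by (simp add: algebra_simps)
    also have "\<dots> = exp (blinfun_apply \<xi> v)" unfolding E_def using re by (simp only: exp_half_line_integral mult_1_right)
    finally show ?thesis .
  qed
  obtain u :: "'a cdual" where u: "blinfun_apply u e1 = -1" "blinfun_apply u e2 = -1"
    using plane_basis_functional[OF pb] by blast
  obtain \<epsilon> where \<epsilon>: "\<epsilon> > 0" "\<And>\<xi>. dist \<xi> u < \<epsilon> \<Longrightarrow> Re (blinfun_apply \<xi> e1) < 0 \<and> Re (blinfun_apply \<xi> e2) < 0"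
    using Re_negative_near[of u e1 e2] u by auto
  have "mero_represents (quot_dual {0}) (exp_integral \<Lambda> {0} ?K) (\<lambda>\<xi>. exp (blinfun_apply \<xi> v))
    (\<lambda>\<xi>. blinfun_apply \<xi> e1 * blinfun_apply \<xi> e2)"
    unfolding exp_integral_def Let_def if_not_P[OF cone_no_line[OF pb]] quot_lattice_zero lm 1
  proof (rule mero_continuation_represents[OF _ _ _ _ \<epsilon>(1), of _ _ _ u])
    show "\<exists>\<zeta>\<in>quot_dual {0}. blinfun_apply \<zeta> e1 * blinfun_apply \<zeta> e2 \<noteq> 0" using u by (intro bexI[of _ u]) auto
    fix \<xi> assume "\<xi> \<in> {\<xi> \<in> quot_dual {0}. Re (blinfun_apply \<xi> e1) < 0 \<and> Re (blinfun_apply \<xi> e2) < 0}"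
    then show "exp (blinfun_apply \<xi> v) = blinfun_apply \<xi> e1 * blinfun_apply \<xi> e2 * set_lebesgue_integral ?m ?K (\<lambda>x. exp (blinfun_apply \<xi> x))"
      using 2 by (simp add: mult.commute)
  qed (use \<epsilon>(2) in \<open>auto intro!: entire_on_exp entire_on_mult entire_on_eval\<close>)
  then show ?thesis by simp
qed

subsection \<open>The Berline-Vergne functions of unimodular cones\<close>

definition todd :: "complex \<Rightarrow> complex" where
  "todd z = (if z = 0 then 1 else z / (exp z - 1))"

text \<open>Off the poles this is 1/(1 - e^z) + 1/z: lattice sum minus integral over the half-line
  from 0. It is the Berline-Vergne function of a half-line.\<close>

definition todd_tail :: "complex \<Rightarrow> complex" where
  "todd_tail z = (if z = 0 then - bern_coeff 1 else (1 - todd z) / z)"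

lemma bern_coeff_0: "bern_coeff 0 = 1"
  using bern_coeff_convolution[of 1] by (simp add: atMost_Suc)

lemma bern_coeff_1: "bern_coeff 1 = - 1 / 2"
proof -
  have "1 + bern_coeff 1 * 2 = 0"
    using bern_coeff_convolution[of 2] bern_coeff_0 by (simp add: atMost_Suc numeral_2_eq_2 field_simps)
  then have "bern_coeff 1 * 2 = - 1" by (simp add: add_eq_0_iff)
  then show ?thesis by (simp add: field_simps)
qed

lemma todd_expansion: "todd has_fps_expansion (fps_X / (fps_exp 1 - 1))"
proof -
  have s: "subdegree (fps_exp 1 - 1 :: complex fps) = 1"
    by (rule subdegreeI) auto
  then have nz: "(fps_exp 1 - 1 :: complex fps) \<noteq> 0" by auto
  have s': "subdegree (1 - fps_exp 1 :: complex fps) = 1"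
    by (rule subdegreeI) auto
  have "(\<lambda>z::complex. exp z - 1) has_fps_expansion fps_exp 1 - 1"
    using has_fps_expansion_exp[of "1::complex"] by (intro has_fps_expansion_diff has_fps_expansion_1) simp
  then have "(\<lambda>z::complex. if z = 0 then 1 else z / (exp z - 1)) has_fps_expansion fps_X / (fps_exp 1 - 1)"
    by (intro has_fps_expansion_divide has_fps_expansion_fps_X nz) (simp_all add: s s')
  then show ?thesis unfolding todd_def[abs_def] .
qed

text \<open>Dividing by z shifts the coefficients by one. The division is legitimate because 1 -
  z/(e^z - 1) vanishes at 0.\<close>

lemma todd_tail_expansion: "todd_tail has_fps_expansion Abs_fps (\<lambda>n. - bern_coeff (Suc n))"
proof -
  let ?F = "1 - fps_X / (fps_exp 1 - 1) :: complex fps"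
  have n0: "fps_nth ?F 0 = 0" using bern_coeff_0 by (simp add: bern_coeff_nth)
  have n1: "fps_nth ?F 1 = - bern_coeff 1" unfolding bern_coeff_nth by simp
  then have "?F \<noteq> 0" using bern_coeff_1 by (metis fps_zero_nth div_0 divide_eq_0_iff neg_equal_0_iff_equal one_neq_zero zero_neq_numeral)
  then have sd: "1 \<le> subdegree ?F" using n0 by (intro subdegree_geI) auto
  have "(\<lambda>z. 1 - todd z) has_fps_expansion ?F"
    by (intro has_fps_expansion_diff has_fps_expansion_1 todd_expansion)
  then have "(\<lambda>z. if z = 0 then - bern_coeff 1 else (1 - todd z) / z ^ 1) has_fps_expansion fps_shift 1 ?F"
    by (rule has_fps_expansion_shift[OF _ sd]) (simp only: n1)
  moreover have "fps_shift 1 ?F = Abs_fps (\<lambda>n. - bern_coeff (Suc n))"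
    by (rule fps_ext) (simp add: bern_coeff_nth)
  ultimately show ?thesis by (simp only: todd_tail_def[abs_def] power_one_right)
qed

lemma has_fps_expansion_scale:
  fixes f :: "complex \<Rightarrow> complex"
  assumes "f has_fps_expansion F"
  shows "(\<lambda>z. f (z * c)) has_fps_expansion Abs_fps (\<lambda>n. c ^ n * fps_nth F n)"
proof -
  have "(\<lambda>z::complex. c * z) has_fps_expansion fps_const c * fps_X"
    by (intro has_fps_expansion_mult has_fps_expansion_const has_fps_expansion_fps_X)
  from has_fps_expansion_compose[OF assms this] show ?thesis
    unfolding mult.commute[of _ c] by (simp add: o_def fps_compose_linear)
qed

lemma fps_expansion_continuous:
  fixes f :: "complex \<Rightarrow> complex"
  assumes "f has_fps_expansion F"
  shows "\<forall>\<^sub>F z in nhds 0. isCont f z"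
proof -
  obtain S where S: "open S" "0 \<in> S" "f holomorphic_on S"
    using has_fps_expansion_imp_holomorphic[OF assms] by metis
  have "isCont f z" if "z \<in> S" for z
    using holomorphic_on_imp_continuous_on[OF S(3)] S(1) that continuous_on_eq_continuous_at by blast
  then show ?thesis using S by (auto simp: eventually_nhds)
qed

section \<open>Germs at zero and identities off a zero set\<close>

lemma eventually_eval:
  assumes "\<forall>\<^sub>F z in nhds 0. P z"
  shows "\<forall>\<^sub>F \<xi> in nhds (0 :: 'a::real_normed_vector cdual). P (blinfun_apply \<xi> x)"
proof -
  have "isCont (\<lambda>\<xi> :: 'a cdual. blinfun_apply \<xi> x) 0" by (intro continuous_intros)
  then have "filterlim (\<lambda>\<xi> :: 'a cdual. blinfun_apply \<xi> x) (nhds 0) (nhds 0)"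
    using tendsto_at_iff_tendsto_nhds[of "\<lambda>\<xi> :: 'a cdual. blinfun_apply \<xi> x" 0]
    by (simp add: continuous_at blinfun.zero_left)
  then show ?thesis using assms by (simp add: filterlim_iff)
qed

text \<open>Relative to the subspace V and near 0 only, because the functions \<mu> are controlled
  only as germs on the dual of the quotient.\<close>

definition continuous_near_zero :: "'a::real_normed_vector cdual set \<Rightarrow> ('a cdual \<Rightarrow> complex) \<Rightarrow> bool" where
  "continuous_near_zero V F \<longleftrightarrow> (\<forall>\<^sub>F \<xi> in nhds 0. \<xi> \<in> V \<longrightarrow> continuous (at \<xi> within V) F)"

lemma continuous_near_zero_eval: "continuous_near_zero V (\<lambda>\<xi>. blinfun_apply \<xi> x)"
  unfolding continuous_near_zero_def by (intro always_eventually allI impI continuous_intros)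

lemma continuous_near_zero_const: "continuous_near_zero V (\<lambda>\<xi>. c)"
  unfolding continuous_near_zero_def by simp

lemma continuous_near_zero_compose:
  assumes "\<forall>\<^sub>F z in nhds 0. isCont f z"
  shows "continuous_near_zero V (\<lambda>\<xi>. f (blinfun_apply \<xi> x))"
  unfolding continuous_near_zero_def
  using eventually_eval[OF assms, of x]
proof eventually_elim
  case (elim \<xi>)
  have "continuous (at \<xi> within V) (\<lambda>\<xi>. blinfun_apply \<xi> x)" by (intro continuous_intros)
  from continuous_within_compose3[where g=f and f="\<lambda>\<xi>. blinfun_apply \<xi> x", OF elim this] show ?case ..
qed

lemma continuous_near_zero_mult:
  "continuous_near_zero V F \<Longrightarrow> continuous_near_zero V G \<Longrightarrow> continuous_near_zero V (\<lambda>\<xi>. F \<xi> * G \<xi>)"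
  unfolding continuous_near_zero_def by (erule (1) eventually_elim2) (auto intro: continuous_mult)

lemma continuous_near_zero_add:
  "continuous_near_zero V F \<Longrightarrow> continuous_near_zero V G \<Longrightarrow> continuous_near_zero V (\<lambda>\<xi>. F \<xi> + G \<xi>)"
  unfolding continuous_near_zero_def by (erule (1) eventually_elim2) (auto intro: continuous_add)

lemma continuous_near_zero_diff:
  "continuous_near_zero V F \<Longrightarrow> continuous_near_zero V G \<Longrightarrow> continuous_near_zero V (\<lambda>\<xi>. F \<xi> - G \<xi>)"
  unfolding continuous_near_zero_def by (erule (1) eventually_elim2) (auto intro: continuous_diff)

lemma continuous_near_zero_holomorphic:
  "\<forall>\<^sub>F \<xi> in nhds 0. \<xi> \<in> V \<longrightarrow> holomorphic_at V F \<xi> \<Longrightarrow> continuous_near_zero V F"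
  unfolding continuous_near_zero_def holomorphic_at_def
  by (erule eventually_mono) (auto intro: has_derivative_continuous)

lemma entire_on_continuous: "entire_on V f \<Longrightarrow> \<xi> \<in> V \<Longrightarrow> continuous (at \<xi> within V) f"
  unfolding entire_on_def holomorphic_at_def using has_derivative_continuous by blast

text \<open>Entire functions form an integral domain: near a point where f is nonzero, g would have
  to vanish, hence everywhere.\<close>

lemma entire_on_mult_nonzero:
  assumes f: "entire_on (quot_dual L) f" "\<exists>\<zeta>\<in>quot_dual L. f \<zeta> \<noteq> 0"
    and g: "entire_on (quot_dual L) g" "\<exists>\<zeta>\<in>quot_dual L. g \<zeta> \<noteq> 0"
  shows "\<exists>\<zeta>\<in>quot_dual L. f \<zeta> * g \<zeta> \<noteq> 0"
proof (rule ccontr)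
  assume *: "\<not> ?thesis"
  obtain u where u: "u \<in> quot_dual L" "f u \<noteq> 0" using f by blast
  obtain \<epsilon> where e: "\<epsilon> > 0" "\<forall>y\<in>quot_dual L. dist u y < \<epsilon> \<longrightarrow> f y \<noteq> 0"
    using continuous_within_avoid[OF entire_on_continuous[OF f(1) u(1)] u(2)] by blast
  have "g \<xi> = 0" if "\<xi> \<in> quot_dual L" for \<xi>
    by (rule entire_on_zero[OF g(1) u(1) e(1) _ that]) (use e(2) * in \<open>auto simp: dist_commute\<close>)
  then show False using g(2) by blast
qed

text \<open>The complement of the zero set of H is dense. A point where F and G differ has by
  continuity a neighbourhood where they differ; H would vanish on it, hence identically.\<close>

lemma eventually_eq_of_dense:
  assumes H: "entire_on (quot_dual L) H" "\<exists>\<zeta>\<in>quot_dual L. H \<zeta> \<noteq> 0"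
    and F: "continuous_near_zero (quot_dual L) F" and G: "continuous_near_zero (quot_dual L) G"
    and eq: "\<forall>\<^sub>F \<xi> in nhds 0. \<xi> \<in> quot_dual L \<longrightarrow> H \<xi> \<noteq> 0 \<longrightarrow> F \<xi> = G \<xi>"
  shows "\<forall>\<^sub>F \<xi> in nhds 0. \<xi> \<in> quot_dual L \<longrightarrow> F \<xi> = G \<xi>"
proof -
  have "\<forall>\<^sub>F \<xi> in nhds 0. (\<xi> \<in> quot_dual L \<longrightarrow> continuous (at \<xi> within quot_dual L) (\<lambda>\<xi>. F \<xi> - G \<xi>)) \<and>
      (\<xi> \<in> quot_dual L \<longrightarrow> H \<xi> \<noteq> 0 \<longrightarrow> F \<xi> = G \<xi>)"
    using continuous_near_zero_diff[OF F G] eq unfolding continuous_near_zero_def by (rule eventually_conj)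
  then obtain \<epsilon> where e: "\<epsilon> > 0" and c: "\<And>\<xi>. dist \<xi> 0 < \<epsilon> \<Longrightarrow> \<xi> \<in> quot_dual L \<Longrightarrow> continuous (at \<xi> within quot_dual L) (\<lambda>\<xi>. F \<xi> - G \<xi>)"
    and h: "\<And>\<xi>. dist \<xi> 0 < \<epsilon> \<Longrightarrow> \<xi> \<in> quot_dual L \<Longrightarrow> H \<xi> \<noteq> 0 \<Longrightarrow> F \<xi> = G \<xi>"
    unfolding eventually_nhds_metric by blast
  have "F \<xi> = G \<xi>" if x: "dist \<xi> 0 < \<epsilon>" "\<xi> \<in> quot_dual L" for \<xi>
  proof (rule ccontr)
    assume "F \<xi> \<noteq> G \<xi>"
    then obtain d where d: "d > 0" "\<forall>y\<in>quot_dual L. dist \<xi> y < d \<longrightarrow> F y - G y \<noteq> 0"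
      using continuous_within_avoid[OF c[OF x], of 0] by auto
    \<comment> \<open>Keeps the ball around \<xi> inside the region where the assumed identity is
      available.\<close>
    define r where "r = min d (\<epsilon> - dist \<xi> 0)"
    have r: "r > 0" using d x by (simp add: r_def)
    have "H \<zeta> = 0" if z: "\<zeta> \<in> quot_dual L" for \<zeta>
    proof (rule entire_on_zero[OF H(1) x(2) r _ z])
      fix y assume y: "y \<in> quot_dual L" "dist y \<xi> < r"
      have "dist y 0 < \<epsilon>" using dist_triangle[of y 0 \<xi>] y(2) by (simp add: r_def)
      moreover have "F y \<noteq> G y" using d(2) y by (auto simp: r_def dist_commute)
      ultimately show "H y = 0" using h y(1) by blast
    qed
    then show False using H(2) by blast
  qed
  then show ?thesis unfolding eventually_nhds_metric using e by blast
qed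

lemma bounded_linear_line_proj: "bounded_linear (line_proj e)"
  using linear_line_proj linear_conv_bounded_linear by blast

lemma dual_proj_zero [simp]: "dual_proj {0} \<xi> = \<xi>"
proof (rule blinfun_eqI)
  fix x
  have "quot_proj {0} = (\<lambda>x::'a. x)" by (rule ext) simp
  then show "blinfun_apply (dual_proj {0} \<xi>) x = blinfun_apply \<xi> x"
    by (simp add: dual_proj_def bounded_linear_Blinfun_apply bounded_linear_ident)
qed

lemma dual_proj_line: "e \<noteq> 0 \<Longrightarrow> blinfun_apply (dual_proj (span {e}) \<xi>) x = blinfun_apply \<xi> (line_proj e x)"
proof -
  assume e: "e \<noteq> 0"
  have "quot_proj (span {e}) = line_proj e" using quot_proj_line[OF e] by (rule ext)
  then show ?thesis by (simp add: dual_proj_def bounded_linear_Blinfun_apply bounded_linear_line_proj)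
qed

lemma dual_proj_UNIV: "dual_proj UNIV \<xi> = 0"
proof (rule blinfun_eqI)
  fix x
  have "quot_proj UNIV = (\<lambda>x::'a. 0)" by (rule ext) simp
  then show "blinfun_apply (dual_proj UNIV \<xi>) x = blinfun_apply 0 x"
    by (simp add: dual_proj_def bounded_linear_Blinfun_apply bounded_linear_zero blinfun.zero_right)
qed

lemma dual_proj_line_mem: "e \<noteq> 0 \<Longrightarrow> dual_proj (span {e}) \<xi> \<in> quot_dual (span {e})"
proof -
  assume e: "e \<noteq> 0"
  have "line_proj e x = 0" if "x \<in> span {e}" for x
    using that line_proj_self[OF e] by (auto simp: span_singleton)
  then show ?thesis unfolding quot_dual_def dual_proj_line[OF e] mem_Collect_eq by (simp add: blinfun.zero_right)
qed

lemma eventually_dual_proj: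
  assumes "\<forall>\<^sub>F \<xi> in nhds 0. P \<xi>"
  shows "\<forall>\<^sub>F \<xi> in nhds 0. P (dual_proj L \<xi>)"
proof -
  have "bounded_linear (\<lambda>\<xi>. dual_proj L \<xi>)"
    unfolding dual_proj_def by (rule bounded_bilinear.bounded_linear_left[OF bounded_bilinear_blinfun_compose])
  then have "isCont (\<lambda>\<xi>. dual_proj L \<xi>) 0" by (rule linear_continuous_at)
  moreover have "dual_proj L 0 = 0" by (rule blinfun_eqI) (simp add: dual_proj_def blinfun.zero_left)
  ultimately have "filterlim (\<lambda>\<xi>. dual_proj L \<xi>) (nhds 0) (nhds 0)"
    unfolding continuous_at tendsto_at_iff_tendsto_nhds by simp
  then show ?thesis using assms by (simp add: filterlim_iff)
qed

lemma inverse_todd: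
  assumes "z \<noteq> 0" "exp z \<noteq> 1"
  shows "1 / (1 - exp z) = - todd z / z" "1 / (1 - exp z) = todd_tail z - 1 / z"
  using assms by (simp_all add: todd_def todd_tail_def field_simps)

lemma rational_point_lattice: "x \<in> \<Gamma> \<Longrightarrow> rational_point \<Gamma> x"
  unfolding rational_point_def by (rule exI[of _ 1]) simp

lemma convex_cone_hull_single: "convex_cone hull {w} = {t *\<^sub>R w |t. t \<ge> 0}"
proof (rule hull_unique)
  have "w = 1 *\<^sub>R w" by simp
  then show "{w} \<subseteq> {t *\<^sub>R w |t. t \<ge> 0}" using zero_le_one by blast
  show "{t *\<^sub>R w |t. t \<ge> 0} \<subseteq> t'" if "{w} \<subseteq> t'" "convex_cone t'" for t'
    using that unfolding convex_cone_iff by auto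
qed (rule convex_cone_ray)

lemma BV_family_instance:
  assumes "Berline_Vergne_family \<Lambda> \<mu>" "rational_subspace \<Lambda> L" "rational_affine_cone (quot_lattice \<Lambda> L) \<aa>"
  shows "\<forall>\<^sub>F \<xi> in nhds 0. \<xi> \<in> quot_dual L \<longrightarrow> holomorphic_at (quot_dual L) (\<mu> L \<aa>) \<xi>"
    and "\<forall>\<^sub>F \<xi> in nhds 0. \<xi> \<in> quot_dual L \<longrightarrow>
           mero_regular (exp_sum \<Lambda> L \<aa>) \<xi> \<longrightarrow>
           (\<forall>F. F face_of \<aa> \<and> F \<noteq> {} \<longrightarrow> mero_regular (exp_integral \<Lambda> L F) \<xi>) \<longrightarrow>
           mero_value (exp_sum \<Lambda> L \<aa>) \<xi> =
             (\<Sum>F | F face_of \<aa> \<and> F \<noteq> {}.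
                \<mu> (span (L \<union> direction_space F)) (transverse_cone \<aa> F)
                  (dual_proj (direction_space F) \<xi>)
                * mero_value (exp_integral \<Lambda> L F) \<xi>)"
  using assms unfolding Berline_Vergne_family_def by blast+

text \<open>X / L(f) is one-dimensional, so the transverse cone is a half-line with two faces. The
  identity reads 1/(1 - e^X) = \<mu> - 1/X after cancelling the exponential of the apex, and it can
  be solved for \<mu>.\<close>

lemma BV_edge:
  fixes e1 e2 :: "'a::euclidean_space"
  assumes pb: "plane_basis e1 e2" and ib: "integral_basis \<Lambda> {e1, e2}" and BV: "Berline_Vergne_family \<Lambda> \<mu>" and v: "v \<in> \<Lambda>"
  shows "\<forall>\<^sub>F \<xi> in nhds 0. \<xi> \<in> quot_dual (span {e1}) \<longrightarrow>
    \<mu> (span {e1}) (half_line (line_proj e1 v) (line_proj e1 e2)) \<xi> = todd_tail (blinfun_apply \<xi> e2)"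
proof -
  note LL = lattice_plane[OF pb ib]
  have nz: "e1 \<noteq> 0" using plane_basis_nonzero[OF pb] by blast
  define L where "L = span {e1}"
  define w where "w = line_proj e1 e2"
  define p where "p = line_proj e1 v"
  define c where "c = (e2 \<bullet> e1) / (e1 \<bullet> e1)"
  define \<Gamma> where "\<Gamma> = quot_lattice \<Lambda> L"
  have w_eq: "w = e2 - c *\<^sub>R e1" by (simp add: w_def line_proj_def c_def)
  have w0: "w \<noteq> 0"
    using plane_basis_eqD[OF pb, of 0 1 c 0] by (auto simp: w_eq)
  have proj: "line_proj e1 (of_int i *\<^sub>R e1 + of_int j *\<^sub>R e2) = of_int j *\<^sub>R w" for i j :: int
    by (simp add: line_proj_add line_proj_scale line_proj_self'[OF nz] w_def)
  have \<Gamma>: "\<Gamma> = {of_int j *\<^sub>R w |j. True}"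
  proof -
    have "\<Gamma> = line_proj e1 ` \<Lambda>" unfolding \<Gamma>_def quot_lattice_def L_def using quot_proj_line[OF nz] by auto
    also have "\<dots> = {of_int j *\<^sub>R w |j. True}" unfolding LL by (force simp: proj)
    finally show ?thesis .
  qed
  obtain i k :: int where "v = of_int i *\<^sub>R e1 + of_int k *\<^sub>R e2" using v unfolding LL by blast
  then have pk: "p = of_int k *\<^sub>R w" unfolding p_def by (simp only: proj)
  have p\<Gamma>: "p \<in> \<Gamma>" unfolding \<Gamma> pk by blast
  have w\<Gamma>: "w \<in> \<Gamma>" unfolding \<Gamma> by (rule CollectI, rule exI[of _ 1]) simp
  have z\<Gamma>: "0 \<in> \<Gamma>" unfolding \<Gamma> by (rule CollectI, rule exI[of _ 0]) simp
  have rsub: "rational_subspace \<Lambda> L"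
  proof -
    have "int_span {e1} = L \<inter> \<Lambda>"
    proof (intro equalityI subsetI)
      fix x assume "x \<in> int_span {e1}"
      then obtain i :: int where x: "x = of_int i *\<^sub>R e1" by (auto simp: int_span_singleton)
      then have "x = of_int i *\<^sub>R e1 + of_int 0 *\<^sub>R e2" by simp
      then show "x \<in> L \<inter> \<Lambda>" unfolding LL L_def span_singleton using x by blast
    next
      fix x assume "x \<in> L \<inter> \<Lambda>"
      then obtain i j :: int and a where x: "x = of_int i *\<^sub>R e1 + of_int j *\<^sub>R e2" "x = a *\<^sub>R e1"
        unfolding LL L_def span_singleton by blast
      then have "of_int i *\<^sub>R e1 + of_int j *\<^sub>R e2 = a *\<^sub>R e1 + 0 *\<^sub>R e2" by simp
      then have "real_of_int j = 0" by (rule plane_basis_eqD(2)[OF pb])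
      then show "x \<in> int_span {e1}" using x(1) by (auto simp: int_span_singleton)
    qed
    then have "integral_basis (L \<inter> \<Lambda>) {e1}" using nz by (simp add: integral_basis_def)
    then show ?thesis unfolding rational_subspace_def lattice_in_def L_def by (auto intro!: exI[of _ "{e1}"])
  qed
  define \<aa> where "\<aa> = half_line p w"
  have rcone: "rational_affine_cone \<Gamma> \<aa>"
    unfolding rational_affine_cone_def
    by (intro exI[of _ p] exI[of _ "{w}"] conjI rational_point_lattice p\<Gamma>)
       (use w\<Gamma> in \<open>auto simp: convex_cone_hull_single \<aa>_def half_line_def\<close>)
  \<comment> \<open>On the annihilator of the edge direction, e2 and its projection w take the same
    value.\<close>
  have kill: "blinfun_apply \<xi> (line_proj e1 x) = blinfun_apply \<xi> x" if "\<xi> \<in> quot_dual L" for \<xi> :: "'a cdual" and x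
  proof -
    have "blinfun_apply \<xi> e1 = 0" using that by (auto simp: quot_dual_def L_def span_base)
    then show ?thesis by (simp add: line_proj_def blinfun.diff_right blinfun.scaleR_right)
  qed
  obtain u0 :: "'a cdual" where u0: "blinfun_apply u0 e1 = 0" "blinfun_apply u0 e2 = - 1"
    using plane_basis_functional[OF pb] by blast
  then have u: "u0 \<in> quot_dual L" by (auto simp: quot_dual_def L_def span_singleton blinfun.scaleR_right)
  have u2: "blinfun_apply u0 w = - 1" using kill[OF u, of e2] u0 by (simp add: w_def)
  have lat: "half_line p w \<inter> \<Gamma> = range (\<lambda>i::nat. p + of_nat i *\<^sub>R w)"
  proof (intro equalityI subsetI)
    fix x assume "x \<in> half_line p w \<inter> \<Gamma>"
    then obtain s and j :: int where s: "s \<ge> 0" "x = p + s *\<^sub>R w" "x = of_int j *\<^sub>R w" unfolding \<Gamma> half_line_def by auto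
    then have "s *\<^sub>R w = of_int (j - k) *\<^sub>R w" by (simp add: pk algebra_simps)
    then have sj: "s = of_int (j - k)" using w0 by simp
    then have "j - k \<ge> 0" using s(1) by simp
    then have "x = p + of_nat (nat (j - k)) *\<^sub>R w" using s(2) sj by simp
    then show "x \<in> range (\<lambda>i::nat. p + of_nat i *\<^sub>R w)" by blast
  next
    fix x assume "x \<in> range (\<lambda>i::nat. p + of_nat i *\<^sub>R w)"
    then obtain i :: nat where x: "x = p + of_nat i *\<^sub>R w" by blast
    then have "x = of_int (k + int i) *\<^sub>R w" by (simp add: pk algebra_simps)
    then have "x \<in> \<Gamma>" unfolding \<Gamma> by blast
    then show "x \<in> half_line p w \<inter> \<Gamma>" using x half_line_mem[of "of_nat i" p w] by simp
  qed
  have lat2: "span {w} \<inter> \<Gamma> = int_span {w}"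
    unfolding int_span_singleton \<Gamma> span_singleton by blast
  have S: "mero_represents (quot_dual L) (exp_sum \<Lambda> L \<aa>) (\<lambda>\<xi>. exp (blinfun_apply \<xi> p)) (\<lambda>\<xi>. 1 - exp (blinfun_apply \<xi> w))"
    unfolding \<aa>_def by (rule exp_sum_half_line[OF w0 lat[unfolded \<Gamma>_def] u]) (simp add: u2)
  have I1: "mero_represents (quot_dual L) (exp_integral \<Lambda> L \<aa>) (\<lambda>\<xi>. exp (blinfun_apply \<xi> p)) (\<lambda>\<xi>. - 1 * blinfun_apply \<xi> w)"
    unfolding \<aa>_def by (rule exp_integral_half_line[OF w0 lat2[unfolded \<Gamma>_def] u]) (simp add: u2)
  have I0: "mero_represents (quot_dual L) (exp_integral \<Lambda> L {p}) (\<lambda>\<xi>. exp (blinfun_apply \<xi> p)) (\<lambda>\<xi>. 1)"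
    by (rule exp_integral_point[OF z\<Gamma>[unfolded \<Gamma>_def]])
  \<comment> \<open>Product of all chosen denominators and of the explicit ones. Where it is nonzero
    every term of the identity is regular and has its explicit value.\<close>
  define H where "H = (\<lambda>\<xi>. (snd (exp_sum \<Lambda> L \<aa>) \<xi> * snd (exp_integral \<Lambda> L \<aa>) \<xi>) * snd (exp_integral \<Lambda> L {p}) \<xi>
     * ((1 - exp (blinfun_apply \<xi> w)) * blinfun_apply \<xi> w))"
  have Hent: "entire_on (quot_dual L) H"
    unfolding H_def using S I1 I0
    by (intro entire_on_mult entire_on_diff entire_on_const entire_on_exp entire_on_eval) (simp_all add: mero_represents_def)
  have Hnz: "\<exists>\<zeta>\<in>quot_dual L. H \<zeta> \<noteq> 0"
    unfolding H_def
  proof (intro entire_on_mult_nonzero entire_on_mult entire_on_diff entire_on_const entire_on_exp entire_on_eval)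
    show "\<exists>\<zeta>\<in>quot_dual L. 1 - exp (blinfun_apply \<zeta> w) \<noteq> 0" "\<exists>\<zeta>\<in>quot_dual L. blinfun_apply \<zeta> w \<noteq> 0"
      using u u2 exp_neq_1[of "- 1"] by (auto intro!: bexI[of _ u0])
  qed (use S I1 I0 in \<open>simp_all add: mero_represents_def\<close>)
  have faces: "{F. F face_of \<aa> \<and> F \<noteq> {}} = {{p}, \<aa>}"
    unfolding \<aa>_def by (rule faces_half_line[OF w0])
  have ne: "{p} \<noteq> \<aa>"
  proof -
    have "p + 1 *\<^sub>R w \<in> \<aa>" unfolding \<aa>_def by (rule half_line_mem) simp
    then show ?thesis using w0 by auto
  qed
  have sL: "span (L \<union> {0}) = L" unfolding L_def by (simp add: span_Un)
  \<comment> \<open>The quotient by the direction of the whole half-line is the zero space, where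
    \<mu> is normalised to 1; \<open>dw\<close> shows that it is evaluated at 0 there.\<close>
  have sU: "span (L \<union> span {w}) = UNIV"
  proof -
    have m: "e1 \<in> span (L \<union> span {w})" "w \<in> span (L \<union> span {w})" by (auto intro!: span_base simp: L_def)
    have "x \<in> span (L \<union> span {w})" for x
    proof -
      obtain a b where "x = a *\<^sub>R e1 + b *\<^sub>R e2" using pb unfolding plane_basis_def by blast
      then have "x = (a + b * c) *\<^sub>R e1 + b *\<^sub>R w" by (simp add: w_eq algebra_simps)
      then show ?thesis using m by (simp add: span_add span_scale)
    qed
    then show ?thesis by blast
  qed
  have dw: "dual_proj (span {w}) \<xi> = 0" if x: "\<xi> \<in> quot_dual L" for \<xi> :: "'a cdual"
  proof (rule blinfun_eqI)
    fix x
    obtain a b where "x = a *\<^sub>R e1 + b *\<^sub>R e2" using pb unfolding plane_basis_def by blast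
    then have xw: "x = (a + b * c) *\<^sub>R e1 + b *\<^sub>R w" by (simp add: w_eq algebra_simps)
    have "e1 \<bullet> w = 0" using line_proj_orthogonal[OF nz, of e2] by (simp add: w_def inner_commute)
    then have "line_proj w e1 = e1" by (simp add: line_proj_def)
    then have "line_proj w x = (a + b * c) *\<^sub>R e1"
      unfolding xw by (simp add: line_proj_add line_proj_scale line_proj_self'[OF w0])
    moreover have "blinfun_apply \<xi> e1 = 0" using x by (auto simp: quot_dual_def L_def span_base)
    ultimately show "blinfun_apply (dual_proj (span {w}) \<xi>) x = blinfun_apply 0 x"
      by (simp add: dual_proj_line[OF w0] blinfun.scaleR_right)
  qed
  have pw: "p \<in> span {w}" unfolding pk by (simp add: span_scale span_base)
  have mu0: "\<mu> UNIV {0} 0 = 1" using BV by (simp add: Berline_Vergne_family_def)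
  note inst = BV_family_instance[OF BV rsub rcone[unfolded \<Gamma>_def]]
  have "\<forall>\<^sub>F \<xi> in nhds 0. \<xi> \<in> quot_dual L \<longrightarrow> H \<xi> \<noteq> 0 \<longrightarrow> \<mu> L \<aa> \<xi> = todd_tail (blinfun_apply \<xi> e2)"
    using inst(2)
  proof eventually_elim
    case (elim \<xi>)
    show ?case
    proof (intro impI)
      assume x: "\<xi> \<in> quot_dual L" and h: "H \<xi> \<noteq> 0"
      let ?P = "exp (blinfun_apply \<xi> p)" and ?X = "blinfun_apply \<xi> w"
      have reg: "mero_regular (exp_sum \<Lambda> L \<aa>) \<xi>" "mero_regular (exp_integral \<Lambda> L \<aa>) \<xi>" "mero_regular (exp_integral \<Lambda> L {p}) \<xi>"
        and X: "?X \<noteq> 0" "exp ?X \<noteq> 1" using h unfolding H_def mero_regular_def mult_eq_0_iff by auto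
      have regF: "\<forall>F. F face_of \<aa> \<and> F \<noteq> {} \<longrightarrow> mero_regular (exp_integral \<Lambda> L F) \<xi>"
      proof (intro allI impI)
        fix F assume "F face_of \<aa> \<and> F \<noteq> {}"
        then have "F \<in> {F. F face_of \<aa> \<and> F \<noteq> {}}" by (rule CollectI)
        then have "F = {p} \<or> F = \<aa>" unfolding faces by simp
        then show "mero_regular (exp_integral \<Lambda> L F) \<xi>" using reg by (elim disjE) simp_all
      qed
      have vS: "mero_value (exp_sum \<Lambda> L \<aa>) \<xi> = ?P / (1 - exp ?X)"
        using mero_represents_value[OF S x _ reg(1)] X by simp
      have v1: "mero_value (exp_integral \<Lambda> L \<aa>) \<xi> = ?P / (- 1 * ?X)"
        using mero_represents_value[OF I1 x _ reg(2)] X by simp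
      have v0: "mero_value (exp_integral \<Lambda> L {p}) \<xi> = ?P"
        using mero_represents_value[OF I0 x _ reg(3)] by simp
      let ?T = "\<lambda>F. \<mu> (span (L \<union> direction_space F)) (transverse_cone \<aa> F) (dual_proj (direction_space F) \<xi>) * mero_value (exp_integral \<Lambda> L F) \<xi>"
      have "?P / (1 - exp ?X) = sum ?T {{p}, \<aa>}"
        using mp[OF mp[OF mp[OF elim x] reg(1)] regF] unfolding faces vS .
      also have "\<dots> = ?T {p} + ?T \<aa>" using ne by simp
      also have "?T {p} = \<mu> L \<aa> \<xi> * ?P"
        unfolding direction_space_point sL dual_proj_zero v0 transverse_cone_half_line_start[of p w, folded \<aa>_def] ..
      also have "?T \<aa> = \<mu> UNIV {0} 0 * (?P / (- 1 * ?X))"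
        unfolding direction_space_half_line[of p w, folded \<aa>_def] sU dw[OF x] v1
          transverse_cone_half_line_full[OF w0 pw, folded \<aa>_def] ..
      finally have "?P / (1 - exp ?X) = \<mu> L \<aa> \<xi> * ?P + \<mu> UNIV {0} 0 * (?P / (- 1 * ?X))" .
      then have "?P * (1 / (1 - exp ?X)) = ?P * (\<mu> L \<aa> \<xi> - 1 / ?X)"
        by (simp add: mu0 algebra_simps)
      then have "1 / (1 - exp ?X) = \<mu> L \<aa> \<xi> - 1 / ?X"
        by (rule mult_left_cancel[OF exp_not_eq_zero, THEN iffD1])
      then have "\<mu> L \<aa> \<xi> = todd_tail ?X" using inverse_todd(2)[OF X] by simp
      then show "\<mu> L \<aa> \<xi> = todd_tail (blinfun_apply \<xi> e2)" using kill[OF x, of e2] by (simp add: w_def)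
    qed
  qed
  from eventually_eq_of_dense[OF Hent Hnz continuous_near_zero_holomorphic[OF inst(1)]
      continuous_near_zero_compose[OF fps_expansion_continuous[OF todd_tail_expansion]] this]
  show ?thesis unfolding \<aa>_def p_def w_def L_def .
qed

lemma cone2_subset_swap: "cone2 e1 e2 \<subseteq> cone2 e2 e1"
proof
  fix z assume "z \<in> cone2 e1 e2"
  then obtain s t where st: "s \<ge> 0" "t \<ge> 0" "z = s *\<^sub>R e1 + t *\<^sub>R e2" unfolding cone2_def by blast
  then have "z = t *\<^sub>R e2 + s *\<^sub>R e1" by (simp add: add.commute)
  then show "z \<in> cone2 e2 e1" unfolding cone2_def using st by blast
qed

text \<open>The identity for the quadrant is stated after multiplication by \<xi>(e1) \<xi>(e2). In
  this form all terms are continuous near 0, so it extends across the zeros of the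
  denominators.\<close>

lemma BV_vertex:
  fixes e1 e2 :: "'a::euclidean_space"
  assumes pb: "plane_basis e1 e2" and ib: "integral_basis \<Lambda> {e1, e2}" and BV: "Berline_Vergne_family \<Lambda> \<mu>" and v: "v \<in> \<Lambda>"
  defines "K \<equiv> (+) v ` cone2 e1 e2"
  shows "\<forall>\<^sub>F \<xi> in nhds 0. holomorphic_at UNIV (\<mu> {0} K) \<xi>"
    and "\<forall>\<^sub>F \<xi> in nhds 0. blinfun_apply \<xi> e1 * blinfun_apply \<xi> e2 * \<mu> {0} K \<xi> =
      todd (blinfun_apply \<xi> e1) * todd (blinfun_apply \<xi> e2) - 1
      + blinfun_apply \<xi> e2 * todd_tail (blinfun_apply \<xi> (line_proj e1 e2))
      + blinfun_apply \<xi> e1 * todd_tail (blinfun_apply \<xi> (line_proj e2 e1))"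
proof -
  have pb': "plane_basis e2 e1" by (rule plane_basis_swap[OF pb])
  have ib': "integral_basis \<Lambda> {e2, e1}" using ib by (simp add: insert_commute)
  have nz: "e1 \<noteq> 0" "e2 \<noteq> 0" using plane_basis_nonzero[OF pb] by auto
  note LL = lattice_plane[OF pb ib]
  have z\<Lambda>: "0 \<in> quot_lattice \<Lambda> {0}"
  proof -
    have "0 = of_int 0 *\<^sub>R e1 + of_int 0 *\<^sub>R e2" by simp
    then show ?thesis unfolding quot_lattice_zero LL by blast
  qed
  obtain u :: "'a cdual" where u: "blinfun_apply u e1 = -1" "blinfun_apply u e2 = -1"
    using plane_basis_functional[OF pb] by blast
  have mem0: "u \<in> quot_dual {0}" by simp
  have primitive: "span {x} \<inter> quot_lattice \<Lambda> {0} = int_span {x}" if pb: "plane_basis x y" and ib: "integral_basis \<Lambda> {x, y}" for x y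
  proof (intro equalityI subsetI)
    fix z assume "z \<in> span {x} \<inter> quot_lattice \<Lambda> {0}"
    then obtain a and i j :: int where z: "z = a *\<^sub>R x" "z = of_int i *\<^sub>R x + of_int j *\<^sub>R y"
      unfolding quot_lattice_zero lattice_plane[OF pb ib] span_singleton by blast
    then have "of_int i *\<^sub>R x + of_int j *\<^sub>R y = a *\<^sub>R x + 0 *\<^sub>R y" by simp
    then have "real_of_int j = 0" by (rule plane_basis_eqD(2)[OF pb])
    then show "z \<in> int_span {x}" using z(2) by (auto simp: int_span_singleton)
  next
    fix z assume "z \<in> int_span {x}"
    then obtain i :: int where z: "z = of_int i *\<^sub>R x" by (auto simp: int_span_singleton)
    then have "z = of_int i *\<^sub>R x + of_int 0 *\<^sub>R y" by simp
    then show "z \<in> span {x} \<inter> quot_lattice \<Lambda> {0}"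
      unfolding quot_lattice_zero lattice_plane[OF pb ib] span_singleton using z by blast
  qed
  have rsub: "rational_subspace \<Lambda> {0}"
  proof -
    have "integral_basis ({0} \<inter> \<Lambda>) {}"
      using z\<Lambda> by (auto simp: integral_basis_def int_span_def independent_empty)
    then show ?thesis unfolding rational_subspace_def lattice_in_def by (auto intro!: exI[of _ "{}"])
  qed
  have rcone: "rational_affine_cone (quot_lattice \<Lambda> {0}) K"
    unfolding rational_affine_cone_def quot_lattice_zero
    by (intro exI[of _ v] exI[of _ "{e1, e2}"] conjI rational_point_lattice v)
       (use basis_subset_lattice[OF ib] in \<open>auto simp: cone2_hull[OF pb] K_def\<close>)
  have S: "mero_represents (quot_dual {0}) (exp_sum \<Lambda> {0} K) (\<lambda>\<xi>. exp (blinfun_apply \<xi> v))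
    (\<lambda>\<xi>. (1 - exp (blinfun_apply \<xi> e1)) * (1 - exp (blinfun_apply \<xi> e2)))"
    using exp_sum_cone[OF pb ib v] by (simp add: K_def)
  have I2: "mero_represents (quot_dual {0}) (exp_integral \<Lambda> {0} K) (\<lambda>\<xi>. exp (blinfun_apply \<xi> v))
    (\<lambda>\<xi>. blinfun_apply \<xi> e1 * blinfun_apply \<xi> e2)"
    using exp_integral_cone[OF pb ib] by (simp add: K_def)
  have I1: "mero_represents (quot_dual {0}) (exp_integral \<Lambda> {0} (half_line v e1)) (\<lambda>\<xi>. exp (blinfun_apply \<xi> v)) (\<lambda>\<xi>. - 1 * blinfun_apply \<xi> e1)"
    by (rule exp_integral_half_line[OF nz(1) primitive[OF pb ib] mem0]) (simp add: u)
  have I1': "mero_represents (quot_dual {0}) (exp_integral \<Lambda> {0} (half_line v e2)) (\<lambda>\<xi>. exp (blinfun_apply \<xi> v)) (\<lambda>\<xi>. - 1 * blinfun_apply \<xi> e2)"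
    by (rule exp_integral_half_line[OF nz(2) primitive[OF pb' ib'] mem0]) (simp add: u)
  have I0: "mero_represents (quot_dual {0}) (exp_integral \<Lambda> {0} {v}) (\<lambda>\<xi>. exp (blinfun_apply \<xi> v)) (\<lambda>\<xi>. 1)"
    by (rule exp_integral_point[OF z\<Lambda>])
  define H where "H = (\<lambda>\<xi>. (snd (exp_sum \<Lambda> {0} K) \<xi> * snd (exp_integral \<Lambda> {0} K) \<xi>) *
     ((snd (exp_integral \<Lambda> {0} (half_line v e1)) \<xi> * snd (exp_integral \<Lambda> {0} (half_line v e2)) \<xi>) * snd (exp_integral \<Lambda> {0} {v}) \<xi>)
     * (((1 - exp (blinfun_apply \<xi> e1)) * (1 - exp (blinfun_apply \<xi> e2))) * (blinfun_apply \<xi> e1 * blinfun_apply \<xi> e2)))"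
  have Hent: "entire_on (quot_dual {0}) H"
    unfolding H_def using S I2 I1 I1' I0
    by (intro entire_on_mult entire_on_diff entire_on_const entire_on_exp entire_on_eval) (simp_all add: mero_represents_def)
  have Hnz: "\<exists>\<zeta>\<in>quot_dual {0}. H \<zeta> \<noteq> 0"
    unfolding H_def
  proof (intro entire_on_mult_nonzero entire_on_mult entire_on_diff entire_on_const entire_on_exp entire_on_eval)
    show "\<exists>\<zeta>\<in>quot_dual {0}. 1 - exp (blinfun_apply \<zeta> e1) \<noteq> 0" "\<exists>\<zeta>\<in>quot_dual {0}. 1 - exp (blinfun_apply \<zeta> e2) \<noteq> 0"
      "\<exists>\<zeta>\<in>quot_dual {0}. blinfun_apply \<zeta> e1 \<noteq> 0" "\<exists>\<zeta>\<in>quot_dual {0}. blinfun_apply \<zeta> e2 \<noteq> 0"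
      using u exp_neq_1[of "- 1"] by (intro bexI[of _ u]; simp)+
  qed (use S I2 I1 I1' I0 in \<open>simp_all add: mero_represents_def\<close>)
  have faces: "{F. F face_of K \<and> F \<noteq> {}} = {{v}, half_line v e1, half_line v e2, K}"
    unfolding K_def by (rule faces_cone[OF pb])
  have m: "v + 1 *\<^sub>R e1 \<in> half_line v e1" "v + 1 *\<^sub>R e2 \<in> half_line v e2" by (rule half_line_mem; simp)+
  have k: "v + 1 *\<^sub>R e1 + 1 *\<^sub>R e2 \<in> K" unfolding K_def by (rule cone2_mem) auto
  have n1: "v + 1 *\<^sub>R e1 \<notin> half_line v e2"
  proof
    assume "v + 1 *\<^sub>R e1 \<in> half_line v e2"
    then obtain t where "1 *\<^sub>R e1 + 0 *\<^sub>R e2 = 0 *\<^sub>R e1 + t *\<^sub>R e2" by (auto simp: half_line_def)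
    from plane_basis_eqD(1)[OF pb this] show False by simp
  qed
  have n2: "v + 1 *\<^sub>R e1 + 1 *\<^sub>R e2 \<notin> half_line v e1"
  proof
    assume "v + 1 *\<^sub>R e1 + 1 *\<^sub>R e2 \<in> half_line v e1"
    then obtain t where "1 *\<^sub>R e1 + 1 *\<^sub>R e2 = t *\<^sub>R e1 + 0 *\<^sub>R e2" by (auto simp: half_line_def add.assoc)
    from plane_basis_eqD(2)[OF pb this] show False by simp
  qed
  have n3: "v + 1 *\<^sub>R e1 + 1 *\<^sub>R e2 \<notin> half_line v e2"
  proof
    assume "v + 1 *\<^sub>R e1 + 1 *\<^sub>R e2 \<in> half_line v e2"
    then obtain t where "1 *\<^sub>R e1 + 1 *\<^sub>R e2 = 0 *\<^sub>R e1 + t *\<^sub>R e2" by (auto simp: half_line_def add.assoc)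
    from plane_basis_eqD(1)[OF pb this] show False by simp
  qed
  have "v + 1 *\<^sub>R e1 + 1 *\<^sub>R e2 \<noteq> v"
    using plane_basis_eqD(1)[OF pb, of 1 1 0 0] by (auto simp: add.assoc)
  moreover have "v + 1 *\<^sub>R e1 \<noteq> v" "v + 1 *\<^sub>R e2 \<noteq> v" using nz by simp_all
  ultimately have ne: "{v} \<noteq> half_line v e1" "{v} \<noteq> half_line v e2" "{v} \<noteq> K" "half_line v e1 \<noteq> half_line v e2"
     "half_line v e1 \<noteq> K" "half_line v e2 \<noteq> K"
    using m k n1 n2 n3 by blast+
  have t1: "transverse_cone K (half_line v x) = half_line (line_proj x v) (line_proj x y)" if pb: "plane_basis x y" and K: "K = (+) v ` cone2 x y" for x y
  proof (rule transverse_cone_edge[OF pb direction_space_half_line])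
    show "half_line v x \<noteq> {}" using half_line_start by blast
    show "\<exists>s. z = v + s *\<^sub>R x" if "z \<in> half_line v x" for z using that by (auto simp: half_line_def)
    show "\<exists>s t. t \<ge> 0 \<and> z = v + s *\<^sub>R x + t *\<^sub>R y" if "z \<in> K" for z
      using that unfolding K cone2_def by (auto simp: add.assoc)
    show "v + 0 *\<^sub>R x + 1 *\<^sub>R y \<in> K" unfolding K by (rule cone2_mem) auto
  qed simp
  have K': "K = (+) v ` cone2 e2 e1"
    unfolding K_def using cone2_subset_swap[of e1 e2] cone2_subset_swap[of e2 e1] by blast
  have K0: "K = (+) v ` cone2 e1 e2" by (simp add: K_def)
  have dK: "direction_space K = UNIV" unfolding K0 by (rule direction_space_cone[OF pb])
  have t0: "transverse_cone K {v} = K"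
  proof (rule transverse_cone_vertex[OF pb, of K v 1 1, folded K_def])
    show "v + 1 *\<^sub>R e1 \<in> K" "v + 1 *\<^sub>R e2 \<in> K"
      using cone2_mem[of 1 0 v e1 e2] cone2_mem[of 0 1 v e1 e2] by (simp_all add: K_def)
  qed auto
  have t2: "transverse_cone K K = {0}" unfolding K_def by (rule transverse_cone_cone_full[OF pb])
  have mu0: "\<mu> UNIV {0} 0 = 1" using BV by (simp add: Berline_Vergne_family_def)
  note inst = BV_family_instance[OF BV rsub rcone]
  show hol: "\<forall>\<^sub>F \<xi> in nhds 0. holomorphic_at UNIV (\<mu> {0} K) \<xi>" using inst(1) by simp
  let ?X = "\<lambda>\<xi>. blinfun_apply \<xi> e1" and ?Y = "\<lambda>\<xi>. blinfun_apply \<xi> e2"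
    and ?Q = "\<lambda>\<xi>. blinfun_apply \<xi> (line_proj e1 e2)" and ?R = "\<lambda>\<xi>. blinfun_apply \<xi> (line_proj e2 e1)"
  have "\<forall>\<^sub>F \<xi> in nhds 0. \<xi> \<in> quot_dual {0} \<longrightarrow> H \<xi> \<noteq> 0 \<longrightarrow>
     ?X \<xi> * ?Y \<xi> * \<mu> {0} K \<xi> = todd (?X \<xi>) * todd (?Y \<xi>) - 1 + ?Y \<xi> * todd_tail (?Q \<xi>) + ?X \<xi> * todd_tail (?R \<xi>)"
    \<comment> \<open>The functions of the two rays enter at projected covectors, so the edge
      formula is evaluated on \<open>line_proj e1 e2\<close> and \<open>line_proj e2 e1\<close> in
      place of e2 and e1.\<close>
    using inst(2) eventually_dual_proj[OF BV_edge[OF pb ib BV v], of "span {e1}"] eventually_dual_proj[OF BV_edge[OF pb' ib' BV v], of "span {e2}"]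
  proof eventually_elim
    case (elim \<xi>)
    show ?case
    proof (intro impI)
      assume h: "H \<xi> \<noteq> 0"
      let ?P = "exp (blinfun_apply \<xi> v)"
      have reg: "mero_regular (exp_sum \<Lambda> {0} K) \<xi>" "mero_regular (exp_integral \<Lambda> {0} K) \<xi>" "mero_regular (exp_integral \<Lambda> {0} {v}) \<xi>"
        "mero_regular (exp_integral \<Lambda> {0} (half_line v e1)) \<xi>" "mero_regular (exp_integral \<Lambda> {0} (half_line v e2)) \<xi>"
        and X: "?X \<xi> \<noteq> 0" "exp (?X \<xi>) \<noteq> 1" "?Y \<xi> \<noteq> 0" "exp (?Y \<xi>) \<noteq> 1"
        using h unfolding H_def mero_regular_def mult_eq_0_iff by auto
      have regF: "\<forall>F. F face_of K \<and> F \<noteq> {} \<longrightarrow> mero_regular (exp_integral \<Lambda> {0} F) \<xi>"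
      proof (intro allI impI)
        fix F assume "F face_of K \<and> F \<noteq> {}"
        then have "F \<in> {F. F face_of K \<and> F \<noteq> {}}" by (rule CollectI)
        then have "F = {v} \<or> F = half_line v e1 \<or> F = half_line v e2 \<or> F = K" unfolding faces by simp
        then show "mero_regular (exp_integral \<Lambda> {0} F) \<xi>" using reg by (elim disjE) simp_all
      qed
      have mem: "\<xi> \<in> quot_dual {0}" by simp
      have vS: "mero_value (exp_sum \<Lambda> {0} K) \<xi> = ?P / ((1 - exp (?X \<xi>)) * (1 - exp (?Y \<xi>)))"
        using mero_represents_value[OF S mem _ reg(1)] X by simp
      have v2: "mero_value (exp_integral \<Lambda> {0} K) \<xi> = ?P / (?X \<xi> * ?Y \<xi>)"
        using mero_represents_value[OF I2 mem _ reg(2)] X by simp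
      have v0: "mero_value (exp_integral \<Lambda> {0} {v}) \<xi> = ?P"
        using mero_represents_value[OF I0 mem _ reg(3)] by simp
      have v1: "mero_value (exp_integral \<Lambda> {0} (half_line v e1)) \<xi> = ?P / (- 1 * ?X \<xi>)"
        using mero_represents_value[OF I1 mem _ reg(4)] X by simp
      have v1': "mero_value (exp_integral \<Lambda> {0} (half_line v e2)) \<xi> = ?P / (- 1 * ?Y \<xi>)"
        using mero_represents_value[OF I1' mem _ reg(5)] X by simp
      have sp: "span ({0} \<union> direction_space F) = direction_space F" for F :: "'a set"
        by (simp add: direction_space_def span_Un)
      have f1: "\<mu> (span {e1}) (half_line (line_proj e1 v) (line_proj e1 e2)) (dual_proj (span {e1}) \<xi>) = todd_tail (?Q \<xi>)"
        using elim(2) dual_proj_line_mem[OF nz(1)] by (simp add: dual_proj_line[OF nz(1)])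
      have f2: "\<mu> (span {e2}) (half_line (line_proj e2 v) (line_proj e2 e1)) (dual_proj (span {e2}) \<xi>) = todd_tail (?R \<xi>)"
        using elim(3) dual_proj_line_mem[OF nz(2)] by (simp add: dual_proj_line[OF nz(2)])
      let ?T = "\<lambda>F. \<mu> (direction_space F) (transverse_cone K F) (dual_proj (direction_space F) \<xi>) * mero_value (exp_integral \<Lambda> {0} F) \<xi>"
      have "mero_value (exp_sum \<Lambda> {0} K) \<xi> = sum ?T {{v}, half_line v e1, half_line v e2, K}"
        using mp[OF mp[OF mp[OF elim(1) mem] reg(1)] regF] unfolding faces sp .
      also have "\<dots> = ?T {v} + (?T (half_line v e1) + (?T (half_line v e2) + ?T K))"
        by (simp only: sum.insert sum.empty finite.emptyI finite_insert insert_iff empty_iff ne simp_thms add_0_right)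
      also have "?T {v} = \<mu> {0} K \<xi> * ?P" by (simp add: t0 v0)
      also have "?T (half_line v e1) = todd_tail (?Q \<xi>) * (?P / (- 1 * ?X \<xi>))"
        unfolding direction_space_half_line t1[OF pb K0] f1 v1 ..
      also have "?T (half_line v e2) = todd_tail (?R \<xi>) * (?P / (- 1 * ?Y \<xi>))"
        unfolding direction_space_half_line t1[OF pb' K'] f2 v1' ..
      also have "?T K = 1 * (?P / (?X \<xi> * ?Y \<xi>))"
        unfolding dK t2 dual_proj_UNIV mu0 v2 ..
      \<comment> \<open>All terms carry the exponential of the apex. Cancelling it removes the
        dependence on the vertex.\<close>
      finally have "?P * (1 / (1 - exp (?X \<xi>)) * (1 / (1 - exp (?Y \<xi>))))
         = ?P * (\<mu> {0} K \<xi> - todd_tail (?Q \<xi>) / ?X \<xi> - todd_tail (?R \<xi>) / ?Y \<xi> + 1 / (?X \<xi> * ?Y \<xi>))"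
        unfolding vS by (simp add: algebra_simps)
      then have "1 / (1 - exp (?X \<xi>)) * (1 / (1 - exp (?Y \<xi>)))
         = \<mu> {0} K \<xi> - todd_tail (?Q \<xi>) / ?X \<xi> - todd_tail (?R \<xi>) / ?Y \<xi> + 1 / (?X \<xi> * ?Y \<xi>)"
        by (rule mult_left_cancel[OF exp_not_eq_zero, THEN iffD1])
      then have "\<mu> {0} K \<xi> - todd_tail (?Q \<xi>) / ?X \<xi> - todd_tail (?R \<xi>) / ?Y \<xi> + 1 / (?X \<xi> * ?Y \<xi>)
         = (- todd (?X \<xi>) / ?X \<xi>) * (- todd (?Y \<xi>) / ?Y \<xi>)"
        unfolding inverse_todd(1)[OF X(1,2)] inverse_todd(1)[OF X(3,4)] by (rule sym)
      then have meq: "\<mu> {0} K \<xi> = todd (?X \<xi>) * todd (?Y \<xi>) / (?X \<xi> * ?Y \<xi>) + todd_tail (?Q \<xi>) / ?X \<xi> + todd_tail (?R \<xi>) / ?Y \<xi> - 1 / (?X \<xi> * ?Y \<xi>)"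
        by (simp add: algebra_simps)
      show "?X \<xi> * ?Y \<xi> * \<mu> {0} K \<xi> = todd (?X \<xi>) * todd (?Y \<xi>) - 1 + ?Y \<xi> * todd_tail (?Q \<xi>) + ?X \<xi> * todd_tail (?R \<xi>)"
      proof -
        have alg: "a * b * (T / (a * b) + q / a + r / b - 1 / (a * b)) = T - 1 + b * q + a * r"
          if "a \<noteq> 0" "b \<noteq> 0" for a b T q r :: complex
          using that by (simp add: field_simps)
        show ?thesis unfolding meq by (rule alg[OF X(1,3)])
      qed
    qed
  qed
  note dn = this
  have c1: "continuous_near_zero (quot_dual {0}) (\<lambda>\<xi>. ?X \<xi> * ?Y \<xi> * \<mu> {0} K \<xi>)"
    by (intro continuous_near_zero_mult continuous_near_zero_eval continuous_near_zero_holomorphic[OF inst(1)])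
  have c2: "continuous_near_zero (quot_dual {0}) (\<lambda>\<xi>. todd (?X \<xi>) * todd (?Y \<xi>) - 1 + ?Y \<xi> * todd_tail (?Q \<xi>) + ?X \<xi> * todd_tail (?R \<xi>))"
    by (intro continuous_near_zero_add continuous_near_zero_diff continuous_near_zero_mult continuous_near_zero_eval continuous_near_zero_const
        continuous_near_zero_compose fps_expansion_continuous[OF todd_tail_expansion] fps_expansion_continuous[OF todd_expansion])
  show "\<forall>\<^sub>F \<xi> in nhds 0. ?X \<xi> * ?Y \<xi> * \<mu> {0} K \<xi> = todd (?X \<xi>) * todd (?Y \<xi>) - 1 + ?Y \<xi> * todd_tail (?Q \<xi>) + ?X \<xi> * todd_tail (?R \<xi>)"
    using eventually_eq_of_dense[OF Hent Hnz c1 c2 dn] by simp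
qed

subsection \<open>The Berline-Vergne operators of a unimodular polygon\<close>

lemma taylor_part_expansion:
  assumes "(\<lambda>z. g (cscale z \<xi>)) has_fps_expansion F"
  shows "taylor_part k g \<xi> = fps_nth F k"
  using fps_nth_fps_expansion[OF assms, of k] by (simp add: taylor_part_def)

lemma eventually_cscale:
  assumes "\<forall>\<^sub>F \<xi> in nhds 0. P \<xi>"
  shows "\<forall>\<^sub>F z in nhds 0. P (cscale z \<xi>)"
proof -
  have "isCont (\<lambda>z. cscale z \<xi>) 0" by (rule linear_continuous_at[OF bounded_linear_cscale])
  then have "filterlim (\<lambda>z. cscale z \<xi>) (nhds 0) (nhds 0)"
    using tendsto_at_iff_tendsto_nhds[of "\<lambda>z. cscale z \<xi>" 0] by (simp add: continuous_at)
  then show ?thesis using assms by (simp add: filterlim_iff)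
qed

lemma taylor_part_edge:
  assumes g: "\<forall>\<^sub>F \<xi> in nhds 0. \<xi> \<in> quot_dual L \<longrightarrow> g \<xi> = todd_tail (blinfun_apply \<xi> e)" and \<xi>: "\<xi> \<in> quot_dual L"
  shows "taylor_part k g \<xi> = - bern_coeff (Suc k) * blinfun_apply \<xi> e ^ k"
proof -
  have "\<forall>\<^sub>F z in nhds 0. g (cscale z \<xi>) = todd_tail (z * blinfun_apply \<xi> e)"
    using eventually_cscale[OF g, of \<xi>] cscale_quot_dual[OF \<xi>] by simp
  from has_fps_expansion_cong[OF this refl, THEN iffD2, OF has_fps_expansion_scale[OF todd_tail_expansion]]
  have "(\<lambda>z. g (cscale z \<xi>)) has_fps_expansion Abs_fps (\<lambda>n. blinfun_apply \<xi> e ^ n * fps_nth (Abs_fps (\<lambda>n. - bern_coeff (Suc n))) n)" .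
  from taylor_part_expansion[OF this, of k] show ?thesis by simp
qed

text \<open>The symbol of the vertex operator, with X, Y, R, Q for the values of the covector on e1,
  e2, u1, u2.\<close>

definition vertex_symbol ::
    "nat \<Rightarrow> complex \<Rightarrow> complex \<Rightarrow> complex \<Rightarrow> complex \<Rightarrow> complex \<Rightarrow> complex \<Rightarrow> complex" where
  "vertex_symbol n c1 c2 X Y R Q =
     (\<Sum>j=1..n - 1. bern_coeff j * bern_coeff (n - j) * (X ^ (j - 1) * Y ^ (n - 1 - j)))
     + bern_coeff n * (c1 * (\<Sum>s=0..n - 2. R ^ s * X ^ (n - 2 - s)) + c2 * (\<Sum>s=0..n - 2. Q ^ s * Y ^ (n - 2 - s)))"

lemma power_diff_sum:
  fixes X R :: complex
  assumes "n \<ge> 2"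
  shows "X ^ (n - 1) - R ^ (n - 1) = (X - R) * (\<Sum>s=0..n - 2. R ^ s * X ^ (n - 2 - s))"
proof -
  obtain m where m: "n = Suc (Suc m)" using assms by (metis add_2_eq_Suc le_Suc_ex)
  have "X ^ Suc m - R ^ Suc m = (X - R) * (\<Sum>s<Suc m. X ^ s * R ^ (m - s))"
    by (rule diff_power_eq_sum)
  also have "(\<Sum>s<Suc m. X ^ s * R ^ (m - s)) = (\<Sum>s\<le>m. R ^ s * X ^ (m - s))"
    unfolding lessThan_Suc_atMost by (rule sum.reindex_bij_witness[of _ "\<lambda>s. m - s" "\<lambda>s. m - s"]) auto
  finally show ?thesis by (simp add: m atLeast0AtMost)
qed

text \<open>The left side is the coefficient of z^n in the cleared vertex identity. Its inner terms
  contain X Y, and X^n - X R^(n-1) does so because X - R = c1 Y; likewise for Y and Q.\<close>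

lemma vertex_symbol_eq:
  fixes X Y R Q c1 c2 :: complex
  assumes n: "n \<ge> 2" and XR: "X - R = c1 * Y" and YQ: "Y - Q = c2 * X"
  shows "(\<Sum>i=0..n. X ^ i * bern_coeff i * (Y ^ (n - i) * bern_coeff (n - i)))
      + Y * (Q ^ (n - 1) * - bern_coeff n) + X * (R ^ (n - 1) * - bern_coeff n)
    = X * Y * vertex_symbol n c1 c2 X Y R Q"
proof -
  let ?t = "\<lambda>i. X ^ i * bern_coeff i * (Y ^ (n - i) * bern_coeff (n - i))"
  have "{0..n} = insert 0 (insert n {1..n - 1})" using n by auto
  then have "sum ?t {0..n} = ?t 0 + (?t n + sum ?t {1..n - 1})" using n by simp
  also have "sum ?t {1..n - 1} = X * Y * (\<Sum>j=1..n - 1. bern_coeff j * bern_coeff (n - j) * (X ^ (j - 1) * Y ^ (n - 1 - j)))"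
    unfolding sum_distrib_left
  proof (rule sum.cong[OF refl])
    fix j assume "j \<in> {1..n - 1}"
    then have j: "j \<noteq> 0" "n - j \<noteq> 0" "n - j - 1 = n - 1 - j" using n by auto
    have "X ^ j = X * X ^ (j - 1)" "Y ^ (n - j) = Y * Y ^ (n - 1 - j)"
      using power_eq_if[of X j] power_eq_if[of Y "n - j"] unfolding j(3) by (simp_all only: j if_False)
    then show "?t j = X * Y * (bern_coeff j * bern_coeff (n - j) * (X ^ (j - 1) * Y ^ (n - 1 - j)))" by simp
  qed
  finally have 1: "sum ?t {0..n} = bern_coeff n * Y ^ n + bern_coeff n * X ^ n
     + X * Y * (\<Sum>j=1..n - 1. bern_coeff j * bern_coeff (n - j) * (X ^ (j - 1) * Y ^ (n - 1 - j)))"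
    by (simp add: bern_coeff_0 mult.commute)
  have "X ^ n - X * R ^ (n - 1) = X * (X ^ (n - 1) - R ^ (n - 1))" "Y ^ n - Y * Q ^ (n - 1) = Y * (Y ^ (n - 1) - Q ^ (n - 1))"
    using n power_eq_if[of X n] power_eq_if[of Y n] by (simp_all add: right_diff_distrib)
  then have 2: "X ^ n = X * R ^ (n - 1) + X * (c1 * Y * (\<Sum>s=0..n - 2. R ^ s * X ^ (n - 2 - s)))"
    "Y ^ n = Y * Q ^ (n - 1) + Y * (c2 * X * (\<Sum>s=0..n - 2. Q ^ s * Y ^ (n - 2 - s)))"
    unfolding power_diff_sum[OF n] XR YQ by (simp_all only: diff_eq_eq add.commute)
  show ?thesis unfolding 1 vertex_symbol_def unfolding 2 by (simp add: algebra_simps)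
qed

text \<open>Along the line z \<xi> the cleared identity becomes an identity of power series in z.
  The factor (z X)(z Y) shifts degree k to k + 2 and leaves X Y, which is cancelled under the
  assumption \<open>nz\<close>.\<close>

lemma taylor_part_vertex_generic:
  assumes hol: "\<forall>\<^sub>F \<xi> in nhds 0. holomorphic_at UNIV g (\<xi> :: 'a::euclidean_space cdual)"
    and id: "\<forall>\<^sub>F \<xi> in nhds 0. blinfun_apply \<xi> e1 * blinfun_apply \<xi> e2 * g \<xi> =
      todd (blinfun_apply \<xi> e1) * todd (blinfun_apply \<xi> e2) - 1
      + blinfun_apply \<xi> e2 * todd_tail (blinfun_apply \<xi> u2) + blinfun_apply \<xi> e1 * todd_tail (blinfun_apply \<xi> u1)"
    and e: "e1 = u1 + c1 *\<^sub>R e2" "e2 = u2 + c2 *\<^sub>R e1"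
    and nz: "blinfun_apply \<xi> e1 \<noteq> 0" "blinfun_apply \<xi> e2 \<noteq> 0"
  shows "taylor_part k g \<xi> = vertex_symbol (k + 2) (of_real c1) (of_real c2) (blinfun_apply \<xi> e1) (blinfun_apply \<xi> e2) (blinfun_apply \<xi> u1) (blinfun_apply \<xi> u2)"
proof -
  define X Y R Q where "X = blinfun_apply \<xi> e1" and "Y = blinfun_apply \<xi> e2" and "R = blinfun_apply \<xi> u1" and "Q = blinfun_apply \<xi> u2"
  have XR: "X - R = of_real c1 * Y" and YQ: "Y - Q = of_real c2 * X"
    unfolding X_def Y_def R_def Q_def
    by (subst e(1), simp add: blinfun.add_right blinfun.scaleR_right scaleR_conv_of_real)
       (subst e(2), simp add: blinfun.add_right blinfun.scaleR_right scaleR_conv_of_real)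
  define G where "G = (\<lambda>z. g (cscale z \<xi>))"
  have "\<forall>\<^sub>F z in nhds 0. G field_differentiable (at z)"
  proof (rule eventually_mono[OF eventually_cscale[OF hol]])
    fix z assume "holomorphic_at UNIV g (cscale z \<xi>)"
    then show "G field_differentiable (at z)"
      using holomorphic_at_line[of "{0}" g 0 z \<xi>] by (simp add: G_def)
  qed
  then obtain S where S: "open S" "0 \<in> S" "\<And>z. z \<in> S \<Longrightarrow> G field_differentiable (at z)"
    unfolding eventually_nhds by blast
  then have "G holomorphic_on S"
    by (auto simp: holomorphic_on_def intro: field_differentiable_at_within)
  then have FG: "G has_fps_expansion fps_expansion G 0" using S by blast
  define T0 :: "complex fps" where "T0 = fps_X / (fps_exp 1 - 1)"
  define A :: "complex \<Rightarrow> complex fps \<Rightarrow> complex fps" where "A = (\<lambda>c F. Abs_fps (\<lambda>n. c ^ n * fps_nth F n))"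
  have cX: "(\<lambda>z. z * c) has_fps_expansion fps_X * fps_const c" for c :: complex
    by (intro has_fps_expansion_mult has_fps_expansion_const has_fps_expansion_fps_X)
  have L: "(\<lambda>z. (z * X) * (z * Y) * G z) has_fps_expansion (fps_X * fps_const X) * (fps_X * fps_const Y) * fps_expansion G 0"
    by (intro has_fps_expansion_mult cX FG)
  have Rt: "(\<lambda>z. todd (z * X) * todd (z * Y) - 1 + z * Y * todd_tail (z * Q) + z * X * todd_tail (z * R)) has_fps_expansion
     A X T0 * A Y T0 - 1 + fps_X * fps_const Y * A Q (Abs_fps (\<lambda>n. - bern_coeff (Suc n))) + fps_X * fps_const X * A R (Abs_fps (\<lambda>n. - bern_coeff (Suc n)))"
    unfolding A_def T0_def
    by (intro has_fps_expansion_add has_fps_expansion_diff has_fps_expansion_mult has_fps_expansion_1 cX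
        has_fps_expansion_scale todd_expansion todd_tail_expansion)
  have "\<forall>\<^sub>F z in nhds 0. (z * X) * (z * Y) * G z = todd (z * X) * todd (z * Y) - 1 + z * Y * todd_tail (z * Q) + z * X * todd_tail (z * R)"
    using eventually_cscale[OF id, of \<xi>] by (simp add: G_def X_def Y_def R_def Q_def)
  from has_fps_expansion_cong[OF this refl, THEN iffD2, OF Rt]
  have "(\<lambda>z. (z * X) * (z * Y) * G z) has_fps_expansion
     A X T0 * A Y T0 - 1 + fps_X * fps_const Y * A Q (Abs_fps (\<lambda>n. - bern_coeff (Suc n))) + fps_X * fps_const X * A R (Abs_fps (\<lambda>n. - bern_coeff (Suc n)))" .
  from fps_expansion_unique_complex[OF L this]
  have "fps_nth ((fps_X * fps_const X) * (fps_X * fps_const Y) * fps_expansion G 0) (Suc (Suc k)) =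
     fps_nth (A X T0 * A Y T0 - 1 + fps_X * fps_const Y * A Q (Abs_fps (\<lambda>n. - bern_coeff (Suc n))) + fps_X * fps_const X * A R (Abs_fps (\<lambda>n. - bern_coeff (Suc n)))) (Suc (Suc k))"
    by simp
  also have "fps_nth ((fps_X * fps_const X) * (fps_X * fps_const Y) * fps_expansion G 0) (Suc (Suc k)) = X * Y * fps_nth (fps_expansion G 0) k"
    by (simp add: mult.assoc)
  also have "fps_nth (A X T0 * A Y T0 - 1 + fps_X * fps_const Y * A Q (Abs_fps (\<lambda>n. - bern_coeff (Suc n))) + fps_X * fps_const X * A R (Abs_fps (\<lambda>n. - bern_coeff (Suc n)))) (Suc (Suc k))
     = (\<Sum>i=0..k + 2. X ^ i * bern_coeff i * (Y ^ (k + 2 - i) * bern_coeff (k + 2 - i)))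
      + Y * (Q ^ (k + 2 - 1) * - bern_coeff (k + 2)) + X * (R ^ (k + 2 - 1) * - bern_coeff (k + 2))"
  proof -
    have 1: "fps_nth (fps_X * fps_const c * F) (Suc m) = c * fps_nth F m" for c :: complex and F m
      by (simp add: mult.assoc)
    have 2: "fps_nth (A X T0 * A Y T0) (Suc (Suc k)) = (\<Sum>i=0..k + 2. X ^ i * bern_coeff i * (Y ^ (k + 2 - i) * bern_coeff (k + 2 - i)))"
      unfolding fps_mult_nth by (simp only: A_def T0_def fps_nth_Abs_fps bern_coeff_nth add_2_eq_Suc')
    show ?thesis unfolding fps_add_nth fps_sub_nth 1 2 by (simp add: A_def)
  qed
  also have "\<dots> = X * Y * vertex_symbol (k + 2) (of_real c1) (of_real c2) X Y R Q"
    by (rule vertex_symbol_eq[OF _ XR YQ]) simp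
  finally have "fps_nth (fps_expansion G 0) k = vertex_symbol (k + 2) (of_real c1) (of_real c2) X Y R Q"
    using nz by (simp add: X_def Y_def)
  then show ?thesis
    using taylor_part_expansion[OF FG[unfolded G_def], of k] by (simp add: G_def X_def Y_def R_def Q_def)
qed

lemma norm_cscale_le: "norm (cscale z \<xi>) \<le> norm z * norm \<xi>"
proof (rule norm_blinfun_bound)
  show "norm (blinfun_apply (cscale z \<xi>) x) \<le> norm z * norm \<xi> * norm x" for x
    using mult_left_mono[OF norm_blinfun[of \<xi> x], of "norm z"] by (simp add: norm_mult mult.assoc)
qed simp

text \<open>Taylor coefficients depend continuously on the direction, by Weierstrass' theorem on the
  derivatives of uniform limits.\<close>

lemma taylor_part_tendsto:
  fixes g :: "'a::euclidean_space cdual \<Rightarrow> complex"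
  assumes hol: "\<forall>\<^sub>F \<xi> in nhds 0. holomorphic_at UNIV g \<xi>"
    and t: "\<And>n. t n \<in> {0..1}" "t \<longlonglongrightarrow> (0::real)"
  shows "(\<lambda>n. taylor_part k g (\<xi> + t n *\<^sub>R u)) \<longlonglongrightarrow> taylor_part k g \<xi>"
proof -
  obtain \<delta> where d: "\<delta> > 0" "\<And>\<xi>. dist \<xi> 0 < \<delta> \<Longrightarrow> holomorphic_at UNIV g \<xi>"
    using hol unfolding eventually_nhds_metric by blast
  \<comment> \<open>Bounds the norm of every direction \<xi> + s u with s in {0..1}, so one radius r
    keeps all the discs inside the domain of holomorphy.\<close>
  define m where "m = norm \<xi> + norm u + 1"
  define r where "r = \<delta> / (2 * m)"
  have m: "m > 0" by (simp add: m_def add_nonneg_pos)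
  then have r: "r > 0" using d by (simp add: r_def)
  have small: "dist (cscale z (\<xi> + s *\<^sub>R u)) 0 < \<delta>" if z: "norm z \<le> r" and s: "s \<in> {0..1}" for z s
  proof -
    have "norm (s *\<^sub>R u) \<le> 1 * norm u" unfolding norm_scaleR using s by (intro mult_right_mono) auto
    then have "norm (\<xi> + s *\<^sub>R u) \<le> m" using norm_triangle_ineq[of \<xi> "s *\<^sub>R u"] by (simp add: m_def)
    then have "norm z * norm (\<xi> + s *\<^sub>R u) \<le> r * m" using z r by (intro mult_mono) auto
    then have "norm (cscale z (\<xi> + s *\<^sub>R u)) \<le> r * m" by (rule order_trans[OF norm_cscale_le])
    also have "\<dots> = \<delta> / 2" using m by (simp add: r_def)
    also have "\<dots> < \<delta>" using d by simp
    finally show ?thesis by simp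
  qed
  \<comment> \<open>Uniform continuity on the compact product turns convergence of the direction
    into uniform convergence in z.\<close>
  define \<Phi> where "\<Phi> = (\<lambda>(z, s). g (cscale z (\<xi> + s *\<^sub>R u)))"
  have gc: "continuous_on (ball 0 \<delta>) g"
  proof (rule continuous_at_imp_continuous_on, rule ballI)
    fix \<eta> :: "'a cdual" assume "\<eta> \<in> ball 0 \<delta>"
    then show "isCont g \<eta>" using d(2)[of \<eta>] unfolding holomorphic_at_def
      by (auto simp: dist_commute intro: has_derivative_continuous)
  qed
  have cc: "continuous_on (cball 0 r \<times> {0..1}) (\<lambda>x. cscale (fst x) (\<xi> + snd x *\<^sub>R u))"
    unfolding cscale_def
    by (intro bounded_bilinear.continuous_on[OF bounded_bilinear_blinfun_compose] continuous_intros
        bounded_linear.continuous_on[OF bounded_linear_blinfun_mult_right])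
  have "continuous_on (cball 0 r \<times> {0..1}) \<Phi>"
    unfolding \<Phi>_def split_beta
    by (rule continuous_on_compose2[OF gc cc]) (use small in \<open>auto simp: dist_commute\<close>)
  then have uc: "uniformly_continuous_on (cball 0 r \<times> {0..1}) \<Phi>"
    by (rule compact_uniformly_continuous) (intro compact_Times compact_cball compact_Icc)
  have ul: "uniform_limit (ball 0 r) (\<lambda>n z. g (cscale z (\<xi> + t n *\<^sub>R u))) (\<lambda>z. g (cscale z \<xi>)) sequentially"
  proof (rule uniform_limitI)
    fix e :: real assume "e > 0"
    then obtain d' where d': "d' > 0" "\<And>x y. x \<in> cball 0 r \<times> {0..1} \<Longrightarrow> y \<in> cball 0 r \<times> {0..1} \<Longrightarrow> dist y x < d' \<Longrightarrow> dist (\<Phi> y) (\<Phi> x) < e"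
      using uc unfolding uniformly_continuous_on_def by meson
    have "\<forall>\<^sub>F n in sequentially. dist (t n) 0 < d'" using t(2) d'(1) by (rule tendstoD)
    then show "\<forall>\<^sub>F n in sequentially. \<forall>z\<in>ball 0 r. dist (g (cscale z (\<xi> + t n *\<^sub>R u))) (g (cscale z \<xi>)) < e"
    proof eventually_elim
      case (elim n)
      show ?case
      proof
        fix z :: complex assume "z \<in> ball 0 r"
        then have "dist (\<Phi> (z, t n)) (\<Phi> (z, 0)) < e"
          using elim t(1)[of n] by (intro d'(2)) (auto simp: dist_Pair_Pair)
        then show "dist (g (cscale z (\<xi> + t n *\<^sub>R u))) (g (cscale z \<xi>)) < e" by (simp add: \<Phi>_def)
      qed
    qed
  qed
  have holo: "(\<lambda>z. g (cscale z (\<xi> + t n *\<^sub>R u))) holomorphic_on ball 0 r" for n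
    unfolding holomorphic_on_def
  proof
    fix z :: complex assume "z \<in> ball 0 r"
    then have "holomorphic_at UNIV g (cscale z (\<xi> + t n *\<^sub>R u))" using small[of z "t n"] t(1)[of n] d(2) by auto
    then have "(\<lambda>z. g (0 + cscale z (\<xi> + t n *\<^sub>R u))) field_differentiable (at z)"
      using holomorphic_at_line[of "{0}" g 0 z "\<xi> + t n *\<^sub>R u"] by simp
    then show "(\<lambda>z. g (cscale z (\<xi> + t n *\<^sub>R u))) field_differentiable (at z within ball 0 r)"
      by (simp add: field_differentiable_at_within)
  qed
  have "(\<lambda>n. (deriv ^^ k) (\<lambda>z. g (cscale z (\<xi> + t n *\<^sub>R u))) 0) \<longlonglongrightarrow> (deriv ^^ k) (\<lambda>z. g (cscale z \<xi>)) 0"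
    by (rule higher_deriv_complex_uniform_limit[OF ul]) (use holo r in auto)
  then show ?thesis unfolding taylor_part_def by (intro tendsto_intros) auto
qed

text \<open>Every covector is a limit of covectors with both values nonzero, and both sides depend
  continuously on the covector.\<close>

lemma taylor_part_vertex:
  assumes pb: "plane_basis e1 e2"
    and hol: "\<forall>\<^sub>F \<xi> in nhds 0. holomorphic_at UNIV g (\<xi> :: 'a::euclidean_space cdual)"
    and id: "\<forall>\<^sub>F \<xi> in nhds 0. blinfun_apply \<xi> e1 * blinfun_apply \<xi> e2 * g \<xi> =
      todd (blinfun_apply \<xi> e1) * todd (blinfun_apply \<xi> e2) - 1
      + blinfun_apply \<xi> e2 * todd_tail (blinfun_apply \<xi> u2) + blinfun_apply \<xi> e1 * todd_tail (blinfun_apply \<xi> u1)"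
    and e: "e1 = u1 + c1 *\<^sub>R e2" "e2 = u2 + c2 *\<^sub>R e1"
  shows "taylor_part k g \<xi> = vertex_symbol (k + 2) (of_real c1) (of_real c2) (blinfun_apply \<xi> e1) (blinfun_apply \<xi> e2) (blinfun_apply \<xi> u1) (blinfun_apply \<xi> u2)"
proof -
  let ?V = "\<lambda>\<xi>. vertex_symbol (k + 2) (of_real c1) (of_real c2) (blinfun_apply \<xi> e1) (blinfun_apply \<xi> e2) (blinfun_apply \<xi> u1) (blinfun_apply \<xi> u2)"
  obtain u :: "'a cdual" where u: "blinfun_apply u e1 = 1" "blinfun_apply u e2 = 1"
    using plane_basis_functional[OF pb] by blast
  define t :: "nat \<Rightarrow> real" where "t = (\<lambda>n. inverse (real (Suc n)))"
  have t: "t n \<in> {0..1}" "t n > 0" for n by (auto simp: t_def field_simps)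
  have t0: "t \<longlonglongrightarrow> 0" unfolding t_def by (rule LIMSEQ_inverse_real_of_nat)
  \<comment> \<open>The perturbation shifts both values by the positive number t n. For z = 0 the
    sum is nonzero by positivity, otherwise because it tends to z.\<close>
  have ev: "\<forall>\<^sub>F n in sequentially. z + of_real (t n) \<noteq> 0" for z :: complex
  proof (cases "z = 0")
    case True
    then show ?thesis using t(2) by (simp add: less_imp_neq[THEN not_sym])
  next
    case False
    have "(\<lambda>n. z + of_real (t n)) \<longlonglongrightarrow> z + of_real 0" by (intro tendsto_intros t0)
    then show ?thesis using False by (intro tendsto_imp_eventually_ne) auto
  qed
  have "(\<lambda>n. taylor_part k g (\<xi> + t n *\<^sub>R u)) \<longlonglongrightarrow> taylor_part k g \<xi>"
    by (rule taylor_part_tendsto[OF hol t(1) t0])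
  moreover have "\<forall>\<^sub>F n in sequentially. taylor_part k g (\<xi> + t n *\<^sub>R u) = ?V (\<xi> + t n *\<^sub>R u)"
    using ev[of "blinfun_apply \<xi> e1"] ev[of "blinfun_apply \<xi> e2"]
  proof eventually_elim
    case (elim n)
    then show ?case
      by (intro taylor_part_vertex_generic[OF hol id e])
         (simp_all add: blinfun.add_left blinfun.scaleR_left u scaleR_conv_of_real)
  qed
  ultimately have 1: "(\<lambda>n. ?V (\<xi> + t n *\<^sub>R u)) \<longlonglongrightarrow> taylor_part k g \<xi>"
    by (rule Lim_transform_eventually)
  have "(\<lambda>n. \<xi> + t n *\<^sub>R u) \<longlonglongrightarrow> \<xi> + 0 *\<^sub>R u" by (intro tendsto_intros t0)
  then have ap: "(\<lambda>n. blinfun_apply (\<xi> + t n *\<^sub>R u) x) \<longlonglongrightarrow> blinfun_apply \<xi> x" for x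
    using bounded_bilinear.tendsto[OF bounded_bilinear_blinfun_apply _ tendsto_const, of "\<lambda>n. \<xi> + t n *\<^sub>R u" \<xi> sequentially x] by simp
  have "(\<lambda>n. ?V (\<xi> + t n *\<^sub>R u)) \<longlonglongrightarrow> ?V \<xi>"
    unfolding vertex_symbol_def by (intro tendsto_intros ap)
  from LIMSEQ_unique[OF 1 this] show ?thesis .
qed

text \<open>An explicit operator with the right symbol shows that the choice in
  \<open>BV_operator\<close> succeeds, and uniqueness then identifies the chosen operator with it on
  smooth functions.\<close>

lemma BV_operator_eq:
  fixes e1 e2 x :: "'a::euclidean_space"
  assumes pb: "plane_basis e1 e2" and E: "const_coeff_operator E"
    and s: "has_symbol E (\<lambda>\<xi>. taylor_part (nat (int n - aff_dim P + aff_dim f))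
          (\<mu> (direction_space f) (transverse_cone P f)) (dual_proj (direction_space f) \<xi>))"
    and g: "smooth g"
  shows "BV_operator \<mu> n P f g x = E g x"
proof -
  let ?s = "\<lambda>\<xi>. taylor_part (nat (int n - aff_dim P + aff_dim f))
          (\<mu> (direction_space f) (transverse_cone P f)) (dual_proj (direction_space f) \<xi>)"
  have "const_coeff_operator (BV_operator \<mu> n P f) \<and> has_symbol (BV_operator \<mu> n P f) ?s"
    unfolding BV_operator_def by (rule someI[of "\<lambda>D. const_coeff_operator D \<and> has_symbol D ?s" E]) (use E s in simp)
  from plane_symbol_determines_operator[OF pb conjunct1[OF this] E conjunct2[OF this] s g] show ?thesis .
qed

lemma BV_operator_edge:
  fixes e1 e2 :: "'a::euclidean_space"
  assumes pb: "plane_basis e1 e2" and ib: "integral_basis \<Lambda> {e1, e2}" and BV: "Berline_Vergne_family \<Lambda> \<mu>" and v: "v \<in> \<Lambda>"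
    and P: "aff_dim P = 2" "aff_dim f = 1" "direction_space f = span {e1}"
      "transverse_cone P f = half_line (line_proj e1 v) (line_proj e1 e2)"
    and n: "n \<ge> 1" and g: "smooth g"
  shows "BV_operator \<mu> n P f g x = edge_operator n (line_proj e1 e2) g x"
proof -
  have nz: "e1 \<noteq> 0" using plane_basis_nonzero[OF pb] by blast
  define E where "E = (\<lambda>g x. - bern_coeff n * foldr nabla (replicate (n - 1) (line_proj e1 e2)) g x :: complex)"
  have "nat (int n - aff_dim P + aff_dim f) = n - 1" using P n by simp
  then have t: "taylor_part (nat (int n - aff_dim P + aff_dim f)) (\<mu> (direction_space f) (transverse_cone P f)) (dual_proj (direction_space f) \<xi>)
     = - bern_coeff n * (\<Prod>u\<leftarrow>replicate (n - 1) (line_proj e1 e2). blinfun_apply \<xi> u)" for \<xi>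
    unfolding P(3,4) using taylor_part_edge[OF BV_edge[OF pb ib BV v] dual_proj_line_mem[OF nz], of "n - 1"] n
    by (simp add: dual_proj_line[OF nz])
  have "BV_operator \<mu> n P f g x = E g x"
  proof (rule BV_operator_eq[OF pb _ _ g])
    show "const_coeff_operator E" unfolding E_def by (rule const_coeff_foldr)
    show "has_symbol E (\<lambda>\<xi>. taylor_part (nat (int n - aff_dim P + aff_dim f))
        (\<mu> (direction_space f) (transverse_cone P f)) (dual_proj (direction_space f) \<xi>))"
      unfolding t E_def by (rule has_symbol_foldr)
  qed
  then show ?thesis by (simp add: E_def edge_operator_def bern_coeff_def)
qed

lemma BV_operator_vertex:
  fixes e1 e2 :: "'a::euclidean_space"
  assumes pb: "plane_basis e1 e2" and ib: "integral_basis \<Lambda> {e1, e2}" and BV: "Berline_Vergne_family \<Lambda> \<mu>" and v: "v \<in> \<Lambda>"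
    and P: "aff_dim P = 2" "transverse_cone P {v} = (+) v ` cone2 e1 e2"
    and u: "u1 = line_proj e2 e1" "u2 = line_proj e1 e2"
    and e: "e1 = u1 + c1 *\<^sub>R e2" "e2 = u2 + c2 *\<^sub>R e1"
    and n: "n \<ge> 2" and g: "smooth g"
  shows "BV_operator \<mu> n P {v} g x = vertex_operator n e1 e2 u1 u2 c1 c2 g x"
proof -
  define E where "E = (\<lambda>g x. (\<Sum>j\<in>{1..n - 1}. bern_coeff j * bern_coeff (n - j) * foldr nabla (replicate (j - 1) e1 @ replicate (n - 1 - j) e2) g x)
     + ((\<Sum>s\<in>{0..n - 2}. bern_coeff n * of_real c1 * foldr nabla (replicate s u1 @ replicate (n - 2 - s) e1) g x)
       + (\<Sum>s\<in>{0..n - 2}. bern_coeff n * of_real c2 * foldr nabla (replicate s u2 @ replicate (n - 2 - s) e2) g x)) :: complex)"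
  have "nat (int n - aff_dim P + aff_dim {v}) = n - 2" using P n by simp
  then have "taylor_part (nat (int n - aff_dim P + aff_dim {v})) (\<mu> (direction_space {v}) (transverse_cone P {v})) (dual_proj (direction_space {v}) \<xi>)
     = vertex_symbol (n - 2 + 2) (of_real c1) (of_real c2) (blinfun_apply \<xi> e1) (blinfun_apply \<xi> e2) (blinfun_apply \<xi> u1) (blinfun_apply \<xi> u2)" for \<xi>
    unfolding P(2) direction_space_point dual_proj_zero
    using taylor_part_vertex[OF pb BV_vertex(1)[OF pb ib BV v] BV_vertex(2)[OF pb ib BV v, folded u] e, of "n - 2"] by simp
  moreover have n2: "n - 2 + 2 = n" using n by simp
  ultimately have t: "taylor_part (nat (int n - aff_dim P + aff_dim {v})) (\<mu> (direction_space {v}) (transverse_cone P {v})) (dual_proj (direction_space {v}) \<xi>)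
     = (\<Sum>j\<in>{1..n - 1}. bern_coeff j * bern_coeff (n - j) * (\<Prod>u\<leftarrow>replicate (j - 1) e1 @ replicate (n - 1 - j) e2. blinfun_apply \<xi> u))
     + ((\<Sum>s\<in>{0..n - 2}. bern_coeff n * of_real c1 * (\<Prod>u\<leftarrow>replicate s u1 @ replicate (n - 2 - s) e1. blinfun_apply \<xi> u))
       + (\<Sum>s\<in>{0..n - 2}. bern_coeff n * of_real c2 * (\<Prod>u\<leftarrow>replicate s u2 @ replicate (n - 2 - s) e2. blinfun_apply \<xi> u)))" for \<xi>
    unfolding n2 by (simp add: vertex_symbol_def sum_distrib_left distrib_left mult.assoc)
  have "BV_operator \<mu> n P {v} g x = E g x"
  proof (rule BV_operator_eq[OF pb _ _ g])
    show "const_coeff_operator E" unfolding E_def by (intro const_coeff_add const_coeff_sum finite_atLeastAtMost)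
    show "has_symbol E (\<lambda>\<xi>. taylor_part (nat (int n - aff_dim P + aff_dim {v}))
        (\<mu> (direction_space {v}) (transverse_cone P {v})) (dual_proj (direction_space {v}) \<xi>))"
      unfolding t E_def by (intro has_symbol_add has_symbol_sum)
  qed
  then show ?thesis
    by (simp add: E_def vertex_operator_def bern_coeff_def sum_distrib_left distrib_left mult.assoc)
qed

subsection \<open>Edges and vertices of a Delzant polygon\<close>

lemma edge_segment:
  fixes P :: "'a::euclidean_space set"
  assumes P: "polytope P" and f: "f \<in> edges P"
  obtains v w where "v \<noteq> w" "f = closed_segment v w" "{x \<in> vertices P. x \<in> f} = {v, w}"
proof -
  have fP: "f face_of P" and d: "aff_dim f = 1" using f by (auto simp: edges_def)
  have "polytope f" using face_of_polytope_polytope[OF P fP] .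
  then have "compact f" "convex f" by (simp_all add: polytope_imp_compact polytope_imp_convex)
  moreover have "f \<noteq> {}" using d by force
  moreover have "collinear f" using d by (simp add: collinear_aff_dim)
  ultimately obtain v w where f_eq: "f = closed_segment v w" using compact_convex_collinear_segment by blast
  have "v \<noteq> w"
  proof
    assume "v = w"
    then have "aff_dim f = 0" by (simp add: f_eq)
    then show False using d by simp
  qed
  moreover have "{x \<in> vertices P. x \<in> f} = {v, w}"
  proof (intro equalityI subsetI)
    fix x assume "x \<in> {x \<in> vertices P. x \<in> f}"
    then have x: "{x} face_of P" "x \<in> f" by (auto simp: vertices_def)
    then have "{x} face_of f" using face_of_subset[OF x(1) _ face_of_imp_subset[OF fP]] by simp
    then show "x \<in> {v, w}" by (simp add: face_of_singleton f_eq extreme_point_of_segment)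
  next
    fix x assume "x \<in> {v, w}"
    then have "{x} face_of f" by (auto simp: face_of_singleton f_eq extreme_point_of_segment)
    then have "{x} face_of P" using fP face_of_trans by blast
    moreover have "x \<in> f" using \<open>x \<in> {v, w}\<close> by (auto simp: f_eq)
    ultimately show "x \<in> {x \<in> vertices P. x \<in> f}" by (simp add: vertices_def)
  qed
  ultimately show ?thesis using that f_eq by blast
qed

text \<open>The intersection of two edges is a face of each. A proper face of an edge has dimension
  below 1 and cannot contain two points.\<close>

lemma edge_eqI:
  fixes P :: "'a::euclidean_space set"
  assumes f: "f \<in> edges P" and g: "g \<in> edges P" and x: "x \<in> f" "x \<in> g" and y: "y \<in> f" "y \<in> g" and "x \<noteq> y"
  shows "f = g"
proof -
  have main: "f \<inter> g = f" if f: "f \<in> edges P" and g: "g \<in> edges P" and xy: "x \<in> f" "x \<in> g" "y \<in> f" "y \<in> g" for f g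
  proof (rule ccontr)
    assume ne: "f \<inter> g \<noteq> f"
    have fP: "f face_of P" "g face_of P" and d: "aff_dim f = 1" using f g by (auto simp: edges_def)
    have "(f \<inter> g) face_of f" by (rule face_of_subset[OF face_of_Int[OF fP] _ face_of_imp_subset[OF fP(1)]]) simp
    from face_of_aff_dim_lt[OF face_of_imp_convex[OF fP(1)] this ne] have "aff_dim (f \<inter> g) < 1" using d by simp
    moreover have "aff_dim {x, y} \<le> aff_dim (f \<inter> g)" using xy by (intro aff_dim_subset) simp
    ultimately show False using \<open>x \<noteq> y\<close> by (simp add: aff_dim_2)
  qed
  from main[OF f g x y] main[OF g f x(2,1) y(2,1)] show ?thesis by (simp add: Int_commute)
qed

lemma Collect_pairD:
  assumes "{x \<in> A. Q x} = {a, b}"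
  shows "a \<in> A" "Q a" "b \<in> A" "Q b"
proof -
  have "a \<in> {x \<in> A. Q x}" "b \<in> {x \<in> A. Q x}" unfolding assms by simp_all
  then show "a \<in> A" "Q a" "b \<in> A" "Q b" by simp_all
qed

text \<open>An affine function, fixed once for each edge, that is nonnegative on P and vanishes on P
  exactly along f. Only its sign and affinity are used, so its scale is immaterial.\<close>

definition slack :: "'a::euclidean_space set \<Rightarrow> 'a set \<Rightarrow> 'a \<Rightarrow> real" where
  "slack P f x = (let (a, b) = (SOME (a, b). P \<subseteq> {x. a \<bullet> x \<le> b} \<and> f = P \<inter> {x. a \<bullet> x = b}) in b - a \<bullet> x)"

definition half_plane :: "'a::euclidean_space set \<Rightarrow> 'a set \<Rightarrow> 'a set" where
  "half_plane P f = {x. slack P f x \<ge> 0}"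

lemma slack_affine: "slack P f ((1 - t) *\<^sub>R x + t *\<^sub>R y) = (1 - t) * slack P f x + t * slack P f y"
  by (simp add: slack_def split_beta Let_def inner_simps algebra_simps)

lemma slack_affine2:
  "slack P f (v + s *\<^sub>R x + t *\<^sub>R y) = slack P f v + s * (slack P f (v + x) - slack P f v) + t * (slack P f (v + y) - slack P f v)"
  by (simp add: slack_def split_beta Let_def inner_simps algebra_simps)

lemma
  assumes P: "polytope P" and f: "f \<in> edges P" and x: "x \<in> P"
  shows slack_nonneg: "slack P f x \<ge> 0" and slack_zero_iff: "slack P f x = 0 \<longleftrightarrow> x \<in> f"
proof -
  let ?R = "\<lambda>(a, b). P \<subseteq> {x. a \<bullet> x \<le> b} \<and> f = P \<inter> {x. a \<bullet> x = b}"
  have "f exposed_face_of P"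
    using f by (simp add: exposed_face_of_polyhedron[OF polytope_imp_polyhedron[OF P]] edges_def)
  then obtain a b where "?R (a, b)" unfolding exposed_face_of_def by auto
  then have "?R (SOME z. ?R z)" by (rule someI)
  then obtain a b where ab: "(SOME z. ?R z) = (a, b)" "P \<subseteq> {x. a \<bullet> x \<le> b}" "f = P \<inter> {x. a \<bullet> x = b}"
    by (cases "SOME z. ?R z") auto
  have s: "slack P f x = b - a \<bullet> x" unfolding slack_def ab(1) by simp
  show "slack P f x \<ge> 0" unfolding s using ab(2) x by auto
  show "slack P f x = 0 \<longleftrightarrow> x \<in> f" unfolding s using ab(3) x by auto
qed

lemma slack_interior:
  assumes P: "polytope P" and f: "f \<in> edges P" and x: "x \<in> interior P" and "aff_dim P \<noteq> 1"
  shows "slack P f x > 0"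
proof -
  have xP: "x \<in> P" using x interior_subset by blast
  have "f face_of P" "f \<noteq> P" using f assms(4) by (auto simp: edges_def)
  then have "x \<notin> f" using face_of_disjoint_interior x by blast
  then show ?thesis using slack_nonneg[OF P f xP] slack_zero_iff[OF P f xP] by simp
qed

section \<open>The frame at a vertex\<close>

locale delzant_polygon =
  fixes \<Lambda> P :: "'a::euclidean_space set"
  assumes dim: "DIM('a) = 2" and lattice: "lattice_in UNIV \<Lambda>"
    and lattice_polytope: "lattice_polytope \<Lambda> P" and delzant: "Delzant \<Lambda> P" and nonempty: "P \<noteq> {}"
begin

lemma polytope: "polytope P" and vertices_lattice: "v \<in> vertices P \<Longrightarrow> v \<in> \<Lambda>"
  using lattice_polytope by (auto simp: lattice_polytope_def)

lemma finite_edges: "finite (edges P)"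
  by (rule finite_subset[OF _ finite_polytope_faces[OF polytope]]) (auto simp: edges_def)

lemma finite_vertices: "finite (vertices P)"
  unfolding vertices_def face_of_singleton by (rule finite_polyhedron_extreme_points[OF polytope_imp_polyhedron[OF polytope]])

lemma vertex_mem: "v \<in> vertices P \<Longrightarrow> v \<in> P"
  unfolding vertices_def using face_of_imp_subset by blast

lemma edge_subset: "f \<in> edges P \<Longrightarrow> f \<subseteq> P"
  unfolding edges_def using face_of_imp_subset by blast

lemma card_vertex_edges: "v \<in> vertices P \<Longrightarrow> card {f \<in> edges P. v \<in> f} = 2"
  using delzant dim by (simp add: Delzant_def)

lemma edge_half_line_point:
  assumes f: "f \<in> edges P" and v: "v \<in> f" and h: "f \<subseteq> half_line v e"
  obtains a where "a > 0" "v + a *\<^sub>R e \<in> f"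
proof -
  obtain p q where pq: "p \<noteq> q" "f = closed_segment p q" using edge_segment[OF polytope f] by blast
  then have "p \<in> f" "q \<in> f" by auto
  then obtain x where x: "x \<in> f" "x \<noteq> v" using pq(1) by metis
  then obtain t where t: "t \<ge> 0" "x = v + t *\<^sub>R e" using h unfolding half_line_def by blast
  then have "t > 0" using x(2) by (cases "t = 0") auto
  then show ?thesis using that x(1) t(2) by blast
qed

text \<open>Edges are convex and leave v along the same ray, so they share the point at the smaller
  of the two lengths and coincide.\<close>

lemma edge_half_line_unique:
  assumes f: "f \<in> edges P" and g: "g \<in> edges P" and v: "v \<in> f" "v \<in> g" and h: "f \<subseteq> half_line v e" "g \<subseteq> half_line v e"
    and e: "e \<noteq> 0"
  shows "f = g"
proof -
  obtain a where a: "a > 0" "v + a *\<^sub>R e \<in> f" using edge_half_line_point[OF f v(1) h(1)] .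
  obtain b where b: "b > 0" "v + b *\<^sub>R e \<in> g" using edge_half_line_point[OF g v(2) h(2)] .
  define m where "m = min a b"
  have m: "m > 0" using a b by (simp add: m_def)
  have mem: "v + m *\<^sub>R e \<in> k" if k: "k \<in> edges P" "v \<in> k" and c: "v + c *\<^sub>R e \<in> k" "c > 0" "m \<le> c" for k c
  proof -
    have "convex k" using k(1) unfolding edges_def using face_of_imp_convex by blast
    then have "(1 - m / c) *\<^sub>R v + (m / c) *\<^sub>R (v + c *\<^sub>R e) \<in> k"
      using k(2) c m by (intro convexD) (auto simp: field_simps)
    moreover have "(1 - m / c) *\<^sub>R v + (m / c) *\<^sub>R (v + c *\<^sub>R e) = v + m *\<^sub>R e"
      using c by (simp add: algebra_simps)
    ultimately show ?thesis by simp
  qed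
  have "v + m *\<^sub>R e \<in> f" "v + m *\<^sub>R e \<in> g"
    using mem[OF f v(1) a(2,1)] mem[OF g v(2) b(2,1)] by (simp_all add: m_def)
  moreover have "v \<noteq> v + m *\<^sub>R e" using m e by simp
  ultimately show ?thesis using edge_eqI[OF f g v(1) v(2)] by blast
qed

text \<open>The two edges at v need different vectors of the Delzant basis, and in dimension 2 these
  exhaust it.\<close>

lemma vertex_basis:
  assumes v: "v \<in> vertices P"
  obtains e1 e2 f1 f2 where "integral_basis \<Lambda> {e1, e2}" "{f \<in> edges P. v \<in> f} = {f1, f2}"
    "f1 \<subseteq> half_line v e1" "f2 \<subseteq> half_line v e2"
proof -
  have "\<exists>E. integral_basis \<Lambda> E \<and> (\<forall>f\<in>edges P. v \<in> f \<longrightarrow> (\<exists>e\<in>E. f \<subseteq> half_line v e))"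
    using delzant v unfolding Delzant_def by simp
  then obtain E where "integral_basis \<Lambda> E \<and> (\<forall>f\<in>edges P. v \<in> f \<longrightarrow> (\<exists>e\<in>E. f \<subseteq> half_line v e))" ..
  note E = conjunct1[OF this] conjunct2[OF this, rule_format]
  obtain f1 f2 where f: "{f \<in> edges P. v \<in> f} = {f1, f2}" "f1 \<noteq> f2"
    using card_vertex_edges[OF v] unfolding card_2_iff by (elim exE conjE) (rule that)
  note f1 = Collect_pairD(1,2)[OF f(1)] and f2 = Collect_pairD(3,4)[OF f(1)]
  obtain e1 where e1: "e1 \<in> E" "f1 \<subseteq> half_line v e1" using E(2)[OF f1] by blast
  obtain e2 where e2: "e2 \<in> E" "f2 \<subseteq> half_line v e2" using E(2)[OF f2] by blast
  have ind: "independent E" using E(1) by (simp add: integral_basis_def)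
  have "e1 \<noteq> 0" using ind e1(1) dependent_zero by blast
  then have "e1 \<noteq> e2" using edge_half_line_unique[OF f1(1) f2(1) f1(2) f2(2) e1(2)] e2(2) f(2) by blast
  moreover have "card E \<le> 2" using independent_card_le[OF ind] dim by simp
  ultimately have "{e1, e2} = E"
    using e1(1) e2(1) finite_independent_basis[OF E(1)] by (intro card_seteq) auto
  then have "integral_basis \<Lambda> {e1, e2}" using E(1) by simp
  then show ?thesis by (rule that[OF _ f(1) e1(2) e2(2)])
qed

text \<open>In coordinates s, t at v the slack of each edge is a positive multiple of one
  coordinate: it vanishes at two points of its own edge and is positive at the far point of the
  other edge.\<close>

lemma vertex_frame:
  assumes v: "v \<in> vertices P" and ib: "integral_basis \<Lambda> {e1, e2}"
    and f: "{f \<in> edges P. v \<in> f} = {f1, f2}" "f1 \<subseteq> half_line v e1" "f2 \<subseteq> half_line v e2"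
  shows "plane_basis e1 e2" and "f1 \<noteq> f2" and "\<exists>a>0. v + a *\<^sub>R e1 \<in> f1" and "\<exists>b>0. v + b *\<^sub>R e2 \<in> f2"
    and "v + s *\<^sub>R e1 + t *\<^sub>R e2 \<in> half_plane P f1 \<longleftrightarrow> t \<ge> 0"
    and "v + s *\<^sub>R e1 + t *\<^sub>R e2 \<in> half_plane P f2 \<longleftrightarrow> s \<ge> 0"
    and "slack P f1 (v + s *\<^sub>R e1 + t *\<^sub>R e2) = 0 \<longleftrightarrow> t = 0"
proof -
  show pb: "plane_basis e1 e2" by (rule integral_basis_plane[OF dim lattice ib])
  show ne: "f1 \<noteq> f2"
  proof
    assume "f1 = f2"
    then show False using card_vertex_edges[OF v] unfolding f(1) by simp
  qed
  note f1 = Collect_pairD(1,2)[OF f(1)] and f2 = Collect_pairD(3,4)[OF f(1)]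
  obtain a where a: "a > 0" "v + a *\<^sub>R e1 \<in> f1" using edge_half_line_point[OF f1 f(2)] .
  obtain b where b: "b > 0" "v + b *\<^sub>R e2 \<in> f2" using edge_half_line_point[OF f2 f(3)] .
  show "\<exists>a>0. v + a *\<^sub>R e1 \<in> f1" "\<exists>b>0. v + b *\<^sub>R e2 \<in> f2" using a b by blast+
  have slack: "\<exists>c>0. \<forall>s t. slack P f (v + s *\<^sub>R e + t *\<^sub>R e') = t * c"
    if f: "f \<in> edges P" "v \<in> f" "v + a *\<^sub>R e \<in> f" "a > 0" and g: "g \<in> edges P" "v \<in> g" "v + b *\<^sub>R e' \<in> g" "b > 0" and fg: "f \<noteq> g"
      and e': "e' \<noteq> 0" for f g e e' a b
  proof -
    have P: "v \<in> P" "v + a *\<^sub>R e \<in> P" "v + b *\<^sub>R e' \<in> P" using f g edge_subset by blast+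
    have 0: "slack P f v = 0" "slack P f (v + a *\<^sub>R e) = 0"
      using slack_zero_iff[OF polytope f(1) P(1)] slack_zero_iff[OF polytope f(1) P(2)] f by simp_all
    have "v \<noteq> v + b *\<^sub>R e'" using e' g(4) by simp
    then have "v + b *\<^sub>R e' \<notin> f" using edge_eqI[OF f(1) g(1) f(2) g(2) _ g(3)] fg by blast
    then have pos: "slack P f (v + b *\<^sub>R e') > 0"
      using slack_zero_iff[OF polytope f(1) P(3)] slack_nonneg[OF polytope f(1) P(3)] by simp
    have s1: "slack P f (v + e) = 0" using slack_affine2[of P f v a e 0 0] 0 f(4) by simp
    have "slack P f (v + b *\<^sub>R e') = b * slack P f (v + e')" using slack_affine2[of P f v 0 0 b e'] 0 by simp
    then have "slack P f (v + e') > 0" using pos g(4) by (simp add: zero_less_mult_iff)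
    then show ?thesis using slack_affine2[of P f v _ e _ e'] 0 s1 by auto
  qed
  obtain c where c: "c > 0" "\<And>s t. slack P f1 (v + s *\<^sub>R e1 + t *\<^sub>R e2) = t * c"
    using slack[OF f1 a(2,1) f2 b(2,1) ne] plane_basis_nonzero[OF pb] by blast
  obtain d where d: "d > 0" "\<And>s t. slack P f2 (v + s *\<^sub>R e2 + t *\<^sub>R e1) = t * d"
    using slack[OF f2 b(2,1) f1 a(2,1) ne[symmetric]] plane_basis_nonzero[OF pb] by blast
  show "v + s *\<^sub>R e1 + t *\<^sub>R e2 \<in> half_plane P f1 \<longleftrightarrow> t \<ge> 0"
    unfolding half_plane_def mem_Collect_eq c(2) using c(1) by (simp add: zero_le_mult_iff)
  have sw: "slack P f2 (v + s *\<^sub>R e1 + t *\<^sub>R e2) = s * d" using d(2)[of t s] by (simp only: add_ac)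
  show "v + s *\<^sub>R e1 + t *\<^sub>R e2 \<in> half_plane P f2 \<longleftrightarrow> s \<ge> 0"
    unfolding half_plane_def mem_Collect_eq sw using d(1) by (simp add: zero_le_mult_iff)
  show "slack P f1 (v + s *\<^sub>R e1 + t *\<^sub>R e2) = 0 \<longleftrightarrow> t = 0" unfolding c(2) using c(1) by simp
qed

lemma subset_half_plane: "f \<in> edges P \<Longrightarrow> P \<subseteq> half_plane P f"
  unfolding half_plane_def using slack_nonneg[OF polytope] by blast

lemma vertex_cone:
  assumes v: "v \<in> vertices P" and ib: "integral_basis \<Lambda> {e1, e2}"
    and f: "{f \<in> edges P. v \<in> f} = {f1, f2}" "f1 \<subseteq> half_line v e1" "f2 \<subseteq> half_line v e2"
  shows "(+) v ` cone2 e1 e2 = half_plane P f1 \<inter> half_plane P f2" and "P \<subseteq> (+) v ` cone2 e1 e2"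
proof -
  note fr = vertex_frame[OF v ib f]
  show eq: "(+) v ` cone2 e1 e2 = half_plane P f1 \<inter> half_plane P f2"
  proof (intro equalityI subsetI)
    fix x assume "x \<in> (+) v ` cone2 e1 e2"
    then obtain s t where "s \<ge> 0" "t \<ge> 0" "x = v + s *\<^sub>R e1 + t *\<^sub>R e2" by (auto simp: cone2_def add.assoc)
    then show "x \<in> half_plane P f1 \<inter> half_plane P f2" using fr(5,6)[of s t] by simp
  next
    fix x assume x: "x \<in> half_plane P f1 \<inter> half_plane P f2"
    obtain s t where "x - v = s *\<^sub>R e1 + t *\<^sub>R e2" using fr(1) unfolding plane_basis_def by blast
    then have x_eq: "x = v + s *\<^sub>R e1 + t *\<^sub>R e2" by (simp add: algebra_simps)
    then show "x \<in> (+) v ` cone2 e1 e2" using x fr(5,6)[of s t] cone2_mem[of s t v e1 e2] by simp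
  qed
  show "P \<subseteq> (+) v ` cone2 e1 e2"
    unfolding eq using subset_half_plane Collect_pairD(1,3)[OF f(1)] by blast
qed

lemma affine_hull_P: "affine hull P = UNIV"
proof -
  obtain v where "v extreme_point_of P"
    using extreme_point_exists_convex[OF polytope_imp_compact polytope_imp_convex nonempty] polytope by blast
  then have v: "v \<in> vertices P" by (simp add: vertices_def face_of_singleton)
  obtain e1 e2 f1 f2 where b: "integral_basis \<Lambda> {e1, e2}" "{f \<in> edges P. v \<in> f} = {f1, f2}"
    "f1 \<subseteq> half_line v e1" "f2 \<subseteq> half_line v e2" using vertex_basis[OF v] .
  note fr = vertex_frame[OF v b]
  have f12: "f1 \<subseteq> P" "f2 \<subseteq> P" using Collect_pairD(1,3)[OF b(2)] edge_subset by blast+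
  obtain a where a: "a > 0" "v + a *\<^sub>R e1 \<in> P" using fr(3) f12 by blast
  obtain c where c: "c > 0" "v + c *\<^sub>R e2 \<in> P" using fr(4) f12 by blast
  have "x \<in> affine hull P" for x
  proof -
    obtain s t where "x - v = s *\<^sub>R e1 + t *\<^sub>R e2" using fr(1) unfolding plane_basis_def by blast
    then have "x = (1 - s / a - t / c) *\<^sub>R v + (s / a) *\<^sub>R (v + a *\<^sub>R e1) + (t / c) *\<^sub>R (v + c *\<^sub>R e2)"
      using a c by (simp add: algebra_simps)
    then have "x \<in> affine hull {v, v + a *\<^sub>R e1, v + c *\<^sub>R e2}"
      unfolding affine_hull_3 mem_Collect_eq
      by (intro exI[of _ "1 - s / a - t / c"] exI[of _ "s / a"] exI[of _ "t / c"]) simp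
    then show ?thesis using hull_mono[of "{v, v + a *\<^sub>R e1, v + c *\<^sub>R e2}" P affine] a c vertex_mem[OF v] by blast
  qed
  then show ?thesis by blast
qed

lemma aff_dim_P: "aff_dim P = 2"
  using aff_dim_affine_hull[of P] by (simp add: affine_hull_P aff_dim_UNIV dim)

lemma interior_nonempty: "interior P \<noteq> {}"
  using rel_interior_interior[OF affine_hull_P] rel_interior_eq_empty[OF polytope_imp_convex[OF polytope]] nonempty by simp

end

subsection \<open>The Brianchon-Gram decomposition\<close>

definition corner :: "'a::euclidean_space set \<Rightarrow> 'a \<Rightarrow> 'a set" where
  "corner P v = {x. \<forall>f\<in>edges P. v \<in> f \<longrightarrow> x \<in> half_plane P f}"

context delzant_polygon
begin

lemma vertex_basis_edge:
  assumes v: "v \<in> vertices P" and f: "f \<in> edges P" "v \<in> f"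
  obtains e1 e2 g where "integral_basis \<Lambda> {e1, e2}" "{f \<in> edges P. v \<in> f} = {f, g}"
    "f \<subseteq> half_line v e1" "g \<subseteq> half_line v e2"
proof -
  obtain e1 e2 f1 f2 where b: "integral_basis \<Lambda> {e1, e2}" "{f \<in> edges P. v \<in> f} = {f1, f2}"
    "f1 \<subseteq> half_line v e1" "f2 \<subseteq> half_line v e2" using vertex_basis[OF v] .
  have "f \<in> {f \<in> edges P. v \<in> f}" using f by simp
  then have "f = f1 \<or> f = f2" unfolding b(2) by simp
  then show ?thesis
  proof
    assume "f = f1"
    then show ?thesis using that[of e1 e2 f2] b by simp
  next
    assume f2: "f = f2"
    have "integral_basis \<Lambda> {e2, e1}" "{f \<in> edges P. v \<in> f} = {f2, f1}"
      using b(1) b(2) by (simp_all only: insert_commute)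
    then show ?thesis unfolding f2[symmetric] using that[of e2 e1 f1] b(3,4) f2 by simp
  qed
qed

lemma edge_line:
  assumes f: "f \<in> edges P" and v: "v \<in> vertices P" "v \<in> f" and w: "w \<in> f" "v \<noteq> w" and y: "slack P f y = 0"
  shows "\<exists>s. y = (1 - s) *\<^sub>R v + s *\<^sub>R w"
proof -
  obtain e1 e2 g where b: "integral_basis \<Lambda> {e1, e2}" "{f \<in> edges P. v \<in> f} = {f, g}"
    "f \<subseteq> half_line v e1" "g \<subseteq> half_line v e2" using vertex_basis_edge[OF v(1) f v(2)] .
  note fr = vertex_frame[OF v(1) b]
  obtain l where l: "w = v + l *\<^sub>R e1" using w(1) b(3) unfolding half_line_def by blast
  have "l \<noteq> 0" using l w(2) by auto
  obtain s t where "y - v = s *\<^sub>R e1 + t *\<^sub>R e2" using fr(1) unfolding plane_basis_def by blast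
  then have y_eq: "y = v + s *\<^sub>R e1 + t *\<^sub>R e2" by (simp add: algebra_simps)
  then have "t = 0" using y fr(7)[of s t] by simp
  then have "y = (1 - s / l) *\<^sub>R v + (s / l) *\<^sub>R w" unfolding y_eq l using \<open>l \<noteq> 0\<close> by (simp add: algebra_simps)
  then show ?thesis by blast
qed

lemma slack_pos:
  assumes f: "f \<in> edges P" and g: "g \<in> edges P" and fg: "f \<noteq> g" and x: "x \<in> f" "x \<in> g" and y: "y \<in> f" "x \<noteq> y"
  shows "slack P g y > 0"
proof -
  have "y \<in> P" using y(1) edge_subset[OF f] by blast
  moreover have "y \<notin> g" using edge_eqI[OF f g x y(1) _ y(2)] fg by blast
  ultimately show ?thesis using slack_nonneg[OF polytope g] slack_zero_iff[OF polytope g, of y] by fastforce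
qed

text \<open>The slack of the other edge at v is 0 at v and positive at w, so on the line through v
  and w its sign is that of s. Exactly two edges meet at v, so there is such an edge.\<close>

lemma other_edges_pos:
  assumes f: "f \<in> edges P" and v: "v \<in> vertices P" "v \<in> f" and w: "w \<in> f" "v \<noteq> w"
  shows "(\<forall>g\<in>edges P. v \<in> g \<longrightarrow> g \<noteq> f \<longrightarrow> slack P g ((1 - s) *\<^sub>R v + s *\<^sub>R w) > 0) \<longleftrightarrow> s > 0"
proof -
  have sl: "slack P g ((1 - s) *\<^sub>R v + s *\<^sub>R w) > 0 \<longleftrightarrow> s > 0" if g: "g \<in> edges P" "v \<in> g" "g \<noteq> f" for g
  proof -
    have "slack P g v = 0" using slack_zero_iff[OF polytope g(1) vertex_mem[OF v(1)]] g(2) by simp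
    moreover have "slack P g w > 0" using slack_pos[OF f g(1) g(3)[symmetric] v(2) g(2) w] .
    ultimately show ?thesis by (simp add: slack_affine zero_less_mult_iff)
  qed
  obtain e1 e2 g where b: "integral_basis \<Lambda> {e1, e2}" "{f \<in> edges P. v \<in> f} = {f, g}"
    "f \<subseteq> half_line v e1" "g \<subseteq> half_line v e2" using vertex_basis_edge[OF v(1) f v(2)] .
  have "g \<in> edges P" "v \<in> g" "g \<noteq> f"
    using Collect_pairD(3,4)[OF b(2)] vertex_frame(2)[OF v(1) b] by simp_all
  then show ?thesis using sl by metis
qed

text \<open>A segment from an interior point to x leaves P through some edge. Its slack is positive
  at the start and zero at the exit, hence negative at x.\<close>

lemma exists_violated_edge:
  assumes x: "x \<notin> P"
  shows "\<exists>f\<in>edges P. slack P f x < 0"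
proof -
  obtain p where p: "p \<in> interior P" using interior_nonempty by blast
  then have pP: "p \<in> P" using interior_subset by blast
  have "closed_segment p x \<inter> frontier P \<noteq> {}"
  proof (rule connected_Int_frontier)
    have "p \<in> closed_segment p x \<inter> P" "x \<in> closed_segment p x - P" using pP x by auto
    then show "closed_segment p x \<inter> P \<noteq> {}" "closed_segment p x - P \<noteq> {}" by blast+
  qed simp
  then obtain y where y: "y \<in> closed_segment p x" "y \<in> frontier P" by blast
  have "y \<in> rel_frontier P" using y(2) rel_frontier_frontier[OF affine_hull_P] by simp
  then obtain f where f: "f facet_of P" "y \<in> f"
    unfolding rel_frontier_of_polyhedron[OF polytope_imp_polyhedron[OF polytope]] by blast
  then have fE: "f \<in> edges P" by (simp add: facet_of_def edges_def aff_dim_P)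
  have yP: "y \<in> P" using f edge_subset[OF fE] by blast
  obtain t where t: "0 \<le> t" "t \<le> 1" "y = (1 - t) *\<^sub>R p + t *\<^sub>R x" using y(1) unfolding closed_segment_def by blast
  have "t \<noteq> 1" using t(3) yP x by auto
  have "(1 - t) * slack P f p + t * slack P f x = 0"
    using slack_affine[of P f t p x] slack_zero_iff[OF polytope fE yP] f(2) t(3) by simp
  moreover have "(1 - t) * slack P f p > 0"
    using \<open>t \<noteq> 1\<close> t slack_interior[OF polytope fE p] aff_dim_P by simp
  ultimately have "t * slack P f x < 0" by linarith
  then have "slack P f x < 0" using t by (simp add: mult_less_0_iff)
  then show ?thesis using fE by blast
qed

text \<open>The points p to be avoided lie on finitely many lines through x, whose union has empty
  interior.\<close>

lemma generic_interior_point: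
  assumes x: "x \<notin> P"
  obtains p where "p \<in> interior P" "\<And>v t. v \<in> vertices P \<Longrightarrow> (1 - t) *\<^sub>R p + t *\<^sub>R x \<noteq> v"
proof -
  let ?H = "\<lambda>V. \<Union>v\<in>V. affine hull {x, v}"
  have "closed (?H V) \<and> interior (?H V) = {}" if "finite V" for V
    using that
  proof induction
    case (insert v V)
    have "interior (affine hull {x, v}) = {}"
      by (rule empty_interior_affine_hull) (use card_insert_le_m1[of 2 "{v}" x] dim in \<open>auto simp: card_insert_if\<close>)
    then show ?case using insert interior_closed_Un_empty_interior[of "affine hull {x, v}" "?H V"]
      by (simp add: closed_Un)
  qed simp
  from this[OF finite_vertices] have "interior (?H (vertices P)) = {}" by blast
  moreover have "\<not> interior P \<subseteq> interior (?H (vertices P))" if "interior (?H (vertices P)) = {}"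
    using that interior_nonempty by blast
  ultimately have "\<not> interior P \<subseteq> ?H (vertices P)" using interior_maximal[OF _ open_interior] by blast
  then obtain p where p: "p \<in> interior P" "p \<notin> ?H (vertices P)" by blast
  have "(1 - t) *\<^sub>R p + t *\<^sub>R x \<noteq> v" if v: "v \<in> vertices P" for v t
  proof
    assume eq: "(1 - t) *\<^sub>R p + t *\<^sub>R x = v"
    have "t \<noteq> 1" using eq vertex_mem[OF v] x by auto
    have "p = (1 / (1 - t)) *\<^sub>R ((1 - t) *\<^sub>R p)" using \<open>t \<noteq> 1\<close> by simp
    also have "(1 - t) *\<^sub>R p = v - t *\<^sub>R x" by (simp add: eq[symmetric])
    also have "(1 / (1 - t)) *\<^sub>R (v - t *\<^sub>R x) = (- t / (1 - t)) *\<^sub>R x + (1 / (1 - t)) *\<^sub>R v"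
      by (simp add: scaleR_diff_right)
    finally have "p = (- t / (1 - t)) *\<^sub>R x + (1 / (1 - t)) *\<^sub>R v" .
    moreover have "- t / (1 - t) + 1 / (1 - t) = 1" using \<open>t \<noteq> 1\<close> by (simp add: field_simps)
    ultimately have "p \<in> affine hull {x, v}" unfolding affine_hull_2 by blast
    then show False using p(2) v by blast
  qed
  then show ?thesis using that p(1) by blast
qed

lemma sum_vertex_edge:
  fixes F :: "'a \<Rightarrow> 'a set \<Rightarrow> 'b::comm_monoid_add"
  shows "(\<Sum>v\<in>vertices P. \<Sum>f | f \<in> edges P \<and> v \<in> f. F v f) = (\<Sum>f\<in>edges P. \<Sum>v | v \<in> vertices P \<and> v \<in> f. F v f)"
  by (rule sum.swap_restrict[OF finite_vertices finite_edges])

lemma card_edge_vertices: "f \<in> edges P \<Longrightarrow> card {v \<in> vertices P. v \<in> f} = 2"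
  by (rule edge_segment[OF polytope, of f]) simp_all

text \<open>Double counting of incidences: two edges at each vertex, two vertices on each
  edge.\<close>

lemma card_vertices_edges: "card (vertices P) = card (edges P)"
proof -
  have "(\<Sum>v\<in>vertices P. card {f \<in> edges P. v \<in> f}) = (\<Sum>f\<in>edges P. card {v \<in> vertices P. v \<in> f})"
    using sum_vertex_edge[of "\<lambda>_ _. 1::nat"] by (simp only: card_eq_sum)
  then show ?thesis by (simp add: card_vertex_edges card_edge_vertices)
qed

text \<open>Outside of the polygon the edges violated at \<open>x\<close> are crossed by a segment from a generic
  interior point to \<open>x\<close>.  A vertex on a violated edge is charged to the edge crossed first: the
  edge through which the segment leaves the polygon is charged twice and every other one once.\<close>

lemma violated_count:
  assumes x: "x \<notin> P"
  shows "(\<Sum>v\<in>vertices P. 1 - of_bool (x \<in> corner P v)) = (\<Sum>f\<in>edges P. 1 - of_bool (x \<in> half_plane P f)) + (1::int)"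
proof -
  obtain p where p: "p \<in> interior P" "\<And>v t. v \<in> vertices P \<Longrightarrow> (1 - t) *\<^sub>R p + t *\<^sub>R x \<noteq> v"
    using generic_interior_point[OF x] by blast
  define y where "y = (\<lambda>t. (1 - t) *\<^sub>R p + t *\<^sub>R x)"
  define B where "B = {f \<in> edges P. slack P f x < 0}"
  \<comment> \<open>The parameter at which the segment from p to x crosses the line carrying
    f.\<close>
  define \<tau> where "\<tau> = (\<lambda>f. slack P f p / (slack P f p - slack P f x))"
  \<comment> \<open>v is charged to the violated edge f when the other edge at v is crossed later or
    not at all.\<close>
  define cnt where "cnt = (\<lambda>v f. f \<in> B \<and> (\<forall>g\<in>edges P. v \<in> g \<longrightarrow> g \<noteq> f \<longrightarrow> slack P g (y (\<tau> f)) > 0))"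
  have sp: "slack P f p > 0" if "f \<in> edges P" for f
    using slack_interior[OF polytope that p(1)] aff_dim_P by simp
  have ys: "slack P f (y t) = (1 - t) * slack P f p + t * slack P f x" for f t
    unfolding y_def by (rule slack_affine)
  have BE: "f \<in> edges P" "slack P f x < 0" if "f \<in> B" for f using that by (auto simp: B_def)
  have \<tau>: "0 < \<tau> f" "\<tau> f < 1" if "f \<in> B" for f
    using sp[OF BE(1)[OF that]] BE(2)[OF that] by (simp_all add: \<tau>_def)
  have cross: "slack P f (y t) > 0 \<longleftrightarrow> t < \<tau> f" "slack P f (y t) = 0 \<longleftrightarrow> t = \<tau> f" if "f \<in> B" for f t
  proof -
    define a b where "a = slack P f p" and "b = slack P f x"
    have ab: "a > 0" "b < 0" using sp[OF BE(1)[OF that]] BE(2)[OF that] by (simp_all add: a_def b_def)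
    have eq: "slack P f (y t) = (a - b) * (\<tau> f - t)"
      unfolding ys \<tau>_def a_def[symmetric] b_def[symmetric] using ab by (simp add: field_simps)
    show "slack P f (y t) > 0 \<longleftrightarrow> t < \<tau> f" "slack P f (y t) = 0 \<longleftrightarrow> t = \<tau> f"
      unfolding eq using ab by (auto simp: zero_less_mult_iff)
  qed
  have good: "slack P f (y t) > 0" if "f \<in> edges P" "f \<notin> B" "0 < t" "t < 1" for f t
  proof -
    have "slack P f x \<ge> 0" using that by (simp add: B_def)
    then have "t * slack P f x \<ge> 0" using that by simp
    moreover have "(1 - t) * slack P f p > 0" using that sp by simp
    ultimately show ?thesis unfolding ys by linarith
  qed
  have vertex: "(\<Sum>f | f \<in> edges P \<and> v \<in> f. of_bool (cnt v f)) = (1 - of_bool (x \<in> corner P v) :: int)" if v: "v \<in> vertices P" for v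
  proof -
    obtain e1 e2 f1 f2 where b: "integral_basis \<Lambda> {e1, e2}" "{f \<in> edges P. v \<in> f} = {f1, f2}"
      "f1 \<subseteq> half_line v e1" "f2 \<subseteq> half_line v e2" using vertex_basis[OF v] .
    note ne = vertex_frame(2)[OF v b] and f1 = Collect_pairD(1,2)[OF b(2)] and f2 = Collect_pairD(3,4)[OF b(2)]
    have all: "(\<forall>g\<in>edges P. v \<in> g \<longrightarrow> Q g) \<longleftrightarrow> Q f1 \<and> Q f2" for Q
    proof -
      have "(\<forall>g\<in>edges P. v \<in> g \<longrightarrow> Q g) \<longleftrightarrow> (\<forall>g\<in>{f \<in> edges P. v \<in> f}. Q g)" by blast
      then show ?thesis unfolding b(2) by simp
    qed
    have c1: "cnt v f1 \<longleftrightarrow> f1 \<in> B \<and> slack P f2 (y (\<tau> f1)) > 0" and c2: "cnt v f2 \<longleftrightarrow> f2 \<in> B \<and> slack P f1 (y (\<tau> f2)) > 0"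
      unfolding cnt_def all using ne by simp_all
    have co: "x \<in> corner P v \<longleftrightarrow> f1 \<notin> B \<and> f2 \<notin> B"
      unfolding corner_def mem_Collect_eq all half_plane_def using f1 f2 by (simp add: B_def not_less)
    \<comment> \<open>Ties cannot occur: equal times would make the segment pass through v, against
      the choice of p. So a vertex on a violated edge is charged exactly once.\<close>
    have "\<tau> f1 \<noteq> \<tau> f2" if "f1 \<in> B" "f2 \<in> B"
    proof
      assume eq: "\<tau> f1 = \<tau> f2"
      have z: "slack P f1 (y (\<tau> f1)) = 0" "slack P f2 (y (\<tau> f1)) = 0" using cross(2) that eq by simp_all
      obtain a where a: "a > 0" "v + a *\<^sub>R e1 \<in> f1" using vertex_frame(3)[OF v b] by blast
      have "v \<noteq> v + a *\<^sub>R e1" using a(1) plane_basis_nonzero[OF vertex_frame(1)[OF v b]] by simp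
      note w = a(2) this
      obtain s where s: "y (\<tau> f1) = (1 - s) *\<^sub>R v + s *\<^sub>R (v + a *\<^sub>R e1)" using edge_line[OF f1(1) v f1(2) w z(1)] by blast
      have "slack P f2 v = 0" using slack_zero_iff[OF polytope f2(1) vertex_mem[OF v]] f2(2) by simp
      then have "s * slack P f2 (v + a *\<^sub>R e1) = 0" using z(2) unfolding s slack_affine by simp
      then have "s = 0" using slack_pos[OF f1(1) f2(1) ne f1(2) f2(2) w] by simp
      then show False using p(2)[OF v, of "\<tau> f1"] s by (simp add: y_def)
    qed
    then have "of_bool (cnt v f1) + of_bool (cnt v f2) = (1 - of_bool (x \<in> corner P v) :: int)"
      using cross(1) good[OF f1(1) _ \<tau>[of f2]] good[OF f2(1) _ \<tau>[of f1]] unfolding c1 c2 co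
      by (cases "f1 \<in> B"; cases "f2 \<in> B") auto
    moreover have "sum F {f1, f2} = F f1 + F f2" for F :: "'a set \<Rightarrow> int" using ne by simp
    ultimately show ?thesis unfolding b(2) by (simp only:)
  qed
  \<comment> \<open>With the crossing point at parameter s on the line from v to w, v is charged for
    s > 0 and w for s < 1: both exactly when the crossing lies on the edge. Genericity excludes s =
    0 and s = 1.\<close>
  have edge: "(\<Sum>v | v \<in> vertices P \<and> v \<in> f. of_bool (cnt v f)) = (1 + of_bool (y (\<tau> f) \<in> f) :: int)" if f: "f \<in> B" for f
  proof -
    obtain v w where vw: "v \<noteq> w" "f = closed_segment v w" "{x \<in> vertices P. x \<in> f} = {v, w}"
      using edge_segment[OF polytope BE(1)[OF f]] .
    note v = Collect_pairD(1,2)[OF vw(3)] and w = Collect_pairD(3,4)[OF vw(3)]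
    have z: "slack P f (y (\<tau> f)) = 0" using cross(2)[OF f] by simp
    obtain s where s: "y (\<tau> f) = (1 - s) *\<^sub>R v + s *\<^sub>R w" using edge_line[OF BE(1)[OF f] v w(2) vw(1) z] by blast
    have s': "y (\<tau> f) = (1 - (1 - s)) *\<^sub>R w + (1 - s) *\<^sub>R v" unfolding s by (simp add: algebra_simps)
    have c1: "cnt v f \<longleftrightarrow> s > 0" unfolding cnt_def s by (simp only: f simp_thms other_edges_pos[OF BE(1)[OF f] v w(2) vw(1)])
    have c2: "cnt w f \<longleftrightarrow> 1 - s > 0" unfolding cnt_def s' by (simp only: f simp_thms other_edges_pos[OF BE(1)[OF f] w v(2) vw(1)[symmetric]])
    have ne: "y (\<tau> f) \<noteq> v" "y (\<tau> f) \<noteq> w" unfolding y_def by (rule p(2)[OF v(1)], rule p(2)[OF w(1)])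
    have s01: "s \<noteq> 0" "s \<noteq> 1"
      using ne unfolding s by auto
    have seg: "z \<in> f \<longleftrightarrow> z \<in> closed_segment v w" for z by (simp only: vw(2))
    have "y (\<tau> f) \<in> f \<longleftrightarrow> 0 \<le> s \<and> s \<le> 1"
    proof
      assume "y (\<tau> f) \<in> f"
      then have "(1 - s) *\<^sub>R v + s *\<^sub>R w \<in> closed_segment v w" using s seg by simp
      then obtain r where r: "0 \<le> r" "r \<le> 1" "(1 - s) *\<^sub>R v + s *\<^sub>R w = (1 - r) *\<^sub>R v + r *\<^sub>R w"
        unfolding in_segment(1) by (elim exE conjE) (rule that)
      from r(3) have "(s - r) *\<^sub>R (w - v) = 0" by (simp add: algebra_simps)
      then show "0 \<le> s \<and> s \<le> 1" using r(1,2) vw(1) by simp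
    next
      assume "0 \<le> s \<and> s \<le> 1"
      then have "(1 - s) *\<^sub>R v + s *\<^sub>R w \<in> closed_segment v w" unfolding in_segment(1) by (intro exI[of _ s]) simp
      then show "y (\<tau> f) \<in> f" using s seg by simp
    qed
    then have "of_bool (cnt v f) + of_bool (cnt w f) = (1 + of_bool (y (\<tau> f) \<in> f) :: int)"
      unfolding c1 c2 using s01 by auto
    moreover have "sum F {v, w} = F v + F w" for F :: "'a \<Rightarrow> int" using vw(1) by simp
    ultimately show ?thesis unfolding vw(3) by (simp only:)
  qed
  have "finite B" unfolding B_def using finite_edges by simp
  have "B \<noteq> {}" using exists_violated_edge[OF x] by (auto simp: B_def)
  \<comment> \<open>The edge crossed first. At its crossing time no edge has been violated yet, so
    the crossing point still belongs to P.\<close>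
  define m where "m = arg_min_on \<tau> B"
  have m: "m \<in> B" "\<And>g. g \<in> B \<Longrightarrow> \<tau> m \<le> \<tau> g"
    unfolding m_def using arg_min_if_finite(1)[OF \<open>finite B\<close> \<open>B \<noteq> {}\<close>] arg_min_least[OF \<open>finite B\<close> \<open>B \<noteq> {}\<close>] by blast+
  have mP: "y (\<tau> m) \<in> P"
  proof (rule ccontr)
    assume "y (\<tau> m) \<notin> P"
    then obtain g where g: "g \<in> edges P" "slack P g (y (\<tau> m)) < 0" using exists_violated_edge by blast
    have gB: "g \<in> B" using good[OF g(1) _ \<tau>[OF m(1)]] g(2) by fastforce
    show False using cross[OF gB, of "\<tau> m"] m(2)[OF gB] g(2) by linarith
  qed
  have mm: "y (\<tau> m) \<in> m" using slack_zero_iff[OF polytope BE(1)[OF m(1)] mP] cross(2)[OF m(1)] by simp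
  \<comment> \<open>Another violated edge crossed inside P would be crossed at the same time, so the
    crossing point would be a common point of two edges, a vertex.\<close>
  have uniq: "g = m" if g: "g \<in> B" "y (\<tau> g) \<in> g" for g
  proof (rule ccontr)
    assume ne: "g \<noteq> m"
    have "y (\<tau> g) \<in> P" using g edge_subset[OF BE(1)[OF g(1)]] by blast
    from slack_nonneg[OF polytope BE(1)[OF m(1)] this] have "\<tau> g \<le> \<tau> m" using cross[OF m(1), of "\<tau> g"] by linarith
    then have "\<tau> g = \<tau> m" using m(2)[OF g(1)] by simp
    then have Y: "y (\<tau> m) \<in> g" using g(2) by simp
    have "g \<inter> m \<subseteq> {y (\<tau> m)}" using edge_eqI[OF BE(1)[OF g(1)] BE(1)[OF m(1)] Y mm] ne by blast
    then have "g \<inter> m = {y (\<tau> m)}" using Y mm by blast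
    moreover have "(g \<inter> m) face_of P" using BE(1)[OF g(1)] BE(1)[OF m(1)] by (auto simp: edges_def intro: face_of_Int)
    ultimately have "y (\<tau> m) \<in> vertices P" by (simp add: vertices_def)
    then show False using p(2)[of "y (\<tau> m)" "\<tau> m"] by (simp add: y_def)
  qed
  have "(\<Sum>f\<in>B. of_bool (y (\<tau> f) \<in> f)) = (\<Sum>f\<in>B. if f = m then 1 else (0::int))"
  proof (rule sum.cong[OF refl])
    fix f assume f: "f \<in> B"
    show "of_bool (y (\<tau> f) \<in> f) = (if f = m then 1 else (0::int))"
    proof (cases "f = m")
      case False
      then have "y (\<tau> f) \<notin> f" using uniq[OF f] by blast
      then show ?thesis using False by simp
    qed (simp add: mm)
  qed
  also have "\<dots> = 1" using m(1) \<open>finite B\<close> by simp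
  finally have one: "(\<Sum>f\<in>B. of_bool (y (\<tau> f) \<in> f)) = (1::int)" .
  have "(\<Sum>v\<in>vertices P. 1 - of_bool (x \<in> corner P v)) = (\<Sum>v\<in>vertices P. \<Sum>f | f \<in> edges P \<and> v \<in> f. of_bool (cnt v f) :: int)"
    by (rule sum.cong[OF refl]) (rule vertex[symmetric])
  also have "\<dots> = (\<Sum>f\<in>edges P. \<Sum>v | v \<in> vertices P \<and> v \<in> f. of_bool (cnt v f))" by (rule sum_vertex_edge)
  also have "\<dots> = (\<Sum>f\<in>edges P. if f \<in> B then 1 + of_bool (y (\<tau> f) \<in> f) else 0)"
  proof (rule sum.cong[OF refl])
    fix f
    have "cnt v f = False" if "f \<notin> B" for v using that by (simp add: cnt_def)
    then show "(\<Sum>v | v \<in> vertices P \<and> v \<in> f. of_bool (cnt v f)) = (if f \<in> B then 1 + of_bool (y (\<tau> f) \<in> f) else (0::int))"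
      using edge by simp
  qed
  also have "\<dots> = (\<Sum>f\<in>edges P \<inter> B. 1 + of_bool (y (\<tau> f) \<in> f))"
    by (rule sum.inter_restrict[OF finite_edges, symmetric])
  also have EB: "edges P \<inter> B = B" by (auto simp: B_def)
  also have "(\<Sum>f\<in>B. 1 + of_bool (y (\<tau> f) \<in> f)) = (\<Sum>f\<in>B. 1) + (1::int)" unfolding sum.distrib one ..
  also have "(\<Sum>f\<in>B. 1) = (\<Sum>f\<in>edges P. if f \<in> B then 1 else (0::int))"
    unfolding sum.inter_restrict[OF finite_edges, symmetric] EB ..
  also have "\<dots> = (\<Sum>f\<in>edges P. 1 - of_bool (x \<in> half_plane P f))"
    by (intro sum.cong refl) (auto simp: B_def half_plane_def)
  finally show ?thesis .
qed

text \<open>Inside P all indicators are 1 and the numbers of vertices and edges agree; outside, the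
  count of violated conditions gives the relation.\<close>

lemma brianchon_gram:
  "(\<Sum>v\<in>vertices P. indicator (corner P v) x) - (\<Sum>f\<in>edges P. indicator (half_plane P f) x) + 1 = (indicator P x :: complex)"
proof -
  have "(\<Sum>v\<in>vertices P. of_bool (x \<in> corner P v)) - (\<Sum>f\<in>edges P. of_bool (x \<in> half_plane P f)) + 1 = (of_bool (x \<in> P) :: int)"
  proof (cases "x \<in> P")
    case True
    then have "x \<in> half_plane P f" if "f \<in> edges P" for f using subset_half_plane that by blast
    then show ?thesis using True by (simp add: corner_def card_vertices_edges)
  next
    case False
    then show ?thesis using violated_count[OF False] by (simp add: sum_subtractf card_vertices_edges)
  qed
  from arg_cong[OF this, of "of_int :: int \<Rightarrow> complex"] show ?thesis
    by (simp add: indicator_def)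
qed

end

subsection \<open>Locality and compactly supported line integrals\<close>

lemma funpow_nabla_cong_open:
  assumes "open U" "\<And>y. y \<in> U \<Longrightarrow> f y = g y" "x \<in> U"
  shows "(nabla u ^^ k) f x = (nabla u ^^ k) g x"
  unfolding funpow_nabla by (rule foldr_nabla_cong_open[OF assms(1,3,2)])

lemma edge_operator_cong_open:
  assumes "open U" "\<And>y. y \<in> U \<Longrightarrow> f y = g y" "x \<in> U"
  shows "edge_operator n u f x = edge_operator n u g x"
  using funpow_nabla_cong_open[where k = "n - 1" and u = u, OF assms] by (simp add: edge_operator_def)

lemma vertex_operator_cong_open:
  assumes U: "open U" and fg: "\<And>y. y \<in> U \<Longrightarrow> f y = g y" and x: "x \<in> U"
  shows "vertex_operator n e1 e2 u1 u2 c1 c2 f x = vertex_operator n e1 e2 u1 u2 c1 c2 g x"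
proof -
  have "(nabla u ^^ j) ((nabla w ^^ k) f) x = (nabla u ^^ j) ((nabla w ^^ k) g) x" for u w j k
    by (rule funpow_nabla_cong_open[OF U _ x]) (rule funpow_nabla_cong_open[OF U fg])
  then show ?thesis unfolding vertex_operator_def by simp
qed

lemma edge_operator_vanish:
  assumes "\<And>x. norm x > r \<Longrightarrow> \<psi> x = 0" "norm x > r"
  shows "edge_operator n u \<psi> x = 0"
  using foldr_nabla_vanish[of r \<psi> x "replicate (n - 1) u", OF assms] by (simp add: edge_operator_def)

lemma vertex_operator_vanish:
  assumes "\<And>x. norm x > r \<Longrightarrow> \<psi> x = 0" "norm x > r"
  shows "vertex_operator n e1 e2 u1 u2 c1 c2 \<psi> x = 0"
proof -
  have "(nabla u ^^ j) ((nabla w ^^ k) \<psi>) x = 0" for u w j k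
    using foldr_nabla_vanish[of r \<psi> x "replicate j u @ replicate k w", OF assms] by simp
  then show ?thesis unfolding vertex_operator_def by simp
qed

lemma edge_operator_continuous:
  assumes "smooth \<psi>"
  shows "continuous_on S (edge_operator n u \<psi>)"
proof -
  have "continuous_on S ((nabla u ^^ (n - 1)) \<psi>)"
    unfolding funpow_nabla by (rule smooth_continuous[OF smooth_foldr_nabla[OF assms]])
  then show ?thesis unfolding edge_operator_def[abs_def] by (intro continuous_intros)
qed

text \<open>In terms of a primitive this is ray from 0 to the right, plus ray from l to the left,
  minus the whole line. The length 3 m lets each of the three windows run past the support, as l is
  at most m; the third starts at - m.\<close>

lemma line_pieces:
  fixes H :: "real \<Rightarrow> complex"
  assumes H: "continuous_on UNIV H" and z: "\<And>s. \<bar>s\<bar> \<ge> real m \<Longrightarrow> H s = 0" and l: "0 \<le> l" "l \<le> real m"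
  shows "integral {0..real (3 * m)} H + integral {0..real (3 * m)} (\<lambda>s. H (l - s)) - integral {0..real (3 * m)} (\<lambda>s. H (s - real m))
    = integral {0..l} H"
proof -
  have "continuous_on {- 4 * real m - 1..4 * real m + 1} H" by (rule continuous_on_subset[OF H]) simp
  then obtain G where G:
    "\<And>x. x \<in> {- 4 * real m - 1..4 * real m + 1} \<Longrightarrow> (G has_vector_derivative H x) (at x within {- 4 * real m - 1..4 * real m + 1})"
    by (rule antiderivative_continuous) (rule that; blast)
  have G': "(G has_vector_derivative H x) (at x)" if "x \<in> {- 4 * real m..4 * real m}" for x
  proof -
    have i: "x \<in> interior {- 4 * real m - 1..4 * real m + 1}" using that by simp
    have "x \<in> {- 4 * real m - 1..4 * real m + 1}" using that by simp
    from G[OF this] show ?thesis unfolding at_within_interior[OF i] .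
  qed
  have I: "integral {a..b} H = G b - G a" if "a \<le> b" "a \<ge> - 4 * real m" "b \<le> 4 * real m" for a b
    by (rule integral_unique, rule fundamental_theorem_of_calculus[OF that(1)], rule has_vector_derivative_at_within, rule G') (use that in auto)
  have I1: "integral {0..real (3 * m)} H = G (real (3 * m)) - G 0" by (rule I) simp_all
  have I2: "integral {0..real (3 * m)} (\<lambda>s. H (l - s)) = - G (l - real (3 * m)) - - G (l - 0)"
  proof (rule integral_unique, rule fundamental_theorem_of_calculus)
    fix s assume s: "s \<in> {0..real (3 * m)}"
    have "((\<lambda>s. l - s) has_vector_derivative - 1) (at s)" by (auto intro!: derivative_eq_intros)
    from vector_diff_chain_at[OF this, of G "H (l - s)"]
    have "(G \<circ> (\<lambda>s. l - s) has_vector_derivative - H (l - s)) (at s)" using G'[of "l - s"] s l by simp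
    then have "((\<lambda>s. - G (l - s)) has_vector_derivative - (- H (l - s))) (at s)"
      unfolding o_def by (rule has_vector_derivative_minus)
    then show "((\<lambda>s. - G (l - s)) has_vector_derivative H (l - s)) (at s within {0..real (3 * m)})"
      by (simp add: has_vector_derivative_at_within)
  qed simp
  have I3: "integral {0..real (3 * m)} (\<lambda>s. H (s - real m)) = G (real (3 * m) - real m) - G (0 - real m)"
  proof (rule integral_unique, rule fundamental_theorem_of_calculus)
    fix s assume s: "s \<in> {0..real (3 * m)}"
    have "((\<lambda>s. s - real m) has_vector_derivative 1) (at s)" by (auto intro!: derivative_eq_intros)
    from vector_diff_chain_at[OF this, of G "H (s - real m)"]
    have "(G \<circ> (\<lambda>s. s - real m) has_vector_derivative H (s - real m)) (at s)" using G'[of "s - real m"] s l by simp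
    then show "((\<lambda>s. G (s - real m)) has_vector_derivative H (s - real m)) (at s within {0..real (3 * m)})"
      unfolding o_def by (rule has_vector_derivative_at_within)
  qed simp
  have zero: "G b = G a" if "a \<le> b" "a \<ge> - 4 * real m" "b \<le> 4 * real m" "b \<le> - real m \<or> a \<ge> real m" for a b
  proof -
    have "integral {a..b} H = integral {a..b} (\<lambda>_. 0)" by (rule integral_cong) (use that z in auto)
    then show ?thesis using I[OF that(1-3)] by simp
  qed
  have "G (real (3 * m)) = G (real (3 * m) - real m)" "G (- real m) = G (l - real (3 * m))"
    by (rule zero; use l in simp)+
  moreover have "integral {0..l} H = G l - G 0" by (rule I) (use l in simp_all)
  ultimately show ?thesis unfolding I1 I2 I3 by simp
qed

lemma set_lebesgue_integral_segment:
  fixes h :: "'a::euclidean_space \<Rightarrow> complex"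
  assumes f: "f = closed_segment v (v + l *\<^sub>R e)" "l > 0" and e: "e \<noteq> 0" "direction_space f \<inter> \<Lambda> = int_span {e}"
    and h: "continuous_on UNIV h"
  shows "set_lebesgue_integral (lattice_measure \<Lambda> f) f h = integral {0..l} (\<lambda>s. h (v + s *\<^sub>R e))"
proof -
  have mem: "x \<in> f \<longleftrightarrow> (\<exists>s\<in>{0..l}. x = v + s *\<^sub>R e)" for x
  proof
    assume "x \<in> f"
    then obtain t where t: "0 \<le> t" "t \<le> 1" "x = (1 - t) *\<^sub>R v + t *\<^sub>R (v + l *\<^sub>R e)" unfolding f(1) in_segment(1) by blast
    then have "x = v + (t * l) *\<^sub>R e" "t * l \<in> {0..l}" using f(2) by (simp_all add: algebra_simps mult_left_le_one_le)
    then show "\<exists>s\<in>{0..l}. x = v + s *\<^sub>R e" by blast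
  next
    assume "\<exists>s\<in>{0..l}. x = v + s *\<^sub>R e"
    then obtain s where s: "s \<in> {0..l}" "x = v + s *\<^sub>R e" by blast
    then have "x = (1 - s / l) *\<^sub>R v + (s / l) *\<^sub>R (v + l *\<^sub>R e)" "0 \<le> s / l" "s / l \<le> 1"
      using f(2) by (simp_all add: algebra_simps)
    then show "x \<in> f" unfolding f(1) in_segment(1) by blast
  qed
  have iff: "v + s *\<^sub>R e \<in> f \<longleftrightarrow> s \<in> {0..l}" for s unfolding mem using e(1) by auto
  have "lattice_measure \<Lambda> f = distr lborel borel (\<lambda>s. v + s *\<^sub>R e)"
    by (rule lattice_measure_line[OF _ _ e]) (use mem f(1) in auto)
  moreover have "f \<in> sets borel" unfolding f(1) by (intro borel_closed closed_segment)
  then have "(\<lambda>x. indicator f x *\<^sub>R h x) \<in> borel_measurable borel"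
    by (intro borel_measurable_scaleR borel_measurable_indicator borel_measurable_continuous_onI h)
  moreover have "(\<lambda>s. v + s *\<^sub>R e) \<in> lborel \<rightarrow>\<^sub>M borel"
    by (simp add: borel_measurable_continuous_onI continuous_intros)
  ultimately have "set_lebesgue_integral (lattice_measure \<Lambda> f) f h = integral\<^sup>L lborel (\<lambda>s. indicator f (v + s *\<^sub>R e) *\<^sub>R h (v + s *\<^sub>R e))"
    unfolding set_lebesgue_integral_def by (simp add: integral_distr)
  also have "\<dots> = set_lebesgue_integral lborel {0..l} (\<lambda>s. h (v + s *\<^sub>R e))"
    unfolding set_lebesgue_integral_def using iff by (simp add: indicator_def)
  also have "\<dots> = integral {0..l} (\<lambda>s. h (v + s *\<^sub>R e))"
  proof (rule set_borel_integral_eq_integral(2))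
    show "set_integrable lborel {0..l} (\<lambda>s. h (v + s *\<^sub>R e))"
      by (intro borel_integrable_atLeastAtMost' continuous_on_compose2[OF h] continuous_intros) auto
  qed
  finally show ?thesis .
qed

text \<open>Both vectors are primitive in the lattice, so c and 1/c are integers.\<close>

lemma primitive_direction_unique:
  assumes pb: "plane_basis e1 e2" "plane_basis e1' e2'" and ib: "integral_basis \<Lambda> {e1, e2}" "integral_basis \<Lambda> {e1', e2'}"
    and c: "e1' = c *\<^sub>R e1"
  shows "c = 1 \<or> c = - 1"
proof -
  have int: "\<exists>i::int. c = of_int i" if a: "plane_basis e1 e2" "integral_basis \<Lambda> {e1, e2}" "integral_basis \<Lambda> {e1', e2'}" "e1' = c *\<^sub>R e1"
    for e1 e2 e1' e2' :: 'a and c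
  proof -
    have "e1' \<in> \<Lambda>" using basis_subset_lattice[OF a(3)] by simp
    then obtain i j :: int where "e1' = of_int i *\<^sub>R e1 + of_int j *\<^sub>R e2" unfolding lattice_plane[OF a(1,2)] by blast
    then have "c *\<^sub>R e1 + 0 *\<^sub>R e2 = of_int i *\<^sub>R e1 + of_int j *\<^sub>R e2" using a(4) by simp
    from plane_basis_eqD(1)[OF a(1) this] show ?thesis by blast
  qed
  have "c \<noteq> 0" using c plane_basis_nonzero[OF pb(2)] by auto
  obtain i :: int where i: "c = of_int i" using int[OF pb(1) ib c] by blast
  have "e1 = (1 / c) *\<^sub>R e1'" using c \<open>c \<noteq> 0\<close> by simp
  then obtain j :: int where j: "1 / c = of_int j" using int[OF pb(2) ib(2,1)] by blast
  have "real_of_int (i * j) = 1" using i j \<open>c \<noteq> 0\<close> by (simp add: field_simps)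
  then have "i * j = 1" by linarith
  then have "i = 1 \<or> i = - 1" using zmult_eq_1_iff by blast
  then show ?thesis using i by auto
qed

lemma expands_cong:
  assumes "expands R a" "\<And>N. N > 0 \<Longrightarrow> S N = R N"
  shows "expands S a"
  using assms by (simp add: expands_def)

lemma region_sum_cong:
  assumes "N > 0" "\<And>x. \<psi> x \<noteq> 0 \<Longrightarrow> x \<in> S \<longleftrightarrow> x \<in> T"
  shows "region_sum \<Lambda> r \<psi> S N = region_sum \<Lambda> r \<psi> T N"
proof -
  have "indicator S x * \<psi> x = indicator T x * \<psi> x" for x using assms(2)[of x] by (auto simp: indicator_def)
  then show ?thesis unfolding region_sum_def by (simp only:)
qed

subsection \<open>Expansions of corners and half-planes\<close>

text \<open>The primitive lattice vector along f pointing away from v. The choice is unambiguous by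
  \<open>frame_unique\<close>; naming it lets ray integrals be summed over incidences.\<close>

definition edge_dir :: "'a::euclidean_space set \<Rightarrow> 'a set \<Rightarrow> 'a \<Rightarrow> 'a set \<Rightarrow> 'a" where
  "edge_dir \<Lambda> P v f = (SOME e1. \<exists>e2 g. integral_basis \<Lambda> {e1, e2} \<and> {f \<in> edges P. v \<in> f} = {f, g}
     \<and> f \<subseteq> half_line v e1 \<and> g \<subseteq> half_line v e2)"

lemma line_proj_decompose: "x = line_proj e x + ((x \<bullet> e) / (e \<bullet> e)) *\<^sub>R e"
  by (simp add: line_proj_def)

text \<open>With the apex at -K (e1 + e2) both boundary rays miss the support, so all coefficients
  from order 2 on vanish, while on the support the quadrant is the whole plane.\<close>

lemma plane_expansion:
  fixes \<psi> :: "'a::euclidean_space \<Rightarrow> complex"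
  assumes pb: "plane_basis e1 e2" and ib: "integral_basis \<Lambda> {e1, e2}"
    and \<psi>: "smooth \<psi>" "\<And>x. norm x > r \<Longrightarrow> \<psi> x = 0"
  shows "\<exists>a. expands (region_sum \<Lambda> r \<psi> UNIV) a \<and> (\<forall>n\<ge>2. a n = 0)"
proof -
  have pb': "plane_basis (- e1) (- e2)"
    unfolding plane_basis_def
  proof (intro conjI allI impI)
    fix x
    obtain a b where "x = a *\<^sub>R e1 + b *\<^sub>R e2" using pb unfolding plane_basis_def by blast
    then show "\<exists>a b. x = a *\<^sub>R - e1 + b *\<^sub>R - e2" by (intro exI[of _ "- a"] exI[of _ "- b"]) simp
  next
    fix a b assume "a *\<^sub>R - e1 + b *\<^sub>R - e2 = 0"
    then have "(- a) *\<^sub>R e1 + (- b) *\<^sub>R e2 = 0" by simp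
    then have "- a = 0 \<and> - b = 0" using pb unfolding plane_basis_def by blast
    then show "a = 0" "b = 0" by simp_all
  qed
  \<comment> \<open>The negated basis is used because the support has to be avoided in the negative
    directions.\<close>
  obtain K :: nat where K: "\<And>s t. s \<ge> real K \<or> t \<ge> real K \<Longrightarrow> norm (0 + s *\<^sub>R - e1 + t *\<^sub>R - e2) > r"
    using cone_cutoff[OF pb'] by blast
  define p where "p = of_int (- int K) *\<^sub>R e1 + of_int (- int K) *\<^sub>R e2"
  have p\<Lambda>: "p \<in> \<Lambda>" unfolding lattice_plane[OF pb ib] p_def by blast
  obtain a where a: "expands (region_sum \<Lambda> r \<psi> ((+) p ` cone2 e1 e2)) a"
    "\<And>n. n \<ge> 2 \<Longrightarrow> a n = ray_integral p e1 (edge_operator n (line_proj e1 e2) \<psi>) + ray_integral p e2 (edge_operator n (line_proj e2 e1) \<psi>)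
        + vertex_operator n e1 e2 (line_proj e2 e1) (line_proj e1 e2) ((e1 \<bullet> e2) / (e2 \<bullet> e2)) ((e2 \<bullet> e1) / (e1 \<bullet> e1)) \<psi> p"
    using cone_expansion[OF pb ib p\<Lambda> line_proj_decompose line_proj_decompose \<psi>] by blast
  have far: "norm (p + s *\<^sub>R e1) > r" "norm (p + s *\<^sub>R e2) > r" for s
    using K[of "real K - s" "real K"] K[of "real K" "real K - s"] by (simp_all add: p_def algebra_simps)
  have "a n = 0" if "n \<ge> 2" for n
    using a(2)[OF that] far edge_operator_vanish[of r \<psi>, OF \<psi>(2)] vertex_operator_vanish[of r \<psi> p, OF \<psi>(2)] far(1)[of 0]
    by (simp add: ray_integral_def)
  moreover have "expands (region_sum \<Lambda> r \<psi> UNIV) a"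
  proof (rule expands_cong[OF a(1)])
    fix N :: nat assume "N > 0"
    then show "region_sum \<Lambda> r \<psi> UNIV N = region_sum \<Lambda> r \<psi> ((+) p ` cone2 e1 e2) N"
    proof (rule region_sum_cong)
      fix x assume nz: "\<psi> x \<noteq> 0"
      obtain s t where st: "x = s *\<^sub>R - e1 + t *\<^sub>R - e2" using pb' unfolding plane_basis_def by blast
      have "s < real K" "t < real K" using K[of s t] \<psi>(2)[of x] nz st by (auto simp: not_le[symmetric])
      then have "p + (real K - s) *\<^sub>R e1 + (real K - t) *\<^sub>R e2 \<in> (+) p ` cone2 e1 e2" by (intro cone2_mem) simp_all
      moreover have "p + (real K - s) *\<^sub>R e1 + (real K - t) *\<^sub>R e2 = x" by (simp add: p_def st algebra_simps)
      ultimately show "x \<in> UNIV \<longleftrightarrow> x \<in> (+) p ` cone2 e1 e2" by simp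
    qed
  qed
  ultimately show ?thesis by blast
qed

context delzant_polygon
begin

section \<open>Operators and expansions in the frame of a vertex\<close>

context
  fixes v e1 e2 f g
  assumes v: "v \<in> vertices P" and ib: "integral_basis \<Lambda> {e1, e2}"
    and fg: "{f \<in> edges P. v \<in> f} = {f, g}" "f \<subseteq> half_line v e1" "g \<subseteq> half_line v e2"
begin

lemma frame_swap: "integral_basis \<Lambda> {e2, e1}" "{f \<in> edges P. v \<in> f} = {g, f}"
  using ib fg(1) by (simp_all only: insert_commute)

lemma frame_unique:
  assumes "integral_basis \<Lambda> {e1', e2'}" "f \<subseteq> half_line v e1'"
  shows "e1' = e1"
proof -
  obtain a where a: "a > 0" "v + a *\<^sub>R e1 \<in> f" using vertex_frame(3)[OF v ib fg] by blast
  then have "v + a *\<^sub>R e1 \<in> half_line v e1'" using assms(2) by blast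
  then obtain t where t: "t \<ge> 0" "a *\<^sub>R e1 = t *\<^sub>R e1'" unfolding half_line_def by auto
  have pb: "plane_basis e1' e2'" by (rule integral_basis_plane[OF dim lattice assms(1)])
  have "e1 = (1 / a) *\<^sub>R (a *\<^sub>R e1)" using a(1) by simp
  then have c: "e1 = (t / a) *\<^sub>R e1'" unfolding t(2) by simp
  from primitive_direction_unique[OF pb vertex_frame(1)[OF v ib fg] assms(1) ib c]
  have "t / a = 1 \<or> t / a = - 1" .
  moreover have "t / a \<ge> 0" using t(1) a(1) by simp
  ultimately show ?thesis using c by auto
qed

lemma edge_dir_frame: "edge_dir \<Lambda> P v f = e1"
proof -
  let ?Q = "\<lambda>e1. \<exists>e2 g. integral_basis \<Lambda> {e1, e2} \<and> {f \<in> edges P. v \<in> f} = {f, g} \<and> f \<subseteq> half_line v e1 \<and> g \<subseteq> half_line v e2"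
  have "?Q e1" by (intro exI conjI) (rule ib fg)+
  then have "?Q (edge_dir \<Lambda> P v f)" unfolding edge_dir_def by (rule someI)
  then show ?thesis by (elim exE conjE) (rule frame_unique)
qed

lemma frame_edge_points: "x \<in> f \<Longrightarrow> \<exists>s. x = v + s *\<^sub>R e1"
  using fg(2) unfolding half_line_def by blast

lemma frame_direction_space: "direction_space f = span {e1}"
proof -
  obtain a where a: "a > 0" "v + a *\<^sub>R e1 \<in> f" using vertex_frame(3)[OF v ib fg] by blast
  show ?thesis
    by (rule direction_space_line[OF frame_edge_points, of _ 0 a]) (use a Collect_pairD(2)[OF fg(1)] in simp_all)
qed

lemma frame_direction_lattice: "direction_space f \<inter> \<Lambda> = int_span {e1}"
proof -
  note pb = vertex_frame(1)[OF v ib fg]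
  have "of_int i *\<^sub>R e1 \<in> \<Lambda>" for i :: int
  proof -
    have "of_int i *\<^sub>R e1 = of_int i *\<^sub>R e1 + of_int 0 *\<^sub>R e2" by simp
    then show ?thesis unfolding lattice_plane[OF pb ib] by blast
  qed
  moreover have "\<exists>i::int. x = of_int i *\<^sub>R e1" if x: "x \<in> span {e1}" "x \<in> \<Lambda>" for x
  proof -
    obtain s where s: "x = s *\<^sub>R e1" using x(1) by (auto simp: span_singleton)
    obtain i j :: int where ij: "x = of_int i *\<^sub>R e1 + of_int j *\<^sub>R e2" using x(2) unfolding lattice_plane[OF pb ib] by blast
    have "s *\<^sub>R e1 + 0 *\<^sub>R e2 = of_int i *\<^sub>R e1 + of_int j *\<^sub>R e2" using s ij by simp
    from plane_basis_eqD(1)[OF pb this] show ?thesis using s by blast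
  qed
  ultimately show ?thesis unfolding frame_direction_space int_span_singleton by (auto simp: span_singleton)
qed

lemma frame_transverse_edge: "transverse_cone P f = half_line (line_proj e1 v) (line_proj e1 e2)"
proof -
  note pb = vertex_frame(1)[OF v ib fg]
  obtain b where b: "b > 0" "v + b *\<^sub>R e2 \<in> g" using vertex_frame(4)[OF v ib fg] by blast
  show ?thesis
  proof (rule transverse_cone_edge[OF pb frame_direction_space frame_edge_points])
    show "f \<noteq> {}" using Collect_pairD(2)[OF fg(1)] by blast
    show "v + 0 *\<^sub>R e1 + b *\<^sub>R e2 \<in> P" using b edge_subset[OF Collect_pairD(3)[OF fg(1)]] by auto
    show "\<exists>s t. t \<ge> 0 \<and> x = v + s *\<^sub>R e1 + t *\<^sub>R e2" if "x \<in> P" for x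
    proof -
      have "x \<in> (+) v ` cone2 e1 e2" using vertex_cone(2)[OF v ib fg] that by blast
      then obtain s t where "t \<ge> 0" "x = v + s *\<^sub>R e1 + t *\<^sub>R e2" by (auto simp: cone2_def add.assoc)
      then show ?thesis by blast
    qed
  qed (simp_all add: b(1))
qed

lemma frame_transverse_vertex: "transverse_cone P {v} = (+) v ` cone2 e1 e2"
proof -
  obtain a where a: "a > 0" "v + a *\<^sub>R e1 \<in> f" using vertex_frame(3)[OF v ib fg] by blast
  obtain b where b: "b > 0" "v + b *\<^sub>R e2 \<in> g" using vertex_frame(4)[OF v ib fg] by blast
  have "v + a *\<^sub>R e1 \<in> P" "v + b *\<^sub>R e2 \<in> P"
    using a b edge_subset[OF Collect_pairD(1)[OF fg(1)]] edge_subset[OF Collect_pairD(3)[OF fg(1)]] by blast+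
  then show ?thesis
    using transverse_cone_vertex[OF vertex_frame(1)[OF v ib fg] vertex_cone(2)[OF v ib fg]] a(1) b(1) by blast
qed

lemma frame_BV_edge:
  assumes "Berline_Vergne_family \<Lambda> \<mu>" "n \<ge> 1" "smooth h"
  shows "BV_operator \<mu> n P f h x = edge_operator n (line_proj e1 e2) h x"
proof (rule BV_operator_edge[OF vertex_frame(1)[OF v ib fg] ib assms(1) vertices_lattice[OF v] aff_dim_P _
      frame_direction_space frame_transverse_edge assms(2,3)])
  show "aff_dim f = 1" using Collect_pairD(1)[OF fg(1)] by (simp add: edges_def)
qed

lemma frame_BV_vertex:
  assumes "Berline_Vergne_family \<Lambda> \<mu>" "n \<ge> 2" "smooth h"
    and "u1 = line_proj e2 e1" "u2 = line_proj e1 e2" "e1 = u1 + c1 *\<^sub>R e2" "e2 = u2 + c2 *\<^sub>R e1"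
  shows "BV_operator \<mu> n P {v} h x = vertex_operator n e1 e2 u1 u2 c1 c2 h x"
  by (rule BV_operator_vertex[OF vertex_frame(1)[OF v ib fg] ib assms(1) vertices_lattice[OF v] aff_dim_P
      frame_transverse_vertex assms(4-7,2,3)])

lemma frame_corner: "corner P v = (+) v ` cone2 e1 e2"
proof -
  have "corner P v = {x. \<forall>f\<in>{f \<in> edges P. v \<in> f}. x \<in> half_plane P f}" unfolding corner_def by blast
  then show ?thesis unfolding fg(1) vertex_cone(1)[OF v ib fg] by auto
qed

text \<open>The quadrant with apex moved back by m along the edge line agrees with the half-plane on
  the support. Its second ray and its apex miss the support, so only the integral along the edge
  line remains.\<close>

lemma half_plane_expansion:
  fixes m :: nat
  assumes \<psi>: "smooth \<psi>" "\<And>x. norm x > r \<Longrightarrow> \<psi> x = 0"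
    and far: "\<And>s t. s \<le> - real m \<Longrightarrow> norm (v + s *\<^sub>R e1 + t *\<^sub>R e2) > r"
  shows "\<exists>a. expands (region_sum \<Lambda> r \<psi> (half_plane P f)) a \<and>
    (\<forall>n\<ge>2. a n = ray_integral (v - real m *\<^sub>R e1) e1 (edge_operator n (line_proj e1 e2) \<psi>))"
proof -
  note pb = vertex_frame(1)[OF v ib fg]
  define p where "p = v - real m *\<^sub>R e1"
  obtain i j :: int where "v = of_int i *\<^sub>R e1 + of_int j *\<^sub>R e2"
    using vertices_lattice[OF v] unfolding lattice_plane[OF pb ib] by blast
  then have "p = of_int (i - int m) *\<^sub>R e1 + of_int j *\<^sub>R e2" by (simp add: p_def algebra_simps)
  then have p\<Lambda>: "p \<in> \<Lambda>" unfolding lattice_plane[OF pb ib] by blast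
  obtain a where a: "expands (region_sum \<Lambda> r \<psi> ((+) p ` cone2 e1 e2)) a"
    "\<And>n. n \<ge> 2 \<Longrightarrow> a n = ray_integral p e1 (edge_operator n (line_proj e1 e2) \<psi>) + ray_integral p e2 (edge_operator n (line_proj e2 e1) \<psi>)
        + vertex_operator n e1 e2 (line_proj e2 e1) (line_proj e1 e2) ((e1 \<bullet> e2) / (e2 \<bullet> e2)) ((e2 \<bullet> e1) / (e1 \<bullet> e1)) \<psi> p"
    using cone_expansion[OF pb ib p\<Lambda> line_proj_decompose line_proj_decompose \<psi>] by blast
  have farp: "norm (p + s *\<^sub>R e2) > r" for s
    using far[of "- real m" s] by (simp add: p_def)
  have "a n = ray_integral p e1 (edge_operator n (line_proj e1 e2) \<psi>)" if "n \<ge> 2" for n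
    using a(2)[OF that] farp edge_operator_vanish[of r \<psi>, OF \<psi>(2)] vertex_operator_vanish[of r \<psi> p, OF \<psi>(2)] farp[of 0]
    by (simp add: ray_integral_def)
  moreover have "expands (region_sum \<Lambda> r \<psi> (half_plane P f)) a"
  proof (rule expands_cong[OF a(1)])
    fix N :: nat assume "N > 0"
    then show "region_sum \<Lambda> r \<psi> (half_plane P f) N = region_sum \<Lambda> r \<psi> ((+) p ` cone2 e1 e2) N"
    proof (rule region_sum_cong)
      fix x assume nz: "\<psi> x \<noteq> 0"
      obtain s t where "x - v = s *\<^sub>R e1 + t *\<^sub>R e2" using pb unfolding plane_basis_def by blast
      then have st: "x = v + s *\<^sub>R e1 + t *\<^sub>R e2" by (simp add: algebra_simps)
      have s: "s > - real m" using far[of s t] \<psi>(2)[of x] nz unfolding st by fastforce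
      have xp: "x = p + (s + real m) *\<^sub>R e1 + t *\<^sub>R e2" by (simp add: st p_def algebra_simps)
      have "x \<in> (+) p ` cone2 e1 e2 \<longleftrightarrow> t \<ge> 0"
      proof
        assume "x \<in> (+) p ` cone2 e1 e2"
        then obtain s' t' where s't': "t' \<ge> 0" "x = p + s' *\<^sub>R e1 + t' *\<^sub>R e2" by (auto simp: cone2_def add.assoc)
        then have "(s + real m) *\<^sub>R e1 + t *\<^sub>R e2 = s' *\<^sub>R e1 + t' *\<^sub>R e2" using xp by (simp add: add.assoc)
        from plane_basis_eqD(2)[OF pb this] show "t \<ge> 0" using s't' by simp
      qed (use s in \<open>simp add: xp cone2_mem\<close>)
      then show "x \<in> half_plane P f \<longleftrightarrow> x \<in> (+) p ` cone2 e1 e2"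
        using vertex_frame(5)[OF v ib fg, of s t] st by simp
    qed
  qed
  ultimately show ?thesis unfolding p_def by blast
qed

end

lemma corner_expansion:
  assumes BV: "Berline_Vergne_family \<Lambda> \<mu>" and v: "v \<in> vertices P"
    and \<psi>: "smooth \<psi>" "\<And>x. norm x > r \<Longrightarrow> \<psi> x = 0"
  shows "\<exists>a. expands (region_sum \<Lambda> r \<psi> (corner P v)) a \<and>
    (\<forall>n\<ge>2. a n = (\<Sum>f | f \<in> edges P \<and> v \<in> f. ray_integral v (edge_dir \<Lambda> P v f) (BV_operator \<mu> n P f \<psi>)) + BV_operator \<mu> n P {v} \<psi> v)"
proof -
  obtain e1 e2 f g where b: "integral_basis \<Lambda> {e1, e2}" "{f \<in> edges P. v \<in> f} = {f, g}"
    "f \<subseteq> half_line v e1" "g \<subseteq> half_line v e2" using vertex_basis[OF v] .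
  note b' = frame_swap[OF v b] b(4,3)
  obtain a where a: "expands (region_sum \<Lambda> r \<psi> ((+) v ` cone2 e1 e2)) a"
    "\<And>n. n \<ge> 2 \<Longrightarrow> a n = ray_integral v e1 (edge_operator n (line_proj e1 e2) \<psi>) + ray_integral v e2 (edge_operator n (line_proj e2 e1) \<psi>)
        + vertex_operator n e1 e2 (line_proj e2 e1) (line_proj e1 e2) ((e1 \<bullet> e2) / (e2 \<bullet> e2)) ((e2 \<bullet> e1) / (e1 \<bullet> e1)) \<psi> v"
    using cone_expansion[OF vertex_frame(1)[OF v b] b(1) vertices_lattice[OF v] line_proj_decompose line_proj_decompose \<psi>] by blast
  have "a n = (\<Sum>f | f \<in> edges P \<and> v \<in> f. ray_integral v (edge_dir \<Lambda> P v f) (BV_operator \<mu> n P f \<psi>)) + BV_operator \<mu> n P {v} \<psi> v"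
    if n: "n \<ge> 2" for n
  proof -
    have "BV_operator \<mu> n P f \<psi> = edge_operator n (line_proj e1 e2) \<psi>" "BV_operator \<mu> n P g \<psi> = edge_operator n (line_proj e2 e1) \<psi>"
      using n by (intro ext frame_BV_edge[OF v b BV _ \<psi>(1)] frame_BV_edge[OF v b' BV _ \<psi>(1)]; simp)+
    moreover have "BV_operator \<mu> n P {v} \<psi> v = vertex_operator n e1 e2 (line_proj e2 e1) (line_proj e1 e2) ((e1 \<bullet> e2) / (e2 \<bullet> e2)) ((e2 \<bullet> e1) / (e1 \<bullet> e1)) \<psi> v"
      by (rule frame_BV_vertex[OF v b BV n \<psi>(1) refl refl line_proj_decompose line_proj_decompose])
    ultimately show ?thesis
      unfolding b(2) a(2)[OF n] using vertex_frame(2)[OF v b] by (simp add: edge_dir_frame[OF v b] edge_dir_frame[OF v b'])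
  qed
  then show ?thesis using a(1) unfolding frame_corner[OF v b] by blast
qed

text \<open>The two corners contribute rays from the ends of f in opposite directions along one
  line, and the half-plane contributes the full line. Their combination is the integral over f
  alone.\<close>

lemma edge_expansion:
  assumes BV: "Berline_Vergne_family \<Lambda> \<mu>" and f: "f \<in> edges P"
    and \<psi>: "smooth \<psi>" "\<And>x. norm x > r \<Longrightarrow> \<psi> x = 0"
  shows "\<exists>a. expands (region_sum \<Lambda> r \<psi> (half_plane P f)) a \<and>
    (\<forall>n\<ge>2. (\<Sum>v | v \<in> vertices P \<and> v \<in> f. ray_integral v (edge_dir \<Lambda> P v f) (BV_operator \<mu> n P f \<psi>)) - a n
       = set_lebesgue_integral (lattice_measure \<Lambda> f) f (BV_operator \<mu> n P f \<psi>))"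
proof -
  obtain v w where vw: "v \<noteq> w" "f = closed_segment v w" "{x \<in> vertices P. x \<in> f} = {v, w}"
    using edge_segment[OF polytope f] .
  note v = Collect_pairD(1,2)[OF vw(3)] and w = Collect_pairD(3,4)[OF vw(3)]
  obtain e1 e2 g where b: "integral_basis \<Lambda> {e1, e2}" "{f \<in> edges P. v \<in> f} = {f, g}"
    "f \<subseteq> half_line v e1" "g \<subseteq> half_line v e2" using vertex_basis_edge[OF v(1) f v(2)] .
  obtain e1' e2' g' where b': "integral_basis \<Lambda> {e1', e2'}" "{f \<in> edges P. w \<in> f} = {f, g'}"
    "f \<subseteq> half_line w e1'" "g' \<subseteq> half_line w e2'" using vertex_basis_edge[OF w(1) f w(2)] .
  note pb = vertex_frame(1)[OF v(1) b] and pb' = vertex_frame(1)[OF w(1) b']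
  have "w \<in> half_line v e1" using b(3) w(2) by blast
  then obtain l where l: "l \<ge> 0" "w = v + l *\<^sub>R e1" unfolding half_line_def by blast
  then have lpos: "l > 0" using vw(1) by (cases "l = 0") auto
  have "v \<in> half_line w e1'" using b'(3) v(2) by blast
  then obtain t where t: "t \<ge> 0" "v = w + t *\<^sub>R e1'" unfolding half_line_def by blast
  then have tpos: "t > 0" using vw(1) by (cases "t = 0") auto
  have "t *\<^sub>R e1' = (- l) *\<^sub>R e1" using l(2) t(2) by (simp add: algebra_simps eq_neg_iff_add_eq_0)
  then have "(1 / t) *\<^sub>R (t *\<^sub>R e1') = (1 / t) *\<^sub>R ((- l) *\<^sub>R e1)" by simp
  then have c: "e1' = (- l / t) *\<^sub>R e1" using tpos by simp
  \<comment> \<open>The primitive directions at the two ends are parallel with negative factor,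
    hence opposite.\<close>
  have "- l / t < 0" using lpos tpos by simp
  then have "- l / t = - 1" using primitive_direction_unique[OF pb pb' b(1) b'(1) c] by linarith
  then have e1': "e1' = - e1" using c by simp
  obtain K1 :: nat where K1: "\<And>s t. s \<ge> real K1 \<or> t \<ge> real K1 \<Longrightarrow> norm (v + s *\<^sub>R e1 + t *\<^sub>R e2) > r"
    using cone_cutoff[OF pb] by blast
  have pbm: "plane_basis (- e1) e2"
    unfolding plane_basis_def
  proof (intro conjI allI impI)
    fix x
    obtain a b where "x = a *\<^sub>R e1 + b *\<^sub>R e2" using pb unfolding plane_basis_def by blast
    then show "\<exists>a b. x = a *\<^sub>R - e1 + b *\<^sub>R e2" by (intro exI[of _ "- a"] exI[of _ b]) simp
  next
    fix a b assume "a *\<^sub>R - e1 + b *\<^sub>R e2 = 0"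
    then have "(- a) *\<^sub>R e1 + b *\<^sub>R e2 = 0" by simp
    then have "- a = 0 \<and> b = 0" using pb unfolding plane_basis_def by blast
    then show "a = 0" "b = 0" by simp_all
  qed
  obtain K2 :: nat where K2: "\<And>s t. s \<ge> real K2 \<or> t \<ge> real K2 \<Longrightarrow> norm (v + s *\<^sub>R - e1 + t *\<^sub>R e2) > r"
    using cone_cutoff[OF pbm] by blast
  \<comment> \<open>Large enough to pass the support on both sides of v and to exceed the lattice
    length of the edge.\<close>
  define m where "m = K1 + K2 + nat \<lceil>l\<rceil>"
  have lm: "l \<le> real m" unfolding m_def by linarith
  have far: "norm (v + s *\<^sub>R e1 + t *\<^sub>R e2) > r" if "s \<le> - real m" for s t
    using K2[of "- s" t] that by (simp add: m_def)
  have far': "norm (v + s *\<^sub>R e1) > r" if "\<bar>s\<bar> \<ge> real m" for s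
    using K1[of s 0] K2[of "- s" 0] that by (cases "s \<ge> 0") (simp_all add: m_def)
  obtain a where a: "expands (region_sum \<Lambda> r \<psi> (half_plane P f)) a"
    "\<And>n. n \<ge> 2 \<Longrightarrow> a n = ray_integral (v - real m *\<^sub>R e1) e1 (edge_operator n (line_proj e1 e2) \<psi>)"
    using half_plane_expansion[OF v(1) b \<psi> far] by blast
  have "(\<Sum>v | v \<in> vertices P \<and> v \<in> f. ray_integral v (edge_dir \<Lambda> P v f) (BV_operator \<mu> n P f \<psi>)) - a n
       = set_lebesgue_integral (lattice_measure \<Lambda> f) f (BV_operator \<mu> n P f \<psi>)" if n: "n \<ge> 2" for n
  proof -
    define h where "h = edge_operator n (line_proj e1 e2) \<psi>"
    have h: "BV_operator \<mu> n P f \<psi> = h"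
      unfolding h_def using n by (intro ext frame_BV_edge[OF v(1) b BV _ \<psi>(1)]) simp
    have hc: "continuous_on UNIV h" unfolding h_def by (rule edge_operator_continuous[OF \<psi>(1)])
    define H where "H = (\<lambda>s. h (v + s *\<^sub>R e1))"
    have Hc: "continuous_on UNIV H" unfolding H_def by (intro continuous_on_compose2[OF hc] continuous_intros) auto
    have z: "H s = 0" if "\<bar>s\<bar> \<ge> real m" for s
      unfolding H_def h_def by (rule edge_operator_vanish[of r \<psi>, OF \<psi>(2) far'[OF that]])
    have pt: "w + s *\<^sub>R e1' = v + (l - s) *\<^sub>R e1" "v - real m *\<^sub>R e1 + s *\<^sub>R e1 = v + (s - real m) *\<^sub>R e1" for s
      unfolding l(2) e1' by (simp_all add: algebra_simps)
    have r1: "ray_integral v e1 h = integral {0..real (3 * m)} H"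
      using ray_integral_cutoff(2)[of "3 * m" h v e1, OF _ hc] z[unfolded H_def] by (simp add: H_def)
    have r2: "ray_integral w e1' h = integral {0..real (3 * m)} (\<lambda>s. H (l - s))"
      unfolding H_def pt(1)[symmetric]
    proof (rule ray_integral_cutoff(2)[OF _ hc])
      fix s assume "s \<ge> real (3 * m)"
      then have "\<bar>l - s\<bar> \<ge> real m" using l(1) lm by simp
      from z[OF this] show "h (w + s *\<^sub>R e1') = 0" unfolding H_def pt(1) .
    qed
    have r3: "ray_integral (v - real m *\<^sub>R e1) e1 h = integral {0..real (3 * m)} (\<lambda>s. H (s - real m))"
      unfolding H_def pt(2)[symmetric]
    proof (rule ray_integral_cutoff(2)[OF _ hc])
      fix s assume "s \<ge> real (3 * m)"
      then have "\<bar>s - real m\<bar> \<ge> real m" by simp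
      from z[OF this] show "h (v - real m *\<^sub>R e1 + s *\<^sub>R e1) = 0" unfolding H_def pt(2) .
    qed
    have "(\<Sum>x | x \<in> vertices P \<and> x \<in> f. ray_integral x (edge_dir \<Lambda> P x f) h) = ray_integral v e1 h + ray_integral w e1' h"
      unfolding vw(3) using vw(1) by (simp add: edge_dir_frame[OF v(1) b] edge_dir_frame[OF w(1) b'])
    then have "(\<Sum>x | x \<in> vertices P \<and> x \<in> f. ray_integral x (edge_dir \<Lambda> P x f) h) - a n = integral {0..l} H"
      unfolding a(2)[OF n] h_def[symmetric] r1 r2 r3 using line_pieces[OF Hc z l(1) lm] by simp
    also have "\<dots> = set_lebesgue_integral (lattice_measure \<Lambda> f) f h"
      unfolding H_def
      by (rule set_lebesgue_integral_segment[OF _ lpos _ frame_direction_lattice[OF v(1) b] hc, symmetric])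
        (use vw(2) l(2) plane_basis_nonzero[OF pb] in simp_all)
    finally show ?thesis unfolding h .
  qed
  then show ?thesis using a(1) by blast
qed

end

subsection \<open>The asymptotic expansion\<close>

context delzant_polygon
begin

lemma lattice_basis:
  obtains e1 e2 where "plane_basis e1 e2" "integral_basis \<Lambda> {e1, e2}"
proof -
  obtain v where "v extreme_point_of P"
    using extreme_point_exists_convex[OF polytope_imp_compact polytope_imp_convex nonempty] polytope by blast
  then have v: "v \<in> vertices P" by (simp add: vertices_def face_of_singleton)
  obtain e1 e2 f1 f2 where b: "integral_basis \<Lambda> {e1, e2}" "{f \<in> edges P. v \<in> f} = {f1, f2}"
    "f1 \<subseteq> half_line v e1" "f2 \<subseteq> half_line v e2" using vertex_basis[OF v] .
  show ?thesis by (rule that[OF integral_basis_plane[OF dim lattice b(1)] b(1)])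
qed

lemma region_sum_decomposition:
  "region_sum \<Lambda> r \<psi> P N = (\<Sum>v\<in>vertices P. region_sum \<Lambda> r \<psi> (corner P v) N)
     + - (\<Sum>f\<in>edges P. region_sum \<Lambda> r \<psi> (half_plane P f) N) + region_sum \<Lambda> r \<psi> UNIV N"
proof -
  let ?G = "{\<gamma> \<in> \<Lambda>. norm \<gamma> \<le> real N * r}"
  have key: "indicator P x * \<psi> x = (\<Sum>v\<in>vertices P. indicator (corner P v) x * \<psi> x)
    + - (\<Sum>f\<in>edges P. indicator (half_plane P f) x * \<psi> x) + indicator UNIV x * \<psi> x" for x
    unfolding brianchon_gram[symmetric] sum_distrib_right[symmetric] by (simp add: algebra_simps)
  have "(\<Sum>\<gamma>\<in>?G. indicator P (\<gamma> /\<^sub>R real N) * \<psi> (\<gamma> /\<^sub>R real N))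
    = (\<Sum>v\<in>vertices P. \<Sum>\<gamma>\<in>?G. indicator (corner P v) (\<gamma> /\<^sub>R real N) * \<psi> (\<gamma> /\<^sub>R real N))
      + - (\<Sum>f\<in>edges P. \<Sum>\<gamma>\<in>?G. indicator (half_plane P f) (\<gamma> /\<^sub>R real N) * \<psi> (\<gamma> /\<^sub>R real N))
      + (\<Sum>\<gamma>\<in>?G. indicator UNIV (\<gamma> /\<^sub>R real N) * \<psi> (\<gamma> /\<^sub>R real N))"
    unfolding key sum.distrib sum_negf sum.swap[where A = "vertices P" and B = ?G] sum.swap[where A = "edges P" and B = ?G] ..
  then show ?thesis
    unfolding region_sum_def sum_divide_distrib[symmetric] by (simp only: add_divide_distrib minus_divide_left)
qed

lemma riemann_region_sum:
  assumes "N > 0" and P: "\<And>x. x \<in> P \<Longrightarrow> norm x \<le> r" "\<And>x. x \<in> P \<Longrightarrow> \<phi> x = \<psi> x"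
  shows "riemann_sum \<Lambda> P \<phi> N = region_sum \<Lambda> r \<psi> P N"
proof -
  obtain e1 e2 where b: "plane_basis e1 e2" "integral_basis \<Lambda> {e1, e2}" using lattice_basis .
  let ?A = "(\<lambda>x. real N *\<^sub>R x) ` P \<inter> \<Lambda>" and ?G = "{\<gamma> \<in> \<Lambda>. norm \<gamma> \<le> real N * r}"
  have A: "\<gamma> \<in> ?A \<longleftrightarrow> \<gamma> \<in> \<Lambda> \<and> \<gamma> /\<^sub>R real N \<in> P" for \<gamma>
  proof
    assume "\<gamma> \<in> \<Lambda> \<and> \<gamma> /\<^sub>R real N \<in> P"
    moreover have "\<gamma> = real N *\<^sub>R (\<gamma> /\<^sub>R real N)" using assms(1) by simp
    ultimately show "\<gamma> \<in> ?A" by blast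
  qed (use assms(1) in auto)
  have "(\<Sum>\<gamma>\<in>?A. \<phi> (\<gamma> /\<^sub>R real N)) = (\<Sum>\<gamma>\<in>?G. indicator P (\<gamma> /\<^sub>R real N) * \<psi> (\<gamma> /\<^sub>R real N))"
  proof (rule sum.mono_neutral_cong_left)
    show "finite ?G" by (rule lattice_ball_finite[OF b])
    show "?A \<subseteq> ?G"
    proof
      fix \<gamma> assume "\<gamma> \<in> ?A"
      then have "\<gamma> \<in> \<Lambda>" "norm (\<gamma> /\<^sub>R real N) \<le> r" using A P(1) by blast+
      then show "\<gamma> \<in> ?G" using assms(1) by (simp add: field_simps)
    qed
    show "\<forall>\<gamma>\<in>?G - ?A. indicator P (\<gamma> /\<^sub>R real N) * \<psi> (\<gamma> /\<^sub>R real N) = 0"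
    proof
      fix \<gamma> assume "\<gamma> \<in> ?G - ?A"
      then have "\<gamma> /\<^sub>R real N \<notin> P" using A by blast
      then show "indicator P (\<gamma> /\<^sub>R real N) * \<psi> (\<gamma> /\<^sub>R real N) = 0" by simp
    qed
    show "\<phi> (\<gamma> /\<^sub>R real N) = indicator P (\<gamma> /\<^sub>R real N) * \<psi> (\<gamma> /\<^sub>R real N)" if "\<gamma> \<in> ?A" for \<gamma>
    proof -
      have "\<gamma> /\<^sub>R real N \<in> P" using A that by blast
      then show ?thesis using P(2) by simp
    qed
  qed
  then show ?thesis unfolding riemann_sum_def region_sum_def aff_dim_P by simp
qed

lemma edge_vertex_frame:
  assumes "f \<in> edges P"
  obtains v e1 e2 g where "v \<in> vertices P" "integral_basis \<Lambda> {e1, e2}" "{f \<in> edges P. v \<in> f} = {f, g}"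
    "f \<subseteq> half_line v e1" "g \<subseteq> half_line v e2"
proof -
  obtain v w where vw: "v \<noteq> w" "f = closed_segment v w" "{x \<in> vertices P. x \<in> f} = {v, w}"
    using edge_segment[OF polytope assms] .
  note v = Collect_pairD(1,2)[OF vw(3)]
  obtain e1 e2 g where "integral_basis \<Lambda> {e1, e2}" "{f \<in> edges P. v \<in> f} = {f, g}"
    "f \<subseteq> half_line v e1" "g \<subseteq> half_line v e2" using vertex_basis_edge[OF v(1) assms v(2)] .
  then show ?thesis by (rule that[OF v(1)])
qed

lemma BV_edge_cong:
  assumes BV: "Berline_Vergne_family \<Lambda> \<mu>" and f: "f \<in> edges P" and n: "n \<ge> 1" and gh: "smooth g" "smooth h"
    and U: "open U" "\<And>y. y \<in> U \<Longrightarrow> g y = h y" "x \<in> U"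
  shows "BV_operator \<mu> n P f g x = BV_operator \<mu> n P f h x"
proof -
  obtain v e1 e2 k where v: "v \<in> vertices P" and b: "integral_basis \<Lambda> {e1, e2}" "{f \<in> edges P. v \<in> f} = {f, k}"
    "f \<subseteq> half_line v e1" "k \<subseteq> half_line v e2" using edge_vertex_frame[OF f] .
  show ?thesis
    unfolding frame_BV_edge[OF v b BV n gh(1)] frame_BV_edge[OF v b BV n gh(2)] by (rule edge_operator_cong_open[OF U])
qed

lemma BV_vertex_cong:
  assumes BV: "Berline_Vergne_family \<Lambda> \<mu>" and v: "v \<in> vertices P" and n: "n \<ge> 2" and gh: "smooth g" "smooth h"
    and U: "open U" "\<And>y. y \<in> U \<Longrightarrow> g y = h y" "x \<in> U"
  shows "BV_operator \<mu> n P {v} g x = BV_operator \<mu> n P {v} h x"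
proof -
  obtain e1 e2 f k where b: "integral_basis \<Lambda> {e1, e2}" "{f \<in> edges P. v \<in> f} = {f, k}"
    "f \<subseteq> half_line v e1" "k \<subseteq> half_line v e2" using vertex_basis[OF v] .
  note eq = frame_BV_vertex[OF v b BV n _ refl refl line_proj_decompose line_proj_decompose]
  show ?thesis unfolding eq[OF gh(1)] eq[OF gh(2)] by (rule vertex_operator_cong_open[OF U])
qed

lemma polygon_expansion:
  assumes BV: "Berline_Vergne_family \<Lambda> \<mu>" and ext: "smooth_extension P \<phi> \<psi>"
  shows "\<exists>A. asymptotic_expansion (riemann_sum \<Lambda> P \<phi>) A \<and>
        (\<forall>n\<ge>2. A n =
           (\<Sum>f\<in>edges P. set_lebesgue_integral (lattice_measure \<Lambda> f) f (BV_operator \<mu> n P f \<psi>)) +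
           (\<Sum>v\<in>vertices P. BV_operator \<mu> n P {v} \<psi> v))"
proof -
  have \<psi>: "smooth \<psi>" "\<And>x. x \<in> P \<Longrightarrow> \<phi> x = \<psi> x" using ext by (simp_all add: smooth_extension_def)
  obtain B where B: "\<And>x. x \<in> P \<Longrightarrow> norm x \<le> B"
    using polytope_imp_bounded[OF polytope] unfolding bounded_iff by blast
  \<comment> \<open>The cutoff is 1 on an open neighbourhood of P, not merely on P, so that
    derivatives at points of P are unchanged.\<close>
  obtain \<eta> :: "'a \<Rightarrow> complex" and r where \<eta>: "smooth \<eta>" "\<And>x. norm x < B + 1 \<Longrightarrow> \<eta> x = 1" "\<And>x. norm x > r \<Longrightarrow> \<eta> x = 0"
    using smooth_cutoff[where r = "B + 1"] by blast
  define g where "g = (\<lambda>x. \<eta> x * \<psi> x)"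
  have g: "smooth g" "\<And>x. norm x > r \<Longrightarrow> g x = 0" using smooth_mult[OF \<eta>(1) \<psi>(1)] \<eta>(3) by (simp_all add: g_def)
  define U where "U = {x :: 'a. norm x < B + 1}"
  have U: "open U" unfolding U_def by (intro open_Collect_less continuous_intros)
  have gU: "g y = \<psi> y" if "y \<in> U" for y using that \<eta>(2) by (simp add: g_def U_def)
  have PU: "x \<in> U" if "x \<in> P" for x using B[OF that] by (simp add: U_def)
  have Pr: "norm x \<le> r" if "x \<in> P" for x using \<eta>(2)[of x] \<eta>(3)[of x] B[OF that] by (cases "norm x > r") auto
  have "\<forall>v\<in>vertices P. \<exists>a. expands (region_sum \<Lambda> r g (corner P v)) a \<and>
    (\<forall>n\<ge>2. a n = (\<Sum>f | f \<in> edges P \<and> v \<in> f. ray_integral v (edge_dir \<Lambda> P v f) (BV_operator \<mu> n P f g)) + BV_operator \<mu> n P {v} g v)"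
    by (rule ballI) (rule corner_expansion[OF BV _ g])
  from bchoice[OF this] obtain av where av: "\<And>v. v \<in> vertices P \<Longrightarrow> expands (region_sum \<Lambda> r g (corner P v)) (av v)"
    "\<And>v n. v \<in> vertices P \<Longrightarrow> n \<ge> 2 \<Longrightarrow> av v n = (\<Sum>f | f \<in> edges P \<and> v \<in> f. ray_integral v (edge_dir \<Lambda> P v f) (BV_operator \<mu> n P f g)) + BV_operator \<mu> n P {v} g v"
    by blast
  have "\<forall>f\<in>edges P. \<exists>a. expands (region_sum \<Lambda> r g (half_plane P f)) a \<and>
    (\<forall>n\<ge>2. (\<Sum>v | v \<in> vertices P \<and> v \<in> f. ray_integral v (edge_dir \<Lambda> P v f) (BV_operator \<mu> n P f g)) - a n
       = set_lebesgue_integral (lattice_measure \<Lambda> f) f (BV_operator \<mu> n P f g))"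
    by (rule ballI) (rule edge_expansion[OF BV _ g])
  from bchoice[OF this] obtain af where af: "\<And>f. f \<in> edges P \<Longrightarrow> expands (region_sum \<Lambda> r g (half_plane P f)) (af f)"
    "\<And>f n. f \<in> edges P \<Longrightarrow> n \<ge> 2 \<Longrightarrow> (\<Sum>v | v \<in> vertices P \<and> v \<in> f. ray_integral v (edge_dir \<Lambda> P v f) (BV_operator \<mu> n P f g)) - af f n
       = set_lebesgue_integral (lattice_measure \<Lambda> f) f (BV_operator \<mu> n P f g)"
    by blast
  obtain e1 e2 where b: "plane_basis e1 e2" "integral_basis \<Lambda> {e1, e2}" using lattice_basis .
  obtain au where au: "expands (region_sum \<Lambda> r g UNIV) au" "\<forall>n\<ge>2. au n = 0"
    using plane_expansion[OF b g] by blast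
  define A where "A = (\<lambda>n. (\<Sum>v\<in>vertices P. av v n) + - (\<Sum>f\<in>edges P. af f n) + au n)"
  have "expands (riemann_sum \<Lambda> P \<phi>) A"
    unfolding A_def
  proof (rule expands_cong)
    show "expands (\<lambda>N. (\<Sum>v\<in>vertices P. region_sum \<Lambda> r g (corner P v) N)
         + - (\<Sum>f\<in>edges P. region_sum \<Lambda> r g (half_plane P f) N) + region_sum \<Lambda> r g UNIV N)
       (\<lambda>n. (\<Sum>v\<in>vertices P. av v n) + - (\<Sum>f\<in>edges P. af f n) + au n)"
      by (rule expands_add[OF expands_add[OF expands_sum[OF finite_vertices av(1)] expands_uminus[OF expands_sum[OF finite_edges af(1)]]] au(1)])
    fix N :: nat assume "N > 0"
    moreover have "\<phi> x = g x" if "x \<in> P" for x using \<psi>(2)[OF that] gU[OF PU[OF that]] by simp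
    ultimately have "riemann_sum \<Lambda> P \<phi> N = region_sum \<Lambda> r g P N" by (intro riemann_region_sum Pr)
    then show "riemann_sum \<Lambda> P \<phi> N = (\<Sum>v\<in>vertices P. region_sum \<Lambda> r g (corner P v) N)
         + - (\<Sum>f\<in>edges P. region_sum \<Lambda> r g (half_plane P f) N) + region_sum \<Lambda> r g UNIV N"
      unfolding region_sum_decomposition .
  qed
  moreover have "A n = (\<Sum>f\<in>edges P. set_lebesgue_integral (lattice_measure \<Lambda> f) f (BV_operator \<mu> n P f \<psi>)) +
           (\<Sum>v\<in>vertices P. BV_operator \<mu> n P {v} \<psi> v)" if n: "n \<ge> 2" for n
  proof -
    let ?J = "\<lambda>v f. ray_integral v (edge_dir \<Lambda> P v f) (BV_operator \<mu> n P f g)"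
    have "(\<Sum>v\<in>vertices P. av v n) = (\<Sum>v\<in>vertices P. (\<Sum>f | f \<in> edges P \<and> v \<in> f. ?J v f) + BV_operator \<mu> n P {v} g v)"
      by (rule sum.cong[OF refl]) (rule av(2)[OF _ n])
    \<comment> \<open>Exchanging the sums over incidences brings the two rays of each edge together
      with its half-plane term.\<close>
    also have "\<dots> = (\<Sum>f\<in>edges P. \<Sum>v | v \<in> vertices P \<and> v \<in> f. ?J v f) + (\<Sum>v\<in>vertices P. BV_operator \<mu> n P {v} g v)"
      unfolding sum.distrib sum_vertex_edge ..
    finally have "A n = (\<Sum>f\<in>edges P. (\<Sum>v | v \<in> vertices P \<and> v \<in> f. ?J v f) - af f n) + (\<Sum>v\<in>vertices P. BV_operator \<mu> n P {v} g v)"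
      using au(2) n unfolding A_def sum_subtractf by simp
    also have "(\<Sum>f\<in>edges P. (\<Sum>v | v \<in> vertices P \<and> v \<in> f. ?J v f) - af f n)
      = (\<Sum>f\<in>edges P. set_lebesgue_integral (lattice_measure \<Lambda> f) f (BV_operator \<mu> n P f \<psi>))"
    proof (rule sum.cong[OF refl])
      fix f assume f: "f \<in> edges P"
      have "BV_operator \<mu> n P f g x = BV_operator \<mu> n P f \<psi> x" if "x \<in> f" for x
      proof (rule BV_edge_cong[OF BV f _ g(1) \<psi>(1) U gU])
        show "x \<in> U" using that edge_subset[OF f] PU by blast
      qed (use n in simp_all)
      then have ind: "indicator f x *\<^sub>R BV_operator \<mu> n P f g x = indicator f x *\<^sub>R BV_operator \<mu> n P f \<psi> x" for x
        by (cases "x \<in> f") simp_all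
      show "(\<Sum>v | v \<in> vertices P \<and> v \<in> f. ?J v f) - af f n = set_lebesgue_integral (lattice_measure \<Lambda> f) f (BV_operator \<mu> n P f \<psi>)"
        unfolding af(2)[OF f n] set_lebesgue_integral_def ind ..
    qed
    also have "(\<Sum>v\<in>vertices P. BV_operator \<mu> n P {v} g v) = (\<Sum>v\<in>vertices P. BV_operator \<mu> n P {v} \<psi> v)"
      by (rule sum.cong[OF refl]) (rule BV_vertex_cong[OF BV _ n g(1) \<psi>(1) U gU PU[OF vertex_mem]])
    finally show ?thesis .
  qed
  ultimately show ?thesis using expands_asymptotic by blast
qed

text \<open>Here e1, e2 need not be the frame of a vertex: e2 is any inward complement of e1. The
  transverse cone is therefore recomputed in this basis, with \<alpha> supplying the sign of the
  e2-coordinate.\<close>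

lemma BV_operator_edge_normal:
  assumes BV: "Berline_Vergne_family \<Lambda> \<mu>" and f: "f \<in> edges P"
    and \<alpha>: "inward_primitive_normal \<Lambda> P f \<alpha>"
    and e1: "direction_space f \<inter> \<Lambda> = int_span {e1}" and e2: "e2 \<in> face_cone P f \<inter> \<Lambda>" and ib: "integral_basis \<Lambda> {e1, e2}"
    and u: "u = ((e2 \<bullet> \<alpha>) / (\<alpha> \<bullet> \<alpha>)) *\<^sub>R \<alpha>" and n: "n \<ge> 1" and g: "smooth g"
  shows "BV_operator \<mu> n P f g x = edge_operator n u g x"
proof -
  have pb: "plane_basis e1 e2" by (rule integral_basis_plane[OF dim lattice ib])
  have \<alpha>0: "\<alpha> \<noteq> 0" and \<alpha>d: "\<And>x. x \<in> direction_space f \<Longrightarrow> \<alpha> \<bullet> x = 0" and \<alpha>P: "\<And>x y. y \<in> P \<Longrightarrow> x \<in> f \<Longrightarrow> \<alpha> \<bullet> (y - x) \<ge> 0"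
    using \<alpha> unfolding inward_primitive_normal_def by blast+
  have "of_int 1 *\<^sub>R e1 \<in> int_span {e1}" unfolding int_span_singleton by blast
  then have e1d: "e1 \<in> direction_space f" using e1 by auto
  then have \<alpha>e1: "\<alpha> \<bullet> e1 = 0" by (rule \<alpha>d)
  obtain a b where ab: "\<alpha> = a *\<^sub>R e1 + b *\<^sub>R e2" using pb unfolding plane_basis_def by blast
  have "\<alpha> \<bullet> \<alpha> = \<alpha> \<bullet> (a *\<^sub>R e1 + b *\<^sub>R e2)" using ab by simp
  then have "\<alpha> \<bullet> \<alpha> = b * (\<alpha> \<bullet> e2)" by (simp add: inner_right_distrib \<alpha>e1)
  then have b0: "b \<noteq> 0" "\<alpha> \<bullet> e2 \<noteq> 0" using \<alpha>0 by auto
  have "face_cone P f \<subseteq> {z. \<alpha> \<bullet> z \<ge> 0}"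
    unfolding face_cone_def by (rule hull_minimal) (use \<alpha>P convex_cone_halfspace_ge in auto)
  then have pos: "\<alpha> \<bullet> e2 > 0" using e2 b0(2) by force
  have "u = line_proj e1 e2"
  proof -
    \<comment> \<open>Both vectors are orthogonal to e1 and have the same inner product with
      \<alpha>. Since e1 and \<alpha> span the plane, the difference is 0.\<close>
    define z where "z = u - line_proj e1 e2"
    have z1: "z \<bullet> e1 = 0"
      unfolding z_def inner_diff_left line_proj_orthogonal[OF plane_basis_nonzero(1)[OF pb]] u by (simp add: \<alpha>e1)
    have "z \<bullet> \<alpha> = 0" unfolding z_def u line_proj_def using \<alpha>0 by (simp add: inner_diff_left inner_commute[of e1 \<alpha>] \<alpha>e1)
    then have "z \<bullet> (a *\<^sub>R e1 + b *\<^sub>R e2) = 0" using ab by simp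
    then have z2: "z \<bullet> e2 = 0" using z1 b0 by (simp add: inner_right_distrib)
    obtain c d where "z = c *\<^sub>R e1 + d *\<^sub>R e2" using pb unfolding plane_basis_def by blast
    then have "z \<bullet> z = z \<bullet> (c *\<^sub>R e1 + d *\<^sub>R e2)" by simp
    then have "z \<bullet> z = 0" by (simp add: inner_right_distrib z1 z2)
    then show ?thesis by (simp add: z_def)
  qed
  obtain v E1 E2 k where v: "v \<in> vertices P" and fr: "integral_basis \<Lambda> {E1, E2}" "{f \<in> edges P. v \<in> f} = {f, k}"
    "f \<subseteq> half_line v E1" "k \<subseteq> half_line v E2" using edge_vertex_frame[OF f] .
  note vf = Collect_pairD(2)[OF fr(2)] and pbE = vertex_frame(1)[OF v fr]
  obtain c where c: "e1 = c *\<^sub>R E1" using e1d unfolding frame_direction_space[OF v fr] by (auto simp: span_singleton)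
  have "c \<noteq> 0" using c plane_basis_nonzero[OF pb] by auto
  have df: "direction_space f = span {e1}"
  proof -
    have "E1 = (1 / c) *\<^sub>R e1" using \<open>c \<noteq> 0\<close> by (simp add: c)
    then have "E1 \<in> span {e1}" by (metis span_base span_scale singletonI)
    moreover have "e1 \<in> span {E1}" unfolding c by (simp add: span_base span_scale)
    ultimately show ?thesis unfolding frame_direction_space[OF v fr] by (simp add: span_eq)
  qed
  obtain B where B: "B > 0" "v + B *\<^sub>R E2 \<in> k" using vertex_frame(4)[OF v fr] by blast
  have BP: "v + B *\<^sub>R E2 \<in> P" using B edge_subset[OF Collect_pairD(3)[OF fr(2)]] by blast
  have half: "\<exists>s t. t \<ge> 0 \<and> x = v + s *\<^sub>R e1 + t *\<^sub>R e2" if "x \<in> P" for x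
  proof -
    obtain s t where st: "x - v = s *\<^sub>R e1 + t *\<^sub>R e2" using pb unfolding plane_basis_def by blast
    have "\<alpha> \<bullet> (x - v) \<ge> 0" by (rule \<alpha>P[OF that vf])
    then have "t \<ge> 0" unfolding st using pos by (simp add: inner_right_distrib \<alpha>e1 zero_le_mult_iff)
    moreover have "x = v + s *\<^sub>R e1 + t *\<^sub>R e2" using st by (simp add: algebra_simps)
    ultimately show ?thesis by blast
  qed
  obtain s0 t0 where st0: "t0 \<ge> 0" "v + B *\<^sub>R E2 = v + s0 *\<^sub>R e1 + t0 *\<^sub>R e2" using half[OF BP] by blast
  have "t0 \<noteq> 0"
  proof
    assume "t0 = 0"
    then have "0 *\<^sub>R E1 + B *\<^sub>R E2 = (s0 * c) *\<^sub>R E1 + 0 *\<^sub>R E2" using st0(2) by (simp add: c)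
    from plane_basis_eqD(2)[OF pbE this] show False using B(1) by simp
  qed
  then have t0: "t0 > 0" using st0(1) by simp
  have "transverse_cone P f = half_line (line_proj e1 v) (line_proj e1 e2)"
  proof (rule transverse_cone_edge[OF pb df _ _ half _ t0])
    show "\<exists>s. x = v + s *\<^sub>R e1" if "x \<in> f" for x
    proof -
      have "x - v \<in> span {e1}" using diff_direction_space[OF vf that] df by simp
      then obtain s where "x - v = s *\<^sub>R e1" by (auto simp: span_singleton)
      then have "x = v + s *\<^sub>R e1" by (simp add: algebra_simps)
      then show ?thesis by blast
    qed
    show "f \<noteq> {}" using vf by blast
    show "v + s0 *\<^sub>R e1 + t0 *\<^sub>R e2 \<in> P" using BP st0(2) by simp
  qed
  moreover have "aff_dim f = 1" using f by (simp add: edges_def)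
  ultimately show ?thesis
    unfolding \<open>u = line_proj e1 e2\<close> by (intro BV_operator_edge[OF pb ib BV vertices_lattice[OF v] aff_dim_P _ df _ n g])
qed

end

theorem corollary5p4:
  fixes \<Lambda> P :: "'a::euclidean_space set"
    and \<phi> \<psi> :: "'a \<Rightarrow> complex"
    and \<mu> :: "'a set \<Rightarrow> 'a set \<Rightarrow> ('a \<Rightarrow>\<^sub>L complex) \<Rightarrow> complex"
  assumes dim: "DIM('a) = 2"
    and lattice: "lattice_in UNIV \<Lambda>"
    and rational: "rational_inner_product \<Lambda>"
    and BV: "Berline_Vergne_family \<Lambda> \<mu>"
    and lattice_polytope: "lattice_polytope \<Lambda> P"
    and Delzant: "Delzant \<Lambda> P"
    and smooth: "smooth_extension P \<phi> \<psi>"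
  shows
    "(\<exists>A. asymptotic_expansion (riemann_sum \<Lambda> P \<phi>) A \<and>
        (\<forall>n\<ge>2. A n =
           (\<Sum>f\<in>edges P. set_lebesgue_integral (lattice_measure \<Lambda> f) f (BV_operator \<mu> n P f \<psi>)) +
           (\<Sum>v\<in>vertices P. BV_operator \<mu> n P {v} \<psi> v)))
     \<and>
     (\<forall>n\<ge>2. \<forall>f\<in>edges P. \<forall>\<alpha> e1 e2 u.
        inward_primitive_normal \<Lambda> P f \<alpha> \<longrightarrow>
        direction_space f \<inter> \<Lambda> = int_span {e1} \<longrightarrow>
        e2 \<in> face_cone P f \<inter> \<Lambda> \<longrightarrow>
        integral_basis \<Lambda> {e1, e2} \<longrightarrow>
        u = ((e2 \<bullet> \<alpha>) / (\<alpha> \<bullet> \<alpha>)) *\<^sub>R \<alpha> \<longrightarrow>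
        (\<forall>g x. smooth g \<longrightarrow>
           BV_operator \<mu> n P f g x = - (bernoulli_number n / fact n) * (nabla u ^^ (n - 1)) g x))
     \<and>
     (\<forall>n\<ge>2. \<forall>v\<in>vertices P. \<forall>e1 e2 u1 u2. \<forall>c1 c2 :: real.
        integral_basis \<Lambda> {e1, e2} \<longrightarrow>
        (\<exists>f1 f2. {f \<in> edges P. v \<in> f} = {f1, f2} \<and> f1 \<subseteq> half_line v e1 \<and> f2 \<subseteq> half_line v e2) \<longrightarrow>
        e1 = u1 + c1 *\<^sub>R e2 \<longrightarrow> u1 \<bullet> e2 = 0 \<longrightarrow> c1 = (e1 \<bullet> e2) / (e2 \<bullet> e2) \<longrightarrow>
        e2 = u2 + c2 *\<^sub>R e1 \<longrightarrow> u2 \<bullet> e1 = 0 \<longrightarrow> c2 = (e1 \<bullet> e2) / (e1 \<bullet> e1) \<longrightarrow>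
        (\<forall>g x. smooth g \<longrightarrow>
           BV_operator \<mu> n P {v} g x =
             (\<Sum>k=1..n - 1.
                bernoulli_number k * bernoulli_number (n - k) / (fact k * fact (n - k))
                * (nabla e1 ^^ (k - 1)) ((nabla e2 ^^ (n - 1 - k)) g) x)
             + bernoulli_number n / fact n
               * (of_real c1 * (\<Sum>s=0..n - 2. (nabla u1 ^^ s) ((nabla e1 ^^ (n - 2 - s)) g) x)
                  + of_real c2 * (\<Sum>s=0..n - 2. (nabla u2 ^^ s) ((nabla e2 ^^ (n - 2 - s)) g) x))))"
proof (cases "P = {}")
  case True
  \<comment> \<open>The empty polytope is Delzant vacuously; its Riemann sums are 0 and all three
    claims are about empty families or zero coefficients.\<close>
  have "edges P = {}" "vertices P = {}" unfolding edges_def vertices_def True by auto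
  moreover have "asymptotic_expansion (riemann_sum \<Lambda> P \<phi>) (\<lambda>n. 0)"
    using expands_asymptotic[OF expands_zero] by (simp add: riemann_sum_def[abs_def] True)
  ultimately show ?thesis by (auto intro!: exI[of _ "\<lambda>n. 0"])
next
  case False
  interpret delzant_polygon \<Lambda> P
    by unfold_locales (rule dim lattice lattice_polytope Delzant False)+
  show ?thesis
  proof (intro conjI)
    show "\<exists>A. asymptotic_expansion (riemann_sum \<Lambda> P \<phi>) A \<and>
        (\<forall>n\<ge>2. A n =
           (\<Sum>f\<in>edges P. set_lebesgue_integral (lattice_measure \<Lambda> f) f (BV_operator \<mu> n P f \<psi>)) +
           (\<Sum>v\<in>vertices P. BV_operator \<mu> n P {v} \<psi> v))"
      by (rule polygon_expansion[OF BV smooth])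
  next
    show "\<forall>n\<ge>2. \<forall>f\<in>edges P. \<forall>\<alpha> e1 e2 u.
        inward_primitive_normal \<Lambda> P f \<alpha> \<longrightarrow>
        direction_space f \<inter> \<Lambda> = int_span {e1} \<longrightarrow>
        e2 \<in> face_cone P f \<inter> \<Lambda> \<longrightarrow>
        integral_basis \<Lambda> {e1, e2} \<longrightarrow>
        u = ((e2 \<bullet> \<alpha>) / (\<alpha> \<bullet> \<alpha>)) *\<^sub>R \<alpha> \<longrightarrow>
        (\<forall>g x. smooth g \<longrightarrow>
           BV_operator \<mu> n P f g x = - (bernoulli_number n / fact n) * (nabla u ^^ (n - 1)) g x)"
    proof (intro allI ballI impI)
      fix n :: nat and f \<alpha> e1 e2 u and g :: "'a \<Rightarrow> complex" and x
      assume n: "2 \<le> n" and a: "f \<in> edges P" "inward_primitive_normal \<Lambda> P f \<alpha>" "direction_space f \<inter> \<Lambda> = int_span {e1}"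
        "e2 \<in> face_cone P f \<inter> \<Lambda>" "integral_basis \<Lambda> {e1, e2}" "u = ((e2 \<bullet> \<alpha>) / (\<alpha> \<bullet> \<alpha>)) *\<^sub>R \<alpha>" and g: "smooth g"
      have "n \<ge> 1" using n by simp
      from BV_operator_edge_normal[OF BV a this g]
      show "BV_operator \<mu> n P f g x = - (bernoulli_number n / fact n) * (nabla u ^^ (n - 1)) g x"
        unfolding edge_operator_def .
    qed
  next
    show "\<forall>n\<ge>2. \<forall>v\<in>vertices P. \<forall>e1 e2 u1 u2. \<forall>c1 c2 :: real.
        integral_basis \<Lambda> {e1, e2} \<longrightarrow>
        (\<exists>f1 f2. {f \<in> edges P. v \<in> f} = {f1, f2} \<and> f1 \<subseteq> half_line v e1 \<and> f2 \<subseteq> half_line v e2) \<longrightarrow>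
        e1 = u1 + c1 *\<^sub>R e2 \<longrightarrow> u1 \<bullet> e2 = 0 \<longrightarrow> c1 = (e1 \<bullet> e2) / (e2 \<bullet> e2) \<longrightarrow>
        e2 = u2 + c2 *\<^sub>R e1 \<longrightarrow> u2 \<bullet> e1 = 0 \<longrightarrow> c2 = (e1 \<bullet> e2) / (e1 \<bullet> e1) \<longrightarrow>
        (\<forall>g x. smooth g \<longrightarrow>
           BV_operator \<mu> n P {v} g x =
             (\<Sum>k=1..n - 1.
                bernoulli_number k * bernoulli_number (n - k) / (fact k * fact (n - k))
                * (nabla e1 ^^ (k - 1)) ((nabla e2 ^^ (n - 1 - k)) g) x)
             + bernoulli_number n / fact n
               * (of_real c1 * (\<Sum>s=0..n - 2. (nabla u1 ^^ s) ((nabla e1 ^^ (n - 2 - s)) g) x)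
                  + of_real c2 * (\<Sum>s=0..n - 2. (nabla u2 ^^ s) ((nabla e2 ^^ (n - 2 - s)) g) x)))"
      unfolding vertex_operator_def[symmetric]
    proof (intro allI ballI impI)
      fix n :: nat and v e1 e2 u1 u2 and c1 c2 :: real and g :: "'a \<Rightarrow> complex" and x
      assume n: "2 \<le> n" and v: "v \<in> vertices P" and ib: "integral_basis \<Lambda> {e1, e2}"
        and "\<exists>f1 f2. {f \<in> edges P. v \<in> f} = {f1, f2} \<and> f1 \<subseteq> half_line v e1 \<and> f2 \<subseteq> half_line v e2"
        and e: "e1 = u1 + c1 *\<^sub>R e2" "u1 \<bullet> e2 = 0" "c1 = (e1 \<bullet> e2) / (e2 \<bullet> e2)"
          "e2 = u2 + c2 *\<^sub>R e1" "u2 \<bullet> e1 = 0" "c2 = (e1 \<bullet> e2) / (e1 \<bullet> e1)" and g: "smooth g"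
      from this(4) obtain f1 f2 where f: "{f \<in> edges P. v \<in> f} = {f1, f2}" "f1 \<subseteq> half_line v e1" "f2 \<subseteq> half_line v e2"
        by (elim exE conjE) (rule that)
      have u1: "u1 = e1 - c1 *\<^sub>R e2" and u2: "u2 = e2 - c2 *\<^sub>R e1" using e(1,4) by (metis add_diff_cancel_right')+
      \<comment> \<open>The prescribed c1 and c2 are the coefficients of the orthogonal projections
        onto the lines of e2 and e1.\<close>
      have u: "u1 = line_proj e2 e1" "u2 = line_proj e1 e2"
        unfolding u1 u2 line_proj_def by (simp_all only: e(3,6) inner_commute)
      show "BV_operator \<mu> n P {v} g x = vertex_operator n e1 e2 u1 u2 c1 c2 g x"
        by (rule frame_BV_vertex[OF v ib f BV n g u e(1,4)])
    qed
  qed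
qed

end
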